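(* Let $\Delta$ be a spherical building of type $\mathsf{B}_n$, $\mathsf{C}_n$, or $\mathsf{D}_n$ with $n\ge 4$ and let $\Pi=(\mathcal{P},\Omega)$ be the associated polar space, defined over the field $\mathbb{K}$. Suppose there exists a point-domestic collineation $\theta$ of $\Pi$ with no fixed points. Let $\mathcal{Q}$ denote the set of lines of $\Pi$ fixed by $\theta$, and let $\Omega'$ denote the set of singular subspaces of $\Pi$ fixed by $\theta$. Then (1) $n$ is even, (2) $\mathrm{Diag}(\theta)=\mathsf{X}_{n;n/2}^2$ with $\mathsf{X}\in\{\mathsf{B},\mathsf{C},\mathsf{D}\}$, and (3) the pair $\Pi'=(\mathcal{Q},\Omega')$ is a polar space defined over either a quadratic extension of $\mathbb{K}$, or over a quaternion division algebra $\mathbb{H}$ which is $2$-dimensional over $\mathbb{K}$ (and $\mathbb{K}$ is $2$-dimensional over the centre of $\mathbb{H}$).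
   Context: Buildings are thick; the associated polar space $\Pi$ is nondegenerate of rank $n$ with thick lines (at least 3 points per line), $\mathcal P$ is its point set and $\Omega$ its set of singular subspaces. Type: $\mathsf C$ if $\Pi$ is symplectic, $\mathsf D$ if $\Pi$ is non-thick (each singular $(n-2)$-space lies in exactly two maximal singular subspaces), $\mathsf B$ otherwise. Polar spaces of rank at least 4 arise from (pseudo-)quadratic, alternating or Hermitian forms; "defined over $\mathbb K$" refers to the underlying field (singular subspaces are projective spaces over $\mathbb K$). Points are opposite iff non-collinear; singular subspaces $X,Y$ are opposite iff they have the same projective dimension and every point of $X$ is opposite some point of $Y$. A collineation is point-domestic if it maps no point to an opposite point. $\mathrm{Diag}(\theta)=\mathsf X_{n;n/2}^2$ means that for $k\in\{1,\dots,n\}$, $\theta$ maps some singular subspace of projective dimension $k-1$ to an opposite one if and only if $k$ is even. In $\Pi'$ the points are the fixed lines, and a fixed singular subspace is regarded as the set of fixed lines it contains; quadratic extensions need not be separable. *)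

theory Defs
  imports "HOL-Algebra.Embedded_Algebras"
begin

section \<open>Polar spaces\<close>

text \<open>
  A geometry is a pair of a point set \<open>P\<close> and a set \<open>\<Omega>\<close> of singular subspaces, each given by the
  set of its points. The rank of a singular subspace is the length of a longest chain of singular
  subspaces below it, that is, its projective dimension plus one (the empty subspace has rank 0,
  points have rank 1, lines have rank 2).
\<close>

definition chain_below :: "'p set set \<Rightarrow> 'p set \<Rightarrow> nat \<Rightarrow> bool" where
  "chain_below \<Omega> X k \<longleftrightarrow>
     (\<exists>c :: nat \<Rightarrow> 'p set. (\<forall>i\<le>k. c i \<in> \<Omega>) \<and> (\<forall>i<k. c i \<subset> c (Suc i)) \<and> c k = X)"

definition has_rank :: "'p set set \<Rightarrow> 'p set \<Rightarrow> nat \<Rightarrow> bool" where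
  "has_rank \<Omega> X k \<longleftrightarrow> chain_below \<Omega> X k \<and> \<not> chain_below \<Omega> X (Suc k)"

definition lines :: "'p set set \<Rightarrow> 'p set set" where
  "lines \<Omega> = {l \<in> \<Omega>. has_rank \<Omega> l 2}"

definition collinear :: "'p set set \<Rightarrow> 'p \<Rightarrow> 'p \<Rightarrow> bool" where
  "collinear \<Omega> x y \<longleftrightarrow> x = y \<or> (\<exists>l \<in> lines \<Omega>. x \<in> l \<and> y \<in> l)"

text \<open>
  The Buekenhout--Shult axioms for a nondegenerate polar space of rank \<open>n\<close> with thick lines. The
  second condition says that \<open>\<Omega>\<close> consists of all singular subspaces of the point-line geometry
  \<open>(P, lines \<Omega>)\<close>. Two points lie on at most one line, since the intersection of two lines is a
  singular subspace and lines have rank 2.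
\<close>

definition polar_space :: "'p set \<Rightarrow> 'p set set \<Rightarrow> nat \<Rightarrow> bool" where
  "polar_space P \<Omega> n \<longleftrightarrow>
     (\<forall>l \<in> lines \<Omega>. l \<subseteq> P \<and> (\<exists>x \<in> l. \<exists>y \<in> l. \<exists>z \<in> l. x \<noteq> y \<and> x \<noteq> z \<and> y \<noteq> z)) \<and>
     \<Omega> = {X. X \<subseteq> P \<and> (\<forall>x \<in> X. \<forall>y \<in> X. collinear \<Omega> x y) \<and>
              (\<forall>l \<in> lines \<Omega>. (\<exists>x \<in> l \<inter> X. \<exists>y \<in> l \<inter> X. x \<noteq> y) \<longrightarrow> l \<subseteq> X)} \<and>
     (\<forall>l \<in> lines \<Omega>. \<forall>p \<in> P - l.
        (\<exists>!x. x \<in> l \<and> collinear \<Omega> p x) \<or> (\<forall>x \<in> l. collinear \<Omega> p x)) \<and>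
     (\<forall>p \<in> P. \<exists>q \<in> P. \<not> collinear \<Omega> p q) \<and>
     (\<exists>X \<in> \<Omega>. has_rank \<Omega> X n) \<and> (\<forall>X \<in> \<Omega>. \<exists>k\<le>n. has_rank \<Omega> X k)"

definition collineation :: "'p set \<Rightarrow> 'p set set \<Rightarrow> ('p \<Rightarrow> 'p) \<Rightarrow> bool" where
  "collineation P \<Omega> \<theta> \<longleftrightarrow> bij_betw \<theta> P P \<and> (\<forall>X. X \<subseteq> P \<longrightarrow> (X \<in> \<Omega> \<longleftrightarrow> \<theta> ` X \<in> \<Omega>))"

definition opposite_points :: "'p set set \<Rightarrow> 'p \<Rightarrow> 'p \<Rightarrow> bool" where
  "opposite_points \<Omega> x y \<longleftrightarrow> \<not> collinear \<Omega> x y"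

definition opposite :: "'p set set \<Rightarrow> 'p set \<Rightarrow> 'p set \<Rightarrow> bool" where
  "opposite \<Omega> X Y \<longleftrightarrow> (\<exists>k. has_rank \<Omega> X k \<and> has_rank \<Omega> Y k) \<and>
     (\<forall>x \<in> X. \<exists>y \<in> Y. opposite_points \<Omega> x y)"

definition point_domestic :: "'p set \<Rightarrow> 'p set set \<Rightarrow> ('p \<Rightarrow> 'p) \<Rightarrow> bool" where
  "point_domestic P \<Omega> \<theta> \<longleftrightarrow> (\<forall>x \<in> P. \<not> opposite_points \<Omega> x (\<theta> x))"


section \<open>Projective spaces over division rings\<close>

definition division_ring :: "('k, 'm) ring_scheme \<Rightarrow> bool" where
  "division_ring K \<longleftrightarrow> ring K \<and> \<one>\<^bsub>K\<^esub> \<noteq> \<zero>\<^bsub>K\<^esub> \<and> Units K = carrier K - {\<zero>\<^bsub>K\<^esub>}"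

text \<open>
  The left vector space of \<open>r\<close>-tuples over a division ring \<open>R\<close>, also regarded as a vector space over
  a division subring with carrier \<open>S\<close>.
\<close>

definition vecs :: "('k, 'm) ring_scheme \<Rightarrow> nat \<Rightarrow> (nat \<Rightarrow> 'k) set" where
  "vecs R r = {v. (\<forall>i<r. v i \<in> carrier R) \<and> (\<forall>i\<ge>r. v i = \<zero>\<^bsub>R\<^esub>)}"

definition vec_zero :: "('k, 'm) ring_scheme \<Rightarrow> nat \<Rightarrow> 'k" where
  "vec_zero R = (\<lambda>i. \<zero>\<^bsub>R\<^esub>)"

definition vec_add :: "('k, 'm) ring_scheme \<Rightarrow> (nat \<Rightarrow> 'k) \<Rightarrow> (nat \<Rightarrow> 'k) \<Rightarrow> nat \<Rightarrow> 'k" where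
  "vec_add R v w = (\<lambda>i. v i \<oplus>\<^bsub>R\<^esub> w i)"

definition vec_smult :: "('k, 'm) ring_scheme \<Rightarrow> 'k \<Rightarrow> (nat \<Rightarrow> 'k) \<Rightarrow> nat \<Rightarrow> 'k" where
  "vec_smult R s v = (\<lambda>i. s \<otimes>\<^bsub>R\<^esub> v i)"

definition subspaces :: "('k, 'm) ring_scheme \<Rightarrow> 'k set \<Rightarrow> nat \<Rightarrow> (nat \<Rightarrow> 'k) set set" where
  "subspaces R S r = {W. W \<subseteq> vecs R r \<and> vec_zero R \<in> W \<and>
     (\<forall>v \<in> W. \<forall>w \<in> W. vec_add R v w \<in> W) \<and> (\<forall>s \<in> S. \<forall>v \<in> W. vec_smult R s v \<in> W)}"

definition one_spaces :: "('k, 'm) ring_scheme \<Rightarrow> 'k set \<Rightarrow> nat \<Rightarrow> (nat \<Rightarrow> 'k) set set" where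
  "one_spaces R S r = {{vec_smult R s v | s. s \<in> S} | v. v \<in> vecs R r \<and> v \<noteq> vec_zero R}"

text \<open>
  \<open>\<phi>\<close> identifies the points of \<open>X\<close> with the 1-dimensional \<open>S\<close>-subspaces of the space of \<open>r\<close>-tuples
  over \<open>R\<close> in such a way that the members of \<open>\<Sigma>\<close> are the \<open>S\<close>-subspaces.
\<close>

definition proj_iso ::
  "('k, 'm) ring_scheme \<Rightarrow> 'k set \<Rightarrow> nat \<Rightarrow> 'p set \<Rightarrow> 'p set set \<Rightarrow> ('p \<Rightarrow> (nat \<Rightarrow> 'k) set) \<Rightarrow> bool"
where
  "proj_iso R S r X \<Sigma> \<phi> \<longleftrightarrow> bij_betw \<phi> X (one_spaces R S r) \<and>
     \<Sigma> = {{x \<in> X. \<phi> x \<subseteq> W} | W. W \<in> subspaces R S r}"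

text \<open>Every singular subspace is a projective space over \<open>K\<close>.\<close>

definition defined_over :: "('k, 'm) ring_scheme \<Rightarrow> 'p set set \<Rightarrow> bool" where
  "defined_over K \<Omega> \<longleftrightarrow>
     (\<forall>X \<in> \<Omega>. \<exists>r \<phi>. proj_iso K (carrier K) r X {Y \<in> \<Omega>. Y \<subseteq> X} \<phi>)"


section \<open>Types and opposition diagrams\<close>

datatype polar_type = TypeB | TypeC | TypeD

definition alternating_form ::
  "('k, 'm) ring_scheme \<Rightarrow> nat \<Rightarrow> ((nat \<Rightarrow> 'k) \<Rightarrow> (nat \<Rightarrow> 'k) \<Rightarrow> 'k) \<Rightarrow> bool" where
  "alternating_form K d f \<longleftrightarrow>
     (\<forall>u \<in> vecs K d. \<forall>v \<in> vecs K d. f u v \<in> carrier K) \<and>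
     (\<forall>u \<in> vecs K d. \<forall>v \<in> vecs K d. \<forall>w \<in> vecs K d.
        f (vec_add K u v) w = f u w \<oplus>\<^bsub>K\<^esub> f v w \<and> f w (vec_add K u v) = f w u \<oplus>\<^bsub>K\<^esub> f w v) \<and>
     (\<forall>s \<in> carrier K. \<forall>u \<in> vecs K d. \<forall>v \<in> vecs K d.
        f (vec_smult K s u) v = s \<otimes>\<^bsub>K\<^esub> f u v \<and> f u (vec_smult K s v) = s \<otimes>\<^bsub>K\<^esub> f u v) \<and>
     (\<forall>v \<in> vecs K d. f v v = \<zero>\<^bsub>K\<^esub>)"

definition nondegenerate_form ::
  "('k, 'm) ring_scheme \<Rightarrow> nat \<Rightarrow> ((nat \<Rightarrow> 'k) \<Rightarrow> (nat \<Rightarrow> 'k) \<Rightarrow> 'k) \<Rightarrow> bool" where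
  "nondegenerate_form K d f \<longleftrightarrow>
     (\<forall>u \<in> vecs K d. u \<noteq> vec_zero K \<longrightarrow> (\<exists>v \<in> vecs K d. f u v \<noteq> \<zero>\<^bsub>K\<^esub>))"

definition symplectic :: "('k, 'm) ring_scheme \<Rightarrow> nat \<Rightarrow> 'p set \<Rightarrow> 'p set set \<Rightarrow> bool" where
  "symplectic K n P \<Omega> \<longleftrightarrow> field K \<and>
     (\<exists>f \<phi>. alternating_form K (2 * n) f \<and> nondegenerate_form K (2 * n) f \<and>
        bij_betw \<phi> P (one_spaces K (carrier K) (2 * n)) \<and>
        \<Omega> = {{x \<in> P. \<phi> x \<subseteq> W} | W. W \<in> subspaces K (carrier K) (2 * n) \<and>
              (\<forall>u \<in> W. \<forall>v \<in> W. f u v = \<zero>\<^bsub>K\<^esub>)})"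

definition nonthick :: "nat \<Rightarrow> 'p set set \<Rightarrow> bool" where
  "nonthick n \<Omega> \<longleftrightarrow>
     (\<forall>U \<in> \<Omega>. has_rank \<Omega> U (n - 1) \<longrightarrow> card {M \<in> \<Omega>. has_rank \<Omega> M n \<and> U \<subseteq> M} = 2)"

definition type_of ::
  "('k, 'm) ring_scheme \<Rightarrow> nat \<Rightarrow> 'p set \<Rightarrow> 'p set set \<Rightarrow> polar_type" where
  "type_of K n P \<Omega> =
     (if symplectic K n P \<Omega> then TypeC else if nonthick n \<Omega> then TypeD else TypeB)"

text \<open>
  A diagram is recorded as its type, its rank, and the set of those \<open>k\<close> for which some singular
  subspace of projective dimension \<open>k - 1\<close> is mapped to an opposite one.
\<close>

definition Diag ::
  "('k, 'm) ring_scheme \<Rightarrow> nat \<Rightarrow> 'p set \<Rightarrow> 'p set set \<Rightarrow> ('p \<Rightarrow> 'p) \<Rightarrow> polar_type \<times> nat \<times> nat set"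
where
  "Diag K n P \<Omega> \<theta> = (type_of K n P \<Omega>, n,
     {k \<in> {1..n}. \<exists>U \<in> \<Omega>. has_rank \<Omega> U k \<and> opposite \<Omega> U (\<theta> ` U)})"

text \<open>The diagram written \<open>X\<close> with subscript \<open>n; n/2\<close> and superscript 2.\<close>

definition diagram_half :: "polar_type \<Rightarrow> nat \<Rightarrow> polar_type \<times> nat \<times> nat set" where
  "diagram_half X n = (X, n, {k \<in> {1..n}. even k})"


section \<open>The fixed structure\<close>

definition fixed_lines :: "'p set set \<Rightarrow> ('p \<Rightarrow> 'p) \<Rightarrow> 'p set set" where
  "fixed_lines \<Omega> \<theta> = {l \<in> lines \<Omega>. \<theta> ` l = l}"

definition fixed_subspaces :: "'p set set \<Rightarrow> ('p \<Rightarrow> 'p) \<Rightarrow> 'p set set" where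
  "fixed_subspaces \<Omega> \<theta> = {X \<in> \<Omega>. \<theta> ` X = X}"

definition as_line_sets :: "'p set set \<Rightarrow> ('p \<Rightarrow> 'p) \<Rightarrow> 'p set set set" where
  "as_line_sets \<Omega> \<theta> = {{l \<in> fixed_lines \<Omega> \<theta>. l \<subseteq> X} | X. X \<in> fixed_subspaces \<Omega> \<theta>}"

definition quadratic_extension ::
  "('k, 'm) ring_scheme \<Rightarrow> ('l, 'o) ring_scheme \<Rightarrow> ('k \<Rightarrow> 'l) \<Rightarrow> bool" where
  "quadratic_extension K L h \<longleftrightarrow> field L \<and> h \<in> ring_hom K L \<and> subfield (h ` carrier K) L \<and>
     ring.dimension L 2 (h ` carrier K) (carrier L)"

definition ring_center :: "('l, 'o) ring_scheme \<Rightarrow> 'l set" where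
  "ring_center H = {z \<in> carrier H. \<forall>x \<in> carrier H. z \<otimes>\<^bsub>H\<^esub> x = x \<otimes>\<^bsub>H\<^esub> z}"

text \<open>A division ring is central over its centre, so only the dimension has to be prescribed.\<close>

definition quaternion_division_algebra :: "('l, 'o) ring_scheme \<Rightarrow> bool" where
  "quaternion_division_algebra H \<longleftrightarrow> division_ring H \<and>
     ring.dimension H 4 (ring_center H) (carrier H)"

definition quaternion_extension ::
  "('k, 'm) ring_scheme \<Rightarrow> ('l, 'o) ring_scheme \<Rightarrow> ('k \<Rightarrow> 'l) \<Rightarrow> bool" where
  "quaternion_extension K H h \<longleftrightarrow> quaternion_division_algebra H \<and>
     h \<in> ring_hom K H \<and> subfield (h ` carrier K) H \<and>
     ring.dimension H 2 (h ` carrier K) (carrier H) \<and>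
     ring_center H \<subseteq> h ` carrier K \<and>
     ring.dimension H 2 (ring_center H) (h ` carrier K)"

text \<open>
  The identification of the singular subspaces of the fixed structure with projective spaces over
  \<open>L\<close> is compatible with the embedding \<open>h\<close> of \<open>K\<close> in \<open>L\<close>: a fixed singular subspace is, as a
  projective space over \<open>K\<close>, obtained by restriction of scalars from \<open>L\<close> to \<open>K\<close>, and its fixed
  subspaces are the \<open>L\<close>-subspaces; in particular its fixed lines are the 1-dimensional
  \<open>L\<close>-subspaces. If the fixed structure has rank 2, its singular subspaces are at most projective
  lines, on which \<^const>\<open>defined_over\<close> alone puts only a condition of cardinality.
\<close>

definition scalar_extension ::
  "('k, 'm) ring_scheme \<Rightarrow> ('l, 'o) ring_scheme \<Rightarrow> ('k \<Rightarrow> 'l) \<Rightarrow> 'p set set \<Rightarrow> ('p \<Rightarrow> 'p) \<Rightarrow> bool"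
where
  "scalar_extension K L h \<Omega> \<theta> \<longleftrightarrow>
     (\<forall>X \<in> fixed_subspaces \<Omega> \<theta>. \<exists>r \<phi>.
        proj_iso L (h ` carrier K) r X {Y \<in> \<Omega>. Y \<subseteq> X} \<phi> \<and>
        {Y \<in> fixed_subspaces \<Omega> \<theta>. Y \<subseteq> X} =
          {{x \<in> X. \<phi> x \<subseteq> W} | W. W \<in> subspaces L (carrier L) r})"

end

theory Submission
  imports Defs
begin

text \<open>
  If a point \<open>y\<close> collinear to \<open>x\<close> is collinear to \<open>\<theta> x\<close>, then \<open>x\<close> is collinear to \<open>\<theta> y\<close>; hence the points
  collinear to \<open>x\<close> and \<open>\<theta> x\<close> are collinear to the preimage of \<open>x\<close>, so that the line through \<open>x\<close> and \<open>\<theta> x\<close>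
  is fixed. The fixed lines therefore partition the points, fixed subspaces have even rank, and a
  fixed subspace that is not maximal extends to one whose rank is larger by two. On a singular
  subspace \<open>U\<close> opposite its image, \<open>x \<mapsto> U \<inter> (\<theta> x)\<^sup>\<bottom>\<close> is a null polarity. Thus \<open>U\<close> has even rank, and
  a null polarity in projective dimension 3 forces the coordinates to commute.

  On a maximal fixed subspace, \<open>\<theta>\<close> is induced by a semilinear map \<open>g\<close> all of whose orbits \<open>v, g v, g\<^sup>2 v\<close>
  are dependent, whence \<open>g\<^sup>2 = a g + b\<close> with constant \<open>a\<close> and \<open>b\<close>. The operators \<open>x + y g\<close> form a
  division ring \<open>L\<close>, a quadratic extension if \<open>g\<close> is linear and a quaternion algebra otherwise, and the
  fixed subspaces are the \<open>L\<close>-subspaces. Two maximal fixed subspaces have a common fixed opposite,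
  and projecting through it identifies them equivariantly, so \<open>L\<close> is the same for all of them.
\<close>

section \<open>Singular subspaces and their ranks\<close>

text \<open>Coordinates are given on each singular subspace separately, and no form on an ambient
  vector space is available. Linear algebra is therefore done inside one singular subspace at a
  time, and whatever relates different subspaces is done by counting ranks: the perp of a point cuts
  out a hyperplane, and joining a point raises the rank by one. Since rank is a length of chains,
  the second fact already needs coordinates.

  A collineation determines the vector of an image point only up to a scalar. Normalising the
  scalars gives an additive \<open>g\<close>; its companion automorphism \<open>\<sigma>\<close>
  comes later, from the spread of fixed lines.

  The bound \<open>n \<ge> 4\<close> provides a subspace of rank 4 opposite its image, on which
  commutativity can be read off, and leaves room in a maximal fixed subspace for vectors outside a
  given spread line, so that coefficients at different vectors can be compared.

  A common fixed opposite of two maximal fixed subspaces is found by descent. At each step a third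
  point on a line yields a second candidate, and at most one of the two candidates is
  blocked.\<close>

lemma chain_below_mono:
  assumes "chain_below \<Omega> X k" and "j \<le> k"
  shows "chain_below \<Omega> X j"
proof -
  obtain c where c: "\<forall>i\<le>k. c i \<in> \<Omega>" "\<forall>i<k. c i \<subset> c (Suc i)" "c k = X"
    using assms(1) unfolding chain_below_def by blast
  show ?thesis
    unfolding chain_below_def
    by (rule exI[of _ "\<lambda>i. c (i + (k - j))"]) (use c assms(2) in auto)
qed

text \<open>Peeling off the top member turns statements about chains into inductions on
  \<open>k\<close>.\<close>

lemma chain_below_Suc:
  "chain_below \<Omega> Y (Suc k) \<longleftrightarrow> Y \<in> \<Omega> \<and> (\<exists>X. X \<subset> Y \<and> chain_below \<Omega> X k)"
proof
  assume "chain_below \<Omega> Y (Suc k)"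
  then obtain c where c: "\<forall>i\<le>Suc k. c i \<in> \<Omega>" "\<forall>i<Suc k. c i \<subset> c (Suc i)" "c (Suc k) = Y"
    unfolding chain_below_def by blast
  then have "chain_below \<Omega> (c k) k" unfolding chain_below_def by (intro exI[of _ c]) auto
  moreover have "c k \<subset> Y" "Y \<in> \<Omega>" using c by auto
  ultimately show "Y \<in> \<Omega> \<and> (\<exists>X. X \<subset> Y \<and> chain_below \<Omega> X k)" by auto
next
  assume "Y \<in> \<Omega> \<and> (\<exists>X. X \<subset> Y \<and> chain_below \<Omega> X k)"
  then obtain X c where Y: "Y \<in> \<Omega>" "X \<subset> Y"
    and c: "\<forall>i\<le>k. c i \<in> \<Omega>" "\<forall>i<k. c i \<subset> c (Suc i)" "c k = X"
    unfolding chain_below_def by blast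
  show "chain_below \<Omega> Y (Suc k)"
    unfolding chain_below_def
    by (rule exI[of _ "c(Suc k := Y)"]) (use Y c in \<open>auto simp: less_Suc_eq le_Suc_eq\<close>)
qed

lemma chain_below_0: "chain_below \<Omega> X 0 \<longleftrightarrow> X \<in> \<Omega>"
  unfolding chain_below_def by auto

lemma chain_below_mem: "chain_below \<Omega> X k \<Longrightarrow> X \<in> \<Omega>"
  unfolding chain_below_def by auto

lemma has_rank_chain_below:
  assumes "has_rank \<Omega> X k" shows "chain_below \<Omega> X j \<longleftrightarrow> j \<le> k"
  using assms chain_below_mono[of \<Omega> X] unfolding has_rank_def by (meson not_less_eq_eq)

lemma has_rank_unique: "has_rank \<Omega> X k \<Longrightarrow> has_rank \<Omega> X j \<Longrightarrow> k = j"
  using has_rank_chain_below[of \<Omega> X k] has_rank_chain_below[of \<Omega> X j] by (meson le_antisym order_refl)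

section \<open>Subspaces, perps and spans in a polar space\<close>

locale polar =
  fixes P :: "'p set" and \<Omega> :: "'p set set" and n :: nat
  assumes ps: "polar_space P \<Omega> n"
begin

abbreviation col :: "'p \<Rightarrow> 'p \<Rightarrow> bool" where "col \<equiv> collinear \<Omega>"

lemmas ps' = ps[unfolded polar_space_def]
lemmas ps_thick = ps'[THEN conjunct1]
lemmas ps_Omega = ps'[THEN conjunct2, THEN conjunct1]
lemmas ps_one_or_all = ps'[THEN conjunct2, THEN conjunct2, THEN conjunct1]
lemmas ps_noncol = ps'[THEN conjunct2, THEN conjunct2, THEN conjunct2, THEN conjunct1]
lemmas ps_rank = ps'[THEN conjunct2, THEN conjunct2, THEN conjunct2, THEN conjunct2]

lemma line_sub: "l \<in> lines \<Omega> \<Longrightarrow> l \<subseteq> P"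
  using ps_thick by blast

lemma Omega_iff: "X \<in> \<Omega> \<longleftrightarrow> X \<subseteq> P \<and> (\<forall>x \<in> X. \<forall>y \<in> X. col x y) \<and>
    (\<forall>l \<in> lines \<Omega>. (\<exists>x \<in> l \<inter> X. \<exists>y \<in> l \<inter> X. x \<noteq> y) \<longrightarrow> l \<subseteq> X)"
  by (rule arg_cong[OF ps_Omega, of "\<lambda>A. X \<in> A", simplified mem_Collect_eq])

lemma line_Omega: "l \<in> lines \<Omega> \<Longrightarrow> l \<in> \<Omega>"
  unfolding lines_def by simp

lemma Omega_sub: "X \<in> \<Omega> \<Longrightarrow> X \<subseteq> P"
  by (simp add: Omega_iff)

lemma Omega_col: "X \<in> \<Omega> \<Longrightarrow> x \<in> X \<Longrightarrow> y \<in> X \<Longrightarrow> col x y"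
  by (simp add: Omega_iff)

text \<open>These are the subspaces of the point-line geometry, whose points need not be pairwise
  collinear. Perps of sets of points are of this kind, and a singular subspace intersected with one
  is again singular.\<close>

definition closed :: "'p set \<Rightarrow> bool" where
  "closed W \<longleftrightarrow> W \<subseteq> P \<and> (\<forall>l \<in> lines \<Omega>. \<forall>x \<in> l \<inter> W. \<forall>y \<in> l \<inter> W. x \<noteq> y \<longrightarrow> l \<subseteq> W)"

lemma closedD: "closed W \<Longrightarrow> l \<in> lines \<Omega> \<Longrightarrow> x \<in> l \<Longrightarrow> y \<in> l \<Longrightarrow> x \<in> W \<Longrightarrow> y \<in> W \<Longrightarrow> x \<noteq> y \<Longrightarrow> l \<subseteq> W"
  unfolding closed_def by blast

lemma closedI:
  assumes "W \<subseteq> P"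
    and "\<And>l x y z. l \<in> lines \<Omega> \<Longrightarrow> x \<in> l \<Longrightarrow> y \<in> l \<Longrightarrow> x \<in> W \<Longrightarrow> y \<in> W \<Longrightarrow> x \<noteq> y \<Longrightarrow> z \<in> l \<Longrightarrow> z \<in> W"
  shows "closed W"
  unfolding closed_def
proof (intro conjI ballI impI subsetI)
  fix l x y z assume "l \<in> lines \<Omega>" "x \<in> l \<inter> W" "y \<in> l \<inter> W" "x \<noteq> y" "z \<in> l"
  then show "z \<in> W" using assms(2)[of l x y z] by simp
qed (use assms(1) in auto)

lemma closed_sub: "closed W \<Longrightarrow> W \<subseteq> P"
  unfolding closed_def by blast

lemma Omega_closed_iff: "X \<in> \<Omega> \<longleftrightarrow> closed X \<and> (\<forall>x \<in> X. \<forall>y \<in> X. col x y)"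
  unfolding Omega_iff closed_def by blast

lemma Omega_closed: "X \<in> \<Omega> \<Longrightarrow> closed X"
  by (simp add: Omega_closed_iff)

lemma closed_P: "closed P"
  unfolding closed_def using line_sub by blast

lemma closed_Int: "closed X \<Longrightarrow> closed Y \<Longrightarrow> closed (X \<inter> Y)"
proof (rule closedI)
  assume X: "closed X" and Y: "closed Y"
  show "X \<inter> Y \<subseteq> P" using closed_sub[OF X] by blast
  fix l x y z assume "l \<in> lines \<Omega>" "x \<in> l" "y \<in> l" "x \<in> X \<inter> Y" "y \<in> X \<inter> Y" "x \<noteq> y" "z \<in> l"
  then show "z \<in> X \<inter> Y" using closedD[OF X, of l x y] closedD[OF Y, of l x y] by auto
qed

lemma Omega_Int_closed: "X \<in> \<Omega> \<Longrightarrow> closed Y \<Longrightarrow> X \<inter> Y \<in> \<Omega>"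
  by (simp add: Omega_closed_iff closed_Int)

lemma Omega_Int: "X \<in> \<Omega> \<Longrightarrow> Y \<in> \<Omega> \<Longrightarrow> X \<inter> Y \<in> \<Omega>"
  by (simp add: Omega_Int_closed Omega_closed)

lemma col_refl [simp]: "col x x"
  unfolding collinear_def by simp

lemma col_sym: "col x y \<longleftrightarrow> col y x"
  unfolding collinear_def by blast

lemma col_line: "col x y \<Longrightarrow> x \<noteq> y \<Longrightarrow> \<exists>l \<in> lines \<Omega>. x \<in> l \<and> y \<in> l"
  unfolding collinear_def by blast

lemma line_unique:
  assumes "l \<in> lines \<Omega>" "m \<in> lines \<Omega>" "x \<in> l" "y \<in> l" "x \<in> m" "y \<in> m" "x \<noteq> y"
  shows "l = m"
  using closedD[OF Omega_closed[OF line_Omega]] assms by (metis subset_antisym)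

lemma line_third: "l \<in> lines \<Omega> \<Longrightarrow> \<exists>z \<in> l. z \<noteq> x \<and> z \<noteq> y"
proof -
  assume "l \<in> lines \<Omega>"
  then obtain a b c where "a \<in> l" "b \<in> l" "c \<in> l" "a \<noteq> b" "a \<noteq> c" "b \<noteq> c"
    using ps_thick by blast
  then show ?thesis by metis
qed

lemma line_two:
  assumes "l \<in> lines \<Omega>" obtains x y where "x \<in> l" "y \<in> l" "x \<noteq> y"
  using ps_thick assms by blast

lemma line_col: "l \<in> lines \<Omega> \<Longrightarrow> x \<in> l \<Longrightarrow> y \<in> l \<Longrightarrow> col x y"
  using Omega_col line_Omega by blast

text \<open>A line through \<open>p\<close> has all its points collinear to \<open>p\<close>, so the
  axiom extends to \<open>p \<in> l\<close> and later arguments need not separate that case.\<close>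

lemma one_or_all:
  assumes "l \<in> lines \<Omega>" "p \<in> P"
  shows "(\<exists>x \<in> l. col p x) \<and> (\<forall>x \<in> l. \<forall>y \<in> l. x \<noteq> y \<longrightarrow> col p x \<longrightarrow> col p y \<longrightarrow> (\<forall>z \<in> l. col p z))"
proof (cases "p \<in> l")
  case True then show ?thesis using assms line_col by blast
next
  case False
  then have "(\<exists>!x. x \<in> l \<and> col p x) \<or> (\<forall>x \<in> l. col p x)"
    using ps_one_or_all assms by blast
  moreover have "\<exists>x. x \<in> l" using line_third[OF assms(1)] by blast
  ultimately show ?thesis by metis
qed

lemma meets: "l \<in> lines \<Omega> \<Longrightarrow> p \<in> P \<Longrightarrow> \<exists>x \<in> l. col p x"
  using one_or_all by blast

lemma col_all:
  "l \<in> lines \<Omega> \<Longrightarrow> p \<in> P \<Longrightarrow> x \<in> l \<Longrightarrow> y \<in> l \<Longrightarrow> x \<noteq> y \<Longrightarrow> col p x \<Longrightarrow> col p y \<Longrightarrow> z \<in> l \<Longrightarrow> col p z"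
  using one_or_all by blast

lemma noncol: "p \<in> P \<Longrightarrow> \<exists>q \<in> P. \<not> col p q"
  using ps_noncol by blast

definition perp :: "'p set \<Rightarrow> 'p set" where
  "perp A = {p \<in> P. \<forall>a \<in> A. col p a}"

text \<open>By the one-or-all axiom for each point \<open>a\<close> of \<open>A\<close>: two points
  of a line collinear to \<open>a\<close> force the whole line.\<close>

lemma closed_perp: "A \<subseteq> P \<Longrightarrow> closed (perp A)"
  unfolding closed_def perp_def
proof (intro conjI ballI impI subsetI)
  fix l x y z assume A: "A \<subseteq> P" and l: "l \<in> lines \<Omega>" and
    x: "x \<in> l \<inter> {p \<in> P. \<forall>a\<in>A. col p a}" and y: "y \<in> l \<inter> {p \<in> P. \<forall>a\<in>A. col p a}"
    and xy: "x \<noteq> y" and z: "z \<in> l"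
  have "col z a" if "a \<in> A" for a
    using col_all[of l a x y z] A l x y xy z that col_sym[of _ a] by auto
  then show "z \<in> {p \<in> P. \<forall>a\<in>A. col p a}" using l z line_sub by blast
qed auto

lemma perpI: "p \<in> P \<Longrightarrow> (\<And>a. a \<in> A \<Longrightarrow> col p a) \<Longrightarrow> p \<in> perp A"
  unfolding perp_def by blast

lemma perpD: "p \<in> perp A \<Longrightarrow> a \<in> A \<Longrightarrow> col p a"
  unfolding perp_def by blast

lemma perp_sub: "perp A \<subseteq> P"
  unfolding perp_def by blast

lemma perp_sym: "A \<subseteq> P \<Longrightarrow> A \<subseteq> perp B \<Longrightarrow> B \<subseteq> P \<Longrightarrow> B \<subseteq> perp A"
  unfolding perp_def using col_sym by blast

lemma Omega_perp: "X \<in> \<Omega> \<Longrightarrow> A \<subseteq> P \<Longrightarrow> X \<inter> perp A \<in> \<Omega>"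
  by (simp add: Omega_Int_closed closed_perp)

text \<open>For a set contained in no singular subspace this is the intersection of the empty
  family, hence everything. Lemmas that place a span in \<open>\<Omega>\<close> therefore ask for a
  clique.\<close>

definition sp :: "'p set \<Rightarrow> 'p set" where
  "sp A = \<Inter> {X \<in> \<Omega>. A \<subseteq> X}"

definition clique :: "'p set \<Rightarrow> bool" where
  "clique A \<longleftrightarrow> A \<subseteq> P \<and> (\<forall>x \<in> A. \<forall>y \<in> A. col x y)"

text \<open>From \<open>A \<subseteq> perp A\<close> follows
  \<open>perp (perp A) \<subseteq> perp A\<close>, so the points of \<open>perp (perp A)\<close> are
  pairwise collinear. This supplies a singular subspace around every clique.\<close>

lemma clique_perp: "clique A \<Longrightarrow> perp (perp A) \<in> \<Omega> \<and> A \<subseteq> perp (perp A)"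
proof -
  assume A: "clique A"
  then have 1: "A \<subseteq> perp A" "A \<subseteq> P" unfolding clique_def perp_def by auto
  then have 2: "A \<subseteq> perp (perp A)" using perp_sym[of "perp A" A] perp_sub by blast
  have "perp (perp A) \<subseteq> perp A" using 1 unfolding perp_def by blast
  then have "\<forall>x \<in> perp (perp A). \<forall>y \<in> perp (perp A). col x y" unfolding perp_def by blast
  then show ?thesis using 2 closed_perp[OF perp_sub] Omega_closed_iff by blast
qed

lemma sp_Omega: "clique A \<Longrightarrow> sp A \<in> \<Omega>"
proof -
  assume "clique A"
  then obtain Z where Z: "Z \<in> \<Omega>" "A \<subseteq> Z" using clique_perp by blast
  have "closed (sp A)"
  proof (rule closedI)
    show "sp A \<subseteq> P" using Z Omega_sub unfolding sp_def by blast
    fix l x y z assume l: "l \<in> lines \<Omega>" "x \<in> l" "y \<in> l" "x \<in> sp A" "y \<in> sp A" "x \<noteq> y" "z \<in> l"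
    have "z \<in> X" if "X \<in> \<Omega>" "A \<subseteq> X" for X
      using closedD[OF Omega_closed[OF that(1)], of l x y] l that unfolding sp_def by auto
    then show "z \<in> sp A" unfolding sp_def by blast
  qed
  moreover have "sp A \<subseteq> Z" using Z unfolding sp_def by blast
  ultimately show ?thesis using Omega_closed_iff Omega_col[OF Z(1)] by blast
qed

lemma sp_sup: "A \<subseteq> sp A"
  unfolding sp_def by blast

lemma sp_least: "X \<in> \<Omega> \<Longrightarrow> A \<subseteq> X \<Longrightarrow> sp A \<subseteq> X"
  unfolding sp_def by blast

text \<open>\<open>W\<close> need not be singular, but its intersection with the span is.\<close>

lemma sp_closed: "clique A \<Longrightarrow> closed W \<Longrightarrow> A \<subseteq> W \<Longrightarrow> sp A \<subseteq> W"
  using sp_least[of "sp A \<inter> W" A] sp_Omega Omega_Int_closed sp_sup by blast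

text \<open>The set \<open>perp (perp A)\<close> is closed and contains the clique, hence its span;
  so collinearity with generators passes to everything they span.\<close>

lemma perp_sp: "clique A \<Longrightarrow> perp (sp A) = perp A"
proof
  assume A: "clique A"
  show "perp (sp A) \<subseteq> perp A" unfolding perp_def using sp_sup by blast
  have "A \<subseteq> perp (perp A)" using clique_perp[OF A] by blast
  then have "sp A \<subseteq> perp (perp A)" using sp_closed[OF A closed_perp[OF perp_sub]] by blast
  then show "perp A \<subseteq> perp (sp A)"
    using perp_sym[of "sp A" "perp A"] sp_Omega[OF A] Omega_sub perp_sub by blast
qed

lemma clique_insert: "X \<in> \<Omega> \<Longrightarrow> p \<in> perp X \<Longrightarrow> clique (insert p X)"
  unfolding clique_def using Omega_sub[of X] perp_sub[of X] perpD[of p X] Omega_col[of X]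
  by (auto simp: col_sym[of _ p])

lemma sing_Omega: "p \<in> P \<Longrightarrow> {p} \<in> \<Omega>"
  unfolding Omega_iff by auto

lemma empty_Omega: "{} \<in> \<Omega>"
  unfolding Omega_iff by auto

section \<open>Ranks and hyperplanes\<close>

definition rk :: "'p set \<Rightarrow> nat" where
  "rk X = (THE k. has_rank \<Omega> X k)"

lemma rk: "X \<in> \<Omega> \<Longrightarrow> has_rank \<Omega> X (rk X)"
proof -
  assume "X \<in> \<Omega>"
  then obtain k where "has_rank \<Omega> X k" using ps_rank by blast
  then show ?thesis unfolding rk_def using has_rank_unique by (metis theI)
qed

lemma has_rank_iff: "has_rank \<Omega> X k \<longleftrightarrow> X \<in> \<Omega> \<and> rk X = k"
  using rk has_rank_unique chain_below_mem unfolding has_rank_def by (metis has_rank_def)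

lemma rk_le: "X \<in> \<Omega> \<Longrightarrow> rk X \<le> n"
proof -
  assume "X \<in> \<Omega>"
  then obtain k where "k \<le> n" "has_rank \<Omega> X k" using ps_rank by blast
  then show ?thesis by (simp add: has_rank_iff)
qed

lemma ex_rk_n: "\<exists>X \<in> \<Omega>. rk X = n"
  using ps_rank has_rank_iff by blast

lemma chain_iff: "chain_below \<Omega> X k \<longleftrightarrow> X \<in> \<Omega> \<and> k \<le> rk X"
  using has_rank_chain_below[OF rk] chain_below_mem by metis

lemma rk_less: "X \<in> \<Omega> \<Longrightarrow> Y \<in> \<Omega> \<Longrightarrow> X \<subset> Y \<Longrightarrow> rk X < rk Y"
  using chain_below_Suc[of \<Omega> Y "rk X"] by (metis Suc_le_lessD chain_iff order_refl)

lemma rk_mono: "X \<in> \<Omega> \<Longrightarrow> Y \<in> \<Omega> \<Longrightarrow> X \<subseteq> Y \<Longrightarrow> rk X \<le> rk Y"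
  using rk_less by (metis order.order_iff_strict psubsetI)

lemma rk_eq: "X \<in> \<Omega> \<Longrightarrow> Y \<in> \<Omega> \<Longrightarrow> X \<subseteq> Y \<Longrightarrow> rk Y \<le> rk X \<Longrightarrow> X = Y"
  using rk_less by (metis leD psubsetI)

lemma rk_empty: "rk {} = 0"
  using chain_below_Suc[of \<Omega> "{}" "rk {} - 1"] empty_Omega chain_iff[of "{}" "rk {}"]
  by (cases "rk {}") auto

lemma rk_sing: "p \<in> P \<Longrightarrow> rk {p} = 1"
proof -
  assume p: "p \<in> P"
  have "\<not> chain_below \<Omega> {p} (Suc (Suc 0))"
  proof
    assume "chain_below \<Omega> {p} (Suc (Suc 0))"
    then obtain X Y where "X \<subset> {p}" "Y \<subset> X" unfolding chain_below_Suc by blast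
    then show False by auto
  qed
  moreover have "chain_below \<Omega> {p} (Suc 0)"
    unfolding chain_below_Suc chain_below_0 using sing_Omega[OF p] empty_Omega by blast
  ultimately show ?thesis using sing_Omega[OF p] unfolding chain_iff by auto
qed

lemma rk_1: "X \<in> \<Omega> \<Longrightarrow> rk X = 1 \<Longrightarrow> \<exists>p \<in> P. X = {p}"
proof -
  assume X: "X \<in> \<Omega>" "rk X = 1"
  then obtain p where p: "p \<in> X" using rk_empty by fastforce
  then have "{p} = X" using X rk_sing[of p] sing_Omega[of p] rk_eq[of "{p}" X] Omega_sub[OF X(1)] by auto
  then show ?thesis using X Omega_sub by blast
qed

lemma lines_iff: "l \<in> lines \<Omega> \<longleftrightarrow> l \<in> \<Omega> \<and> rk l = 2"
  unfolding lines_def has_rank_iff by auto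

text \<open>Hyperplanes are defined through lines because rank is a length of chains and no theory
  of dimension is at hand at this point.\<close>

definition hyper :: "'p set \<Rightarrow> 'p set \<Rightarrow> bool" where
  "hyper H Y \<longleftrightarrow> H \<in> \<Omega> \<and> Y \<in> \<Omega> \<and> H \<subset> Y \<and> (\<forall>l \<in> lines \<Omega>. l \<subseteq> Y \<longrightarrow> l \<inter> H \<noteq> {})"

lemma line_in:
  assumes "X \<in> \<Omega>" "x \<in> X" "y \<in> X" "x \<noteq> y"
  obtains l where "l \<in> lines \<Omega>" "x \<in> l" "y \<in> l" "l \<subseteq> X"
proof -
  obtain l where "l \<in> lines \<Omega>" "x \<in> l" "y \<in> l" using assms Omega_col col_line by metis
  then show ?thesis using that closedD[OF Omega_closed[OF assms(1)]] assms by metis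
qed

text \<open>A point of \<open>Y\<close> is joined to a point \<open>q\<close> of \<open>Z\<close>
  outside \<open>H\<close>. The joining line meets \<open>H\<close> in a second point of
  \<open>Z\<close>, so it lies in \<open>Z\<close>.\<close>

lemma hyper_max:
  assumes H: "hyper H Y" and Z: "Z \<in> \<Omega>" "H \<subset> Z" "Z \<subseteq> Y"
  shows "Z = Y"
proof -
  obtain q where q: "q \<in> Z" "q \<notin> H" using Z by blast
  have "y \<in> Z" if y: "y \<in> Y" for y
  proof (cases "y = q")
    case False
    obtain l where l: "l \<in> lines \<Omega>" "y \<in> l" "q \<in> l" "l \<subseteq> Y"
      using line_in[of Y y q] H y q Z False unfolding hyper_def by blast
    then obtain s where "s \<in> l" "s \<in> H" using H unfolding hyper_def by blast
    then have "l \<subseteq> Z" using closedD[OF Omega_closed[OF Z(1)], of l s q] l q Z by blast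
    then show ?thesis using l by blast
  qed (use q in simp)
  then show ?thesis using Z by blast
qed

text \<open>The chain is traced on \<open>H\<close>. If its member \<open>Z\<close> next to the top
  lies in \<open>H\<close>, its length already suffices. Otherwise \<open>Z \<inter> H\<close> is a
  hyperplane of \<open>Z\<close>, the induction applies to it, and \<open>hyper_max\<close> makes it
  a proper part of \<open>H\<close>.\<close>

lemma hyper_chain: "hyper H Y \<Longrightarrow> chain_below \<Omega> Y (Suc k) \<Longrightarrow> chain_below \<Omega> H k"
proof (induction k arbitrary: H Y)
  case 0
  then show ?case unfolding hyper_def chain_below_0 by blast
next
  case (Suc k)
  then obtain Z where Z: "Z \<subset> Y" "chain_below \<Omega> Z (Suc k)"
    using chain_below_Suc by metis
  have ZO: "Z \<in> \<Omega>" and HO: "H \<in> \<Omega>"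
    using Z chain_below_mem Suc.prems unfolding hyper_def by blast+
  show ?case
  proof (cases "Z \<subseteq> H")
    case True
    then have "Suc k \<le> rk H" using rk_mono[of Z H] Z(2) ZO HO unfolding chain_iff by simp
    then show ?thesis using HO unfolding chain_iff by simp
  next
    case False
    have "hyper (Z \<inter> H) Z"
      unfolding hyper_def
    proof (intro conjI ballI impI)
      show "Z \<inter> H \<in> \<Omega>" "Z \<in> \<Omega>" using Omega_Int[OF ZO HO] ZO by auto
      show "Z \<inter> H \<subset> Z" using False by blast
      fix l assume l: "l \<in> lines \<Omega>" "l \<subseteq> Z"
      then have "l \<inter> H \<noteq> {}" using Suc.prems(1) Z(1) unfolding hyper_def by (meson psubsetE subset_trans)
      then show "l \<inter> (Z \<inter> H) \<noteq> {}" using l by blast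
    qed
    then have "chain_below \<Omega> (Z \<inter> H) k" using Suc.IH Z by blast
    moreover have "Z \<inter> H \<subset> H"
    proof (rule ccontr)
      assume "\<not> Z \<inter> H \<subset> H"
      then have "H \<subset> Z" using False by auto
      then show False using hyper_max[OF Suc.prems(1) ZO] Z by blast
    qed
    ultimately show ?thesis using HO unfolding chain_below_Suc by blast
  qed
qed

lemma rk_hyper: "hyper H Y \<Longrightarrow> rk Y = Suc (rk H)"
proof -
  assume H: "hyper H Y"
  then have O: "H \<in> \<Omega>" "Y \<in> \<Omega>" "H \<subset> Y" unfolding hyper_def by auto
  then have "rk H < rk Y" using rk_less by blast
  moreover have "chain_below \<Omega> Y (Suc (rk Y - 1))" using O calculation chain_iff by simp
  then have "rk Y - 1 \<le> rk H" using hyper_chain[OF H] unfolding chain_iff by blast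
  ultimately show ?thesis by linarith
qed

text \<open>Every line has a point collinear to \<open>p\<close>. In this form the polar space axiom
  controls ranks.\<close>

lemma hyper_perp:
  assumes "X \<in> \<Omega>" "p \<in> P" "\<not> X \<subseteq> perp {p}"
  shows "hyper (X \<inter> perp {p}) X"
  unfolding hyper_def
proof (intro conjI ballI impI)
  show "X \<inter> perp {p} \<in> \<Omega>" using assms Omega_perp by simp
  show "X \<in> \<Omega>" by fact
  show "X \<inter> perp {p} \<subset> X" using assms by blast
  fix l assume l: "l \<in> lines \<Omega>" "l \<subseteq> X"
  then obtain x where "x \<in> l" "col p x" using meets assms by blast
  then show "l \<inter> (X \<inter> perp {p}) \<noteq> {}"
    using l line_sub unfolding perp_def by (auto simp: col_sym[of p])
qed

lemma rk_perp: "X \<in> \<Omega> \<Longrightarrow> p \<in> P \<Longrightarrow> x \<in> X \<Longrightarrow> \<not> col p x \<Longrightarrow> rk X = Suc (rk (X \<inter> perp {p}))"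
  using rk_hyper[OF hyper_perp[of X p]] perpD[of x "{p}" p] col_sym by blast

lemma rk_perp_ge: "X \<in> \<Omega> \<Longrightarrow> p \<in> P \<Longrightarrow> rk X \<le> Suc (rk (X \<inter> perp {p}))"
  using rk_hyper[OF hyper_perp[of X p]] by (cases "X \<subseteq> perp {p}") (auto simp: inf.absorb1)

end

section \<open>Left vector spaces and coordinates of singular subspaces\<close>

text \<open>Scalars act from the left and need not commute. Instances are the tuples over
  \<open>K\<close>, the tuples over the extension, and the tuples over \<open>K\<close> with the
  extension acting on them.\<close>

locale left_vs =
  fixes R :: "('k, 'm) ring_scheme" (structure) and M :: "('k, 'v, 'n) module_scheme" (structure)
  assumes div: "division_ring R" and grp: "abelian_group M"
    and smult_closed [simp, intro]:
      "\<lbrakk>a \<in> carrier R; v \<in> carrier M\<rbrakk> \<Longrightarrow> a \<odot>\<^bsub>M\<^esub> v \<in> carrier M"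
    and smult_l_distr: "\<lbrakk>a \<in> carrier R; b \<in> carrier R; v \<in> carrier M\<rbrakk> \<Longrightarrow>
      (a \<oplus> b) \<odot>\<^bsub>M\<^esub> v = a \<odot>\<^bsub>M\<^esub> v \<oplus>\<^bsub>M\<^esub> b \<odot>\<^bsub>M\<^esub> v"
    and smult_r_distr: "\<lbrakk>a \<in> carrier R; v \<in> carrier M; w \<in> carrier M\<rbrakk> \<Longrightarrow>
      a \<odot>\<^bsub>M\<^esub> (v \<oplus>\<^bsub>M\<^esub> w) = a \<odot>\<^bsub>M\<^esub> v \<oplus>\<^bsub>M\<^esub> a \<odot>\<^bsub>M\<^esub> w"
    and smult_assoc: "\<lbrakk>a \<in> carrier R; b \<in> carrier R; v \<in> carrier M\<rbrakk> \<Longrightarrow>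
      (a \<otimes> b) \<odot>\<^bsub>M\<^esub> v = a \<odot>\<^bsub>M\<^esub> (b \<odot>\<^bsub>M\<^esub> v)"
    and smult_one [simp]: "v \<in> carrier M \<Longrightarrow> \<one> \<odot>\<^bsub>M\<^esub> v = v"
begin

sublocale R: ring R using div unfolding division_ring_def by blast
sublocale M: abelian_group M by (rule grp)

lemma one_neq_zero [simp]: "\<one> \<noteq> \<zero>"
  using div unfolding division_ring_def by blast

lemma unit: "a \<in> carrier R \<Longrightarrow> a \<noteq> \<zero> \<Longrightarrow> a \<in> Units R"
  using div unfolding division_ring_def by blast

lemma inv_closed [simp, intro]: "a \<in> carrier R \<Longrightarrow> a \<noteq> \<zero> \<Longrightarrow> inv a \<in> carrier R"
  using unit R.Units_inv_closed by blast

lemma l_inv: "a \<in> carrier R \<Longrightarrow> a \<noteq> \<zero> \<Longrightarrow> inv a \<otimes> a = \<one>"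
  using unit R.Units_l_inv by blast

lemma r_inv: "a \<in> carrier R \<Longrightarrow> a \<noteq> \<zero> \<Longrightarrow> a \<otimes> inv a = \<one>"
  using unit R.Units_r_inv by blast

lemma smult_zero_l [simp]: "v \<in> carrier M \<Longrightarrow> \<zero> \<odot>\<^bsub>M\<^esub> v = \<zero>\<^bsub>M\<^esub>"
  using smult_l_distr[of "\<zero>" "\<zero>" v] by (metis M.add.l_cancel_one R.l_zero R.zero_closed smult_closed)

lemma smult_zero_r [simp]: "a \<in> carrier R \<Longrightarrow> a \<odot>\<^bsub>M\<^esub> \<zero>\<^bsub>M\<^esub> = \<zero>\<^bsub>M\<^esub>"
  using smult_r_distr[of a "\<zero>\<^bsub>M\<^esub>" "\<zero>\<^bsub>M\<^esub>"] by (metis M.add.l_cancel_one M.l_zero M.zero_closed smult_closed)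

lemma smult_l_minus: "a \<in> carrier R \<Longrightarrow> v \<in> carrier M \<Longrightarrow> (\<ominus> a) \<odot>\<^bsub>M\<^esub> v = \<ominus>\<^bsub>M\<^esub> (a \<odot>\<^bsub>M\<^esub> v)"
  using smult_l_distr[of "\<ominus> a" a v] by (simp add: M.minus_equality R.l_neg)

lemma smult_inv: "a \<in> carrier R \<Longrightarrow> a \<noteq> \<zero> \<Longrightarrow> v \<in> carrier M \<Longrightarrow> inv a \<odot>\<^bsub>M\<^esub> (a \<odot>\<^bsub>M\<^esub> v) = v"
  by (metis inv_closed l_inv smult_assoc smult_one)

definition subsp :: "'v set \<Rightarrow> bool" where
  "subsp W \<longleftrightarrow> W \<subseteq> carrier M \<and> \<zero>\<^bsub>M\<^esub> \<in> W \<and> (\<forall>v \<in> W. \<forall>w \<in> W. v \<oplus>\<^bsub>M\<^esub> w \<in> W) \<and>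
     (\<forall>a \<in> carrier R. \<forall>v \<in> W. a \<odot>\<^bsub>M\<^esub> v \<in> W)"

lemma subsp_carrier: "subsp W \<Longrightarrow> v \<in> W \<Longrightarrow> v \<in> carrier M"
  unfolding subsp_def by blast

lemma subsp_zero: "subsp W \<Longrightarrow> \<zero>\<^bsub>M\<^esub> \<in> W"
  unfolding subsp_def by blast

lemma subsp_add: "subsp W \<Longrightarrow> v \<in> W \<Longrightarrow> w \<in> W \<Longrightarrow> v \<oplus>\<^bsub>M\<^esub> w \<in> W"
  unfolding subsp_def by blast

lemma subsp_smult: "subsp W \<Longrightarrow> a \<in> carrier R \<Longrightarrow> v \<in> W \<Longrightarrow> a \<odot>\<^bsub>M\<^esub> v \<in> W"
  unfolding subsp_def by blast

lemma subsp_minus: "subsp W \<Longrightarrow> v \<in> W \<Longrightarrow> \<ominus>\<^bsub>M\<^esub> v \<in> W"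
  using subsp_smult[of W "\<ominus> \<one>" v] subsp_carrier[of W v] by (simp add: smult_l_minus)

lemma subsp_diff: "subsp W \<Longrightarrow> v \<in> W \<Longrightarrow> w \<in> W \<Longrightarrow> v \<ominus>\<^bsub>M\<^esub> w \<in> W"
  unfolding a_minus_def by (simp add: subsp_add subsp_minus)

lemma subsp_add_cancel:
  assumes W: "subsp W" and v: "v \<in> W" "w \<in> carrier M" "v \<oplus>\<^bsub>M\<^esub> w \<in> W"
  shows "w \<in> W"
proof -
  have "\<ominus>\<^bsub>M\<^esub> v \<oplus>\<^bsub>M\<^esub> (v \<oplus>\<^bsub>M\<^esub> w) \<in> W" using assms subsp_add subsp_minus by simp
  then show ?thesis using v subsp_carrier[OF W] by (simp add: M.r_neg1)
qed

lemma subsp_smult_cancel: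
  assumes W: "subsp W" and a: "a \<in> carrier R" "a \<noteq> \<zero>" "v \<in> carrier M" "a \<odot>\<^bsub>M\<^esub> v \<in> W"
  shows "v \<in> W"
  using subsp_smult[OF W inv_closed[OF a(1,2)] a(4)] smult_inv[OF a(1-3)] by simp

definition ext :: "'v set \<Rightarrow> 'v \<Rightarrow> 'v set" where
  "ext W v = {w \<oplus>\<^bsub>M\<^esub> a \<odot>\<^bsub>M\<^esub> v | w a. w \<in> W \<and> a \<in> carrier R}"

lemma subsp_ext:
  assumes W: "subsp W" and v: "v \<in> carrier M"
  shows "subsp (ext W v)" and "W \<subseteq> ext W v" and "v \<in> ext W v"
    and "subsp W' \<Longrightarrow> W \<subseteq> W' \<Longrightarrow> v \<in> W' \<Longrightarrow> ext W v \<subseteq> W'"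
proof -
  note c = subsp_carrier[OF W]
  have z: "w \<in> ext W v" if "w \<in> W" for w
    unfolding ext_def using that c v by (intro CollectI exI[of _ w] exI[of _ "\<zero>"]) simp
  then show "W \<subseteq> ext W v" by blast
  show "v \<in> ext W v"
    unfolding ext_def using v subsp_zero[OF W] by (intro CollectI exI[of _ "\<zero>\<^bsub>M\<^esub>"] exI[of _ "\<one>"]) simp
  show "ext W v \<subseteq> W'" if "subsp W'" "W \<subseteq> W'" "v \<in> W'"
    unfolding ext_def using that subsp_add[OF that(1)] subsp_smult[OF that(1)] by blast
  show "subsp (ext W v)"
    unfolding subsp_def
  proof (intro conjI ballI)
    show "ext W v \<subseteq> carrier M" unfolding ext_def using c v by blast
    show "\<zero>\<^bsub>M\<^esub> \<in> ext W v" using z subsp_zero[OF W] by blast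
  next
    fix x y assume "x \<in> ext W v" "y \<in> ext W v"
    then obtain w a w' b where *: "x = w \<oplus>\<^bsub>M\<^esub> a \<odot>\<^bsub>M\<^esub> v" "y = w' \<oplus>\<^bsub>M\<^esub> b \<odot>\<^bsub>M\<^esub> v"
      "w \<in> W" "w' \<in> W" "a \<in> carrier R" "b \<in> carrier R"
      unfolding ext_def by blast
    then have "x \<oplus>\<^bsub>M\<^esub> y = (w \<oplus>\<^bsub>M\<^esub> w') \<oplus>\<^bsub>M\<^esub> (a \<oplus> b) \<odot>\<^bsub>M\<^esub> v"
      using c v by (simp add: smult_l_distr M.a_ac)
    then show "x \<oplus>\<^bsub>M\<^esub> y \<in> ext W v"
      unfolding ext_def using * subsp_add[OF W] by blast
  next
    fix a x assume a: "a \<in> carrier R" and "x \<in> ext W v"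
    then obtain w b where *: "x = w \<oplus>\<^bsub>M\<^esub> b \<odot>\<^bsub>M\<^esub> v" "w \<in> W" "b \<in> carrier R"
      unfolding ext_def by blast
    then have "a \<odot>\<^bsub>M\<^esub> x = a \<odot>\<^bsub>M\<^esub> w \<oplus>\<^bsub>M\<^esub> (a \<otimes> b) \<odot>\<^bsub>M\<^esub> v"
      using c v a by (simp add: smult_r_distr smult_assoc)
    then show "a \<odot>\<^bsub>M\<^esub> x \<in> ext W v"
      unfolding ext_def using * a subsp_smult[OF W] by blast
  qed
qed

definition sp1 :: "'v \<Rightarrow> 'v set" where "sp1 v = {a \<odot>\<^bsub>M\<^esub> v | a. a \<in> carrier R}"

lemma subsp_zero_only: "subsp {\<zero>\<^bsub>M\<^esub>}"
  unfolding subsp_def by simp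

lemma sp1_ext: "v \<in> carrier M \<Longrightarrow> sp1 v = ext {\<zero>\<^bsub>M\<^esub>} v"
proof -
  assume "v \<in> carrier M"
  then have "\<zero>\<^bsub>M\<^esub> \<oplus>\<^bsub>M\<^esub> a \<odot>\<^bsub>M\<^esub> v = a \<odot>\<^bsub>M\<^esub> v" if "a \<in> carrier R" for a using that by simp
  then show ?thesis unfolding sp1_def ext_def by (metis (no_types, opaque_lifting) singletonD singletonI)
qed

lemma subsp_sp1: "v \<in> carrier M \<Longrightarrow> subsp (sp1 v)"
  using subsp_ext(1)[OF subsp_zero_only] by (simp add: sp1_ext)

lemma sp1_self: "v \<in> carrier M \<Longrightarrow> v \<in> sp1 v"
  using subsp_ext(3)[OF subsp_zero_only] by (simp add: sp1_ext)

lemma sp1_least: "subsp W \<Longrightarrow> v \<in> W \<Longrightarrow> sp1 v \<subseteq> W"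
  unfolding sp1_def using subsp_smult by blast

lemma sp1_eq:
  assumes "v \<in> carrier M" "w \<in> sp1 v" "w \<noteq> \<zero>\<^bsub>M\<^esub>" shows "sp1 w = sp1 v"
proof -
  obtain a where a: "a \<in> carrier R" "w = a \<odot>\<^bsub>M\<^esub> v" using assms unfolding sp1_def by blast
  have nz: "a \<noteq> \<zero>" using assms a(2) smult_zero_l by blast
  have w: "w \<in> carrier M" using a assms(1) by simp
  then have "a \<odot>\<^bsub>M\<^esub> v \<in> sp1 w" using sp1_self a(2) by blast
  then have "v \<in> sp1 w" by (rule subsp_smult_cancel[OF subsp_sp1[OF w] a(1) nz assms(1)])
  then show ?thesis using sp1_least[OF subsp_sp1[OF w]] sp1_least[OF subsp_sp1[OF assms(1)] assms(2)] by blast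
qed

text \<open>A 2-dimensional space meets a hyperplane: subtract from \<open>w\<close> the multiple of
  \<open>v\<close> that cancels the coefficient of \<open>p\<close>.\<close>

lemma ext_meets:
  assumes W: "subsp W" and p: "p \<in> carrier M" and v: "v \<in> ext W p" and w: "w \<in> ext W p"
    and nz: "v \<noteq> \<zero>\<^bsub>M\<^esub>" and wv: "w \<notin> sp1 v"
  obtains x where "x \<in> W" "x \<noteq> \<zero>\<^bsub>M\<^esub>" "x \<in> ext (sp1 v) w"
proof -
  note c = subsp_carrier[OF W]
  have cv: "v \<in> carrier M" "w \<in> carrier M" using subsp_carrier[OF subsp_ext(1)[OF W p]] v w by auto
  obtain v1 a where 1: "v = v1 \<oplus>\<^bsub>M\<^esub> a \<odot>\<^bsub>M\<^esub> p" "v1 \<in> W" "a \<in> carrier R"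
    using v unfolding ext_def by blast
  obtain w1 b where 2: "w = w1 \<oplus>\<^bsub>M\<^esub> b \<odot>\<^bsub>M\<^esub> p" "w1 \<in> W" "b \<in> carrier R"
    using w unfolding ext_def by blast
  note E = subsp_ext[OF subsp_sp1[OF cv(1)] cv(2)]
  have vE: "v \<in> ext (sp1 v) w" using E(2) sp1_self[OF cv(1)] by blast
  show ?thesis
  proof (cases "a = \<zero>")
    case True
    then have "v = v1" using 1 c p by simp
    then show ?thesis using that[of v] 1 nz vE by blast
  next
    case False
    define d where "d = b \<otimes> inv a"
    have d: "d \<in> carrier R" "d \<otimes> a = b" using False 1 2 d_def
      by (auto simp: R.m_assoc l_inv)
    have "d \<odot>\<^bsub>M\<^esub> v = d \<odot>\<^bsub>M\<^esub> v1 \<oplus>\<^bsub>M\<^esub> b \<odot>\<^bsub>M\<^esub> p"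
      using 1 d c p by (simp add: smult_r_distr smult_assoc[symmetric])
    then have "w \<ominus>\<^bsub>M\<^esub> d \<odot>\<^bsub>M\<^esub> v = w1 \<ominus>\<^bsub>M\<^esub> d \<odot>\<^bsub>M\<^esub> v1"
      using 2 c p d 1 by (simp add: a_minus_def M.minus_add M.a_ac) (simp add: M.a_assoc[symmetric] M.r_neg)
    moreover have "w1 \<ominus>\<^bsub>M\<^esub> d \<odot>\<^bsub>M\<^esub> v1 \<in> W" using subsp_diff[OF W] subsp_smult[OF W] 1 2 d by blast
    moreover have "w \<ominus>\<^bsub>M\<^esub> d \<odot>\<^bsub>M\<^esub> v \<in> ext (sp1 v) w"
      using subsp_diff[OF E(1)] subsp_smult[OF E(1)] E(3) vE d by blast
    moreover have "w \<ominus>\<^bsub>M\<^esub> d \<odot>\<^bsub>M\<^esub> v \<noteq> \<zero>\<^bsub>M\<^esub>"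
    proof
      assume "w \<ominus>\<^bsub>M\<^esub> d \<odot>\<^bsub>M\<^esub> v = \<zero>\<^bsub>M\<^esub>"
      then have "w = d \<odot>\<^bsub>M\<^esub> v" using cv d by (metis M.minus_equality M.minus_minus M.a_inv_closed a_minus_def smult_closed)
      then show False using wv d unfolding sp1_def by blast
    qed
    ultimately show ?thesis using that by metis
  qed
qed

end

section \<open>Projective coordinates on a singular subspace\<close>

definition tuples :: "('k, 'm) ring_scheme \<Rightarrow> nat \<Rightarrow> ('k, nat \<Rightarrow> 'k) module" where
  "tuples R r = \<lparr>carrier = vecs R r, mult = (\<lambda>_ _. vec_zero R), one = vec_zero R,
     zero = vec_zero R, add = vec_add R, smult = vec_smult R\<rparr>"

lemma tuples_simps [simp]:
  "carrier (tuples R r) = vecs R r" "\<zero>\<^bsub>tuples R r\<^esub> = vec_zero R"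
  "v \<oplus>\<^bsub>tuples R r\<^esub> w = vec_add R v w" "a \<odot>\<^bsub>tuples R r\<^esub> v = vec_smult R a v"
  unfolding tuples_def by simp_all

lemma vecs_entry: "ring R \<Longrightarrow> v \<in> vecs R r \<Longrightarrow> v i \<in> carrier R"
  unfolding vecs_def using ring.ring_simprules(2)[of R] by (cases "i < r") auto

lemma left_vs_tuples:
  assumes R: "division_ring R" shows "left_vs R (tuples R r)"
proof -
  interpret R: ring R using R unfolding division_ring_def by blast
  note e = vecs_entry[OF R.ring_axioms]
  have g: "abelian_group (tuples R r)"
  proof (rule abelian_groupI, unfold tuples_simps)
    fix x y z assume x: "x \<in> vecs R r"
    show "vec_add R (vec_zero R) x = x"
      unfolding vec_add_def vec_zero_def using e[OF x] by simp
    have "(\<lambda>i. \<ominus>\<^bsub>R\<^esub> x i) \<in> vecs R r" using x unfolding vecs_def by simp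
    moreover have "vec_add R (\<lambda>i. \<ominus>\<^bsub>R\<^esub> x i) x = vec_zero R"
      unfolding vec_add_def vec_zero_def using e[OF x] by (simp add: R.l_neg)
    ultimately show "\<exists>y \<in> vecs R r. vec_add R y x = vec_zero R" by blast
    assume y: "y \<in> vecs R r"
    show "vec_add R x y \<in> vecs R r" using x y unfolding vecs_def vec_add_def by simp
    show "vec_add R x y = vec_add R y x"
      unfolding vec_add_def using e[OF x] e[OF y] by (simp add: R.a_comm)
    assume z: "z \<in> vecs R r"
    show "vec_add R (vec_add R x y) z = vec_add R x (vec_add R y z)"
      unfolding vec_add_def using e[OF x] e[OF y] e[OF z] by (simp add: R.a_assoc)
  next
    show "vec_zero R \<in> vecs R r" unfolding vecs_def vec_zero_def by simp
  qed
  show ?thesis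
  proof (rule left_vs.intro, fact R, fact g, unfold tuples_simps)
    fix a b v w assume a: "a \<in> carrier R" and v: "v \<in> vecs R r"
    show "vec_smult R a v \<in> vecs R r" using a v by (simp add: vec_smult_def vecs_def)
    show "vec_smult R a (vec_add R v w) = vec_add R (vec_smult R a v) (vec_smult R a w)"
      if "w \<in> vecs R r"
      using a e[OF v] e[OF that] by (simp add: vec_smult_def vec_add_def R.r_distr)
    assume b: "b \<in> carrier R"
    show "vec_smult R (a \<oplus>\<^bsub>R\<^esub> b) v = vec_add R (vec_smult R a v) (vec_smult R b v)"
      using a b e[OF v] by (simp add: vec_smult_def vec_add_def R.l_distr)
    show "vec_smult R (a \<otimes>\<^bsub>R\<^esub> b) v = vec_smult R a (vec_smult R b v)"
      using a b e[OF v] by (simp add: vec_smult_def R.m_assoc)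
  next
    fix v assume v: "v \<in> vecs R r"
    show "vec_smult R \<one>\<^bsub>R\<^esub> v = v"
      using e[OF v] by (simp add: vec_smult_def)
  qed
qed

lemma subspaces_iff:
  assumes R: "division_ring R"
  shows "W \<in> subspaces R (carrier R) r \<longleftrightarrow> left_vs.subsp R (tuples R r) W"
  unfolding left_vs.subsp_def[OF left_vs_tuples[OF R]] subspaces_def by auto

text \<open>Two kinds of instances occur: \<open>S\<close> the whole carrier, and \<open>S\<close>
  the image of \<open>K\<close> in the extension. The second describes a space over the extension
  with scalars restricted to \<open>K\<close>.\<close>

locale proj =
  fixes R :: "('k, 'm) ring_scheme" and S :: "'k set" and r :: nat
    and X :: "'p set" and \<Sigma> :: "'p set set" and \<phi> :: "'p \<Rightarrow> (nat \<Rightarrow> 'k) set"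
  assumes div: "division_ring R" and S: "S \<subseteq> carrier R" "\<one>\<^bsub>R\<^esub> \<in> S" "\<zero>\<^bsub>R\<^esub> \<in> S"
    "\<And>s t. s \<in> S \<Longrightarrow> t \<in> S \<Longrightarrow> s \<otimes>\<^bsub>R\<^esub> t \<in> S"
    "\<And>s. s \<in> S \<Longrightarrow> s \<noteq> \<zero>\<^bsub>R\<^esub> \<Longrightarrow> \<exists>t \<in> S. t \<otimes>\<^bsub>R\<^esub> s = \<one>\<^bsub>R\<^esub>"
    and iso: "proj_iso R S r X \<Sigma> \<phi>"
begin

sublocale V: left_vs R "tuples R r" by (rule left_vs_tuples[OF div])

definition ray :: "(nat \<Rightarrow> 'k) \<Rightarrow> (nat \<Rightarrow> 'k) set" where
  "ray v = {vec_smult R s v | s. s \<in> S}"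

lemma ray_iff: "w \<in> ray v \<longleftrightarrow> (\<exists>s \<in> S. w = vec_smult R s v)"
  unfolding ray_def by blast

lemma one_spaces_ray: "one_spaces R S r = ray ` {v \<in> vecs R r. v \<noteq> vec_zero R}"
  unfolding one_spaces_def ray_def[symmetric] by blast

lemma bij: "bij_betw \<phi> X (one_spaces R S r)"
  using iso unfolding proj_iso_def by blast

lemma Sigma: "\<Sigma> = {{x \<in> X. \<phi> x \<subseteq> W} | W. W \<in> subspaces R S r}"
  using iso unfolding proj_iso_def by blast

lemma ray_self: "v \<in> vecs R r \<Longrightarrow> v \<in> ray v"
  unfolding ray_iff using V.smult_one[of v] S(2) by (intro bexI[of _ "\<one>\<^bsub>R\<^esub>"]) simp_all

lemma ray_eq: "v \<in> vecs R r \<Longrightarrow> w \<in> ray v \<Longrightarrow> w \<noteq> vec_zero R \<Longrightarrow> ray w = ray v"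
proof -
  assume v: "v \<in> vecs R r" and w: "w \<in> ray v" and nz: "w \<noteq> vec_zero R"
  then obtain s where s: "s \<in> S" "w = vec_smult R s v" unfolding ray_iff by blast
  have "s \<noteq> \<zero>\<^bsub>R\<^esub>" using nz s v V.smult_zero_l[of v] by auto
  then obtain t where t: "t \<in> S" "t \<otimes>\<^bsub>R\<^esub> s = \<one>\<^bsub>R\<^esub>" using S(5) s by blast
  have a: "vec_smult R a w = vec_smult R (a \<otimes>\<^bsub>R\<^esub> s) v" if "a \<in> S" for a
    using V.smult_assoc[of a s v] subsetD[OF S(1)] s v that by simp
  have b: "vec_smult R a v = vec_smult R (a \<otimes>\<^bsub>R\<^esub> t) w" if "a \<in> S" for a
  proof -
    have "vec_smult R (a \<otimes>\<^bsub>R\<^esub> t) w = vec_smult R ((a \<otimes>\<^bsub>R\<^esub> t) \<otimes>\<^bsub>R\<^esub> s) v" using a S(4) that t by blast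
    also have "(a \<otimes>\<^bsub>R\<^esub> t) \<otimes>\<^bsub>R\<^esub> s = a" using t s that S(1) by (auto simp: V.R.m_assoc subset_iff)
    finally show ?thesis by simp
  qed
  show ?thesis
  proof
    show "ray w \<subseteq> ray v" unfolding subset_iff ray_iff using a S(4)[OF _ s(1)] by metis
    show "ray v \<subseteq> ray w" unfolding subset_iff ray_iff using b S(4)[OF _ t(1)] by metis
  qed
qed

lemma pt:
  assumes "v \<in> vecs R r" "v \<noteq> vec_zero R"
  obtains x where "x \<in> X" "\<phi> x = ray v"
proof -
  have "ray v \<in> \<phi> ` X"
    unfolding bij_betw_imp_surj_on[OF bij] one_spaces_ray using assms by simp
  then show ?thesis using that by (metis imageE)
qed

lemma rep:
  assumes "x \<in> X"
  obtains v where "v \<in> vecs R r" "v \<noteq> vec_zero R" "\<phi> x = ray v"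
proof -
  have "\<phi> x \<in> ray ` {v \<in> vecs R r. v \<noteq> vec_zero R}"
    using assms bij_betw_imp_surj_on[OF bij] unfolding one_spaces_ray by blast
  then show ?thesis using that by blast
qed

lemma phi_ray: "x \<in> X \<Longrightarrow> v \<in> \<phi> x \<Longrightarrow> v \<noteq> vec_zero R \<Longrightarrow> \<phi> x = ray v"
  using rep[of x] ray_eq by metis

lemma phi_vecs: "x \<in> X \<Longrightarrow> v \<in> \<phi> x \<Longrightarrow> v \<in> vecs R r"
  using rep[of x] V.smult_closed subsetD[OF S(1)] unfolding tuples_simps by (metis ray_iff)

lemma phi_inj: "x \<in> X \<Longrightarrow> y \<in> X \<Longrightarrow> v \<in> \<phi> x \<Longrightarrow> v \<in> \<phi> y \<Longrightarrow> v \<noteq> vec_zero R \<Longrightarrow> x = y"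
  using phi_ray[of x v] phi_ray[of y v] inj_onD[OF bij_betw_imp_inj_on[OF bij], of x y] by simp

lemma phi_rep: "x \<in> X \<Longrightarrow> \<exists>v \<in> \<phi> x. v \<in> vecs R r \<and> v \<noteq> vec_zero R"
  using rep[of x] ray_self by metis

lemma pt': "v \<in> vecs R r \<Longrightarrow> v \<noteq> vec_zero R \<Longrightarrow> \<exists>x \<in> X. v \<in> \<phi> x"
  using pt ray_self by metis

text \<open>The zero vector is put in explicitly because \<open>Y\<close> may be empty.\<close>

definition VS :: "'p set \<Rightarrow> (nat \<Rightarrow> 'k) set" where
  "VS Y = {v \<in> vecs R r. v = vec_zero R \<or> (\<exists>y \<in> Y. v \<in> \<phi> y)}"

lemma sub_phi:
  assumes W: "W \<in> subspaces R S r" and x: "x \<in> X" and v: "v \<in> \<phi> x" "v \<noteq> vec_zero R"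
  shows "v \<in> W \<longleftrightarrow> \<phi> x \<subseteq> W"
proof
  assume "v \<in> W"
  then show "\<phi> x \<subseteq> W"
    unfolding phi_ray[OF x v] using W unfolding subspaces_def by (auto simp: ray_iff)
qed (use v in blast)

lemma VS_sub: assumes W: "W \<in> subspaces R S r" shows "VS {x \<in> X. \<phi> x \<subseteq> W} = W"
proof
  have 0: "vec_zero R \<in> W" "W \<subseteq> vecs R r" using W unfolding subspaces_def by auto
  show "VS {x \<in> X. \<phi> x \<subseteq> W} \<subseteq> W" unfolding VS_def using 0 by auto
  show "W \<subseteq> VS {x \<in> X. \<phi> x \<subseteq> W}"
  proof
    fix w assume w: "w \<in> W"
    show "w \<in> VS {x \<in> X. \<phi> x \<subseteq> W}"
    proof (cases "w = vec_zero R")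
      case True then show ?thesis unfolding VS_def using 0 by auto
    next
      case False
      then obtain x where "x \<in> X" "w \<in> \<phi> x" using pt' w 0 by blast
      then show ?thesis using sub_phi[OF W] w False 0 unfolding VS_def by blast
    qed
  qed
qed

lemma VS_Sigma: "Y \<in> \<Sigma> \<Longrightarrow> VS Y \<in> subspaces R S r"
  unfolding Sigma using VS_sub by auto

lemma VS_iff: "Y \<in> \<Sigma> \<Longrightarrow> x \<in> X \<Longrightarrow> v \<in> \<phi> x \<Longrightarrow> v \<noteq> vec_zero R \<Longrightarrow> v \<in> VS Y \<longleftrightarrow> x \<in> Y"
  unfolding Sigma using VS_sub sub_phi by auto

lemma VS_phi: "Y \<in> \<Sigma> \<Longrightarrow> x \<in> X \<Longrightarrow> x \<in> Y \<longleftrightarrow> \<phi> x \<subseteq> VS Y"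
  unfolding Sigma using VS_sub by auto

lemma sub_Sigma: "W \<in> subspaces R S r \<Longrightarrow> {x \<in> X. \<phi> x \<subseteq> W} \<in> \<Sigma>"
  unfolding Sigma by auto

lemma VS_mono: "Y \<subseteq> Z \<Longrightarrow> VS Y \<subseteq> VS Z"
  unfolding VS_def by blast

end

lemma proj_full:
  assumes R: "division_ring R" and iso: "proj_iso R (carrier R) r X \<Sigma> \<phi>"
  shows "proj R (carrier R) r X \<Sigma> \<phi>"
proof -
  interpret V: left_vs R "tuples R r" by (rule left_vs_tuples[OF R])
  show ?thesis by (unfold_locales; use R iso V.l_inv in auto)
qed

section \<open>Joins and rank counts\<close>

locale polar_over = polar P \<Omega> n
  for P :: "'p set" and \<Omega> :: "'p set set" and n :: nat +
  fixes K :: "('k, 'm) ring_scheme"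
  assumes K: "division_ring K" and over: "defined_over K \<Omega>"
begin

lemma coord:
  assumes "T \<in> \<Omega>"
  obtains r \<phi> where "proj K (carrier K) r T {Y \<in> \<Omega>. Y \<subseteq> T} \<phi>"
  using assms over proj_full[OF K] unfolding defined_over_def by metis

lemma sp_insert_Omega: "X \<in> \<Omega> \<Longrightarrow> p \<in> perp X \<Longrightarrow> sp (insert p X) \<in> \<Omega>"
  using sp_Omega clique_insert by blast

text \<open>The vectors of \<open>ext\<close> describe a singular subspace containing
  \<open>X\<close> and \<open>p\<close>, so the span cannot be larger.\<close>

lemma VS_join:
  assumes C: "proj K (carrier K) r T {Y \<in> \<Omega>. Y \<subseteq> T} \<phi>"
    and X: "X \<in> \<Omega>" and p: "p \<in> perp X" and T: "sp (insert p X) \<subseteq> T"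
    and v: "v \<in> \<phi> p" "v \<noteq> vec_zero K"
  shows "proj.VS K r \<phi> (sp (insert p X)) = left_vs.ext K (tuples K r) (proj.VS K r \<phi> X) v"
proof -
  interpret C: proj K "carrier K" r T "{Y \<in> \<Omega>. Y \<subseteq> T}" \<phi> by (rule C)
  let ?J = "sp (insert p X)" let ?E = "C.V.ext (C.VS X) v"
  have J: "?J \<in> \<Omega>" using sp_insert_Omega X p by blast
  have JT: "?J \<in> {Y \<in> \<Omega>. Y \<subseteq> T}" using J T by simp
  have pT: "p \<in> T" "p \<in> ?J" and XJ: "X \<subseteq> ?J" using sp_sup[of "insert p X"] T by auto
  have XT: "X \<in> {Y \<in> \<Omega>. Y \<subseteq> T}" using X XJ T by auto
  have vv: "v \<in> carrier (tuples K r)" using C.phi_vecs[OF pT(1) v(1)] by simp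
  have VX: "C.V.subsp (C.VS X)" using C.VS_Sigma[OF XT] by (simp add: subspaces_iff[OF K])
  have VJ: "C.V.subsp (C.VS ?J)" using C.VS_Sigma[OF JT] by (simp add: subspaces_iff[OF K])
  note E = C.V.subsp_ext[OF VX vv]
  have ES: "?E \<in> subspaces K (carrier K) r" using E(1) by (simp add: subspaces_iff[OF K])
  have vJ: "v \<in> C.VS ?J" using C.VS_iff[OF JT pT(1) v] pT(2) by simp
  have "?E \<subseteq> C.VS ?J" using E(4)[OF VJ C.VS_mono[OF XJ] vJ] .
  moreover have "C.VS ?J \<subseteq> ?E"
  proof -
    have Z: "{x \<in> T. \<phi> x \<subseteq> ?E} \<in> \<Omega>" using C.sub_Sigma[OF ES] by simp
    have "X \<subseteq> {x \<in> T. \<phi> x \<subseteq> ?E}" using C.VS_phi[OF XT] E(2) XT by auto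
    moreover have "p \<in> {x \<in> T. \<phi> x \<subseteq> ?E}" using C.sub_phi[OF ES pT(1) v] E(3) pT by simp
    ultimately have "?J \<subseteq> {x \<in> T. \<phi> x \<subseteq> ?E}" using sp_least[OF Z, of "insert p X"] by simp
    then show ?thesis using C.VS_mono[of ?J "{x \<in> T. \<phi> x \<subseteq> ?E}"] unfolding C.VS_sub[OF ES] by simp
  qed
  ultimately show ?thesis by blast
qed

text \<open>Coordinates enter the theory of ranks here: by \<open>ext_meets\<close>, the vectors of
  any line in the span of \<open>X\<close> and \<open>p\<close> include a nonzero vector of
  \<open>X\<close>.\<close>

lemma hyper_join:
  assumes X: "X \<in> \<Omega>" and p: "p \<in> perp X" "p \<notin> X"
  shows "hyper X (sp (insert p X))"
proof -
  let ?T = "sp (insert p X)"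
  have T: "?T \<in> \<Omega>" using sp_Omega clique_insert X p by blast
  have XT: "X \<subset> ?T" and pT: "p \<in> ?T" using sp_sup[of "insert p X"] p by auto
  obtain r \<phi> where "proj K (carrier K) r ?T {Y \<in> \<Omega>. Y \<subseteq> ?T} \<phi>" using coord[OF T] .
  then interpret C: proj K "carrier K" r ?T "{Y \<in> \<Omega>. Y \<subseteq> ?T}" \<phi> .
  obtain pv where pv: "pv \<in> \<phi> p" "pv \<in> vecs K r" "pv \<noteq> vec_zero K" using C.phi_rep[OF pT] by blast
  have VX: "C.V.subsp (C.VS X)" using C.VS_Sigma X XT by (simp add: subspaces_iff[OF K])
  have VT: "C.VS ?T = C.V.ext (C.VS X) pv" using VS_join[OF C.proj_axioms X p(1) subset_refl pv(1,3)] .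
  show ?thesis
    unfolding hyper_def
  proof (intro conjI ballI impI)
    fix l assume l: "l \<in> lines \<Omega>" "l \<subseteq> ?T"
    obtain x y where xy: "x \<in> l" "y \<in> l" "x \<noteq> y" using line_two[OF l(1)] .
    have xT: "x \<in> ?T" and yT: "y \<in> ?T" using xy l by auto
    obtain v where v: "v \<in> \<phi> x" "v \<in> vecs K r" "v \<noteq> vec_zero K" using C.phi_rep[OF xT] by blast
    obtain w where w: "w \<in> \<phi> y" "w \<in> vecs K r" "w \<noteq> vec_zero K" using C.phi_rep[OF yT] by blast
    have "w \<notin> C.V.sp1 v"
    proof
      assume "w \<in> C.V.sp1 v"
      then have "w \<in> \<phi> x" unfolding C.phi_ray[OF xT v(1,3)] C.V.sp1_def C.ray_iff by auto
      then show False using C.phi_inj[OF xT yT _ w(1,3)] xy by blast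
    qed
    moreover have "v \<in> C.VS ?T" "w \<in> C.VS ?T" unfolding C.VS_def using v w xT yT by blast+
    then have "v \<in> C.V.ext (C.VS X) pv" "w \<in> C.V.ext (C.VS X) pv" unfolding VT by auto
    ultimately obtain u where u: "u \<in> C.VS X" "u \<noteq> vec_zero K" "u \<in> C.V.ext (C.V.sp1 v) w"
      using C.V.ext_meets[OF VX, of pv v w] pv v w by auto
    then have uv: "u \<in> vecs K r" unfolding C.VS_def by blast
    then obtain z where z: "z \<in> ?T" "u \<in> \<phi> z" using C.pt' u(2) by blast
    have "z \<in> X" using C.VS_iff[of X z u] X XT z u by blast
    have lS: "l \<in> {Y \<in> \<Omega>. Y \<subseteq> ?T}" using l line_Omega by blast
    have lV: "C.V.subsp (C.VS l)" using C.VS_Sigma[OF lS] by (simp add: subspaces_iff[OF K])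
    have "v \<in> C.VS l" "w \<in> C.VS l" using C.VS_iff[OF lS] xy v w xT yT by blast+
    then have "C.V.ext (C.V.sp1 v) w \<subseteq> C.VS l"
      using C.V.subsp_ext(4)[OF C.V.subsp_sp1[of v] _ lV, of w] C.V.sp1_least[OF lV, of v] v w by simp
    then have "z \<in> l" using C.VS_iff[OF lS z u(2)] u by blast
    then show "l \<inter> X \<noteq> {}" using \<open>z \<in> X\<close> by blast
  qed (use X T XT in auto)
qed

lemma rk_join: "X \<in> \<Omega> \<Longrightarrow> p \<in> perp X \<Longrightarrow> p \<notin> X \<Longrightarrow> rk (sp (insert p X)) = Suc (rk X)"
  using rk_hyper[OF hyper_join] .

text \<open>Growing \<open>X0\<close> to \<open>X\<close> point by point raises its rank by one at
  each step and lowers the rank of the part of \<open>Y\<close> perpendicular to it by at most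
  one.\<close>

lemma rk_perp_bound:
  assumes "X \<in> \<Omega>" "X0 \<in> \<Omega>" "X0 \<subseteq> X" "Y \<in> \<Omega>" "Y \<subseteq> perp X0"
  shows "rk Y + rk X0 \<le> rk (Y \<inter> perp X) + rk X"
  using assms(2-)
proof (induction "rk X - rk X0" arbitrary: X0 Y rule: less_induct)
  case less
  show ?case
  proof (cases "X0 = X")
    case True
    then show ?thesis using less.prems by (simp add: inf.absorb1)
  next
    case False
    then obtain p where p: "p \<in> X" "p \<notin> X0" using less.prems by blast
    then have pp: "p \<in> perp X0" "p \<in> P"
      using less.prems assms(1) Omega_sub[OF assms(1)] Omega_col[OF assms(1)] by (auto simp: perp_def)
    let ?X1 = "sp (insert p X0)" and ?Y1 = "Y \<inter> perp {p}"
    have X1: "?X1 \<in> \<Omega>" "rk ?X1 = Suc (rk X0)"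
      using sp_insert_Omega rk_join less.prems pp p by auto
    have X1X: "?X1 \<subseteq> X" using sp_least[OF assms(1)] p less.prems by simp
    have Y1: "?Y1 \<in> \<Omega>" "rk Y \<le> Suc (rk ?Y1)" using Omega_perp rk_perp_ge less.prems pp by auto
    have "?Y1 \<subseteq> perp (insert p X0)" using less.prems(4) unfolding perp_def by blast
    then have Y1X: "?Y1 \<subseteq> perp ?X1" using perp_sp[OF clique_insert] less.prems pp by metis
    have "rk ?X1 \<le> rk X" using rk_mono X1 X1X assms(1) by blast
    then have "rk ?Y1 + rk ?X1 \<le> rk (?Y1 \<inter> perp X) + rk X"
      using less.hyps[OF _ X1(1) X1X Y1(1) Y1X] X1(2) by linarith
    moreover have "?Y1 \<inter> perp X = Y \<inter> perp X" using p unfolding perp_def by blast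
    ultimately show ?thesis using X1 Y1 by simp
  qed
qed

lemma perp_empty: "perp {} = P"
  unfolding perp_def by simp

lemma rk_perp_bound0: "X \<in> \<Omega> \<Longrightarrow> Y \<in> \<Omega> \<Longrightarrow> rk Y \<le> rk (Y \<inter> perp X) + rk X"
  using rk_perp_bound[of X "{}" Y] empty_Omega rk_empty Omega_sub perp_empty by simp

text \<open>In a subspace \<open>M\<close> of rank \<open>n\<close> the part perpendicular to
  \<open>X\<close> has larger rank than \<open>X \<inter> M\<close>, so it contains a point outside
  \<open>X\<close>.\<close>

lemma extend:
  assumes X: "X \<in> \<Omega>" "rk X < n"
  obtains p where "p \<in> perp X" "p \<notin> X"
proof -
  obtain M where M: "M \<in> \<Omega>" "rk M = n" using ex_rk_n by blast
  have XM: "X \<inter> M \<in> \<Omega>" using Omega_Int X M by blast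
  have "M \<subseteq> perp (X \<inter> M)" using Omega_col[OF M(1)] Omega_sub[OF M(1)] unfolding perp_def by blast
  then have "rk M + rk (X \<inter> M) \<le> rk (M \<inter> perp X) + rk X"
    using rk_perp_bound[OF X(1) XM] M by blast
  then have "rk (X \<inter> M) < rk (M \<inter> perp X)" using M X by linarith
  then have "\<not> M \<inter> perp X \<subseteq> X \<inter> M"
    using rk_mono[of "M \<inter> perp X" "X \<inter> M"] Omega_perp[OF M(1) Omega_sub[OF X(1)]] XM by linarith
  then show ?thesis using that by blast
qed

lemma extend_max: "X \<in> \<Omega> \<Longrightarrow> \<exists>M \<in> \<Omega>. X \<subseteq> M \<and> rk M = n"
proof (induction "n - rk X" arbitrary: X rule: less_induct)
  case less
  show ?case
  proof (cases "rk X = n")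
    case False
    then have lt: "rk X < n" using rk_le[OF less.prems] by linarith
    then obtain p where p: "p \<in> perp X" "p \<notin> X" using extend less.prems by blast
    let ?X = "sp (insert p X)"
    have "?X \<in> \<Omega>" "rk ?X = Suc (rk X)" "X \<subseteq> ?X"
      using sp_insert_Omega rk_join less.prems p sp_sup[of "insert p X"] by auto
    then show ?thesis using less.hyps[of ?X] lt by (metis diff_less_mono2 lessI subset_trans)
  qed (use less.prems in blast)
qed

lemma max_perp: "M \<in> \<Omega> \<Longrightarrow> rk M = n \<Longrightarrow> perp M = M"
proof
  assume M: "M \<in> \<Omega>" "rk M = n"
  show "perp M \<subseteq> M"
    using rk_join[OF M(1)] rk_le[OF sp_insert_Omega[OF M(1)]] M(2) by fastforce
  show "M \<subseteq> perp M" using Omega_col[OF M(1)] Omega_sub[OF M(1)] unfolding perp_def by blast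
qed

end

section \<open>The fixed lines of a point-domestic collineation\<close>

context polar_over
begin

lemma Omega_perp_self: "X \<in> \<Omega> \<Longrightarrow> Y \<in> \<Omega> \<Longrightarrow> Y \<subseteq> X \<Longrightarrow> X \<subseteq> perp Y"
  using Omega_col[of X] Omega_sub[of X] unfolding perp_def by blast

text \<open>While \<open>N\<close> meets \<open>M\<close> in a point \<open>x\<close>, it is
  replaced by the span of \<open>p\<close> and \<open>N \<inter> perp {p}\<close>, where
  \<open>p\<close> is not collinear to \<open>x\<close>. The intersection with \<open>M\<close>
  loses \<open>x\<close> and gains nothing.\<close>

lemma opposite_max:
  assumes M: "M \<in> \<Omega>" "rk M = n"
  shows "\<exists>N \<in> \<Omega>. rk N = n \<and> N \<inter> M = {}"
proof -
  have "\<exists>N' \<in> \<Omega>. rk N' = n \<and> N' \<inter> M = {}" if "N \<in> \<Omega>" "rk N = n" for N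
    using that
  proof (induction "rk (N \<inter> M)" arbitrary: N rule: less_induct)
    case less
    show ?case
    proof (cases "N \<inter> M = {}")
      case False
      then obtain x where x: "x \<in> N" "x \<in> M" by blast
      then have xP: "x \<in> P" using Omega_sub M by blast
      then obtain p where p: "p \<in> P" "\<not> col x p" using noncol by blast
      let ?H = "N \<inter> perp {p}" and ?N = "sp (insert p (N \<inter> perp {p}))"
      have HO: "?H \<in> \<Omega>" and Hn: "Suc (rk ?H) = n"
        using Omega_perp rk_perp[OF less.prems(1) p(1) x(1)] less.prems p col_sym by auto
      have pH: "p \<in> perp ?H" using p(1) perpD[of _ "{p}" p] col_sym by (intro perpI) auto
      have pnH: "p \<notin> ?H" using Omega_col[OF less.prems(1) x(1)] p(2) by blast
      have N: "?N \<in> \<Omega>" "rk ?N = n" "?H \<subseteq> ?N" "p \<in> ?N"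
        using sp_insert_Omega[OF HO pH] rk_join[OF HO pH pnH] Hn sp_sup[of "insert p ?H"] by auto
      \<comment> \<open>\<open>N\<close> is spanned by \<open>x\<close> and
        \<open>N \<inter> perp {p}\<close>. The point \<open>z\<close> is collinear to
        \<open>x\<close> inside \<open>M\<close> and to the rest inside \<open>?N\<close>, so
        maximality of \<open>N\<close> puts it in \<open>N\<close>.\<close>
      have "z \<in> N" if z: "z \<in> ?N" "z \<in> M" for z
      proof -
        have xH: "x \<in> perp ?H" using Omega_perp_self[OF less.prems(1) HO] x by blast
        have xnH: "x \<notin> ?H" using p perpD[of x "{p}" p] by blast
        have "sp (insert x ?H) = N"
          using rk_eq[OF sp_insert_Omega[OF HO xH] less.prems(1)] sp_least[OF less.prems(1), of "insert x ?H"]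
            rk_join[OF HO xH xnH] Hn x less.prems by auto
        moreover have "z \<in> perp (insert x ?H)"
          using z Omega_col[OF M(1) z(2) x(2)] Omega_col[OF N(1) z(1)] N(3) Omega_sub[OF M(1)]
          by (intro perpI) auto
        ultimately have "z \<in> perp N" using perp_sp[OF clique_insert[OF HO xH]] by simp
        then show ?thesis using max_perp less.prems by simp
      qed
      then have sub: "?N \<inter> M \<subseteq> N \<inter> M" by blast
      have "x \<notin> ?N" using Omega_col[OF N(1) _ N(4), of x] p by blast
      then have "?N \<inter> M \<subset> N \<inter> M" using sub x by blast
      then have "rk (?N \<inter> M) < rk (N \<inter> M)" using rk_less Omega_Int N M less.prems by simp
      then show ?thesis using less.hyps N by blast
    qed (use less.prems in blast)
  qed
  then show ?thesis using M by blast
qed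

text \<open>\<open>perp M = M\<close> misses \<open>Y\<close>, so in the count from \<open>T\<close>
  up to \<open>M\<close> nothing of \<open>Y\<close> remains.\<close>

lemma opposite_bound:
  assumes M: "M \<in> \<Omega>" "rk M = n" and T: "T \<in> \<Omega>" "T \<subseteq> M"
    and Y: "Y \<in> \<Omega>" "Y \<subseteq> perp T" "Y \<inter> M = {}"
  shows "rk Y + rk T \<le> n"
  using rk_perp_bound[OF M(1) T Y(1,2)] Y(3) M max_perp[OF M] rk_empty by simp

text \<open>This amounts to \<open>perp (perp X) = X\<close>, in the form that forces a point into a
  fixed line. In a maximal subspace \<open>N\<close> disjoint from one through \<open>X\<close> and
  \<open>w\<close>, the perp of \<open>X\<close> leaves a larger rank than the perp of
  \<open>X\<close> and \<open>w\<close> together.\<close>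

lemma separate:
  assumes X: "X \<in> \<Omega>" and w: "w \<in> perp X" "w \<notin> X"
  obtains q where "q \<in> perp X" "\<not> col q w"
proof -
  let ?T = "sp (insert w X)"
  have T: "?T \<in> \<Omega>" "rk ?T = Suc (rk X)" using sp_insert_Omega rk_join X w by auto
  obtain M where M: "M \<in> \<Omega>" "?T \<subseteq> M" "rk M = n" using extend_max T by blast
  obtain N where N: "N \<in> \<Omega>" "rk N = n" "N \<inter> M = {}" using opposite_max M by blast
  have O: "N \<inter> perp X \<in> \<Omega>" "N \<inter> perp ?T \<in> \<Omega>" using Omega_perp N Omega_sub X T by auto
  have "rk N \<le> rk (N \<inter> perp X) + rk X" using rk_perp_bound0 X N by blast
  moreover have "rk (N \<inter> perp ?T) + rk ?T \<le> n"
    using opposite_bound[OF M(1,3) T(1) M(2) O(2)] N by blast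
  ultimately have "\<not> N \<inter> perp X \<subseteq> N \<inter> perp ?T"
    using rk_mono[OF O] T N by linarith
  then obtain q where q: "q \<in> perp X" "q \<notin> perp ?T" by blast
  then have "q \<notin> perp (insert w X)" using perp_sp[OF clique_insert[OF X w(1)]] by simp
  then have "\<not> col q w" using q unfolding perp_def by auto
  then show ?thesis using that q by blast
qed

lemma clique2: "x \<in> P \<Longrightarrow> y \<in> P \<Longrightarrow> col x y \<Longrightarrow> clique {x, y}"
  unfolding clique_def using col_sym[of x y] by auto

lemma sp_line: "l \<in> lines \<Omega> \<Longrightarrow> x \<in> l \<Longrightarrow> y \<in> l \<Longrightarrow> x \<noteq> y \<Longrightarrow> sp {x, y} = l"
proof
  assume l: "l \<in> lines \<Omega>" "x \<in> l" "y \<in> l" "x \<noteq> y"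
  show "sp {x, y} \<subseteq> l" using sp_least[OF line_Omega[OF l(1)], of "{x, y}"] l(2,3) by simp
  have "clique {x, y}" using clique2[of x y] line_sub[OF l(1)] line_col[OF l(1-3)] l(2,3) by auto
  then show "l \<subseteq> sp {x, y}"
    using closedD[OF Omega_closed[OF sp_Omega] l(1), of "{x, y}" x y] l(2-4) sp_sup[of "{x, y}"] by simp
qed

end

section \<open>A point-domestic collineation without fixed points\<close>

locale domestic = polar_over P \<Omega> n K
  for P :: "'p set" and \<Omega> :: "'p set set" and n :: nat and K :: "('k, 'm) ring_scheme" +
  fixes \<theta> :: "'p \<Rightarrow> 'p"
  assumes coll: "collineation P \<Omega> \<theta>" and dom: "point_domestic P \<Omega> \<theta>"
    and nofix: "\<And>x. x \<in> P \<Longrightarrow> \<theta> x \<noteq> x"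
begin

lemma th_bij: "bij_betw \<theta> P P"
  using coll unfolding collineation_def by blast

lemma th_P [simp]: "x \<in> P \<Longrightarrow> \<theta> x \<in> P"
  using th_bij bij_betwE by blast

lemma th_inj: "inj_on \<theta> P"
  using bij_betw_imp_inj_on[OF th_bij] .

lemma th_surj: "\<theta> ` P = P"
  using bij_betw_imp_surj_on[OF th_bij] .

lemma th_pre: "x \<in> P \<Longrightarrow> \<exists>w \<in> P. \<theta> w = x"
  by (subst (asm) th_surj[symmetric]) auto

lemma th_eq: "x \<in> P \<Longrightarrow> y \<in> P \<Longrightarrow> \<theta> x = \<theta> y \<longleftrightarrow> x = y"
  using inj_on_eq_iff[OF th_inj] .

lemma th_Omega_iff: "X \<subseteq> P \<Longrightarrow> \<theta> ` X \<in> \<Omega> \<longleftrightarrow> X \<in> \<Omega>"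
  using coll unfolding collineation_def by blast

lemma th_Omega: "X \<in> \<Omega> \<Longrightarrow> \<theta> ` X \<in> \<Omega>"
  using th_Omega_iff Omega_sub by blast

lemma th_sub: "X \<subseteq> P \<Longrightarrow> Y \<subseteq> P \<Longrightarrow> \<theta> ` X \<subseteq> \<theta> ` Y \<longleftrightarrow> X \<subseteq> Y"
  using inj_on_image_mem_iff[OF th_inj _, of _ Y] by (metis imageI image_mono subset_iff)

lemma th_preimage: "Y \<subseteq> P \<Longrightarrow> \<exists>X \<subseteq> P. \<theta> ` X = Y"
  by (rule exI[of _ "{x \<in> P. \<theta> x \<in> Y}"]) (use th_surj in auto)

lemma th_chain: "X \<subseteq> P \<Longrightarrow> chain_below \<Omega> (\<theta> ` X) k \<longleftrightarrow> chain_below \<Omega> X k"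
proof (induction k arbitrary: X)
  case 0 then show ?case by (simp add: chain_below_0 th_Omega_iff)
next
  case (Suc k)
  have sub: "\<theta> ` Z \<subset> \<theta> ` X \<longleftrightarrow> Z \<subset> X" if "Z \<subseteq> P" for Z
    unfolding psubset_eq th_sub[OF that Suc.prems]
      inj_on_image_eq_iff[OF th_inj that Suc.prems] by simp
  show ?case
  proof
    assume "chain_below \<Omega> (\<theta> ` X) (Suc k)"
    then obtain Y where Y: "\<theta> ` X \<in> \<Omega>" "Y \<subset> \<theta> ` X" "chain_below \<Omega> Y k"
      unfolding chain_below_Suc by blast
    then have "Y \<subseteq> P" using Omega_sub by blast
    then obtain Z where Z: "Z \<subseteq> P" "\<theta> ` Z = Y" using th_preimage by blast
    then have "chain_below \<Omega> Z k" "Z \<subset> X" using Suc.IH[of Z] Y(2,3) sub[of Z] by (metis, metis)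
    moreover have "X \<in> \<Omega>" using Y(1) th_Omega_iff[OF Suc.prems] by simp
    ultimately show "chain_below \<Omega> X (Suc k)" unfolding chain_below_Suc by blast
  next
    assume "chain_below \<Omega> X (Suc k)"
    then obtain Z where Z: "X \<in> \<Omega>" "Z \<subset> X" "chain_below \<Omega> Z k"
      unfolding chain_below_Suc by blast
    then have "Z \<subseteq> P" using Suc.prems by blast
    then have "chain_below \<Omega> (\<theta> ` Z) k" "\<theta> ` Z \<subset> \<theta> ` X" using Suc.IH[of Z] Z(2,3) sub[of Z] by (metis, metis)
    then show "chain_below \<Omega> (\<theta> ` X) (Suc k)" unfolding chain_below_Suc using th_Omega[OF Z(1)] by blast
  qed
qed

lemma th_rk: "X \<in> \<Omega> \<Longrightarrow> rk (\<theta> ` X) = rk X"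
  using th_chain[OF Omega_sub, of X] rk[of X] has_rank_iff[of "\<theta> ` X" "rk X"]
  unfolding has_rank_def by simp

lemma th_line: "l \<in> lines \<Omega> \<Longrightarrow> \<theta> ` l \<in> lines \<Omega>"
  by (simp add: lines_iff th_Omega th_rk)

lemma th_col: "x \<in> P \<Longrightarrow> y \<in> P \<Longrightarrow> col (\<theta> x) (\<theta> y) \<longleftrightarrow> col x y"
proof
  assume P: "x \<in> P" "y \<in> P"
  show "col (\<theta> x) (\<theta> y)" if "col x y"
  proof (cases "x = y")
    case False
    then obtain l where "l \<in> lines \<Omega>" "x \<in> l" "y \<in> l" using col_line \<open>col x y\<close> by blast
    then show ?thesis using line_col[OF th_line, of l "\<theta> x" "\<theta> y"] by simp
  qed simp
  show "col x y" if c: "col (\<theta> x) (\<theta> y)"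
  proof (cases "x = y")
    case False
    then have "\<theta> x \<noteq> \<theta> y" using th_eq P by blast
    then obtain m where m: "m \<in> lines \<Omega>" "\<theta> x \<in> m" "\<theta> y \<in> m" using col_line c by blast
    then obtain l where l: "l \<subseteq> P" "\<theta> ` l = m" using th_preimage line_sub by blast
    have "l \<in> \<Omega>" using l m th_Omega_iff line_Omega by blast
    moreover have "x \<in> l" "y \<in> l" using inj_on_image_mem_iff[OF th_inj _ l(1)] l(2) P m by blast+
    ultimately show ?thesis by (rule Omega_col)
  qed simp
qed

lemma col_th: "x \<in> P \<Longrightarrow> col x (\<theta> x)"
  using dom unfolding point_domestic_def opposite_points_def by blast

text \<open>
  On a line \<open>xy\<close> with \<open>y\<close> collinear to \<open>\<theta> x\<close>, every further point is collinear to \<open>\<theta> x\<close> and to its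
  own image, hence to the whole image line.
\<close>

lemma col_th_sym:
  assumes P: "x \<in> P" "y \<in> P" and c: "col x y" "col y (\<theta> x)"
  shows "col x (\<theta> y)"
proof (cases "x = y")
  case True then show ?thesis using col_th P by simp
next
  case False
  then obtain l where l: "l \<in> lines \<Omega>" "x \<in> l" "y \<in> l" using col_line c by blast
  obtain z where z: "z \<in> l" "z \<noteq> x" "z \<noteq> y" using line_third l by blast
  have zP: "z \<in> P" using line_sub l z by blast
  have "col (\<theta> x) z"
    using col_all[OF l(1) th_P[OF P(1)] l(2,3) False _ _ z(1)] col_th[OF P(1)] c(2)
    by (simp add: col_sym[of "\<theta> x"])
  then have "col z (\<theta> y)"
    using col_all[OF th_line[OF l(1)] zP, of "\<theta> x" "\<theta> z" "\<theta> y"] col_th[OF zP] th_eq[OF zP P(1)] z l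
    by (simp add: col_sym[of "\<theta> x"])
  then show ?thesis
    using col_all[OF l(1) th_P[OF P(2)] z(1) l(3) z(3) _ _ l(2)] col_th[OF P(2)]
    by (simp add: col_sym[of "\<theta> y"])
qed

definition L :: "'p \<Rightarrow> 'p set" where "L x = sp {x, \<theta> x}"

lemma L_line: assumes x: "x \<in> P" shows "L x \<in> lines \<Omega>" "x \<in> L x" "\<theta> x \<in> L x"
proof -
  have "x \<noteq> \<theta> x" using nofix x by metis
  then obtain l where l: "l \<in> lines \<Omega>" "x \<in> l" "\<theta> x \<in> l" using col_line[OF col_th[OF x]] by blast
  then have "L x = l" unfolding L_def using sp_line \<open>x \<noteq> \<theta> x\<close> by blast
  then show "L x \<in> lines \<Omega>" "x \<in> L x" "\<theta> x \<in> L x" using l by auto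
qed

lemma L_fixed: assumes x: "x \<in> P" shows "\<theta> ` L x = L x"
proof -
  note l = L_line[OF x]
  obtain w where w: "w \<in> P" "\<theta> w = x" using th_pre[OF x] by blast
  have "w \<in> L x"
  proof (rule ccontr)
    assume nw: "w \<notin> L x"
    have all: "col q w" if "q \<in> perp (L x)" for q
    proof -
      have q: "q \<in> P" "col q x" "col q (\<theta> x)" using subsetD[OF perp_sub that] perpD[OF that] l by auto
      then have "col x (\<theta> q)" using col_th_sym[OF x q(1)] by (simp add: col_sym[of q x])
      then show ?thesis using th_col[OF w(1) q(1)] w by (simp add: col_sym[of q w])
    qed
    \<comment> \<open>By \<open>all\<close>, \<open>w\<close> is collinear to every point of
      \<open>perp (L x)\<close>, in particular to \<open>L x\<close> itself. For a point outside
      \<open>L x\<close> this is what \<open>separate\<close> excludes.\<close>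
    have "L x \<subseteq> perp (L x)" using Omega_perp_self[OF line_Omega[OF l(1)] line_Omega[OF l(1)]] by simp
    then have "w \<in> perp (L x)" using all w by (intro perpI) (auto simp: col_sym[of w])
    then show False using separate[OF line_Omega[OF l(1)] _ nw] all by metis
  qed
  then have "x \<in> \<theta> ` L x" using w(2) by auto
  then show ?thesis
    using line_unique[OF th_line[OF l(1)] l(1), of x "\<theta> x"] l nofix[OF x] by simp
qed

text \<open>A fixed line through \<open>x\<close> has \<open>\<theta> x\<close> as a second point.
  So the fixed lines are the \<open>L x\<close>, one through each point.\<close>

lemma fixed_line_L: "l \<in> lines \<Omega> \<Longrightarrow> \<theta> ` l = l \<Longrightarrow> x \<in> l \<Longrightarrow> l = L x"
proof -
  assume l: "l \<in> lines \<Omega>" "\<theta> ` l = l" "x \<in> l"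
  then have "x \<in> P" "\<theta> x \<in> l" using line_sub by auto
  then show ?thesis using line_unique[of l "L x" x "\<theta> x"] L_line[of x] nofix[of x] l by auto
qed

lemma L_th: "x \<in> P \<Longrightarrow> y \<in> L x \<Longrightarrow> \<theta> y \<in> L x"
  using L_fixed by blast

lemma L_P: "x \<in> P \<Longrightarrow> L x \<subseteq> P"
  using L_line line_sub by blast

lemma L_eq: "x \<in> P \<Longrightarrow> y \<in> L x \<Longrightarrow> L y = L x"
  using fixed_line_L[of "L x" y] L_line L_fixed by simp

lemma L_Omega: "x \<in> P \<Longrightarrow> L x \<in> \<Omega>"
  using L_line line_Omega by blast

section \<open>Invariant subspaces and their ranks\<close>

definition invar :: "'p set \<Rightarrow> bool" where
  "invar W \<longleftrightarrow> W \<subseteq> P \<and> \<theta> ` W = W"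

lemma invar_th: "invar W \<Longrightarrow> x \<in> W \<Longrightarrow> \<theta> x \<in> W"
  unfolding invar_def by blast

lemma invar_L_sub: "invar W \<Longrightarrow> closed W \<Longrightarrow> x \<in> W \<Longrightarrow> L x \<subseteq> W"
proof -
  assume W: "invar W" "closed W" "x \<in> W"
  then have "x \<in> P" using closed_sub by auto
  then show ?thesis using closedD[OF W(2), of "L x" x "\<theta> x"] invar_th[OF W(1,3)] L_line[of x] nofix[of x] W(3) by auto
qed

text \<open>Both inclusions hold because \<open>\<theta>\<close> permutes the points of each
  \<open>L x\<close>.\<close>

lemma invarI:
  assumes W: "W \<subseteq> P" and L: "\<And>x. x \<in> W \<Longrightarrow> L x \<subseteq> W"
  shows "invar W"
proof -
  have "\<theta> ` W = W"
  proof (intro subset_antisym subsetI)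
    show "x \<in> W" if x: "x \<in> \<theta> ` W" for x
    proof -
      obtain y where y: "y \<in> W" "x = \<theta> y" using x by (rule imageE)
      then show ?thesis using L[OF y(1)] L_line(3)[of y] W by auto
    qed
    show "x \<in> \<theta> ` W" if x: "x \<in> W" for x
    proof -
      have "x \<in> P" using W x by auto
      then have "x \<in> \<theta> ` L x" using L_fixed[of x] L_line(2)[of x] by simp
      then show ?thesis using L[OF x] by auto
    qed
  qed
  then show ?thesis using W unfolding invar_def by simp
qed

lemma invar_L: "x \<in> P \<Longrightarrow> invar (L x)"
  using L_P L_fixed unfolding invar_def by blast

lemma invar_Int: "invar X \<Longrightarrow> invar Y \<Longrightarrow> invar (X \<inter> Y)"
  using inj_on_image_Int[OF th_inj, of X Y] unfolding invar_def by auto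

lemma invar_perp:
  assumes A: "invar A" shows "invar (perp A)"
proof -
  have AP: "A \<subseteq> P" "\<theta> ` A = A" using A unfolding invar_def by auto
  have iff: "\<theta> x \<in> perp A \<longleftrightarrow> x \<in> perp A" if x: "x \<in> P" for x
  proof
    assume h: "\<theta> x \<in> perp A"
    have "col x a" if "a \<in> A" for a
      using th_col[of x a] perpD[OF h invar_th[OF A that]] AP(1) x that by auto
    then show "x \<in> perp A" using x perpI by simp
  next
    assume h: "x \<in> perp A"
    have "col (\<theta> x) a" if "a \<in> A" for a
    proof -
      obtain b where b: "b \<in> A" "a = \<theta> b" using AP(2) \<open>a \<in> A\<close> by (metis imageE)
      then show ?thesis using th_col[of x b] perpD[OF h b(1)] x AP(1) by auto
    qed
    then show "\<theta> x \<in> perp A" using x perpI by simp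
  qed
  have "\<theta> ` perp A = perp A"
  proof (intro subset_antisym subsetI)
    show "x \<in> perp A" if "x \<in> \<theta> ` perp A" for x
      using that iff subsetD[OF perp_sub] by (metis imageE)
    show "x \<in> \<theta> ` perp A" if x: "x \<in> perp A" for x
    proof -
      obtain y where "y \<in> P" "x = \<theta> y" using th_pre subsetD[OF perp_sub x] by blast
      then show ?thesis using iff x by simp
    qed
  qed
  then show ?thesis using perp_sub unfolding invar_def by simp
qed

lemma perp_L: "x \<in> P \<Longrightarrow> perp (L x) = perp {x, \<theta> x}"
  unfolding L_def using perp_sp[OF clique2] col_th by simp

text \<open>Forward invariance is enough because the image has the same rank.\<close>

lemma invar_Omega: "X \<in> \<Omega> \<Longrightarrow> (\<And>x. x \<in> X \<Longrightarrow> \<theta> x \<in> X) \<Longrightarrow> invar X"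
proof -
  assume X: "X \<in> \<Omega>" "\<And>x. x \<in> X \<Longrightarrow> \<theta> x \<in> X"
  have "\<theta> ` X = X" by (rule rk_eq[OF th_Omega[OF X(1)] X(1)]) (use X th_rk in auto)
  then show ?thesis using Omega_sub[OF X(1)] unfolding invar_def by simp
qed

definition Fix :: "'p set set" where "Fix = {X \<in> \<Omega>. invar X}"

lemma Fix_eq: "Fix = fixed_subspaces \<Omega> \<theta>"
  unfolding Fix_def fixed_subspaces_def invar_def using Omega_sub by blast

lemma FixD: "X \<in> Fix \<Longrightarrow> X \<in> \<Omega>" "X \<in> Fix \<Longrightarrow> invar X"
  unfolding Fix_def by auto

lemma Fix_L_sub: "X \<in> Fix \<Longrightarrow> x \<in> X \<Longrightarrow> L x \<subseteq> X"
  using invar_L_sub FixD Omega_closed by blast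

lemma L_Fix: "x \<in> P \<Longrightarrow> L x \<in> Fix"
  unfolding Fix_def using L_Omega invar_L by blast

lemma Fix_Int: "X \<in> Fix \<Longrightarrow> Y \<in> Fix \<Longrightarrow> X \<inter> Y \<in> Fix"
  unfolding Fix_def using Omega_Int invar_Int by blast

lemma Fix_perp_L: "X \<in> Fix \<Longrightarrow> x \<in> P \<Longrightarrow> X \<inter> perp (L x) \<in> Fix"
  unfolding Fix_def using Omega_perp[OF _ L_P] invar_Int invar_perp invar_L by blast

lemma Fix_perp_Fix: "X \<in> Fix \<Longrightarrow> Y \<in> Fix \<Longrightarrow> X \<inter> perp Y \<in> Fix"
  unfolding Fix_def using Omega_perp[OF _ Omega_sub] invar_Int invar_perp by blast

text \<open>Two perps of points lower the rank by at most two. The drop is exactly two because the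
  point \<open>y\<close> of \<open>L x\<close> collinear to \<open>q\<close> is not in
  \<open>perp (L q)\<close>: otherwise the invariant subspace \<open>X \<inter> perp (L q)\<close>
  would contain \<open>L y = L x\<close>, hence \<open>x\<close>.\<close>

lemma rk_perp_L:
  assumes X: "X \<in> Fix" and x: "x \<in> X" and q: "q \<in> P" "\<not> col q x"
  shows "rk X = Suc (Suc (rk (X \<inter> perp (L q))))"
proof -
  let ?H = "X \<inter> perp {q}" and ?Y = "X \<inter> perp (L q)"
  have H: "?H \<in> \<Omega>" "rk X = Suc (rk ?H)" using Omega_perp rk_perp[OF _ q(1) x q(2)] FixD X q by auto
  have Y: "?Y = ?H \<inter> perp {\<theta> q}" using perp_L[OF q(1)] unfolding perp_def by auto
  have YO: "?Y \<in> \<Omega>" using Fix_perp_L X q FixD by blast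
  have xP: "x \<in> P" using X x FixD Omega_sub by blast
  obtain y where y: "y \<in> L x" "col q y" using meets L_line xP q by blast
  have yX: "y \<in> X" "y \<in> P" using y Fix_L_sub X x L_P xP by auto
  have "y \<notin> ?Y"
  proof
    assume "y \<in> ?Y"
    then have "L y \<subseteq> ?Y" using Fix_L_sub Fix_perp_L X q by blast
    then have "x \<in> perp (L q)" using L_eq[OF xP y(1)] L_line(2)[OF xP] by blast
    then show False using perpD[of x "L q" q] L_line(2) q col_sym by blast
  qed
  moreover have "y \<in> ?H" using y yX col_sym by (auto intro: perpI)
  ultimately have "rk ?Y < rk ?H" using rk_less[OF YO H(1)] Y by blast
  moreover have "rk ?H \<le> Suc (rk ?Y)" using rk_perp_ge[OF H(1), of "\<theta> q"] q Y by simp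
  ultimately show ?thesis using H by linarith
qed

lemma Fix_even: "X \<in> Fix \<Longrightarrow> even (rk X)"
proof (induction "rk X" arbitrary: X rule: less_induct)
  case less
  show ?case
  proof (cases "X = {}")
    case False
    then obtain x where x: "x \<in> X" by blast
    then obtain q where q: "q \<in> P" "\<not> col q x" using noncol[of x] less.prems FixD Omega_sub col_sym by blast
    have "rk X = Suc (Suc (rk (X \<inter> perp (L q))))" using rk_perp_L less.prems x q by blast
    then show ?thesis using less.hyps[OF _ Fix_perp_L[OF less.prems q(1)]] by simp
  qed (use rk_empty in simp)
qed

text \<open>The join of \<open>X\<close> and \<open>L x\<close>, formed in two steps so that
  \<open>rk_join\<close> applies to each.\<close>

definition jn :: "'p set \<Rightarrow> 'p \<Rightarrow> 'p set" where
  "jn X x = sp (insert (\<theta> x) (sp (insert x X)))"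

lemma jn:
  assumes X: "X \<in> Fix" and x: "x \<in> perp X" "x \<notin> X"
  shows "jn X x \<in> Fix" "rk (jn X x) = Suc (Suc (rk X))" "X \<subseteq> jn X x" "L x \<subseteq> jn X x"
    "Z \<in> \<Omega> \<Longrightarrow> X \<subseteq> Z \<Longrightarrow> L x \<subseteq> Z \<Longrightarrow> jn X x \<subseteq> Z"
    "perp (jn X x) = perp X \<inter> perp (L x)"
proof -
  note XO = FixD(1)[OF X]
  have xP: "x \<in> P" using x perp_sub by blast
  note l = L_line[OF xP]
  let ?Y = "sp (insert x X)"
  have Y: "?Y \<in> \<Omega>" "rk ?Y = Suc (rk X)" "X \<subseteq> ?Y" "x \<in> ?Y"
    using sp_insert_Omega[OF XO x(1)] rk_join[OF XO x] sp_sup[of "insert x X"] by auto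
  have disj: "L x \<inter> X = {}"
    using L_eq[OF xP] Fix_L_sub[OF X] l(2) x(2) by blast
  \<comment> \<open>If \<open>\<theta> x\<close> were in \<open>?Y\<close>, the whole line
    \<open>L x\<close> would be, and it would meet the hyperplane \<open>X\<close> of
    \<open>?Y\<close>; but \<open>L x\<close> is disjoint from the fixed subspace
    \<open>X\<close>.\<close>
  have ny: "\<theta> x \<notin> ?Y"
  proof
    assume "\<theta> x \<in> ?Y"
    then have "L x \<subseteq> ?Y" using closedD[OF Omega_closed[OF Y(1)] l(1), of x "\<theta> x"] l Y nofix[OF xP] by metis
    then show False using hyper_join[OF XO x] l(1) disj unfolding hyper_def by blast
  qed
  have "\<theta> x \<in> perp (insert x X)"
    using xP invar_th[OF invar_perp[OF FixD(2)[OF X]] x(1)] col_th[OF xP] col_sym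
    by (auto intro!: perpI dest: perpD)
  then have py: "\<theta> x \<in> perp ?Y" using perp_sp[OF clique_insert[OF XO x(1)]] by simp
  have J: "jn X x \<in> \<Omega>" "rk (jn X x) = Suc (Suc (rk X))" "?Y \<subseteq> jn X x" "\<theta> x \<in> jn X x"
    unfolding jn_def using sp_insert_Omega[OF Y(1) py] rk_join[OF Y(1) py ny] Y sp_sup[of "insert (\<theta> x) ?Y"] by auto
  show "rk (jn X x) = Suc (Suc (rk X))" "X \<subseteq> jn X x" using J Y by auto
  show LJ: "L x \<subseteq> jn X x"
    using closedD[OF Omega_closed[OF J(1)] l(1), of x "\<theta> x"] l J Y nofix[OF xP] by (metis subsetD)
  show least: "jn X x \<subseteq> Z" if "Z \<in> \<Omega>" "X \<subseteq> Z" "L x \<subseteq> Z" for Z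
    unfolding jn_def using sp_least[OF that(1), of "insert (\<theta> x) ?Y"] sp_least[OF that(1), of "insert x X"] that l by blast
  have "jn X x \<subseteq> \<theta> ` jn X x"
  proof (rule least[OF th_Omega[OF J(1)]])
    have "\<theta> ` X = X" using FixD(2)[OF X] unfolding invar_def by simp
    moreover have "X \<subseteq> jn X x" using Y(3) J(3) by (rule subset_trans)
    ultimately show "X \<subseteq> \<theta> ` jn X x" using image_mono[of X "jn X x" \<theta>] by simp
    show "L x \<subseteq> \<theta> ` jn X x" using image_mono[OF LJ, of \<theta>] L_fixed[OF xP] by simp
  qed
  then have "\<theta> ` jn X x = jn X x" using rk_eq[OF J(1) th_Omega[OF J(1)]] th_rk[OF J(1)] by simp
  then show "jn X x \<in> Fix" unfolding Fix_def invar_def using J Omega_sub by blast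
  have "perp (jn X x) = perp {\<theta> x} \<inter> perp ?Y"
    unfolding jn_def using perp_sp[OF clique_insert[OF Y(1) py]] by (auto simp: perp_def)
  also have "perp ?Y = perp {x} \<inter> perp X"
    using perp_sp[OF clique_insert[OF XO x(1)]] by (auto simp: perp_def)
  finally show "perp (jn X x) = perp X \<inter> perp (L x)"
    unfolding perp_L[OF xP] by (auto simp: perp_def)
qed

lemma empty_Fix: "{} \<in> Fix"
  unfolding Fix_def invar_def using empty_Omega by simp

lemma Fix_extend: "X \<in> Fix \<Longrightarrow> \<exists>M \<in> Fix. X \<subseteq> M \<and> rk M = n"
proof (induction "n - rk X" arbitrary: X rule: less_induct)
  case less
  show ?case
  proof (cases "rk X = n")
    case False
    then have lt: "rk X < n" using rk_le FixD less.prems le_neq_implies_less by blast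
    then obtain x where x: "x \<in> perp X" "x \<notin> X" using extend FixD less.prems by blast
    note J = jn[OF less.prems x]
    have "n - rk (jn X x) < n - rk X" using J(2) lt by linarith
    then obtain M where "M \<in> Fix" "jn X x \<subseteq> M" "rk M = n" using less.hyps J(1) by blast
    then show ?thesis using J(3) by blast
  qed (use less.prems in blast)
qed

lemma even_n: "even n"
  using Fix_extend[OF empty_Fix] Fix_even by blast

end

section \<open>The opposition diagram\<close>

context domestic
begin

text \<open>On a singular subspace, \<open>col x (\<theta> y)\<close> is thus a symmetric relation,
  and \<open>col_th\<close> makes it reflexive: this is the null polarity.\<close>

lemma th_sym: "x \<in> P \<Longrightarrow> y \<in> P \<Longrightarrow> col x y \<Longrightarrow> col x (\<theta> y) \<longleftrightarrow> col y (\<theta> x)"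
  using col_th_sym[of x y] col_th_sym[of y x] col_sym[of x y] by metis

text \<open>Opposition of \<open>U\<close> and its image with the points of the image named by
  points of \<open>U\<close>: the polarity on \<open>U\<close> has no radical.\<close>

definition oppth :: "'p set \<Rightarrow> bool" where
  "oppth U \<longleftrightarrow> (\<forall>u \<in> U. \<exists>v \<in> U. \<not> col u (\<theta> v))"

lemma mem_perp1: "q \<in> perp {p} \<longleftrightarrow> q \<in> P \<and> col q p"
  unfolding perp_def by simp

text \<open>\<open>V\<close> is the perp, for the polarity, of the hyperbolic pair \<open>x\<close>,
  \<open>u\<close>. With no form available, the splitting is obtained from ranks.\<close>

lemma opp_split:
  assumes U: "U \<in> \<Omega>" "oppth U" and xu: "x \<in> U" "u \<in> U" "\<not> col x (\<theta> u)"
  defines "V \<equiv> U \<inter> perp {\<theta> x} \<inter> perp {\<theta> u}"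
  shows "V \<in> \<Omega>" "rk U = Suc (Suc (rk V))" "oppth V"
proof -
  have sub: "a \<in> P" if "a \<in> U" for a using that Omega_sub[OF U(1)] by auto
  have sym: "col a (\<theta> b) \<longleftrightarrow> col b (\<theta> a)" if "a \<in> U" "b \<in> U" for a b
    using th_sym[OF sub sub Omega_col[OF U(1)]] that by blast
  let ?H = "U \<inter> perp {\<theta> x}"
  have H: "?H \<in> \<Omega>" "rk U = Suc (rk ?H)"
    using Omega_perp[OF U(1)] rk_perp[OF U(1) th_P[OF sub[OF xu(1)]] xu(2)] sym[OF xu(1,2)] xu sub
    by (auto simp: col_sym[of "\<theta> x"])
  have xH: "x \<in> ?H" using xu(1) sub col_th by (simp add: mem_perp1)
  have "rk ?H = Suc (rk V)" unfolding V_def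
    using rk_perp[OF H(1) th_P[OF sub[OF xu(2)]] xH] xu(3) by (simp add: col_sym[of "\<theta> u"])
  then show rkV: "rk U = Suc (Suc (rk V))" using H by simp
  show VO: "V \<in> \<Omega>" unfolding V_def using Omega_perp[OF H(1)] xu sub by simp
  show "oppth V"
    unfolding oppth_def
  proof (rule ballI, rule ccontr)
    fix v assume v: "v \<in> V" and "\<not> (\<exists>w \<in> V. \<not> col v (\<theta> w))"
    then have all: "\<And>w. w \<in> V \<Longrightarrow> col v (\<theta> w)" by blast
    have vU: "v \<in> U" and vxu: "col v (\<theta> x)" "col v (\<theta> u)" using v unfolding V_def by (auto simp: mem_perp1)
    obtain w where w: "w \<in> U" "\<not> col v (\<theta> w)" using U(2) vU unfolding oppth_def by blast
    \<comment> \<open>\<open>?S\<close> is the polar hyperplane of the radical point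
      \<open>v\<close>; it contains \<open>x\<close> and \<open>u\<close>. Its part perpendicular to
      \<open>\<theta> x\<close> contains \<open>V\<close> and has the same rank, so it is
      \<open>V\<close>. But \<open>x\<close> belongs to it and is not collinear to
      \<open>\<theta> u\<close>.\<close>
    let ?S = "U \<inter> perp {\<theta> v}"
    have S: "?S \<in> \<Omega>" using Omega_perp[OF U(1)] sub vU by simp
    have rS: "rk U = Suc (rk ?S)"
      using rk_perp[OF U(1) th_P[OF sub[OF vU]] w(1)] w(2) sym[OF vU w(1)] by (simp add: col_sym[of "\<theta> v"])
    have xS: "x \<in> ?S" "u \<in> ?S" using sym[OF vU] vxu xu sub by (auto simp: mem_perp1)
    have S2: "?S \<inter> perp {\<theta> x} \<in> \<Omega>" using Omega_perp[OF S] xu sub by simp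
    have "rk ?S = Suc (rk (?S \<inter> perp {\<theta> x}))"
      using rk_perp[OF S th_P[OF sub[OF xu(1)]] xS(2)] xu(3) sym[OF xu(1,2)] by (simp add: col_sym[of "\<theta> x"])
    then have r: "rk (?S \<inter> perp {\<theta> x}) = rk V" using rkV rS by simp
    have "V \<subseteq> ?S \<inter> perp {\<theta> x}"
    proof
      fix w assume w: "w \<in> V"
      then have wU: "w \<in> U" "w \<in> perp {\<theta> x}" unfolding V_def by auto
      then have "col w (\<theta> v)" using sym[OF vU wU(1)] all[OF w] by simp
      then show "w \<in> ?S \<inter> perp {\<theta> x}" using wU sub by (simp add: mem_perp1)
    qed
    then have "V = ?S \<inter> perp {\<theta> x}" using rk_eq[OF VO S2] r by simp
    moreover have "x \<in> ?S \<inter> perp {\<theta> x}" using xS xH by simp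
    ultimately have "x \<in> V" by simp
    then show False using xu(3) unfolding V_def by (simp add: mem_perp1)
  qed
qed

lemma opp_even: "U \<in> \<Omega> \<Longrightarrow> oppth U \<Longrightarrow> even (rk U)"
proof (induction "rk U" arbitrary: U rule: less_induct)
  case less
  show ?case
  proof (cases "U = {}")
    case False
    then obtain x u where xu: "x \<in> U" "u \<in> U" "\<not> col x (\<theta> u)"
      using less.prems(2) unfolding oppth_def by blast
    note s = opp_split[OF less.prems xu]
    show ?thesis using less.hyps[OF _ s(1,3)] s(2) by simp
  qed (use rk_empty in simp)
qed

definition nd :: "'p set \<Rightarrow> bool" where
  "nd W \<longleftrightarrow> closed W \<and> (\<forall>a \<in> W. \<exists>b \<in> W. \<not> col a b)"

text \<open>A point \<open>b\<close> not collinear to \<open>a\<close> is moved into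
  \<open>perp {x, y}\<close> in three steps: \<open>c\<close> on \<open>ay\<close> collinear to
  \<open>b\<close>, \<open>d\<close> on \<open>bc\<close> collinear to \<open>x\<close>,
  \<open>e\<close> on \<open>xd\<close> collinear to \<open>y\<close>. On \<open>bc\<close> and
  \<open>xd\<close> the point \<open>a\<close> is collinear only to \<open>c\<close> and
  \<open>x\<close> respectively, so it is not collinear to \<open>e\<close>.\<close>

lemma nd_perp:
  assumes W: "nd W" and xy: "x \<in> W" "y \<in> W" "\<not> col x y"
  shows "nd (W \<inter> perp {x, y})"
  unfolding nd_def
proof (intro conjI ballI)
  have cW: "closed W" and WP: "W \<subseteq> P" using W closed_sub unfolding nd_def by auto
  show "closed (W \<inter> perp {x, y})" using closed_Int[OF cW closed_perp[of "{x, y}"]] xy WP by auto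
  fix a assume a: "a \<in> W \<inter> perp {x, y}"
  then have a': "a \<in> W" "a \<in> P" "col a x" "col a y" using WP by (auto simp: perp_def)
  obtain b where b: "b \<in> W" "\<not> col a b" using W a' unfolding nd_def by blast
  have P: "x \<in> P" "y \<in> P" "b \<in> P" using xy b WP by auto
  have ay: "a \<noteq> y" "a \<noteq> x" using a' xy by (auto simp: col_sym[of y])
  obtain l where l: "l \<in> lines \<Omega>" "a \<in> l" "y \<in> l" using col_line[OF a'(4) ay(1)] by blast
  obtain c where c: "c \<in> l" "col b c" using meets[OF l(1) P(3)] by blast
  have lW: "l \<subseteq> W" using closedD[OF cW l(1-3) a'(1) xy(2) ay(1)] .
  have ac: "col a c" using line_col[OF l(1,2) c(1)] .
  then have bc: "b \<noteq> c" "c \<noteq> a" using b(2) c(2) by (auto simp: col_sym[of b])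
  obtain m where m: "m \<in> lines \<Omega>" "b \<in> m" "c \<in> m" using col_line[OF c(2) bc(1)] by blast
  have mW: "m \<subseteq> W" using closedD[OF cW m b(1)] c(1) lW bc(1) by blast
  obtain d where d: "d \<in> m" "col x d" using meets[OF m(1) P(1)] by blast
  have "d \<noteq> c"
  proof
    assume "d = c"
    then have "col x c" using d by simp
    then have "col x y"
      using col_all[OF l(1) P(1) l(2) c(1) bc(2)[symmetric] _ _ l(3)] a'(3) by (simp add: col_sym[of x a])
    then show False using xy by simp
  qed
  have nad: "\<not> col a d" using col_all[OF m(1) a'(2) d(1) m(3) \<open>d \<noteq> c\<close> _ ac m(2)] b(2) by blast
  then have "x \<noteq> d" using a'(3) by blast
  then obtain k where k: "k \<in> lines \<Omega>" "x \<in> k" "d \<in> k" using col_line[OF d(2)] by blast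
  have kW: "k \<subseteq> W" using closedD[OF cW k xy(1)] d(1) mW \<open>x \<noteq> d\<close> by blast
  obtain e where e: "e \<in> k" "col y e" using meets[OF k(1) P(2)] by blast
  have "e \<noteq> x" using e xy by (auto simp: col_sym[of y])
  then have "\<not> col a e" using col_all[OF k(1) a'(2) e(1) k(2) _ _ a'(3) k(3)] nad by blast
  moreover have "col e x" "col e y" using line_col[OF k(1) e(1) k(2)] e(2) by (auto simp: col_sym[of e y])
  moreover have "e \<in> W" "e \<in> P" using e kW WP by auto
  ultimately show "\<exists>b \<in> W \<inter> perp {x, y}. \<not> col a b" by (auto simp: perp_def)
qed

lemma perp_image: "A \<subseteq> P \<Longrightarrow> perp (\<theta> ` A) = \<theta> ` perp A"
proof (intro subset_antisym subsetI)
  assume A: "A \<subseteq> P"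
  fix x assume x: "x \<in> perp (\<theta> ` A)"
  then obtain y where y: "y \<in> P" "\<theta> y = x" using th_pre subsetD[OF perp_sub] by blast
  have "y \<in> perp A" using y A x th_col[OF y(1)] by (intro perpI) (auto dest: perpD)
  then show "x \<in> \<theta> ` perp A" using y by blast
next
  assume A: "A \<subseteq> P"
  fix x assume "x \<in> \<theta> ` perp A"
  then obtain y where y: "y \<in> perp A" "x = \<theta> y" by blast
  have yP: "y \<in> P" using y perp_sub by blast
  show "x \<in> perp (\<theta> ` A)" using y yP A th_col[OF yP] by (intro perpI) (auto dest: perpD)
qed

lemma perp_image_sp: "clique A \<Longrightarrow> perp (\<theta> ` sp A) = perp (\<theta> ` A)"
  using perp_image[OF Omega_sub[OF sp_Omega]] perp_image[of A] perp_sp[of A] unfolding clique_def by simp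

lemma perp_insert: "perp (insert a A) = perp {a} \<inter> perp A"
  unfolding perp_def by auto

text \<open>The induction carries along that the perp \<open>?W\<close> of \<open>U\<close> and its
  image is nondegenerate. This supplies a hyperbolic pair \<open>x\<close>, \<open>u\<close> in
  \<open>?W\<close>, by which \<open>U\<close> is enlarged.\<close>

lemma opp_exists: "2 * j \<le> n \<Longrightarrow> \<exists>U \<in> \<Omega>. rk U = 2 * j \<and> oppth U \<and> nd (perp U \<inter> perp (\<theta> ` U))"
proof (induction j)
  case 0
  have "nd P" unfolding nd_def using closed_P noncol by blast
  then show ?case using empty_Omega rk_empty perp_empty unfolding oppth_def by (intro bexI[of _ "{}"]) simp_all
next
  case (Suc j)
  then obtain U where U: "U \<in> \<Omega>" "rk U = 2 * j" "oppth U" and nd: "nd (perp U \<inter> perp (\<theta> ` U))" by auto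
  let ?W = "perp U \<inter> perp (\<theta> ` U)"
  have UP: "U \<subseteq> P" using Omega_sub U by blast
  have cW: "closed ?W" and WP: "?W \<subseteq> P" using nd closed_sub unfolding nd_def by auto
  have thW: "\<theta> w \<in> ?W" if w: "w \<in> ?W" for w
  proof -
    have wP: "w \<in> P" using w WP by blast
    have "col (\<theta> w) u \<and> col (\<theta> w) (\<theta> u)" if u: "u \<in> U" for u
    proof -
      have uP: "u \<in> P" using u UP by blast
      have "w \<in> perp (L u)" unfolding perp_L[OF uP] using w u wP by (auto simp: perp_def)
      then have "\<theta> w \<in> perp (L u)" using invar_th[OF invar_perp[OF invar_L[OF uP]]] by blast
      then show ?thesis unfolding perp_L[OF uP] by (auto simp: perp_def)
    qed
    then show ?thesis using th_P[OF wP] by (auto simp: perp_def)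
  qed
  have LW: "L w \<subseteq> ?W" if w: "w \<in> ?W" for w
  proof -
    have wP: "w \<in> P" using w WP by blast
    show ?thesis using closedD[OF cW L_line[OF wP] w thW[OF w] nofix[OF wP, symmetric]] .
  qed
  \<comment> \<open>\<open>?W\<close> has a point by a count in a maximal subspace through
    \<open>U\<close>: being perpendicular to the image of \<open>U\<close> costs at most
    \<open>2 * j\<close>, which is less than \<open>n\<close>.\<close>
  obtain M where M: "M \<in> \<Omega>" "U \<subseteq> M" "rk M = n" using extend_max U by blast
  let ?D = "M \<inter> perp (\<theta> ` U)"
  have "rk M \<le> rk ?D + rk (\<theta> ` U)" using rk_perp_bound0[OF th_Omega[OF U(1)] M(1)] .
  then have "rk ?D \<noteq> 0" using M U Suc.prems th_rk by simp
  then have "?D \<noteq> {}" using rk_empty by metis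
  then obtain x where x: "x \<in> M" "x \<in> perp (\<theta> ` U)" by blast
  have xW: "x \<in> ?W" using x Omega_perp_self[OF M(1) U(1) M(2)] by blast
  have xP: "x \<in> P" using xW WP by blast
  obtain q where q: "q \<in> ?W" "\<not> col x q" using nd xW unfolding nd_def by blast
  have qP: "q \<in> P" using q WP by blast
  obtain u where u: "u \<in> L q" "col x u" using meets[OF L_line(1)[OF qP] xP] by blast
  have uW: "u \<in> ?W" using u LW q by blast
  have uP: "u \<in> P" using uW WP by blast
  \<comment> \<open>Otherwise \<open>u\<close> would lie in \<open>perp (L x)\<close>, and by
    invariance so would all of \<open>L u = L q\<close>, including \<open>q\<close>.\<close>
  have nux: "\<not> col u (\<theta> x)"
  proof
    assume "col u (\<theta> x)"
    then have "u \<in> perp (L x)" unfolding perp_L[OF xP] using u uP by (simp add: perp_def col_sym[of u x])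
    then have "L u \<subseteq> perp (L x)" using invar_L_sub[OF invar_perp[OF invar_L[OF xP]] closed_perp[OF L_P[OF xP]]] by blast
    then have "q \<in> perp (L x)" using L_eq[OF qP u(1)] L_line(2)[OF qP] by auto
    then show False using perpD[of q "L x" x] L_line(2)[OF xP] q by (simp add: col_sym[of q])
  qed
  then have nxu: "\<not> col x (\<theta> u)" using th_sym[OF xP uP u(2)] by simp
  have xU: "x \<in> perp U" "x \<notin> U"
    using xW U(3) unfolding oppth_def by (auto simp: perp_def)
  let ?Y = "sp (insert x U)"
  have cl: "clique (insert x U)" using clique_insert[OF U(1) xU(1)] .
  have Y: "?Y \<in> \<Omega>" "rk ?Y = Suc (2 * j)" "U \<subseteq> ?Y" "x \<in> ?Y"
    using sp_Omega[OF cl] rk_join[OF U(1) xU] U(2) sp_sup[of "insert x U"] by auto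
  have YP: "?Y \<subseteq> P" using Omega_sub Y by blast
  have "insert x U \<subseteq> perp {\<theta> x}"
    using thW[OF xW] UP col_th[OF xP] xP by (auto simp: perp_def col_sym[of "\<theta> x"])
  then have Yx: "?Y \<subseteq> perp {\<theta> x}" using sp_closed[OF cl closed_perp] xP by simp
  have "u \<in> perp (insert x U)" using uW u by (auto simp: perp_def col_sym[of u x])
  then have uY: "u \<in> perp ?Y" using perp_sp[OF cl] by simp
  have unY: "u \<notin> ?Y" using Yx nux by (auto simp: perp_def)
  let ?U = "sp (insert u ?Y)"
  have clu: "clique (insert u ?Y)" using clique_insert[OF Y(1) uY] .
  have U': "?U \<in> \<Omega>" "rk ?U = Suc (Suc (2 * j))" "?Y \<subseteq> ?U" "u \<in> ?U"
    using sp_Omega[OF clu] rk_join[OF Y(1) uY unY] Y(2) sp_sup[of "insert u ?Y"] by auto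
  have "oppth ?U"
    unfolding oppth_def
  proof (rule ballI, rule ccontr)
    \<comment> \<open>A radical point \<open>v\<close> is perpendicular to
      \<open>\<theta> x\<close>, which cuts \<open>?U\<close> down to \<open>?Y\<close>, and to
      \<open>\<theta> u\<close>, which cuts \<open>?Y\<close> down to \<open>U\<close>. On
      \<open>U\<close> there is no radical.\<close>
    fix v assume v: "v \<in> ?U" and "\<not> (\<exists>w \<in> ?U. \<not> col v (\<theta> w))"
    then have all: "\<And>w. w \<in> ?U \<Longrightarrow> col v (\<theta> w)" by blast
    have vP: "v \<in> P" using v Omega_sub[OF U'(1)] by blast
    have O: "?U \<inter> perp {\<theta> x} \<in> \<Omega>" "?Y \<inter> perp {\<theta> u} \<in> \<Omega>" using Omega_perp U' Y xP uP by auto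
    have "rk ?U = Suc (rk (?U \<inter> perp {\<theta> x}))"
      using rk_perp[OF U'(1) th_P[OF xP] U'(4)] nux by (simp add: col_sym[of u])
    then have "rk (?U \<inter> perp {\<theta> x}) \<le> rk ?Y" using U'(2) Y(2) by linarith
    moreover have "?Y \<subseteq> ?U \<inter> perp {\<theta> x}" using U'(3) Yx by (rule Int_greatest)
    ultimately have YU: "?Y = ?U \<inter> perp {\<theta> x}" using rk_eq[OF Y(1) O(1)] by blast
    have "x \<in> ?U" using Y(4) U'(3) by blast
    then have "v \<in> perp {\<theta> x}" using all[of x] vP by (simp add: mem_perp1)
    then have vY: "v \<in> ?Y" by (subst YU) (use v in simp)
    have "rk ?Y = Suc (rk (?Y \<inter> perp {\<theta> u}))"
      using rk_perp[OF Y(1) th_P[OF uP] Y(4)] nxu by (simp add: col_sym[of x])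
    moreover have "U \<subseteq> ?Y \<inter> perp {\<theta> u}"
      using Y(3) thW[OF uW] UP by (auto simp: perp_def col_sym[of "\<theta> u"])
    ultimately have UY: "U = ?Y \<inter> perp {\<theta> u}" using rk_eq[OF U(1) O(2)] Y(2) U(2) by linarith
    have "v \<in> perp {\<theta> u}" using all[OF U'(4)] vP by (simp add: mem_perp1)
    then have "v \<in> U" by (subst UY) (use vY in simp)
    then show False using U(3) all Y(3) U'(3) unfolding oppth_def by blast
  qed
  moreover have "nd (perp ?U \<inter> perp (\<theta> ` ?U))"
  proof -
    \<comment> \<open>The pairs \<open>x\<close>, \<open>\<theta> u\<close> and \<open>u\<close>,
      \<open>\<theta> x\<close> are each non-collinear, and each point of one is collinear to both
      points of the other. So \<open>nd_perp\<close> can be applied twice.\<close>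
    have "nd (?W \<inter> perp {x, \<theta> u})" using nd_perp[OF nd xW thW[OF uW] nxu] .
    moreover have "u \<in> ?W \<inter> perp {x, \<theta> u}" "\<theta> x \<in> ?W \<inter> perp {x, \<theta> u}"
      using uW thW[OF xW] u(2) col_th[OF uP] col_th[OF xP] th_col[OF xP uP]
      by (auto simp: perp_def col_sym[of u x] col_sym[of "\<theta> x" x])
    ultimately have "nd ((?W \<inter> perp {x, \<theta> u}) \<inter> perp {u, \<theta> x})" using nd_perp nux by blast
    moreover have "perp ?U = perp {u} \<inter> (perp {x} \<inter> perp U)"
      using perp_sp[OF clu] perp_sp[OF cl] perp_insert by metis
    moreover have "perp (\<theta> ` ?U) = perp {\<theta> u} \<inter> (perp {\<theta> x} \<inter> perp (\<theta> ` U))"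
      using perp_image_sp[OF clu] perp_image_sp[OF cl] perp_insert image_insert by metis
    moreover have "(?W \<inter> perp {x, \<theta> u}) \<inter> perp {u, \<theta> x} =
      (perp {u} \<inter> (perp {x} \<inter> perp U)) \<inter> (perp {\<theta> u} \<inter> (perp {\<theta> x} \<inter> perp (\<theta> ` U)))"
      by (auto simp: perp_def)
    ultimately show ?thesis by simp
  qed
  ultimately show ?case using U' by (intro bexI[of _ ?U]) simp_all
qed

lemma opposite_iff: "U \<in> \<Omega> \<Longrightarrow> opposite \<Omega> U (\<theta> ` U) \<longleftrightarrow> oppth U"
  unfolding opposite_def oppth_def opposite_points_def has_rank_iff using th_Omega th_rk by auto

lemma Diag_half: "Diag K n P \<Omega> \<theta> = diagram_half (type_of K n P \<Omega>) n"
proof -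
  have "(\<exists>U \<in> \<Omega>. has_rank \<Omega> U k \<and> opposite \<Omega> U (\<theta> ` U)) \<longleftrightarrow> even k" if "k \<le> n" for k
  proof
    assume "\<exists>U \<in> \<Omega>. has_rank \<Omega> U k \<and> opposite \<Omega> U (\<theta> ` U)"
    then obtain U where "U \<in> \<Omega>" "rk U = k" "oppth U" using opposite_iff by (auto simp: has_rank_iff)
    then show "even k" using opp_even by blast
  next
    assume "even k"
    then obtain j where j: "k = 2 * j" by blast
    then obtain U where "U \<in> \<Omega>" "rk U = k" "oppth U" using opp_exists[of j] \<open>k \<le> n\<close> by auto
    then show "\<exists>U \<in> \<Omega>. has_rank \<Omega> U k \<and> opposite \<Omega> U (\<theta> ` U)"
      using opposite_iff by (intro bexI[of _ U]) (simp_all add: has_rank_iff)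
  qed
  then have "{k \<in> {1..n}. \<exists>U \<in> \<Omega>. has_rank \<Omega> U k \<and> opposite \<Omega> U (\<theta> ` U)} = {k \<in> {1..n}. even k}"
    by (intro Collect_cong) (simp cong: conj_cong)
  then show ?thesis unfolding Diag_def diagram_half_def by simp
qed

section \<open>The polar space of fixed lines\<close>

abbreviation Q :: "'p set set" where "Q \<equiv> fixed_lines \<Omega> \<theta>"

definition F :: "'p set \<Rightarrow> 'p set set" where "F X = {l \<in> Q. l \<subseteq> X}"

abbreviation Omega' :: "'p set set set" where "Omega' \<equiv> as_line_sets \<Omega> \<theta>"

lemma Omega'_eq: "Omega' = F ` Fix"
  unfolding as_line_sets_def F_def Fix_eq by auto

lemma Q_iff: "l \<in> Q \<longleftrightarrow> (\<exists>x \<in> P. l = L x)"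
proof
  assume "l \<in> Q"
  then have l: "l \<in> lines \<Omega>" "\<theta> ` l = l" unfolding fixed_lines_def by auto
  obtain x where "x \<in> l" using line_two l by blast
  then show "\<exists>x \<in> P. l = L x" using fixed_line_L l line_sub by blast
next
  assume "\<exists>x \<in> P. l = L x"
  then obtain x where x: "x \<in> P" "l = L x" by blast
  then show "l \<in> Q" unfolding fixed_lines_def using L_line(1)[OF x(1)] L_fixed[OF x(1)] by simp
qed

lemma Q_L: "l \<in> Q \<Longrightarrow> x \<in> l \<Longrightarrow> l = L x"
  unfolding fixed_lines_def using fixed_line_L by blast

lemma Q_rk: "l \<in> Q \<Longrightarrow> l \<in> Fix \<and> rk l = 2"
  using Q_iff L_Fix L_line lines_iff by metis

lemma Q_ex: "l \<in> Q \<Longrightarrow> \<exists>x \<in> P. x \<in> l \<and> l = L x"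
  using Q_iff L_line(2) by blast

lemma Fix_P: "X \<in> Fix \<Longrightarrow> x \<in> X \<Longrightarrow> x \<in> P"
  using FixD(1) Omega_sub by blast

lemma L_Q: "x \<in> P \<Longrightarrow> L x \<in> Q"
  using Q_iff by auto

lemma F_L: "X \<in> Fix \<Longrightarrow> x \<in> X \<Longrightarrow> L x \<in> F X"
  unfolding F_def using L_Q[OF Fix_P] Fix_L_sub by simp

lemma F_sub: "X \<in> Fix \<Longrightarrow> Y \<in> Fix \<Longrightarrow> F X \<subseteq> F Y \<longleftrightarrow> X \<subseteq> Y"
proof
  assume X: "X \<in> Fix" "Y \<in> Fix" and s: "F X \<subseteq> F Y"
  show "X \<subseteq> Y"
  proof
    fix x assume x: "x \<in> X"
    then have "L x \<in> F Y" using F_L[OF X(1)] s by auto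
    then show "x \<in> Y" unfolding F_def using L_line(2)[OF Fix_P[OF X(1) x]] by blast
  qed
next
  assume "X \<subseteq> Y" then show "F X \<subseteq> F Y" unfolding F_def by blast
qed

lemma F_eq: "X \<in> Fix \<Longrightarrow> Y \<in> Fix \<Longrightarrow> F X = F Y \<longleftrightarrow> X = Y"
  using F_sub[of X Y] F_sub[of Y X] by auto

lemma F_psub: "X \<in> Fix \<Longrightarrow> Y \<in> Fix \<Longrightarrow> F X \<subset> F Y \<longleftrightarrow> X \<subset> Y"
  using F_sub[of X Y] F_eq[of X Y] unfolding psubset_eq by simp

text \<open>Fixed subspaces have even rank, so a proper inclusion between them costs at least two;
  intersecting with \<open>perp (L q)\<close> costs exactly two. Rank in the fixed structure is
  therefore half the rank in \<open>\<Omega>\<close>.\<close>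

lemma F_chain: "X \<in> Fix \<Longrightarrow> chain_below Omega' (F X) k \<longleftrightarrow> 2 * k \<le> rk X"
proof (induction k arbitrary: X)
  case 0
  then show ?case by (simp add: chain_below_0 Omega'_eq)
next
  case (Suc k)
  show ?case
  proof
    assume "chain_below Omega' (F X) (Suc k)"
    then obtain S where S: "S \<subset> F X" "chain_below Omega' S k" unfolding chain_below_Suc by blast
    then obtain Y where Y: "Y \<in> Fix" "S = F Y" using chain_below_mem[OF S(2)] unfolding Omega'_eq by blast
    then have "2 * k \<le> rk Y" "Y \<subset> X" using Suc.IH[OF Y(1)] S F_psub[OF Y(1) Suc.prems] by auto
    moreover have "rk Y < rk X" using rk_less[OF FixD(1) FixD(1)] Y(1) Suc.prems \<open>Y \<subset> X\<close> by blast
    ultimately show "2 * Suc k \<le> rk X" using Fix_even[OF Y(1)] Fix_even[OF Suc.prems] by presburger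
  next
    assume r: "2 * Suc k \<le> rk X"
    then have "X \<noteq> {}" using rk_empty by auto
    then obtain x where x: "x \<in> X" by blast
    then obtain q where q: "q \<in> P" "\<not> col q x" using noncol[OF Fix_P[OF Suc.prems x]] col_sym by metis
    let ?Y = "X \<inter> perp (L q)"
    have Y: "?Y \<in> Fix" "rk X = Suc (Suc (rk ?Y))"
      using Fix_perp_L[OF Suc.prems q(1)] rk_perp_L[OF Suc.prems x q] by auto
    then have c: "chain_below Omega' (F ?Y) k" using Suc.IH r by simp
    have "?Y \<noteq> X" using Y(2) by auto
    then have "F ?Y \<subset> F X" using F_psub[OF Y(1) Suc.prems] by blast
    moreover have "F X \<in> Omega'" unfolding Omega'_eq using Suc.prems by blast
    ultimately show "chain_below Omega' (F X) (Suc k)" unfolding chain_below_Suc using c by blast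
  qed
qed

lemma F_rank: "X \<in> Fix \<Longrightarrow> has_rank Omega' (F X) k \<longleftrightarrow> rk X = 2 * k"
  unfolding has_rank_def using F_chain[of X k] F_chain[of X "Suc k"] Fix_even[of X] by presburger

lemma lines'_iff: "S \<in> lines Omega' \<longleftrightarrow> (\<exists>T \<in> Fix. rk T = 4 \<and> S = F T)"
proof
  assume "S \<in> lines Omega'"
  then obtain T where "T \<in> Fix" "S = F T" "has_rank Omega' S 2" unfolding lines_def Omega'_eq by blast
  then show "\<exists>T \<in> Fix. rk T = 4 \<and> S = F T" using F_rank[of T 2] by auto
next
  assume "\<exists>T \<in> Fix. rk T = 4 \<and> S = F T"
  then show "S \<in> lines Omega'" unfolding lines_def Omega'_eq using F_rank[of _ 2] Omega'_eq by auto
qed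

lemma jn_lines:
  assumes l: "l \<in> Q" "m \<in> Q" "l \<noteq> m" "l \<subseteq> perp m"
  obtains T where "T \<in> Fix" "rk T = 4" "l \<subseteq> T" "m \<subseteq> T" "\<And>Z. Z \<in> \<Omega> \<Longrightarrow> l \<subseteq> Z \<Longrightarrow> m \<subseteq> Z \<Longrightarrow> T \<subseteq> Z"
proof -
  obtain x where x: "x \<in> P" "x \<in> l" "l = L x" using Q_ex l by blast
  have "x \<notin> m" using x Q_L[OF l(2)] l(3) by blast
  moreover have "x \<in> perp m" using x l by blast
  ultimately show ?thesis
    using that[of "jn m x"] jn[of m x] Q_rk[OF l(2)] x(3) by auto
qed

lemma perp_comm: "A \<subseteq> P \<Longrightarrow> B \<subseteq> P \<Longrightarrow> A \<subseteq> perp B \<longleftrightarrow> B \<subseteq> perp A"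
  using perp_sym by blast

lemma Q_P: "l \<in> Q \<Longrightarrow> l \<subseteq> P"
  using Q_iff L_P by blast

text \<open>Distinct fixed lines are disjoint, so perpendicular ones have a join of rank 4, which is
  a line of the fixed structure.\<close>

lemma col'_iff: "l \<in> Q \<Longrightarrow> m \<in> Q \<Longrightarrow> collinear Omega' l m \<longleftrightarrow> l \<subseteq> perp m"
proof
  assume Q: "l \<in> Q" "m \<in> Q"
  show "l \<subseteq> perp m" if c: "collinear Omega' l m"
  proof (cases "l = m")
    case True
    then show ?thesis using Omega_perp_self[of m m] Q_rk[OF Q(2)] FixD(1) by simp
  next
    case False
    then obtain S where S: "S \<in> lines Omega'" "l \<in> S" "m \<in> S" using c unfolding collinear_def by blast
    then obtain T where "T \<in> Fix" "S = F T" using lines'_iff by auto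
    then have "T \<in> \<Omega>" "l \<subseteq> T" "m \<subseteq> T" using S FixD(1) unfolding F_def by auto
    moreover have "m \<in> \<Omega>" using Q_rk[OF Q(2)] FixD(1) by simp
    ultimately show ?thesis using Omega_perp_self[of T m] by blast
  qed
  show "collinear Omega' l m" if c: "l \<subseteq> perp m"
  proof (cases "l = m")
    case False
    obtain T where "T \<in> Fix" "rk T = 4" "l \<subseteq> T" "m \<subseteq> T" by (rule jn_lines[OF Q False c])
    then have "F T \<in> lines Omega'" "l \<in> F T" "m \<in> F T" using lines'_iff Q unfolding F_def by auto
    then show ?thesis unfolding collinear_def by blast
  qed (simp add: collinear_def)
qed

lemma col'_sym: "l \<in> Q \<Longrightarrow> m \<in> Q \<Longrightarrow> collinear Omega' l m \<longleftrightarrow> m \<subseteq> perp l"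
  using col'_iff perp_comm Q_P by metis

text \<open>A line \<open>m\<close> in \<open>T\<close> that is not fixed has three points, and they
  lie on different fixed lines, because two of them on one fixed line would make \<open>m\<close>
  that line.\<close>

lemma three_lines:
  assumes T: "T \<in> Fix" "rk T = 4"
  shows "\<exists>x \<in> F T. \<exists>y \<in> F T. \<exists>z \<in> F T. x \<noteq> y \<and> x \<noteq> z \<and> y \<noteq> z"
proof -
  have "T \<noteq> {}" using T rk_empty by auto
  then obtain x where x: "x \<in> T" by blast
  have xP: "x \<in> P" using Fix_P T x by blast
  have "\<not> T \<subseteq> L x"
    using rk_mono[OF FixD(1)[OF T(1)] L_Omega[OF xP]] T L_line[OF xP] lines_iff by auto
  then obtain y where y: "y \<in> T" "y \<notin> L x" by blast
  have yP: "y \<in> P" using Fix_P T y by blast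
  have "x \<noteq> y" using y L_line(2)[OF xP] by blast
  then obtain m where m: "m \<in> lines \<Omega>" "x \<in> m" "y \<in> m" "m \<subseteq> T" using line_in[OF FixD(1)[OF T(1)] x y(1)] by blast
  obtain z where z: "z \<in> m" "z \<noteq> x" "z \<noteq> y" using line_third m by blast
  have zP: "z \<in> P" using z m Fix_P T by blast
  have d: "L a \<noteq> L b" if "a \<in> m" "b \<in> m" "a \<noteq> b" "a \<in> P" "b \<in> P" for a b
  proof
    assume "L a = L b"
    then have "a \<in> L a" "b \<in> L a" using L_line(2) that by auto
    then have "m = L a" using line_unique[OF m(1) L_line(1)[OF that(4)]] that by blast
    then have "L x = L a" using L_eq[OF that(4)] m by blast
    then show False using \<open>m = L a\<close> m y by blast
  qed
  have "L x \<in> F T" "L y \<in> F T" "L z \<in> F T" using F_L T x y z m by auto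
  moreover have "L x \<noteq> L y" "L x \<noteq> L z" "L y \<noteq> L z" using d m z xP yP zP \<open>x \<noteq> y\<close> by metis+
  ultimately show ?thesis by blast
qed

text \<open>For the harder inclusion, the subspace belonging to a closed set \<open>S\<close> is the
  union of its members. A point on a line joining members \<open>a\<close> and \<open>b\<close> lies
  in their join, all of whose fixed lines belong to \<open>S\<close>.\<close>

lemma Omega'_closed:
  "Omega' = {S. S \<subseteq> Q \<and> (\<forall>x \<in> S. \<forall>y \<in> S. collinear Omega' x y) \<and>
     (\<forall>l \<in> lines Omega'. (\<exists>x \<in> l \<inter> S. \<exists>y \<in> l \<inter> S. x \<noteq> y) \<longrightarrow> l \<subseteq> S)}"
proof (intro subset_antisym subsetI)
  fix S assume "S \<in> Omega'"
  then obtain X where X: "X \<in> Fix" "S = F X" unfolding Omega'_eq by blast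
  have 1: "S \<subseteq> Q" unfolding X F_def by blast
  have 2: "collinear Omega' x y" if "x \<in> S" "y \<in> S" for x y
  proof -
    have xy: "x \<in> Q" "y \<in> Q" "x \<subseteq> X" "y \<subseteq> X" using that unfolding X F_def by auto
    then have "X \<subseteq> perp y" using Omega_perp_self[OF FixD(1)[OF X(1)], of y] Q_rk[OF xy(2)] FixD(1) by simp
    then show ?thesis using col'_iff[OF xy(1,2)] xy(3) by simp
  qed
  have 3: "l \<subseteq> S" if l: "l \<in> lines Omega'" "x \<in> l \<inter> S" "y \<in> l \<inter> S" "x \<noteq> y" for l x y
  proof -
    obtain T where T: "T \<in> Fix" "rk T = 4" "l = F T" using l lines'_iff by blast
    have xy: "x \<in> Q" "y \<in> Q" "x \<subseteq> T" "y \<subseteq> T" "x \<subseteq> X" "y \<subseteq> X" using l(2,3) T X unfolding F_def by auto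
    \<comment> \<open>The join \<open>Z\<close> of \<open>x\<close> and \<open>y\<close> lies in
      both \<open>T\<close> and \<open>X\<close>; having rank 4 it equals \<open>T\<close>.\<close>
    obtain Z where Z: "Z \<in> Fix" "rk Z = 4" "\<And>Y. Y \<in> \<Omega> \<Longrightarrow> x \<subseteq> Y \<Longrightarrow> y \<subseteq> Y \<Longrightarrow> Z \<subseteq> Y"
      by (rule jn_lines[OF xy(1,2) l(4)]) (use 2[of x y] col'_iff[OF xy(1,2)] l(2,3) in auto)
    have "Z \<subseteq> T" "Z \<subseteq> X" using Z(3) xy FixD(1) T(1) X(1) by auto
    then have "Z = T" using rk_eq FixD(1) Z T by auto
    then show ?thesis using \<open>Z \<subseteq> X\<close> unfolding T X F_def by blast
  qed
  show "S \<in> {S. S \<subseteq> Q \<and> (\<forall>x \<in> S. \<forall>y \<in> S. collinear Omega' x y) \<and>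
     (\<forall>l \<in> lines Omega'. (\<exists>x \<in> l \<inter> S. \<exists>y \<in> l \<inter> S. x \<noteq> y) \<longrightarrow> l \<subseteq> S)}"
  proof (intro CollectI conjI ballI impI)
    fix l assume "l \<in> lines Omega'" "\<exists>x \<in> l \<inter> S. \<exists>y \<in> l \<inter> S. x \<noteq> y"
    then show "l \<subseteq> S" using 3[of l] by (elim bexE)
  qed (fact 1, use 2 in auto)
next
  fix S assume "S \<in> {S. S \<subseteq> Q \<and> (\<forall>x \<in> S. \<forall>y \<in> S. collinear Omega' x y) \<and>
     (\<forall>l \<in> lines Omega'. (\<exists>x \<in> l \<inter> S. \<exists>y \<in> l \<inter> S. x \<noteq> y) \<longrightarrow> l \<subseteq> S)}"
  then have S: "S \<subseteq> Q" "\<And>x y. x \<in> S \<Longrightarrow> y \<in> S \<Longrightarrow> collinear Omega' x y"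
    and Sl: "\<And>l x y. l \<in> lines Omega' \<Longrightarrow> x \<in> l \<inter> S \<Longrightarrow> y \<in> l \<inter> S \<Longrightarrow> x \<noteq> y \<Longrightarrow> l \<subseteq> S"
    unfolding mem_Collect_eq by (simp, metis, metis)
  let ?X = "\<Union>S"
  have XP: "?X \<subseteq> P" using S(1) Q_P by blast
  have clq: "col x y" if xy: "x \<in> ?X" "y \<in> ?X" for x y
  proof -
    obtain a b where "a \<in> S" "x \<in> a" "b \<in> S" "y \<in> b" using xy by blast
    moreover then have "a \<subseteq> perp b" using S(2)[of a b] col'_iff[of a b] S(1) by auto
    ultimately show ?thesis using perpD[of x b y] by auto
  qed
  have "closed ?X"
  proof (rule closedI[OF XP])
    fix l x y z assume l: "l \<in> lines \<Omega>" "x \<in> l" "y \<in> l" "x \<in> ?X" "y \<in> ?X" "x \<noteq> y" "z \<in> l"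
    then obtain a b where ab: "a \<in> S" "x \<in> a" "b \<in> S" "y \<in> b" by blast
    have abQ: "a \<in> Q" "b \<in> Q" using ab S(1) by auto
    show "z \<in> ?X"
    proof (cases "a = b")
      case True
      have "a \<in> \<Omega>" using Q_rk[OF abQ(1)] FixD(1) by simp
      then have "l \<subseteq> a" using closedD[OF Omega_closed l(1-3)] ab l(6) True by simp
      then show ?thesis using ab l by blast
    next
      case False
      have "a \<subseteq> perp b" using S(2)[OF ab(1,3)] col'_iff[OF abQ] by simp
      then obtain T where T: "T \<in> Fix" "rk T = 4" "a \<subseteq> T" "b \<subseteq> T" by (rule jn_lines[OF abQ False])
      have aT: "a \<in> F T" "b \<in> F T" "F T \<in> lines Omega'" using T abQ lines'_iff unfolding F_def by auto
      then have FS: "F T \<subseteq> S" using Sl[of "F T" a b] ab False by blast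
      have "l \<subseteq> T" using closedD[OF Omega_closed[OF FixD(1)[OF T(1)]] l(1-3)] ab T(3,4) l(6) by auto
      then have zT: "z \<in> T" using l by blast
      then have "L z \<in> S" using F_L[OF T(1)] FS by blast
      then show ?thesis using L_line(2)[OF Fix_P[OF T(1) zT]] by blast
    qed
  qed
  then have XO: "?X \<in> \<Omega>" unfolding Omega_closed_iff using clq by simp
  have LX: "L x \<in> S" if x: "x \<in> ?X" for x
  proof -
    obtain a where "a \<in> S" "x \<in> a" using x by blast
    then show ?thesis using Q_L[of a x] S(1) by blast
  qed
  have "invar ?X" using invarI[OF XP] LX by blast
  then have XF: "?X \<in> Fix" unfolding Fix_def using XO by blast
  have "F ?X = S"
  proof (intro subset_antisym subsetI)
    fix l assume "l \<in> F ?X"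
    then have l: "l \<in> Q" "l \<subseteq> ?X" unfolding F_def by auto
    then obtain x where "x \<in> l" "l = L x" using Q_ex by blast
    then show "l \<in> S" using LX l by blast
  next
    fix l assume "l \<in> S" then show "l \<in> F ?X" unfolding F_def using S(1) by blast
  qed
  then show "S \<in> Omega'" unfolding Omega'_eq using XF by blast
qed

lemma fixed_polar_space: "polar_space Q Omega' (n div 2)"
  unfolding polar_space_def
proof (intro conjI)
  show "\<forall>l \<in> lines Omega'. l \<subseteq> Q \<and> (\<exists>x \<in> l. \<exists>y \<in> l. \<exists>z \<in> l. x \<noteq> y \<and> x \<noteq> z \<and> y \<noteq> z)"
  proof
    fix l assume "l \<in> lines Omega'"
    then obtain T where T: "T \<in> Fix" "rk T = 4" "l = F T" using lines'_iff by auto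
    then show "l \<subseteq> Q \<and> (\<exists>x \<in> l. \<exists>y \<in> l. \<exists>z \<in> l. x \<noteq> y \<and> x \<noteq> z \<and> y \<noteq> z)"
      using three_lines[OF T(1,2)] by (simp add: F_def)
  qed
  show "Omega' = {S. S \<subseteq> Q \<and> (\<forall>x \<in> S. \<forall>y \<in> S. collinear Omega' x y) \<and>
     (\<forall>l \<in> lines Omega'. (\<exists>x \<in> l \<inter> S. \<exists>y \<in> l \<inter> S. x \<noteq> y) \<longrightarrow> l \<subseteq> S)}" by (rule Omega'_closed)
  show "\<forall>l \<in> lines Omega'. \<forall>p \<in> Q - l. (\<exists>!x. x \<in> l \<and> collinear Omega' p x) \<or> (\<forall>x \<in> l. collinear Omega' p x)"
  proof (intro ballI)
    fix l p assume l: "l \<in> lines Omega'" and p: "p \<in> Q - l"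
    then obtain T where T: "T \<in> Fix" "rk T = 4" "l = F T" using lines'_iff by auto
    have pQ: "p \<in> Q" using p by blast
    show "(\<exists>!x. x \<in> l \<and> collinear Omega' p x) \<or> (\<forall>x \<in> l. collinear Omega' p x)"
    proof (cases "T \<subseteq> perp p")
      case True
      have "collinear Omega' p x" if "x \<in> l" for x
        using that True col'_sym[OF pQ, of x] unfolding T F_def by blast
      then show ?thesis by blast
    next
      case False
      then obtain x a where xa: "x \<in> T" "a \<in> p" "\<not> col x a"
        using Fix_P[OF T(1)] by (metis perpI subsetI)
      have aP: "a \<in> P" and pL: "p = L a" using Q_P[OF pQ] xa Q_L[OF pQ] by auto
      \<comment> \<open>By \<open>rk_perp_L\<close> this has rank 4 - 2 = 2, so it is a single fixed
        line, the only one in \<open>T\<close> collinear to \<open>p\<close>.\<close>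
      let ?E = "T \<inter> perp p"
      have E: "?E \<in> Fix" using Fix_perp_L[OF T(1) aP] pL by simp
      have "rk T = Suc (Suc (rk ?E))" using rk_perp_L[OF T(1) xa(1) aP] xa(3) pL by (simp add: col_sym[of a])
      then have rE: "rk ?E = 2" using T by simp
      then have EQ: "?E \<in> Q" using E lines_iff FixD unfolding fixed_lines_def invar_def by simp
      have "?E \<in> l \<and> collinear Omega' p ?E" using EQ col'_sym[OF pQ EQ] unfolding T F_def by blast
      moreover have "y = ?E" if y: "y \<in> l" "collinear Omega' p y" for y
      proof -
        have yQ: "y \<in> Q" "y \<subseteq> T" using y unfolding T F_def by auto
        then have "y \<subseteq> ?E" using col'_sym[OF pQ yQ(1)] y by blast
        then show ?thesis using rk_eq[OF FixD(1) FixD(1)] Q_rk[OF yQ(1)] E rE by simp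
      qed
      ultimately show ?thesis by blast
    qed
  qed
  show "\<forall>p \<in> Q. \<exists>q \<in> Q. \<not> collinear Omega' p q"
  proof
    fix p assume p: "p \<in> Q"
    then obtain a where a: "a \<in> P" "a \<in> p" "p = L a" using Q_ex by blast
    obtain q where q: "q \<in> P" "\<not> col a q" using noncol a by blast
    have qQ: "L q \<in> Q" using Q_iff q by blast
    have "\<not> collinear Omega' p (L q)"
      using col'_iff[OF p qQ] perpD[of a "L q" q] a q L_line(2)[OF q(1)] by blast
    then show "\<exists>q \<in> Q. \<not> collinear Omega' p q" using qQ by blast
  qed
  show "\<exists>X \<in> Omega'. has_rank Omega' X (n div 2)"
  proof -
    obtain M where M: "M \<in> Fix" "rk M = n" using Fix_extend[OF empty_Fix] by blast
    then have "has_rank Omega' (F M) (n div 2)" using F_rank even_n by simp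
    then show ?thesis using M unfolding Omega'_eq by blast
  qed
  show "\<forall>X \<in> Omega'. \<exists>k \<le> n div 2. has_rank Omega' X k"
  proof
    fix S assume "S \<in> Omega'"
    then obtain X where X: "X \<in> Fix" "S = F X" unfolding Omega'_eq by blast
    have "rk X = 2 * (rk X div 2)" "rk X div 2 \<le> n div 2"
      using Fix_even[OF X(1)] rk_le[OF FixD(1)[OF X(1)]] by (simp, simp add: div_le_mono)
    then show "\<exists>k \<le> n div 2. has_rank Omega' S k" using F_rank[OF X(1)] X(2) by blast
  qed
qed

end

section \<open>Commutativity of the ground field\<close>

context left_vs
begin

lemma add_zero_unique:
  "x \<in> carrier R \<Longrightarrow> y \<in> carrier R \<Longrightarrow> z \<in> carrier R \<Longrightarrow> x \<oplus> y = \<zero> \<Longrightarrow> x \<oplus> z = \<zero> \<Longrightarrow> y = z"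
  by (metis R.a_comm R.minus_equality)

text \<open>
  The matrix entries \<open>l\<close> and \<open>m\<close> of the polarity at the points \<open>e1 + a e2\<close> and \<open>e1 + b e3\<close> determine
  it at \<open>e1 + a e2 + b e3\<close>; that this last point is absolute forces \<open>m = - l b\<^sup>-\<^sup>1 a\<close>.
\<close>

lemma null_polarity_commutative:
  assumes sub: "\<And>v. v \<in> carrier M \<Longrightarrow> subsp {w \<in> carrier M. B v w}"
    and sym: "\<And>v w. v \<in> carrier M \<Longrightarrow> w \<in> carrier M \<Longrightarrow> B v w \<Longrightarrow> B w v"
    and refl: "\<And>v. v \<in> carrier M \<Longrightarrow> B v v"
    and hyp: "\<And>v w w'. v \<in> carrier M \<Longrightarrow> w \<in> carrier M \<Longrightarrow> w' \<in> carrier M \<Longrightarrow> \<not> B v w \<Longrightarrow>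
      \<exists>c \<in> carrier R. B v (w' \<oplus>\<^bsub>M\<^esub> c \<odot>\<^bsub>M\<^esub> w)"
    and e: "e1 \<in> carrier M" "e2 \<in> carrier M" "e3 \<in> carrier M" "e4 \<in> carrier M"
    and B: "B e1 e2" "B e1 e3" "B e4 e2" "B e4 e3" "\<not> B e1 e4" "\<not> B e2 e3"
    and ab: "a \<in> carrier R" "b \<in> carrier R"
  shows "a \<otimes> b = b \<otimes> a"
proof -
  have add: "B v (w \<oplus>\<^bsub>M\<^esub> w')" if "v \<in> carrier M" "w \<in> carrier M" "w' \<in> carrier M" "B v w" "B v w'" for v w w'
    using subsp_add[OF sub[OF that(1)]] that by simp
  have cancel: "B v w'" if "v \<in> carrier M" "w \<in> carrier M" "w' \<in> carrier M" "B v w" "B v (w \<oplus>\<^bsub>M\<^esub> w')" for v w w'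
    using subsp_add_cancel[OF sub[OF that(1)], of w w'] that by simp
  have sm: "B v (c \<odot>\<^bsub>M\<^esub> w)" if "v \<in> carrier M" "w \<in> carrier M" "c \<in> carrier R" "B v w" for v w c
    using subsp_smult[OF sub[OF that(1)], of c w] that by simp
  have smc: "B v w" if "v \<in> carrier M" "w \<in> carrier M" "c \<in> carrier R" "c \<noteq> \<zero>" "B v (c \<odot>\<^bsub>M\<^esub> w)" for v w c
    using subsp_smult_cancel[OF sub[OF that(1)], of c w] that by simp
  note B' = sym[OF e(1,2) B(1)] sym[OF e(1,3) B(2)] sym[OF e(4,2) B(3)] sym[OF e(4,3) B(4)]
  have nB: "\<not> B e4 e1" "\<not> B e3 e2" using B sym e by blast+
  have el: "\<exists>l \<in> carrier R. B (e1 \<oplus>\<^bsub>M\<^esub> a \<odot>\<^bsub>M\<^esub> e2) (e4 \<oplus>\<^bsub>M\<^esub> l \<odot>\<^bsub>M\<^esub> e3)"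
    if a: "a \<in> carrier R" "a \<noteq> \<zero>" for a
  proof (rule hyp)
    show "\<not> B (e1 \<oplus>\<^bsub>M\<^esub> a \<odot>\<^bsub>M\<^esub> e2) e3"
    proof
      assume "B (e1 \<oplus>\<^bsub>M\<^esub> a \<odot>\<^bsub>M\<^esub> e2) e3"
      then have "B e3 (e1 \<oplus>\<^bsub>M\<^esub> a \<odot>\<^bsub>M\<^esub> e2)" using sym e a by simp
      then have "B e3 (a \<odot>\<^bsub>M\<^esub> e2)" using cancel[OF e(3,1) _ B'(2)] e a by simp
      then show False using smc[OF e(3,2) a] nB by blast
    qed
  qed (use e a in auto)
  have em: "\<exists>m \<in> carrier R. B (e1 \<oplus>\<^bsub>M\<^esub> b \<odot>\<^bsub>M\<^esub> e3) (e4 \<oplus>\<^bsub>M\<^esub> m \<odot>\<^bsub>M\<^esub> e2)"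
    if b: "b \<in> carrier R" "b \<noteq> \<zero>" for b
  proof (rule hyp)
    show "\<not> B (e1 \<oplus>\<^bsub>M\<^esub> b \<odot>\<^bsub>M\<^esub> e3) e2"
    proof
      assume "B (e1 \<oplus>\<^bsub>M\<^esub> b \<odot>\<^bsub>M\<^esub> e3) e2"
      then have "B e2 (e1 \<oplus>\<^bsub>M\<^esub> b \<odot>\<^bsub>M\<^esub> e3)" using sym e b by simp
      then have "B e2 (b \<odot>\<^bsub>M\<^esub> e3)" using cancel[OF e(2,1) _ B'(1)] e b by simp
      then show False using smc[OF e(2,3) b] B(6) by blast
    qed
  qed (use e b in auto)
  have key: "m \<oplus> (l \<otimes> inv b) \<otimes> a = \<zero>"
    if a: "a \<in> carrier R" "a \<noteq> \<zero>" and b: "b \<in> carrier R" "b \<noteq> \<zero>"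
      and l: "l \<in> carrier R" "B (e1 \<oplus>\<^bsub>M\<^esub> a \<odot>\<^bsub>M\<^esub> e2) (e4 \<oplus>\<^bsub>M\<^esub> l \<odot>\<^bsub>M\<^esub> e3)"
      and m: "m \<in> carrier R" "B (e1 \<oplus>\<^bsub>M\<^esub> b \<odot>\<^bsub>M\<^esub> e3) (e4 \<oplus>\<^bsub>M\<^esub> m \<odot>\<^bsub>M\<^esub> e2)"
    for a b l m
  proof (rule ccontr)
    let ?x = "e1 \<oplus>\<^bsub>M\<^esub> a \<odot>\<^bsub>M\<^esub> e2 \<oplus>\<^bsub>M\<^esub> b \<odot>\<^bsub>M\<^esub> e3"
    let ?s1 = "e4 \<oplus>\<^bsub>M\<^esub> l \<odot>\<^bsub>M\<^esub> e3" and ?s2 = "e4 \<oplus>\<^bsub>M\<^esub> m \<odot>\<^bsub>M\<^esub> e2"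
    let ?q = "a \<odot>\<^bsub>M\<^esub> e2 \<oplus>\<^bsub>M\<^esub> b \<odot>\<^bsub>M\<^esub> e3"
    define d where "d = l \<otimes> inv b"
    define t where "t = m \<oplus> d \<otimes> a"
    assume "m \<oplus> (l \<otimes> inv b) \<otimes> a \<noteq> \<zero>"
    then have t: "t \<noteq> \<zero>" "t \<in> carrier R" and d: "d \<in> carrier R" "d \<otimes> b = l"
      unfolding t_def d_def using a b l m by (auto simp: R.m_assoc l_inv)
    have c: "?x \<in> carrier M" "?s1 \<in> carrier M" "?s2 \<in> carrier M" "?q \<in> carrier M"
      "a \<odot>\<^bsub>M\<^esub> e2 \<in> carrier M" "b \<odot>\<^bsub>M\<^esub> e3 \<in> carrier M" "e1 \<oplus>\<^bsub>M\<^esub> a \<odot>\<^bsub>M\<^esub> e2 \<in> carrier M"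
      "e1 \<oplus>\<^bsub>M\<^esub> b \<odot>\<^bsub>M\<^esub> e3 \<in> carrier M" "l \<odot>\<^bsub>M\<^esub> e3 \<in> carrier M" "m \<odot>\<^bsub>M\<^esub> e2 \<in> carrier M"
      using a b l m e by auto
    have s3: "B e3 ?s1" using add[OF e(3,4) c(9) B'(4)] sm[OF e(3,3) l(1) refl[OF e(3)]] by blast
    have "B ?s1 (b \<odot>\<^bsub>M\<^esub> e3)" using sm[OF c(2) e(3) b(1)] sym[OF e(3) c(2) s3] by blast
    then have "B ?s1 ?x" using add[OF c(2,7,6)] sym[OF c(7,2) l(2)] by blast
    then have x1: "B ?x ?s1" using sym c by blast
    have s2: "B e2 ?s2" using add[OF e(2,4) c(10) B'(3)] sm[OF e(2,2) m(1) refl[OF e(2)]] by blast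
    have "B ?s2 (a \<odot>\<^bsub>M\<^esub> e2)" using sm[OF c(3) e(2) a(1)] sym[OF e(2) c(3) s2] by blast
    then have "B ?s2 ((e1 \<oplus>\<^bsub>M\<^esub> b \<odot>\<^bsub>M\<^esub> e3) \<oplus>\<^bsub>M\<^esub> a \<odot>\<^bsub>M\<^esub> e2)" using add[OF c(3,8,5)] sym[OF c(8,3) m(2)] by blast
    then have "B ?s2 ?x" using e c by (simp add: M.a_ac)
    then have x2: "B ?x ?s2" using sym c by blast
    have "B e1 ?q" using add[OF e(1) c(5,6)] sm[OF e(1,2) a(1) B(1)] sm[OF e(1,3) b(1) B(2)] by blast
    then have "B e1 (e1 \<oplus>\<^bsub>M\<^esub> ?q)" using add[OF e(1,1) c(4) refl[OF e(1)]] by blast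
    then have "B e1 ?x" using e c by (simp add: M.a_assoc)
    then have "B ?x e1" using sym e c by blast
    moreover have "B ?x (e1 \<oplus>\<^bsub>M\<^esub> ?q)" using refl[OF c(1)] e c by (simp add: M.a_assoc)
    ultimately have xq: "B ?x ?q" using cancel[OF c(1) e(1) c(4)] by blast
    \<comment> \<open>The multiple of \<open>?q\<close> is chosen so that the \<open>e3\<close>
      coefficients of the two sides agree; the sides then differ from \<open>?s1\<close> by
      \<open>t e2\<close> only. With \<open>t\<close> nonzero, \<open>?x\<close> becomes
      perpendicular to \<open>e2\<close>, which makes \<open>e2\<close> perpendicular to
      \<open>e3\<close>.\<close>
    have "B ?x (?s2 \<oplus>\<^bsub>M\<^esub> d \<odot>\<^bsub>M\<^esub> ?q)" using add[OF c(1,3) _ x2] sm[OF c(1,4) d(1) xq] c d by simp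
    also have "?s2 \<oplus>\<^bsub>M\<^esub> d \<odot>\<^bsub>M\<^esub> ?q = ?s1 \<oplus>\<^bsub>M\<^esub> t \<odot>\<^bsub>M\<^esub> e2"
      unfolding t_def using e a b d m l
      by (simp add: smult_r_distr smult_l_distr smult_assoc[symmetric] M.a_ac)
    finally have "B ?x (t \<odot>\<^bsub>M\<^esub> e2)" using cancel[OF c(1,2) _ x1] e t by simp
    then have "B ?x e2" using smc[OF c(1) e(2) t(2,1)] by blast
    then have "B e2 ?x" using sym e c by blast
    moreover have "B e2 (e1 \<oplus>\<^bsub>M\<^esub> a \<odot>\<^bsub>M\<^esub> e2)"
      using add[OF e(2,1) c(5) B'(1)] sm[OF e(2,2) a(1) refl[OF e(2)]] by blast
    ultimately have "B e2 (b \<odot>\<^bsub>M\<^esub> e3)" using cancel[OF e(2) c(7,6)] by blast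
    then show False using smc[OF e(2,3) b] B by blast
  qed
  show ?thesis
  proof (cases "a = \<zero> \<or> b = \<zero>")
    case True then show ?thesis using ab by auto
  next
    case False
    then have a: "a \<in> carrier R" "a \<noteq> \<zero>" and b: "b \<in> carrier R" "b \<noteq> \<zero>" using ab by auto
    have one: "\<one> \<in> carrier R" "\<one> \<noteq> \<zero>" by auto
    \<comment> \<open>Since \<open>l\<close> depends on \<open>a\<close> alone and \<open>m\<close>
      on \<open>b\<close> alone, \<open>key\<close> can be compared at \<open>(a, b)\<close>,
      \<open>(1, b)\<close>, \<open>(a, 1)\<close> and \<open>(1, 1)\<close>. Eliminating
      \<open>m\<close> and \<open>m'\<close> leaves \<open>l a = k\<close> and
      \<open>l b^-1 a = k b^-1\<close>.\<close>
    obtain k where k: "k \<in> carrier R" "B (e1 \<oplus>\<^bsub>M\<^esub> \<one> \<odot>\<^bsub>M\<^esub> e2) (e4 \<oplus>\<^bsub>M\<^esub> k \<odot>\<^bsub>M\<^esub> e3)" using el[OF one] by blast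
    obtain l where l: "l \<in> carrier R" "B (e1 \<oplus>\<^bsub>M\<^esub> a \<odot>\<^bsub>M\<^esub> e2) (e4 \<oplus>\<^bsub>M\<^esub> l \<odot>\<^bsub>M\<^esub> e3)" using el[OF a] by blast
    obtain m where m: "m \<in> carrier R" "B (e1 \<oplus>\<^bsub>M\<^esub> b \<odot>\<^bsub>M\<^esub> e3) (e4 \<oplus>\<^bsub>M\<^esub> m \<odot>\<^bsub>M\<^esub> e2)" using em[OF b] by blast
    obtain m' where m': "m' \<in> carrier R" "B (e1 \<oplus>\<^bsub>M\<^esub> \<one> \<odot>\<^bsub>M\<^esub> e3) (e4 \<oplus>\<^bsub>M\<^esub> m' \<odot>\<^bsub>M\<^esub> e2)" using em[OF one] by blast
    have inv1: "inv \<one> = \<one>" by (rule R.inv_one)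
    have 1: "m \<oplus> (l \<otimes> inv b) \<otimes> a = \<zero>" using key[OF a b l m] .
    have 2: "m \<oplus> k \<otimes> inv b = \<zero>" using key[OF one b k m] k b by simp
    have 3: "m' \<oplus> l \<otimes> a = \<zero>" using key[OF a one l m'] l a inv1 by simp
    have 4: "m' \<oplus> k = \<zero>" using key[OF one one k m'] k inv1 by simp
    have kl: "l \<otimes> a = k" using add_zero_unique[OF m'(1) _ k(1) 3 4] l a by simp
    have "(l \<otimes> inv b) \<otimes> a = k \<otimes> inv b"
      using add_zero_unique[OF m(1) _ _ 1 2] l a b k by simp
    then have lb: "l \<otimes> (inv b \<otimes> a) = l \<otimes> (a \<otimes> inv b)"
      using kl l a b by (simp add: R.m_assoc[symmetric])
    have "l \<noteq> \<zero>"
    proof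
      assume "l = \<zero>"
      then have "B (e1 \<oplus>\<^bsub>M\<^esub> a \<odot>\<^bsub>M\<^esub> e2) e4" using l e by simp
      then have "B e4 (e1 \<oplus>\<^bsub>M\<^esub> a \<odot>\<^bsub>M\<^esub> e2)" using sym e a by simp
      then have "B e4 (a \<odot>\<^bsub>M\<^esub> e2 \<oplus>\<^bsub>M\<^esub> e1)" using e a by (simp add: M.a_comm)
      then have "B e4 e1" using cancel[OF e(4) _ e(1) sm[OF e(4,2) a(1) B(3)]] e a by simp
      then show False using nB by blast
    qed
    then have "inv b \<otimes> a = a \<otimes> inv b"
      using lb R.Units_l_cancel[OF unit[OF l(1)], of "inv b \<otimes> a" "a \<otimes> inv b"] a b by simp
    then have "b \<otimes> (inv b \<otimes> a) \<otimes> b = b \<otimes> (a \<otimes> inv b) \<otimes> b" by simp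
    moreover have "b \<otimes> (inv b \<otimes> a) = a" using a b r_inv[OF b] by (simp add: R.m_assoc[symmetric])
    moreover have "b \<otimes> (a \<otimes> inv b) \<otimes> b = b \<otimes> a"
      using a b l_inv[OF b] by (simp add: R.m_assoc)
    ultimately show ?thesis by simp
  qed
qed

end

context domestic
begin

text \<open>The relation \<open>col x (\<theta> y)\<close> is lifted to the vectors of a subspace of
  rank 4 opposite its image, given by \<open>opp_exists\<close> with \<open>j = 2\<close>.\<close>

lemma K_commutative:
  assumes n: "n \<ge> 4" and ab: "a \<in> carrier K" "b \<in> carrier K"
  shows "a \<otimes>\<^bsub>K\<^esub> b = b \<otimes>\<^bsub>K\<^esub> a"
proof -
  obtain U where U: "U \<in> \<Omega>" "rk U = 4" "oppth U" using opp_exists[of 2] n by auto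
  obtain r \<phi> where "proj K (carrier K) r U {Y \<in> \<Omega>. Y \<subseteq> U} \<phi>" using coord[OF U(1)] .
  then interpret C: proj K "carrier K" r U "{Y \<in> \<Omega>. Y \<subseteq> U}" \<phi> .
  have UP: "x \<in> P" if "x \<in> U" for x using that Omega_sub[OF U(1)] by auto
  have sym: "col x (\<theta> y) \<longleftrightarrow> col y (\<theta> x)" if "x \<in> U" "y \<in> U" for x y
    using th_sym[OF UP UP Omega_col[OF U(1)]] that by blast
  \<comment> \<open>Zero is made perpendicular to everything, so that the perp of each vector is a
    subspace.\<close>
  define B where "B v w \<longleftrightarrow> v = vec_zero K \<or> w = vec_zero K \<or>
    (\<exists>x \<in> U. \<exists>y \<in> U. v \<in> \<phi> x \<and> w \<in> \<phi> y \<and> col x (\<theta> y))" for v w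
  have Biff: "B v w \<longleftrightarrow> col x (\<theta> y)"
    if "x \<in> U" "y \<in> U" "v \<in> \<phi> x" "w \<in> \<phi> y" "v \<noteq> vec_zero K" "w \<noteq> vec_zero K" for v w x y
    unfolding B_def using that C.phi_inj by metis
  define H where "H x = U \<inter> perp {\<theta> x}" for x
  have H: "H x \<in> {Y \<in> \<Omega>. Y \<subseteq> U}" if "x \<in> U" for x
    unfolding H_def using Omega_perp[OF U(1)] UP that by simp
  have BH: "{w \<in> carrier (tuples K r). B v w} = C.VS (H x)" if x: "x \<in> U" "v \<in> \<phi> x" "v \<noteq> vec_zero K" for v x
  proof -
    have "B v w \<longleftrightarrow> w \<in> C.VS (H x)" if w: "w \<in> vecs K r" for w
    proof (cases "w = vec_zero K")
      case True then show ?thesis unfolding B_def C.VS_def using w by simp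
    next
      case False
      then obtain y where y: "y \<in> U" "w \<in> \<phi> y" using C.pt'[OF w] by blast
      have "B v w \<longleftrightarrow> col y (\<theta> x)" using Biff[OF x(1) y(1) x(2) y(2) x(3) False] sym[OF x(1) y(1)] by simp
      also have "\<dots> \<longleftrightarrow> y \<in> H x" unfolding H_def using y UP by (simp add: mem_perp1)
      also have "\<dots> \<longleftrightarrow> w \<in> C.VS (H x)" using C.VS_iff[OF H[OF x(1)] y False] by simp
      finally show ?thesis .
    qed
    moreover have "C.VS (H x) \<subseteq> vecs K r" unfolding C.VS_def by blast
    ultimately show ?thesis by auto
  qed
  have "U \<noteq> {}" using U(2) rk_empty by auto
  then obtain x u where xu: "x \<in> U" "u \<in> U" "\<not> col x (\<theta> u)" using U(3) unfolding oppth_def by blast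
  let ?V = "U \<inter> perp {\<theta> x} \<inter> perp {\<theta> u}"
  note V = opp_split[OF U(1,3) xu]
  have "?V \<noteq> {}" using V(2) U(2) rk_empty by auto
  \<comment> \<open>\<open>x\<close>, \<open>u\<close> and \<open>y\<close>, \<open>w\<close> are
    mutually perpendicular hyperbolic pairs; their vectors become \<open>e1\<close>,
    \<open>e4\<close> and \<open>e2\<close>, \<open>e3\<close>.\<close>
  then obtain y w where yw: "y \<in> ?V" "w \<in> ?V" "\<not> col y (\<theta> w)" using V(3) unfolding oppth_def by blast
  then have yw': "y \<in> U" "w \<in> U" "col y (\<theta> x)" "col y (\<theta> u)" "col w (\<theta> x)" "col w (\<theta> u)"
    by (auto simp: mem_perp1)
  obtain e1 where e1: "e1 \<in> \<phi> x" "e1 \<in> vecs K r" "e1 \<noteq> vec_zero K" using C.phi_rep[OF xu(1)] by blast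
  obtain e4 where e4: "e4 \<in> \<phi> u" "e4 \<in> vecs K r" "e4 \<noteq> vec_zero K" using C.phi_rep[OF xu(2)] by blast
  obtain e2 where e2: "e2 \<in> \<phi> y" "e2 \<in> vecs K r" "e2 \<noteq> vec_zero K" using C.phi_rep[OF yw'(1)] by blast
  obtain e3 where e3: "e3 \<in> \<phi> w" "e3 \<in> vecs K r" "e3 \<noteq> vec_zero K" using C.phi_rep[OF yw'(2)] by blast
  show ?thesis
  proof (rule C.V.null_polarity_commutative[of B e1 e2 e3 e4])
    fix v assume v: "v \<in> carrier (tuples K r)"
    show "C.V.subsp {w \<in> carrier (tuples K r). B v w}"
    proof (cases "v = vec_zero K")
      case True
      then have "{w \<in> carrier (tuples K r). B v w} = carrier (tuples K r)" unfolding B_def by simp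
      then show ?thesis unfolding C.V.subsp_def using C.V.M.add.m_closed C.V.M.zero_closed C.V.smult_closed by simp
    next
      case False
      then obtain x where x: "x \<in> U" "v \<in> \<phi> x" using C.pt'[of v] v by auto
      show ?thesis unfolding BH[OF x False] using C.VS_Sigma[OF H[OF x(1)]] by (simp add: subspaces_iff[OF K])
    qed
    show "B v v"
    proof (cases "v = vec_zero K")
      case False
      then obtain x where x: "x \<in> U" "v \<in> \<phi> x" using C.pt'[of v] v by auto
      then show ?thesis using Biff[OF x(1,1) x(2,2) False False] col_th UP by simp
    qed (simp add: B_def)
    fix w assume w: "w \<in> carrier (tuples K r)"
    show "B w v" if "B v w" using that sym unfolding B_def by metis
    fix w' assume w': "w' \<in> carrier (tuples K r)" and nB: "\<not> B v w"
    then have nz: "v \<noteq> vec_zero K" "w \<noteq> vec_zero K" unfolding B_def by auto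
    obtain x where x: "x \<in> U" "v \<in> \<phi> x" using C.pt'[of v] v nz by auto
    obtain y where y: "y \<in> U" "w \<in> \<phi> y" using C.pt'[of w] w nz by auto
    have nc: "\<not> col x (\<theta> y)" using Biff[OF x(1) y(1) x(2) y(2) nz] nB by simp
    have HO: "H x \<in> \<Omega>" "H x \<subseteq> U" using H[OF x(1)] by auto
    have "y \<notin> H x" unfolding H_def using nc sym[OF x(1) y(1)] by (simp add: mem_perp1)
    moreover have yp: "y \<in> perp (H x)" using Omega_perp_self[OF U(1) HO] y by blast
    ultimately have rJ: "rk (sp (insert y (H x))) = Suc (rk (H x))" using rk_join[OF HO(1)] by blast
    have "rk U = Suc (rk (H x))"
      unfolding H_def using rk_perp[OF U(1) th_P[OF UP[OF x(1)]] y(1)] nc sym[OF x(1) y(1)] by (simp add: col_sym[of y])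
    then have J: "sp (insert y (H x)) = U"
      using rk_eq[OF sp_insert_Omega[OF HO(1) yp] U(1)] sp_least[OF U(1), of "insert y (H x)"] HO y rJ by simp
    \<comment> \<open>\<open>U\<close> is the join of the hyperplane \<open>H x\<close> with the
      point \<open>y\<close> outside it, so \<open>w'\<close> is a vector of \<open>H x\<close> plus
      a multiple of \<open>w\<close>.\<close>
    have "C.VS U = C.V.ext (C.VS (H x)) w"
      using VS_join[OF C.proj_axioms HO(1) yp _ y(2) nz(2)] J by simp
    moreover have "w' \<in> C.VS U" unfolding C.VS_def using C.pt'[of w'] w' by auto
    ultimately obtain h c where h: "w' = vec_add K h (vec_smult K c w)" "h \<in> C.VS (H x)" "c \<in> carrier K"
      unfolding C.V.ext_def by auto
    have hc: "h \<in> carrier (tuples K r)" and Bh: "B v h" using BH[OF x nz(1)] h(2) by auto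
    have "w' \<oplus>\<^bsub>tuples K r\<^esub> (\<ominus>\<^bsub>K\<^esub> c) \<odot>\<^bsub>tuples K r\<^esub> w = h"
      using h hc w C.V.smult_l_minus[OF h(3) w] C.V.M.a_assoc[of h "c \<odot>\<^bsub>tuples K r\<^esub> w"]
        C.V.M.r_neg[of "c \<odot>\<^bsub>tuples K r\<^esub> w"] C.V.smult_closed[OF h(3) w] C.V.M.r_zero[OF hc]
        C.V.M.a_inv_closed[of "c \<odot>\<^bsub>tuples K r\<^esub> w"]
      by simp
    then show "\<exists>c \<in> carrier K. B v (w' \<oplus>\<^bsub>tuples K r\<^esub> c \<odot>\<^bsub>tuples K r\<^esub> w)"
      using Bh h(3) by (intro bexI[of _ "\<ominus>\<^bsub>K\<^esub> c"]) simp_all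
  next
    show "B e1 e2" using Biff[OF xu(1) yw'(1) e1(1) e2(1) e1(3) e2(3)] sym[OF xu(1) yw'(1)] yw' by simp
    show "B e1 e3" using Biff[OF xu(1) yw'(2) e1(1) e3(1) e1(3) e3(3)] sym[OF xu(1) yw'(2)] yw' by simp
    show "B e4 e2" using Biff[OF xu(2) yw'(1) e4(1) e2(1) e4(3) e2(3)] sym[OF xu(2) yw'(1)] yw' by simp
    show "B e4 e3" using Biff[OF xu(2) yw'(2) e4(1) e3(1) e4(3) e3(3)] sym[OF xu(2) yw'(2)] yw' by simp
    show "\<not> B e1 e4" using Biff[OF xu(1,2) e1(1) e4(1) e1(3) e4(3)] xu by simp
    show "\<not> B e2 e3" using Biff[OF yw'(1,2) e2(1) e3(1) e2(3) e3(3)] yw by simp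
  qed (use e1 e2 e3 e4 ab in auto)
qed

lemma K_field: "n \<ge> 4 \<Longrightarrow> field K"
proof -
  assume n: "n \<ge> 4"
  interpret R: ring K using K unfolding division_ring_def by blast
  interpret cring K by unfold_locales (use K_commutative[OF n] in auto)
  show ?thesis by (rule cring_fieldI) (use K in \<open>auto simp: division_ring_def\<close>)
qed

end

section \<open>The fundamental theorem of projective geometry\<close>

context left_vs
begin

definition sp2 :: "'v \<Rightarrow> 'v \<Rightarrow> 'v set" where "sp2 u v = ext (sp1 u) v"

lemma sp2:
  assumes "u \<in> carrier M" "v \<in> carrier M"
  shows subsp_sp2: "subsp (sp2 u v)" and sp2_l: "u \<in> sp2 u v" and sp2_r: "v \<in> sp2 u v"
    and sp2_least: "subsp W \<Longrightarrow> u \<in> W \<Longrightarrow> v \<in> W \<Longrightarrow> sp2 u v \<subseteq> W"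
  unfolding sp2_def
  using subsp_ext[OF subsp_sp1[OF assms(1)] assms(2)] sp1_self[OF assms(1)] sp1_least[of W u] by auto

lemma sp2E:
  assumes "w \<in> sp2 u v"
  obtains a b where "a \<in> carrier R" "b \<in> carrier R" "w = a \<odot>\<^bsub>M\<^esub> u \<oplus>\<^bsub>M\<^esub> b \<odot>\<^bsub>M\<^esub> v"
  using assms unfolding sp2_def ext_def sp1_def by auto

lemma sp1E:
  assumes "w \<in> sp1 v" obtains a where "a \<in> carrier R" "w = a \<odot>\<^bsub>M\<^esub> v"
  using assms unfolding sp1_def by auto

lemma sp1I: "a \<in> carrier R \<Longrightarrow> a \<odot>\<^bsub>M\<^esub> v \<in> sp1 v"
  unfolding sp1_def by blast

lemma add_diff_cancel:
  assumes "x \<in> carrier M" "y \<in> carrier M" "z \<in> carrier M"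
  shows "(x \<oplus>\<^bsub>M\<^esub> y) \<ominus>\<^bsub>M\<^esub> (x \<oplus>\<^bsub>M\<^esub> z) = y \<ominus>\<^bsub>M\<^esub> z"
proof -
  have "(x \<oplus>\<^bsub>M\<^esub> y) \<ominus>\<^bsub>M\<^esub> (x \<oplus>\<^bsub>M\<^esub> z) = (y \<oplus>\<^bsub>M\<^esub> x) \<oplus>\<^bsub>M\<^esub> (\<ominus>\<^bsub>M\<^esub> x \<oplus>\<^bsub>M\<^esub> \<ominus>\<^bsub>M\<^esub> z)"
    using assms by (simp add: M.minus_eq M.minus_add M.a_comm)
  also have "\<dots> = y \<oplus>\<^bsub>M\<^esub> (x \<oplus>\<^bsub>M\<^esub> (\<ominus>\<^bsub>M\<^esub> x \<oplus>\<^bsub>M\<^esub> \<ominus>\<^bsub>M\<^esub> z))"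
    using assms by (simp add: M.a_assoc)
  also have "\<dots> = y \<ominus>\<^bsub>M\<^esub> z" using assms by (simp add: M.minus_eq M.r_neg2)
  finally show ?thesis .
qed

lemma sp2_same: "v \<in> carrier M \<Longrightarrow> sp2 v v = sp1 v"
  using sp2(4)[OF _ _ subsp_sp1, of v v v] sp1_least[OF sp2(1) sp2(2), of v v] sp1_self[of v] by auto

lemma sp1_sub_sp2: "u \<in> carrier M \<Longrightarrow> v \<in> carrier M \<Longrightarrow> sp1 u \<subseteq> sp2 u v"
  using sp1_least[OF sp2(1) sp2(2)] by blast

lemma subsp_add_iff: "subsp W \<Longrightarrow> v \<in> W \<Longrightarrow> w \<in> carrier M \<Longrightarrow> v \<oplus>\<^bsub>M\<^esub> w \<in> W \<longleftrightarrow> w \<in> W"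
  using subsp_add[of W v w] subsp_add_cancel[of W v w] by blast

lemma subsp_smult_iff:
  "subsp W \<Longrightarrow> c \<in> carrier R \<Longrightarrow> c \<noteq> \<zero> \<Longrightarrow> v \<in> carrier M \<Longrightarrow> c \<odot>\<^bsub>M\<^esub> v \<in> W \<longleftrightarrow> v \<in> W"
  using subsp_smult[of W c v] subsp_smult_cancel[of W c v] by blast

lemma sp1_sym: "v \<in> carrier M \<Longrightarrow> w \<in> sp1 v \<Longrightarrow> w \<noteq> \<zero>\<^bsub>M\<^esub> \<Longrightarrow> v \<in> sp1 w"
  using sp1_eq[of v w] sp1_self[of v] by simp

text \<open>In \<open>w = a e + b u\<close> the coefficient \<open>b\<close> is nonzero, so the
  equation can be solved for \<open>u\<close>.\<close>

lemma sp2_exchange: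
  assumes c: "e \<in> carrier M" "u \<in> carrier M" "w \<in> carrier M" and w: "w \<in> sp2 e u" "w \<notin> sp1 e"
  shows "u \<in> sp2 e w" and "sp2 e u = sp2 e w"
proof -
  obtain a b where ab: "a \<in> carrier R" "b \<in> carrier R" "w = a \<odot>\<^bsub>M\<^esub> e \<oplus>\<^bsub>M\<^esub> b \<odot>\<^bsub>M\<^esub> u" using sp2E[OF w(1)] .
  have b: "b \<noteq> \<zero>"
  proof
    assume "b = \<zero>"
    then have "w = a \<odot>\<^bsub>M\<^esub> e" using ab c by simp
    then show False using w(2) ab(1) unfolding sp1_def by blast
  qed
  note S = subsp_sp2[OF c(1,3)]
  have "a \<odot>\<^bsub>M\<^esub> e \<in> sp2 e w" using subsp_smult[OF S ab(1) sp2_l[OF c(1,3)]] .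
  then have "b \<odot>\<^bsub>M\<^esub> u \<in> sp2 e w"
    using subsp_add_cancel[OF S, of "a \<odot>\<^bsub>M\<^esub> e" "b \<odot>\<^bsub>M\<^esub> u"] sp2_r[OF c(1,3)] ab c by simp
  then show u: "u \<in> sp2 e w" using subsp_smult_cancel[OF S ab(2) b c(2)] by blast
  show "sp2 e u = sp2 e w"
    using sp2_least[OF c(1,2) S sp2_l[OF c(1,3)] u] sp2_least[OF c(1,3) subsp_sp2[OF c(1,2)] sp2_l[OF c(1,2)] w(1)]
    by blast
qed

text \<open>Subtraction puts \<open>(x - y) v\<close> into \<open>W\<close>, and a nonzero scalar
  could be cancelled there.\<close>

lemma coef_cancel:
  assumes that: "x \<in> carrier R" "y \<in> carrier R" "v \<in> carrier M" "subsp W" "v \<notin> W"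
    "w \<in> W" "w' \<in> W" "w \<oplus>\<^bsub>M\<^esub> x \<odot>\<^bsub>M\<^esub> v = w' \<oplus>\<^bsub>M\<^esub> y \<odot>\<^bsub>M\<^esub> v"
  shows "x = y"
proof (rule ccontr)
  assume ne: "x \<noteq> y"
  have cw: "w \<in> carrier M" "w' \<in> carrier M" using that subsp_carrier by auto
  have nz: "x \<ominus> y \<noteq> \<zero>"
    using ne that(1,2) by (metis R.add.inv_solve_right R.l_zero R.minus_eq R.zero_closed)
  have "w \<oplus>\<^bsub>M\<^esub> (x \<ominus> y) \<odot>\<^bsub>M\<^esub> v = (w \<oplus>\<^bsub>M\<^esub> x \<odot>\<^bsub>M\<^esub> v) \<ominus>\<^bsub>M\<^esub> y \<odot>\<^bsub>M\<^esub> v"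
    using that(1-3) cw by (simp add: R.minus_eq M.minus_eq smult_l_distr smult_l_minus M.a_assoc)
  also have "\<dots> = w'" using that(1-3,8) cw by (simp add: M.minus_eq M.a_assoc M.r_neg)
  finally have "w \<oplus>\<^bsub>M\<^esub> (x \<ominus> y) \<odot>\<^bsub>M\<^esub> v \<in> W" using that by simp
  then have "(x \<ominus> y) \<odot>\<^bsub>M\<^esub> v \<in> W" using subsp_add_iff[OF that(4,6)] that(1-3) by simp
  then show False using subsp_smult_iff[OF that(4) _ nz that(3)] that(1,2,5) by simp
qed

lemma indep3:
  assumes c: "f \<in> carrier M" "p \<in> carrier M" "q \<in> carrier M"
    and i: "f \<noteq> \<zero>\<^bsub>M\<^esub>" "p \<notin> sp1 f" "q \<notin> sp2 f p"
    and k: "a \<in> carrier R" "b \<in> carrier R" "d \<in> carrier R" "a' \<in> carrier R" "b' \<in> carrier R" "d' \<in> carrier R"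
    and eq: "a \<odot>\<^bsub>M\<^esub> f \<oplus>\<^bsub>M\<^esub> b \<odot>\<^bsub>M\<^esub> p \<oplus>\<^bsub>M\<^esub> d \<odot>\<^bsub>M\<^esub> q = a' \<odot>\<^bsub>M\<^esub> f \<oplus>\<^bsub>M\<^esub> b' \<odot>\<^bsub>M\<^esub> p \<oplus>\<^bsub>M\<^esub> d' \<odot>\<^bsub>M\<^esub> q"
  shows "a = a'" "b = b'" "d = d'"
proof -
  note cancel = coef_cancel
  note S2 = subsp_sp2[OF c(1,2)] note S1 = subsp_sp1[OF c(1)]
  have m: "x \<odot>\<^bsub>M\<^esub> f \<oplus>\<^bsub>M\<^esub> y \<odot>\<^bsub>M\<^esub> p \<in> sp2 f p" if "x \<in> carrier R" "y \<in> carrier R" for x y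
    using subsp_add[OF S2] subsp_smult[OF S2] sp2_l[OF c(1,2)] sp2_r[OF c(1,2)] that by blast
  have m1: "x \<odot>\<^bsub>M\<^esub> f \<in> sp1 f" if "x \<in> carrier R" for x using that unfolding sp1_def by blast
  show d: "d = d'" using cancel[OF k(3,6) c(3) S2 i(3) m[OF k(1,2)] m[OF k(4,5)] eq] .
  have eq2: "a \<odot>\<^bsub>M\<^esub> f \<oplus>\<^bsub>M\<^esub> b \<odot>\<^bsub>M\<^esub> p = a' \<odot>\<^bsub>M\<^esub> f \<oplus>\<^bsub>M\<^esub> b' \<odot>\<^bsub>M\<^esub> p"
    using eq d k c by simp
  show b: "b = b'" using cancel[OF k(2,5) c(2) S1 i(2) m1[OF k(1)] m1[OF k(4)] eq2] .
  have "\<zero>\<^bsub>M\<^esub> \<oplus>\<^bsub>M\<^esub> a \<odot>\<^bsub>M\<^esub> f = \<zero>\<^bsub>M\<^esub> \<oplus>\<^bsub>M\<^esub> a' \<odot>\<^bsub>M\<^esub> f" using eq2 b k c by simp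
  then show "a = a'"
    using cancel[OF k(1,4) c(1) subsp_zero_only _ subsp_zero[OF subsp_zero_only] subsp_zero[OF subsp_zero_only]] i(1) by blast
qed

end

text \<open>\<open>t\<close> picks a vector of the image of each point, with no relation between the
  choices. \<open>t_sp2\<close> says that lines are preserved in both directions; at
  \<open>u = v\<close> it says that the map on points is well defined and injective.\<close>

locale collineation_rep = left_vs R M
  for R :: "('k, 'm) ring_scheme" (structure) and M :: "('k, 'v, 'n) module_scheme" (structure) +
  fixes t :: "'v \<Rightarrow> 'v"
  assumes t_closed: "\<And>v. v \<in> carrier M \<Longrightarrow> v \<noteq> \<zero>\<^bsub>M\<^esub> \<Longrightarrow> t v \<in> carrier M"
    and t_nonzero: "\<And>v. v \<in> carrier M \<Longrightarrow> v \<noteq> \<zero>\<^bsub>M\<^esub> \<Longrightarrow> t v \<noteq> \<zero>\<^bsub>M\<^esub>"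
    and t_sp2: "\<And>u v w. u \<in> carrier M \<Longrightarrow> v \<in> carrier M \<Longrightarrow> w \<in> carrier M \<Longrightarrow>
      u \<noteq> \<zero>\<^bsub>M\<^esub> \<Longrightarrow> v \<noteq> \<zero>\<^bsub>M\<^esub> \<Longrightarrow> w \<noteq> \<zero>\<^bsub>M\<^esub> \<Longrightarrow> w \<in> sp2 u v \<longleftrightarrow> t w \<in> sp2 (t u) (t v)"
    and dim3: "\<And>u v. u \<in> carrier M \<Longrightarrow> v \<in> carrier M \<Longrightarrow> \<exists>w \<in> carrier M. w \<notin> sp2 u v"
begin

lemma t_sp1:
  "u \<in> carrier M \<Longrightarrow> w \<in> carrier M \<Longrightarrow> u \<noteq> \<zero>\<^bsub>M\<^esub> \<Longrightarrow> w \<noteq> \<zero>\<^bsub>M\<^esub> \<Longrightarrow> w \<in> sp1 u \<longleftrightarrow> t w \<in> sp1 (t u)"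
  using t_sp2[of u u w] sp2_same[of u] sp2_same[of "t u"] t_closed by simp

text \<open>
  A representative of the image of \<open>e\<close> being fixed, the representative \<open>y\<close> of the image of \<open>v\<close> is
  normalised by requiring \<open>t e + y\<close> to represent the image of \<open>e + v\<close>.
\<close>

lemma normalised:
  assumes e: "e \<in> carrier M" "e \<noteq> \<zero>\<^bsub>M\<^esub>" and v: "v \<in> carrier M" "v \<notin> sp1 e"
  shows "\<exists>!y. y \<in> sp1 (t v) \<and> t e \<oplus>\<^bsub>M\<^esub> y \<in> sp1 (t (e \<oplus>\<^bsub>M\<^esub> v))"
    and "y \<in> sp1 (t v) \<and> t e \<oplus>\<^bsub>M\<^esub> y \<in> sp1 (t (e \<oplus>\<^bsub>M\<^esub> v)) \<Longrightarrow>
      y \<in> carrier M \<and> y \<noteq> \<zero>\<^bsub>M\<^esub>"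
proof -
  let ?Q = "\<lambda>y. y \<in> sp1 (t v) \<and> t e \<oplus>\<^bsub>M\<^esub> y \<in> sp1 (t (e \<oplus>\<^bsub>M\<^esub> v))"
  have v0: "v \<noteq> \<zero>\<^bsub>M\<^esub>" using v subsp_zero[OF subsp_sp1[OF e(1)]] by metis
  let ?s = "e \<oplus>\<^bsub>M\<^esub> v"
  have s: "?s \<in> carrier M" using e v by simp
  have sv: "?s \<notin> sp1 e" using subsp_add_iff[OF subsp_sp1[OF e(1)] sp1_self[OF e(1)] v(1)] v(2) by simp
  then have s0: "?s \<noteq> \<zero>\<^bsub>M\<^esub>" using subsp_zero[OF subsp_sp1[OF e(1)]] by metis
  have sv': "?s \<notin> sp1 v"
  proof
    assume "?s \<in> sp1 v"
    then have "v \<oplus>\<^bsub>M\<^esub> e \<in> sp1 v" using e v by (simp add: M.a_comm)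
    then have "e \<in> sp1 v" using subsp_add_iff[OF subsp_sp1[OF v(1)] sp1_self[OF v(1)] e(1)] by simp
    then show False using sp1_sym[OF v(1) _ e(2)] v(2) by blast
  qed
  have tc: "t e \<in> carrier M" "t v \<in> carrier M" "t ?s \<in> carrier M" using t_closed e v v0 s s0 by auto
  have te0: "t ?s \<noteq> \<zero>\<^bsub>M\<^esub>" using t_nonzero s s0 by blast
  have n1: "t ?s \<notin> sp1 (t v)" using t_sp1[OF v(1) s v0 s0] sv' by simp
  have n2: "t ?s \<notin> sp1 (t e)" using t_sp1[OF e(1) s e(2) s0] sv by simp
  have "?s \<in> sp2 e v"
    using subsp_add[OF subsp_sp2[OF e(1) v(1)]] sp2_l[OF e(1) v(1)] sp2_r[OF e(1) v(1)] by blast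
  then have "t ?s \<in> sp2 (t e) (t v)" using t_sp2[OF e(1) v(1) s e(2) v0 s0] by simp
  then obtain a b where ab: "a \<in> carrier R" "b \<in> carrier R" "t ?s = a \<odot>\<^bsub>M\<^esub> t e \<oplus>\<^bsub>M\<^esub> b \<odot>\<^bsub>M\<^esub> t v" by (rule sp2E)
  have a0: "a \<noteq> \<zero>"
  proof
    assume "a = \<zero>"
    then have "t ?s = b \<odot>\<^bsub>M\<^esub> t v" using ab tc by simp
    then show False using n1 ab(2) unfolding sp1_def by blast
  qed
  \<comment> \<open>Dividing \<open>t ?s\<close> by \<open>a\<close> makes the coefficient of
    \<open>t e\<close> equal to one.\<close>
  let ?y = "(inv a \<otimes> b) \<odot>\<^bsub>M\<^esub> t v"
  have "inv a \<odot>\<^bsub>M\<^esub> t ?s = t e \<oplus>\<^bsub>M\<^esub> ?y"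
    using ab tc a0 by (simp add: smult_r_distr smult_inv smult_assoc)
  then have "t e \<oplus>\<^bsub>M\<^esub> ?y \<in> sp1 (t ?s)" using sp1I[OF inv_closed[OF ab(1) a0], of "t ?s"] by simp
  moreover have "?y \<in> sp1 (t v)" using ab a0 unfolding sp1_def by blast
  ultimately have ex: "?Q ?y" by blast
  have cy: "y \<in> carrier M" if "y \<in> sp1 (t v)" for y using subsp_carrier[OF subsp_sp1[OF tc(2)] that] .
  have uniq: "y = y'" if y: "?Q y" "?Q y'" for y y'
  proof (rule ccontr)
    assume ne: "y \<noteq> y'"
    have c: "y \<in> carrier M" "y' \<in> carrier M" using y cy by auto
    have "y \<ominus>\<^bsub>M\<^esub> y' = (t e \<oplus>\<^bsub>M\<^esub> y) \<ominus>\<^bsub>M\<^esub> (t e \<oplus>\<^bsub>M\<^esub> y')"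
      using add_diff_cancel[OF tc(1) c] by simp
    then have d1: "y \<ominus>\<^bsub>M\<^esub> y' \<in> sp1 (t ?s)" using subsp_diff[OF subsp_sp1[OF tc(3)]] y by simp
    have d2: "y \<ominus>\<^bsub>M\<^esub> y' \<in> sp1 (t v)" using subsp_diff[OF subsp_sp1[OF tc(2)]] y by simp
    have "y \<ominus>\<^bsub>M\<^esub> y' \<noteq> \<zero>\<^bsub>M\<^esub>"
      using ne c by (metis M.add.inv_solve_right M.l_zero M.minus_eq M.zero_closed)
    then have "t ?s \<in> sp1 (y \<ominus>\<^bsub>M\<^esub> y')" using sp1_sym[OF tc(3) d1] by blast
    then show False using sp1_least[OF subsp_sp1[OF tc(2)] d2] n1 by blast
  qed
  show "\<exists>!y. ?Q y" using ex uniq by blast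
  show "y \<in> carrier M \<and> y \<noteq> \<zero>\<^bsub>M\<^esub>" if "?Q y"
  proof
    show "y \<in> carrier M" using that cy by blast
    show "y \<noteq> \<zero>\<^bsub>M\<^esub>"
    proof
      assume "y = \<zero>\<^bsub>M\<^esub>"
      then have "t e \<in> sp1 (t ?s)" using that tc by simp
      then have "t ?s \<in> sp1 (t e)" using sp1_sym[OF tc(3)] t_nonzero e by blast
      then show False using n2 by blast
    qed
  qed
qed

text \<open>Outside the span of \<open>e\<close> the normalised vector \<open>g0 v\<close> is used,
  and its additivity is a comparison of intersecting lines. On the span of \<open>e\<close> the
  value is forced by additivity, as a difference. How \<open>g\<close> treats scalars is settled
  later, by the spread.\<close>

theorem additive_rep:
  obtains g where "\<And>v. v \<in> carrier M \<Longrightarrow> g v \<in> carrier M"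
    "\<And>v w. v \<in> carrier M \<Longrightarrow> w \<in> carrier M \<Longrightarrow> g (v \<oplus>\<^bsub>M\<^esub> w) = g v \<oplus>\<^bsub>M\<^esub> g w"
    "\<And>v. v \<in> carrier M \<Longrightarrow> v \<noteq> \<zero>\<^bsub>M\<^esub> \<Longrightarrow> g v \<noteq> \<zero>\<^bsub>M\<^esub> \<and> g v \<in> sp1 (t v)"
proof -
  obtain e where e: "e \<in> carrier M" "e \<noteq> \<zero>\<^bsub>M\<^esub>"
    using dim3[of "\<zero>\<^bsub>M\<^esub>" "\<zero>\<^bsub>M\<^esub>"] subsp_zero[OF subsp_sp2[of "\<zero>\<^bsub>M\<^esub>" "\<zero>\<^bsub>M\<^esub>"]] M.zero_closed by metis
  define f where "f = t e"
  have f: "f \<in> carrier M" "f \<noteq> \<zero>\<^bsub>M\<^esub>" using t_closed t_nonzero e f_def by auto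
  note Se = subsp_sp1[OF e(1)]
  define g0 where "g0 v = (THE y. y \<in> sp1 (t v) \<and> t e \<oplus>\<^bsub>M\<^esub> y \<in> sp1 (t (e \<oplus>\<^bsub>M\<^esub> v)))" for v
  have g0: "g0 v \<in> sp1 (t v)" "f \<oplus>\<^bsub>M\<^esub> g0 v \<in> sp1 (t (e \<oplus>\<^bsub>M\<^esub> v))" "g0 v \<in> carrier M" "g0 v \<noteq> \<zero>\<^bsub>M\<^esub>"
    if v: "v \<in> carrier M" "v \<notin> sp1 e" for v
    using theI'[OF normalised(1)[OF e v]] normalised(2)[OF e v] unfolding g0_def[symmetric] f_def by auto
  have g0_eq: "g0 v = y" if v: "v \<in> carrier M" "v \<notin> sp1 e" and y: "y \<in> sp1 (t v)" "f \<oplus>\<^bsub>M\<^esub> y \<in> sp1 (t (e \<oplus>\<^bsub>M\<^esub> v))" for v y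
    unfolding g0_def by (rule the1_equality[OF normalised(1)[OF e v]]) (use y f_def in simp)
  have nz: "v \<noteq> \<zero>\<^bsub>M\<^esub>" if "v \<notin> sp1 e" for v using that subsp_zero[OF Se] by metis
  have mem: "g0 v \<in> W \<longleftrightarrow> t v \<in> W" if v: "v \<in> carrier M" "v \<notin> sp1 e" and W: "subsp W" for v W
  proof -
    have "t v \<in> carrier M" using t_closed v nz by blast
    then show ?thesis
      using sp1_least[OF W, of "t v"] sp1_least[OF W, of "g0 v"] sp1_sym[of "t v" "g0 v"] g0[OF v] by blast
  qed
  have e_nsp: "u \<notin> sp2 e w \<Longrightarrow> u \<notin> sp1 e" if "w \<in> carrier M" for u w
    using sp1_sub_sp2[OF e(1) that] by blast
  have add_nsp: "x \<oplus>\<^bsub>M\<^esub> u \<notin> sp1 e" if "x \<in> sp1 e" "u \<in> carrier M" "u \<notin> sp1 e" for x u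
    using subsp_add_iff[OF Se that(1,2)] that(3) by simp
  have ex_sp2: "u \<notin> sp2 e w" if "u \<in> carrier M" "w \<in> carrier M" "w \<notin> sp2 e u" "u \<notin> sp1 e" for u w
    using sp2_exchange(1)[OF e(1) that(2,1)] that by blast
  have ind: "g0 v \<notin> sp1 f" "g0 w \<notin> sp2 f (g0 v)" if v: "v \<in> carrier M" "v \<notin> sp1 e" and w: "w \<in> carrier M" "w \<notin> sp2 e v" for v w
  proof -
    have v0: "v \<noteq> \<zero>\<^bsub>M\<^esub>" using nz v by blast
    have w1: "w \<notin> sp1 e" using e_nsp v w by blast
    then have w0: "w \<noteq> \<zero>\<^bsub>M\<^esub>" using nz by blast
    have tv: "t v \<in> carrier M" using t_closed v v0 by blast
    show "g0 v \<notin> sp1 f" using mem[OF v subsp_sp1[OF f(1)]] t_sp1[OF e(1) v(1) e(2) v0] v f_def by simp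
    have "t w \<notin> sp2 f (t v)" using t_sp2[OF e(1) v(1) w(1) e(2) v0 w0] w f_def by simp
    moreover have "sp2 f (g0 v) \<subseteq> sp2 f (t v)"
      using sp2_least[OF f(1) g0(3)[OF v] subsp_sp2[OF f(1) tv] sp2_l[OF f(1) tv]]
        mem[OF v subsp_sp2[OF f(1) tv]] sp2_r[OF f(1) tv] by blast
    ultimately have "t w \<notin> sp2 f (g0 v)" by blast
    then show "g0 w \<notin> sp2 f (g0 v)" using mem[OF w(1) w1 subsp_sp2[OF f(1) g0(3)[OF v]]] by blast
  qed
  \<comment> \<open>Here \<open>e\<close>, \<open>v\<close>, \<open>w\<close> are independent. The
    point of \<open>e + v + w\<close> lies on the line from \<open>e + v\<close> to \<open>w\<close>
    and on the line from \<open>e + w\<close> to \<open>v\<close>, so its image is the point of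
    \<open>f + ?p + ?q\<close>. The image of \<open>v + w\<close> is then located on two lines in
    the same way.\<close>
  have A: "g0 (v \<oplus>\<^bsub>M\<^esub> w) = g0 v \<oplus>\<^bsub>M\<^esub> g0 w"
    if v: "v \<in> carrier M" "v \<notin> sp1 e" and w: "w \<in> carrier M" "w \<notin> sp2 e v" for v w
  proof -
    have w1: "w \<notin> sp1 e" using e_nsp v w by blast
    have v2: "v \<notin> sp2 e w" using ex_sp2[OF v(1) w v(2)] .
    note gv = g0[OF v] and gw = g0[OF w(1) w1]
    let ?p = "g0 v" and ?q = "g0 w" and ?s = "e \<oplus>\<^bsub>M\<^esub> v \<oplus>\<^bsub>M\<^esub> w"
    have ev: "e \<oplus>\<^bsub>M\<^esub> v \<in> carrier M" "e \<oplus>\<^bsub>M\<^esub> w \<in> carrier M" "?s \<in> carrier M" "v \<oplus>\<^bsub>M\<^esub> w \<in> carrier M" using e v w by auto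
    have ev1: "e \<oplus>\<^bsub>M\<^esub> v \<notin> sp1 e" "e \<oplus>\<^bsub>M\<^esub> w \<notin> sp1 e" using add_nsp[OF sp1_self[OF e(1)]] v w w1 by auto
    note S2 = subsp_sp2[OF e(1) v(1)]
    have evS: "e \<oplus>\<^bsub>M\<^esub> v \<in> sp2 e v" using subsp_add[OF S2 sp2_l[OF e(1) v(1)] sp2_r[OF e(1) v(1)]] .
    have s2: "?s \<notin> sp2 e v" using subsp_add_iff[OF S2 evS w(1)] w by simp
    have vw2: "v \<oplus>\<^bsub>M\<^esub> w \<notin> sp2 e v" using subsp_add_iff[OF S2 sp2_r[OF e(1) v(1)] w(1)] w by simp
    have s1: "?s \<notin> sp1 e" "v \<oplus>\<^bsub>M\<^esub> w \<notin> sp1 e" using s2 vw2 e_nsp v by blast+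
    note n = nz[OF v(2)] nz[OF w1] nz[OF ev1(1)] nz[OF ev1(2)] nz[OF s1(1)] nz[OF s1(2)]
    have tc: "t v \<in> carrier M" "t w \<in> carrier M" "t (e \<oplus>\<^bsub>M\<^esub> v) \<in> carrier M" "t (e \<oplus>\<^bsub>M\<^esub> w) \<in> carrier M"
      "t ?s \<in> carrier M" "t (v \<oplus>\<^bsub>M\<^esub> w) \<in> carrier M" using t_closed n v w ev by auto
    have c: "f \<oplus>\<^bsub>M\<^esub> ?p \<in> carrier M" "f \<oplus>\<^bsub>M\<^esub> ?q \<in> carrier M" "f \<oplus>\<^bsub>M\<^esub> ?p \<oplus>\<^bsub>M\<^esub> ?q \<in> carrier M" using f gv gw by auto
    note I = ind[OF v w]
    have fp0: "f \<oplus>\<^bsub>M\<^esub> ?p \<noteq> \<zero>\<^bsub>M\<^esub>"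
      using I(1) subsp_add_iff[OF subsp_sp1[OF f(1)] sp1_self[OF f(1)] gv(3)] subsp_zero[OF subsp_sp1[OF f(1)]] by metis
    have fq0: "f \<oplus>\<^bsub>M\<^esub> ?q \<noteq> \<zero>\<^bsub>M\<^esub>"
    proof -
      have "?q \<notin> sp1 f" using I(2) sp1_sub_sp2[OF f(1) gv(3)] by blast
      then show ?thesis using subsp_add_iff[OF subsp_sp1[OF f(1)] sp1_self[OF f(1)] gw(3)] subsp_zero[OF subsp_sp1[OF f(1)]] by metis
    qed
    have in1: "t ?s \<in> sp2 (f \<oplus>\<^bsub>M\<^esub> ?p) ?q"
    proof -
      have "?s \<in> sp2 (e \<oplus>\<^bsub>M\<^esub> v) w" using subsp_add[OF subsp_sp2 sp2_l sp2_r] ev w by blast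
      then have "t ?s \<in> sp2 (t (e \<oplus>\<^bsub>M\<^esub> v)) (t w)" using t_sp2[OF ev(1) w(1) ev(3) n(3,2,5)] by simp
      moreover have "t (e \<oplus>\<^bsub>M\<^esub> v) \<in> sp1 (f \<oplus>\<^bsub>M\<^esub> ?p)" using sp1_sym[OF tc(3) gv(2) fp0] .
      then have "t (e \<oplus>\<^bsub>M\<^esub> v) \<in> sp2 (f \<oplus>\<^bsub>M\<^esub> ?p) ?q" using sp1_sub_sp2[OF c(1) gw(3)] by blast
      moreover have "t w \<in> sp2 (f \<oplus>\<^bsub>M\<^esub> ?p) ?q"
        using mem[OF w(1) w1 subsp_sp2[OF c(1) gw(3)]] sp2_r[OF c(1) gw(3)] by blast
      ultimately show ?thesis using sp2_least[OF tc(3,2) subsp_sp2[OF c(1) gw(3)]] by blast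
    qed
    have in2: "t ?s \<in> sp2 (f \<oplus>\<^bsub>M\<^esub> ?q) ?p"
    proof -
      have "e \<oplus>\<^bsub>M\<^esub> w \<oplus>\<^bsub>M\<^esub> v \<in> sp2 (e \<oplus>\<^bsub>M\<^esub> w) v" using subsp_add[OF subsp_sp2 sp2_l sp2_r] ev v by blast
      moreover have "e \<oplus>\<^bsub>M\<^esub> w \<oplus>\<^bsub>M\<^esub> v = ?s" using e v w by (simp add: M.a_ac)
      ultimately have "t ?s \<in> sp2 (t (e \<oplus>\<^bsub>M\<^esub> w)) (t v)" using t_sp2[OF ev(2) v(1) ev(3) n(4,1,5)] by simp
      moreover have "t (e \<oplus>\<^bsub>M\<^esub> w) \<in> sp1 (f \<oplus>\<^bsub>M\<^esub> ?q)" using sp1_sym[OF tc(4) gw(2) fq0] .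
      then have "t (e \<oplus>\<^bsub>M\<^esub> w) \<in> sp2 (f \<oplus>\<^bsub>M\<^esub> ?q) ?p" using sp1_sub_sp2[OF c(2) gv(3)] by blast
      moreover have "t v \<in> sp2 (f \<oplus>\<^bsub>M\<^esub> ?q) ?p"
        using mem[OF v subsp_sp2[OF c(2) gv(3)]] sp2_r[OF c(2) gv(3)] by blast
      ultimately show ?thesis using sp2_least[OF tc(4,1) subsp_sp2[OF c(2) gv(3)]] by blast
    qed
    obtain a b where ab: "a \<in> carrier R" "b \<in> carrier R" "t ?s = a \<odot>\<^bsub>M\<^esub> (f \<oplus>\<^bsub>M\<^esub> ?p) \<oplus>\<^bsub>M\<^esub> b \<odot>\<^bsub>M\<^esub> ?q" using sp2E[OF in1] .
    obtain a' b' where ab': "a' \<in> carrier R" "b' \<in> carrier R" "t ?s = a' \<odot>\<^bsub>M\<^esub> (f \<oplus>\<^bsub>M\<^esub> ?q) \<oplus>\<^bsub>M\<^esub> b' \<odot>\<^bsub>M\<^esub> ?p" using sp2E[OF in2] .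
    have "a \<odot>\<^bsub>M\<^esub> f \<oplus>\<^bsub>M\<^esub> a \<odot>\<^bsub>M\<^esub> ?p \<oplus>\<^bsub>M\<^esub> b \<odot>\<^bsub>M\<^esub> ?q = a' \<odot>\<^bsub>M\<^esub> f \<oplus>\<^bsub>M\<^esub> b' \<odot>\<^bsub>M\<^esub> ?p \<oplus>\<^bsub>M\<^esub> a' \<odot>\<^bsub>M\<^esub> ?q"
      using ab ab' f gv(3) gw(3) by (simp add: smult_r_distr M.a_ac)
    note E1 = indep3[OF f(1) gv(3) gw(3) f(2) I ab(1,1,2) ab'(1,2,1) this]
    have ts: "t ?s = a \<odot>\<^bsub>M\<^esub> (f \<oplus>\<^bsub>M\<^esub> ?p \<oplus>\<^bsub>M\<^esub> ?q)"
      using ab E1 f gv(3) gw(3) by (simp add: smult_r_distr)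
    then have ts1: "t ?s \<in> sp1 (f \<oplus>\<^bsub>M\<^esub> ?p \<oplus>\<^bsub>M\<^esub> ?q)" using ab(1) unfolding sp1_def by blast
    then have fpq: "f \<oplus>\<^bsub>M\<^esub> ?p \<oplus>\<^bsub>M\<^esub> ?q \<in> sp1 (t ?s)" using sp1_sym[OF c(3)] t_nonzero[OF ev(3) n(5)] by blast
    have in3: "t (v \<oplus>\<^bsub>M\<^esub> w) \<in> sp2 ?p ?q"
    proof -
      have "v \<oplus>\<^bsub>M\<^esub> w \<in> sp2 v w" using subsp_add[OF subsp_sp2 sp2_l sp2_r] v w by blast
      then have "t (v \<oplus>\<^bsub>M\<^esub> w) \<in> sp2 (t v) (t w)" using t_sp2[OF v(1) w(1) ev(4) n(1,2,6)] by simp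
      moreover have "sp2 (t v) (t w) \<subseteq> sp2 ?p ?q"
        using sp2_least[OF tc(1,2) subsp_sp2[OF gv(3) gw(3)]] mem[OF v subsp_sp2[OF gv(3) gw(3)]]
          mem[OF w(1) w1 subsp_sp2[OF gv(3) gw(3)]] sp2_l[OF gv(3) gw(3)] sp2_r[OF gv(3) gw(3)] by blast
      ultimately show ?thesis by blast
    qed
    have in4: "t (v \<oplus>\<^bsub>M\<^esub> w) \<in> sp2 (f \<oplus>\<^bsub>M\<^esub> ?p \<oplus>\<^bsub>M\<^esub> ?q) f"
    proof -
      note SS = subsp_sp2[OF ev(3) e(1)]
      have "e \<oplus>\<^bsub>M\<^esub> (v \<oplus>\<^bsub>M\<^esub> w) \<in> sp2 ?s e" using sp2_l[OF ev(3) e(1)] e v w by (simp add: M.a_assoc)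
      then have "v \<oplus>\<^bsub>M\<^esub> w \<in> sp2 ?s e" using subsp_add_iff[OF SS sp2_r[OF ev(3) e(1)] ev(4)] by simp
      then have "t (v \<oplus>\<^bsub>M\<^esub> w) \<in> sp2 (t ?s) f" using t_sp2[OF ev(3) e(1) ev(4) n(5) e(2) n(6)] f_def by simp
      moreover have "sp2 (t ?s) f \<subseteq> sp2 (f \<oplus>\<^bsub>M\<^esub> ?p \<oplus>\<^bsub>M\<^esub> ?q) f"
        using sp2_least[OF tc(5) f(1) subsp_sp2[OF c(3) f(1)]] ts1 sp1_sub_sp2[OF c(3) f(1)] sp2_r[OF c(3) f(1)] by blast
      ultimately show ?thesis by blast
    qed
    obtain x y where xy: "x \<in> carrier R" "y \<in> carrier R" "t (v \<oplus>\<^bsub>M\<^esub> w) = x \<odot>\<^bsub>M\<^esub> ?p \<oplus>\<^bsub>M\<^esub> y \<odot>\<^bsub>M\<^esub> ?q" using sp2E[OF in3] .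
    obtain x' y' where xy': "x' \<in> carrier R" "y' \<in> carrier R"
      "t (v \<oplus>\<^bsub>M\<^esub> w) = x' \<odot>\<^bsub>M\<^esub> (f \<oplus>\<^bsub>M\<^esub> ?p \<oplus>\<^bsub>M\<^esub> ?q) \<oplus>\<^bsub>M\<^esub> y' \<odot>\<^bsub>M\<^esub> f" using sp2E[OF in4] .
    have l: "\<zero> \<odot>\<^bsub>M\<^esub> f \<oplus>\<^bsub>M\<^esub> x \<odot>\<^bsub>M\<^esub> ?p \<oplus>\<^bsub>M\<^esub> y \<odot>\<^bsub>M\<^esub> ?q = t (v \<oplus>\<^bsub>M\<^esub> w)"
      using xy f gv(3) gw(3) by simp
    have r: "(x' \<oplus> y') \<odot>\<^bsub>M\<^esub> f \<oplus>\<^bsub>M\<^esub> x' \<odot>\<^bsub>M\<^esub> ?p \<oplus>\<^bsub>M\<^esub> x' \<odot>\<^bsub>M\<^esub> ?q = t (v \<oplus>\<^bsub>M\<^esub> w)"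
      using xy' f gv(3) gw(3) by (simp add: smult_r_distr smult_l_distr M.a_ac)
    note E2 = indep3[OF f(1) gv(3) gw(3) f(2) I R.zero_closed xy(1,2) R.a_closed[OF xy'(1,2)] xy'(1,1) trans[OF l r[symmetric]]]
    have tvw: "t (v \<oplus>\<^bsub>M\<^esub> w) = x \<odot>\<^bsub>M\<^esub> (?p \<oplus>\<^bsub>M\<^esub> ?q)"
      using xy E2 gv(3) gw(3) by (simp add: smult_r_distr)
    then have "t (v \<oplus>\<^bsub>M\<^esub> w) \<in> sp1 (?p \<oplus>\<^bsub>M\<^esub> ?q)" using xy(1) unfolding sp1_def by blast
    then have "?p \<oplus>\<^bsub>M\<^esub> ?q \<in> sp1 (t (v \<oplus>\<^bsub>M\<^esub> w))"
      using sp1_sym[of "?p \<oplus>\<^bsub>M\<^esub> ?q"] gv(3) gw(3) t_nonzero[OF ev(4) n(6)] by blast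
    moreover have "f \<oplus>\<^bsub>M\<^esub> (?p \<oplus>\<^bsub>M\<^esub> ?q) \<in> sp1 (t (e \<oplus>\<^bsub>M\<^esub> (v \<oplus>\<^bsub>M\<^esub> w)))"
      using fpq f gv(3) gw(3) e v w by (simp add: M.a_assoc)
    ultimately show ?thesis using g0_eq[OF ev(4) s1(2)] by blast
  qed
  obtain u0 where u0: "u0 \<in> carrier M" "u0 \<notin> sp1 e" using dim3[OF e(1) e(1)] sp2_same[OF e(1)] by auto
  \<comment> \<open>Any vector outside the span of \<open>e\<close> may serve as \<open>u0\<close>;
    \<open>gx\<close> shows that the difference does not depend on it.\<close>
  define g where "g v = (if v \<in> sp1 e then g0 (v \<oplus>\<^bsub>M\<^esub> u0) \<ominus>\<^bsub>M\<^esub> g0 u0 else g0 v)" for v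
  have ec: "x \<in> carrier M" if "x \<in> sp1 e" for x using subsp_carrier[OF Se that] .
  \<comment> \<open>Both sides are \<open>g0 (x + u + u')\<close>, split in two ways.\<close>
  have step: "g0 (x \<oplus>\<^bsub>M\<^esub> u) \<oplus>\<^bsub>M\<^esub> g0 u' = g0 u \<oplus>\<^bsub>M\<^esub> g0 (x \<oplus>\<^bsub>M\<^esub> u')"
    if x: "x \<in> sp1 e" and u: "u \<in> carrier M" "u \<notin> sp1 e" and u': "u' \<in> carrier M" "u' \<notin> sp2 e u" for x u u'
  proof -
    note xc = ec[OF x]
    have xS: "x \<in> sp2 e u" using sp1_sub_sp2[OF e(1) u(1)] x by blast
    have xu: "x \<oplus>\<^bsub>M\<^esub> u \<in> sp2 e u" using subsp_add[OF subsp_sp2[OF e(1) u(1)] xS sp2_r[OF e(1) u(1)]] .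
    have xu1: "x \<oplus>\<^bsub>M\<^esub> u \<notin> sp1 e" using add_nsp[OF x u] .
    have "sp2 e u = sp2 e (x \<oplus>\<^bsub>M\<^esub> u)" using sp2_exchange(2)[OF e(1) u(1) _ xu xu1] xc u by simp
    then have "g0 (x \<oplus>\<^bsub>M\<^esub> u \<oplus>\<^bsub>M\<^esub> u') = g0 (x \<oplus>\<^bsub>M\<^esub> u) \<oplus>\<^bsub>M\<^esub> g0 u'" using A[OF _ xu1 u'(1)] u' xc u by simp
    moreover have "x \<oplus>\<^bsub>M\<^esub> u' \<notin> sp2 e u" using subsp_add_iff[OF subsp_sp2[OF e(1) u(1)] xS u'(1)] u'(2) by simp
    then have "g0 (u \<oplus>\<^bsub>M\<^esub> (x \<oplus>\<^bsub>M\<^esub> u')) = g0 u \<oplus>\<^bsub>M\<^esub> g0 (x \<oplus>\<^bsub>M\<^esub> u')" using A[OF u] xc u' by simp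
    moreover have "u \<oplus>\<^bsub>M\<^esub> (x \<oplus>\<^bsub>M\<^esub> u') = x \<oplus>\<^bsub>M\<^esub> u \<oplus>\<^bsub>M\<^esub> u'" using xc u u' by (simp add: M.a_ac)
    ultimately show ?thesis by simp
  qed
  have delta: "g0 (x \<oplus>\<^bsub>M\<^esub> u) \<ominus>\<^bsub>M\<^esub> g0 u = g0 (x \<oplus>\<^bsub>M\<^esub> u') \<ominus>\<^bsub>M\<^esub> g0 u'"
    if x: "x \<in> sp1 e" and u: "u \<in> carrier M" "u \<notin> sp1 e" and u': "u' \<in> carrier M" "u' \<notin> sp2 e u" for x u u'
  proof -
    have u1: "u' \<notin> sp1 e" using e_nsp u u' by blast
    have c: "g0 (x \<oplus>\<^bsub>M\<^esub> u) \<in> carrier M" "g0 u \<in> carrier M" "g0 (x \<oplus>\<^bsub>M\<^esub> u') \<in> carrier M" "g0 u' \<in> carrier M"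
      using g0(3) add_nsp[OF x] ec[OF x] u u'(1) u1 by auto
    have "g0 (x \<oplus>\<^bsub>M\<^esub> u) \<oplus>\<^bsub>M\<^esub> g0 u' = g0 (x \<oplus>\<^bsub>M\<^esub> u') \<oplus>\<^bsub>M\<^esub> g0 u"
      using step[OF x u u'] c by (simp add: M.a_comm)
    then have "(g0 (x \<oplus>\<^bsub>M\<^esub> u) \<oplus>\<^bsub>M\<^esub> g0 u') \<oplus>\<^bsub>M\<^esub> (\<ominus>\<^bsub>M\<^esub> g0 u \<oplus>\<^bsub>M\<^esub> \<ominus>\<^bsub>M\<^esub> g0 u') =
      (g0 (x \<oplus>\<^bsub>M\<^esub> u') \<oplus>\<^bsub>M\<^esub> g0 u) \<oplus>\<^bsub>M\<^esub> (\<ominus>\<^bsub>M\<^esub> g0 u \<oplus>\<^bsub>M\<^esub> \<ominus>\<^bsub>M\<^esub> g0 u')" by simp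
    moreover have "(p \<oplus>\<^bsub>M\<^esub> b) \<oplus>\<^bsub>M\<^esub> (\<ominus>\<^bsub>M\<^esub> a \<oplus>\<^bsub>M\<^esub> \<ominus>\<^bsub>M\<^esub> b) = p \<ominus>\<^bsub>M\<^esub> a"
      "(p \<oplus>\<^bsub>M\<^esub> a) \<oplus>\<^bsub>M\<^esub> (\<ominus>\<^bsub>M\<^esub> a \<oplus>\<^bsub>M\<^esub> \<ominus>\<^bsub>M\<^esub> b) = p \<ominus>\<^bsub>M\<^esub> b"
      if "p \<in> carrier M" "a \<in> carrier M" "b \<in> carrier M" for p a b
      using that M.r_neg2[of b "\<ominus>\<^bsub>M\<^esub> a"] M.r_neg2[of a "\<ominus>\<^bsub>M\<^esub> b"]
      by (simp_all add: M.minus_eq M.a_assoc M.a_comm[of "\<ominus>\<^bsub>M\<^esub> a"])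
    ultimately show ?thesis using c by simp
  qed
  have gx: "g x = g0 (x \<oplus>\<^bsub>M\<^esub> u) \<ominus>\<^bsub>M\<^esub> g0 u" if x: "x \<in> sp1 e" and u: "u \<in> carrier M" "u \<notin> sp1 e" for x u
  proof (cases "u \<in> sp2 e u0")
    case False
    then show ?thesis using delta[OF x u0 u(1)] x unfolding g_def by simp
  next
    \<comment> \<open>If \<open>u\<close> lies in the span of \<open>e\<close> and
      \<open>u0\<close>, the two are compared through a third vector \<open>w\<close> outside that
      span.\<close>
    case True
    then have eq: "sp2 e u0 = sp2 e u" using sp2_exchange(2)[OF e(1) u0(1) u(1)] u by blast
    obtain w where w: "w \<in> carrier M" "w \<notin> sp2 e u0" using dim3[OF e(1) u0(1)] by blast
    then show ?thesis using delta[OF x u0 w] delta[OF x u w(1)] x eq unfolding g_def by simp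
  qed
  have g_out: "g v = g0 v" if "v \<notin> sp1 e" for v using that unfolding g_def by simp
  have g_closed: "g v \<in> carrier M" if v: "v \<in> carrier M" for v
  proof (cases "v \<in> sp1 e")
    case True
    then show ?thesis unfolding g_def using g0(3)[OF u0] g0(3)[OF _ add_nsp[OF True u0]] v u0 by simp
  next
    case False then show ?thesis using g_out g0(3) v by simp
  qed
  have gB: "g0 (x \<oplus>\<^bsub>M\<^esub> u) = g x \<oplus>\<^bsub>M\<^esub> g0 u" if x: "x \<in> sp1 e" and u: "u \<in> carrier M" "u \<notin> sp1 e" for x u
    unfolding gx[OF x u] using g0(3)[OF u] g0(3)[OF _ add_nsp[OF x u]] ec[OF x] u
    by (simp add: M.minus_eq M.a_assoc M.l_neg)
  have rc: "a = b" if "a \<in> carrier M" "b \<in> carrier M" "z \<in> carrier M" "a \<oplus>\<^bsub>M\<^esub> z = b \<oplus>\<^bsub>M\<^esub> z" for a b z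
    using M.add.right_cancel[OF that(3) that(1,2)] that(4) by simp
  have g_add: "g (v \<oplus>\<^bsub>M\<^esub> w) = g v \<oplus>\<^bsub>M\<^esub> g w" if v: "v \<in> carrier M" and w: "w \<in> carrier M" for v w
  proof -
    consider "v \<in> sp1 e" "w \<in> sp1 e" | "v \<in> sp1 e" "w \<notin> sp1 e" | "v \<notin> sp1 e" "w \<in> sp1 e"
      | "v \<notin> sp1 e" "w \<notin> sp1 e" by blast
    then show ?thesis
    proof cases
      case 1
      have wu: "w \<oplus>\<^bsub>M\<^esub> u0 \<in> carrier M" "w \<oplus>\<^bsub>M\<^esub> u0 \<notin> sp1 e" using add_nsp[OF 1(2) u0] w u0 by auto
      have "g0 (v \<oplus>\<^bsub>M\<^esub> (w \<oplus>\<^bsub>M\<^esub> u0)) = g v \<oplus>\<^bsub>M\<^esub> g w \<oplus>\<^bsub>M\<^esub> g0 u0"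
        using gB[OF 1(1) wu] gB[OF 1(2) u0] g_closed v w g0(3)[OF u0] by (simp add: M.a_assoc)
      moreover have "g0 ((v \<oplus>\<^bsub>M\<^esub> w) \<oplus>\<^bsub>M\<^esub> u0) = g (v \<oplus>\<^bsub>M\<^esub> w) \<oplus>\<^bsub>M\<^esub> g0 u0"
        using gB[OF subsp_add[OF Se 1] u0] .
      ultimately have "g (v \<oplus>\<^bsub>M\<^esub> w) \<oplus>\<^bsub>M\<^esub> g0 u0 = (g v \<oplus>\<^bsub>M\<^esub> g w) \<oplus>\<^bsub>M\<^esub> g0 u0"
        using v w u0 by (simp add: M.a_assoc)
      then show ?thesis using rc[of "g (v \<oplus>\<^bsub>M\<^esub> w)" "g v \<oplus>\<^bsub>M\<^esub> g w" "g0 u0"] g_closed[OF v] g_closed[OF w] g_closed[OF M.a_closed[OF v w]] M.a_closed g0(3)[OF u0] by simp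
    next
      case 2 then show ?thesis using gB[OF 2(1) w 2(2)] g_out add_nsp[OF 2(1) w 2(2)] by simp
    next
      case 3 then show ?thesis
        using gB[OF 3(2) v 3(1)] g_out[OF 3(1)] g_out[OF add_nsp[OF 3(2) v 3(1)]]
          M.a_comm[OF v w] M.a_comm[OF g_closed[OF w] g_closed[OF v]] by simp
    next
      case 4
      show ?thesis
      proof (cases "w \<in> sp2 e v")
        case False
        then show ?thesis using A[OF v 4(1) w False] g_out 4
          subsp_add_iff[OF subsp_sp2[OF e(1) v] sp2_r[OF e(1) v] w] e_nsp[OF v] by simp
      next
        case True
        \<comment> \<open>\<open>w\<close> is dependent on \<open>e\<close> and \<open>v\<close>, so
          \<open>A\<close> does not apply directly; a vector \<open>u\<close> outside their span is
          added and cancelled at the end.\<close>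
        obtain u where u: "u \<in> carrier M" "u \<notin> sp2 e v" using dim3[OF e(1) v] by blast
        note S = subsp_sp2[OF e(1) v]
        have u1: "u \<notin> sp1 e" using e_nsp v u by blast
        have sub: "u \<notin> sp2 e z" if "z \<in> carrier M" "z \<in> sp2 e v" for z
          using sp2_least[OF e(1) that(1) S sp2_l[OF e(1) v] that(2)] u by blast
        have vw: "v \<oplus>\<^bsub>M\<^esub> w \<in> sp2 e v" "v \<oplus>\<^bsub>M\<^esub> w \<in> carrier M"
          using subsp_add[OF S sp2_r[OF e(1) v] True] v w by auto
        have "g0 (v \<oplus>\<^bsub>M\<^esub> w \<oplus>\<^bsub>M\<^esub> u) = g (v \<oplus>\<^bsub>M\<^esub> w) \<oplus>\<^bsub>M\<^esub> g0 u"
        proof (cases "v \<oplus>\<^bsub>M\<^esub> w \<in> sp1 e")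
          case True then show ?thesis using gB[OF True u(1) u1] by simp
        next
          case False then show ?thesis using A[OF vw(2) False u(1) sub[OF vw(2,1)]] g_out by simp
        qed
        moreover have "w \<oplus>\<^bsub>M\<^esub> u \<notin> sp2 e v" using subsp_add_iff[OF S True u(1)] u by simp
        then have "g0 (v \<oplus>\<^bsub>M\<^esub> (w \<oplus>\<^bsub>M\<^esub> u)) = g0 v \<oplus>\<^bsub>M\<^esub> (g0 w \<oplus>\<^bsub>M\<^esub> g0 u)"
          using A[OF v 4(1)] A[OF w 4(2) u(1) sub[OF w True]] w u by simp
        ultimately have "g (v \<oplus>\<^bsub>M\<^esub> w) \<oplus>\<^bsub>M\<^esub> g0 u = (g v \<oplus>\<^bsub>M\<^esub> g w) \<oplus>\<^bsub>M\<^esub> g0 u"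
          using v w u g_out 4 g0(3)[OF v 4(1)] g0(3)[OF w 4(2)] g0(3)[OF u(1) u1] by (simp add: M.a_assoc)
        then show ?thesis using rc[of "g (v \<oplus>\<^bsub>M\<^esub> w)" "g v \<oplus>\<^bsub>M\<^esub> g w" "g0 u"] g_closed[OF v] g_closed[OF w] g_closed[OF M.a_closed[OF v w]] M.a_closed g0(3)[OF u(1) u1] by simp
      qed
    qed
  qed
  have g_t: "g v \<noteq> \<zero>\<^bsub>M\<^esub> \<and> g v \<in> sp1 (t v)" if v: "v \<in> carrier M" "v \<noteq> \<zero>\<^bsub>M\<^esub>" for v
  proof (cases "v \<in> sp1 e")
    case False then show ?thesis using g0[OF v(1) False] g_out by simp
  next
    case True
    have tv: "t v \<in> sp1 f" using t_sp1[OF e(1) v(1) e(2) v(2)] True f_def by simp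
    have in2: "g v \<in> sp2 f (g0 u)" if u: "u \<in> carrier M" "u \<notin> sp1 e" for u
    proof -
      note gu = g0[OF u]
      have xu: "v \<oplus>\<^bsub>M\<^esub> u \<in> carrier M" "v \<oplus>\<^bsub>M\<^esub> u \<notin> sp1 e" using add_nsp[OF True u] v u by auto
      have "v \<oplus>\<^bsub>M\<^esub> u \<in> sp2 e u"
        using subsp_add[OF subsp_sp2[OF e(1) u(1)] _ sp2_r[OF e(1) u(1)]] sp1_sub_sp2[OF e(1) u(1)] True by blast
      then have "t (v \<oplus>\<^bsub>M\<^esub> u) \<in> sp2 f (t u)"
        using t_sp2[OF e(1) u(1) xu(1) e(2) nz[OF u(2)] nz[OF xu(2)]] f_def by simp
      moreover have "sp2 f (t u) \<subseteq> sp2 f (g0 u)"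
        using sp2_least[OF f(1) t_closed[OF u(1) nz[OF u(2)]] subsp_sp2[OF f(1) gu(3)] sp2_l[OF f(1) gu(3)]]
          mem[OF u subsp_sp2[OF f(1) gu(3)]] sp2_r[OF f(1) gu(3)] by blast
      ultimately have "g0 (v \<oplus>\<^bsub>M\<^esub> u) \<in> sp2 f (g0 u)" using mem[OF xu subsp_sp2[OF f(1) gu(3)]] by blast
      then show ?thesis using gx[OF True u] subsp_diff[OF subsp_sp2[OF f(1) gu(3)]] sp2_r[OF f(1) gu(3)] by simp
    qed
    obtain w where w: "w \<in> carrier M" "w \<notin> sp2 e u0" using dim3[OF e(1) u0(1)] by blast
    have w1: "w \<notin> sp1 e" using e_nsp u0 w by blast
    note gu = g0[OF u0] and gw = g0[OF w(1) w1]
    \<comment> \<open>By \<open>in2\<close>, \<open>g v\<close> lies in the span of \<open>f\<close>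
      and \<open>g0 u0\<close> and in that of \<open>f\<close> and \<open>g0 w\<close>; these two
      meet only in the span of \<open>f\<close>.\<close>
    have "g v \<in> sp1 f"
    proof (rule ccontr)
      assume "g v \<notin> sp1 f"
      then have "g0 w \<in> sp2 f (g v)" "sp2 f (g0 u0) = sp2 f (g v)"
        using sp2_exchange(1)[OF f(1) gw(3) g_closed[OF v(1)] in2[OF w(1) w1]]
          sp2_exchange(2)[OF f(1) gu(3) g_closed[OF v(1)] in2[OF u0]] by auto
      then show False using ind(2)[OF u0 w] by simp
    qed
    then have 1: "g v \<in> sp1 (t v)" using sp1_eq[OF f(1) tv t_nonzero[OF v]] by simp
    have "g v \<noteq> \<zero>\<^bsub>M\<^esub>"
    proof
      assume "g v = \<zero>\<^bsub>M\<^esub>"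
      then have "g0 (v \<oplus>\<^bsub>M\<^esub> u0) = g0 u0" using gB[OF True u0] gu(3) by simp
      moreover have vu: "v \<oplus>\<^bsub>M\<^esub> u0 \<in> carrier M" "v \<oplus>\<^bsub>M\<^esub> u0 \<notin> sp1 e" using add_nsp[OF True u0] v u0 by auto
      have tu: "t u0 \<in> carrier M" using t_closed[OF u0(1) nz[OF u0(2)]] .
      have "t (v \<oplus>\<^bsub>M\<^esub> u0) \<in> sp1 (t u0)"
        using mem[OF vu subsp_sp1[OF tu]] gu(1) calculation by simp
      then have "v \<oplus>\<^bsub>M\<^esub> u0 \<in> sp1 u0" using t_sp1[OF u0(1) vu(1) nz[OF u0(2)] nz[OF vu(2)]] by simp
      then have "u0 \<oplus>\<^bsub>M\<^esub> v \<in> sp1 u0" using u0 v by (simp add: M.a_comm)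
      then have "v \<in> sp1 u0" using subsp_add_iff[OF subsp_sp1[OF u0(1)] sp1_self[OF u0(1)] v(1)] by simp
      then have "u0 \<in> sp1 v" using sp1_sym[OF u0(1) _ v(2)] by blast
      then show False using sp1_least[OF Se True] u0(2) by blast
    qed
    then show ?thesis using 1 by blast
  qed
  show ?thesis using that[of g] g_closed g_add g_t by blast
qed

end

section \<open>The field extension\<close>

text \<open>The conditions express that \<open>g\<close> moves every point, maps points to points,
  and keeps \<open>v\<close>, \<open>g v\<close>, \<open>g (g v)\<close> dependent, as on a fixed
  line. \<open>g_sp1\<close> allows the scalar to vary with \<open>v\<close>; that it does not is a
  consequence.\<close>

locale spread_rep = left_vs R M + F: field R
  for R :: "('k, 'm) ring_scheme" (structure) and M :: "('k, 'v, 'n) module_scheme" (structure) +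
  fixes g :: "'v \<Rightarrow> 'v"
  assumes g_closed: "\<And>v. v \<in> carrier M \<Longrightarrow> g v \<in> carrier M"
    and g_add: "\<And>v w. v \<in> carrier M \<Longrightarrow> w \<in> carrier M \<Longrightarrow> g (v \<oplus>\<^bsub>M\<^esub> w) = g v \<oplus>\<^bsub>M\<^esub> g w"
    and g_indep: "\<And>v. v \<in> carrier M \<Longrightarrow> v \<noteq> \<zero>\<^bsub>M\<^esub> \<Longrightarrow> g v \<notin> sp1 v"
    and g_sp1: "\<And>v c. v \<in> carrier M \<Longrightarrow> c \<in> carrier R \<Longrightarrow> g (c \<odot>\<^bsub>M\<^esub> v) \<in> sp1 (g v)"
    and g_line: "\<And>v. v \<in> carrier M \<Longrightarrow> g (g v) \<in> sp2 v (g v)"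
    and dim3: "\<And>u v. u \<in> carrier M \<Longrightarrow> v \<in> carrier M \<Longrightarrow> \<exists>w \<in> carrier M. w \<notin> sp2 u v"
begin

definition S :: "'v \<Rightarrow> 'v set" where "S v = sp2 v (g v)"

lemma subsp_S: "v \<in> carrier M \<Longrightarrow> subsp (S v)"
  unfolding S_def using subsp_sp2 g_closed by simp

lemma S_self: "v \<in> carrier M \<Longrightarrow> v \<in> S v" "v \<in> carrier M \<Longrightarrow> g v \<in> S v"
  unfolding S_def using sp2_l sp2_r g_closed by simp_all

lemma S_g:
  assumes v: "v \<in> carrier M" and w: "w \<in> S v" shows "g w \<in> S v"
proof -
  note gv = g_closed[OF v]
  obtain a b where ab: "a \<in> carrier R" "b \<in> carrier R" "w = a \<odot>\<^bsub>M\<^esub> v \<oplus>\<^bsub>M\<^esub> b \<odot>\<^bsub>M\<^esub> g v"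
    using w unfolding S_def by (rule sp2E)
  have "g (a \<odot>\<^bsub>M\<^esub> v) \<in> S v"
    using g_sp1[OF v ab(1)] sp1_least[OF subsp_S[OF v] S_self(2)[OF v]] by blast
  moreover have "g (g v) \<in> S v" using g_line[OF v] unfolding S_def .
  then have "g (b \<odot>\<^bsub>M\<^esub> g v) \<in> S v"
    using g_sp1[OF gv ab(2)] sp1_least[OF subsp_S[OF v]] by blast
  ultimately show ?thesis using subsp_add[OF subsp_S[OF v]] ab g_add v gv by simp
qed

text \<open>With \<open>w\<close> the 2-dimensional space \<open>S v\<close> contains the
  independent vector \<open>g w\<close>, so it equals \<open>S w\<close>. Thus the
  \<open>S v\<close> form a spread: two of them are equal or meet only in zero.\<close>

lemma S_eq:
  assumes v: "v \<in> carrier M" and w: "w \<in> S v" "w \<noteq> \<zero>\<^bsub>M\<^esub>" shows "S w = S v"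
proof -
  have wc: "w \<in> carrier M" using subsp_carrier[OF subsp_S[OF v] w(1)] .
  note gv = g_closed[OF v] and gw = g_closed[OF wc]
  have nw: "g w \<notin> sp1 w" using g_indep wc w by blast
  have gwS: "g w \<in> sp2 v (g v)" using S_g[OF v w(1)] unfolding S_def .
  show ?thesis
  proof (cases "w \<in> sp1 v")
    case True
    then have e: "sp1 w = sp1 v" using sp1_eq v w by blast
    then have "sp2 v (g v) = sp2 v (g w)" using sp2_exchange(2)[OF v gv gw gwS] nw by simp
    then show ?thesis unfolding S_def sp2_def e by simp
  next
    case False
    have wS: "w \<in> sp2 v (g v)" using w(1) unfolding S_def .
    have 1: "sp2 v (g v) = sp2 v w" using sp2_exchange(2)[OF v gv wc wS False] .
    have 2: "sp2 v w = sp2 w v"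
      using sp2_least[OF v wc subsp_sp2[OF wc v] sp2_r[OF wc v] sp2_l[OF wc v]]
        sp2_least[OF wc v subsp_sp2[OF v wc] sp2_r[OF v wc] sp2_l[OF v wc]] by blast
    have "sp2 w v = sp2 w (g w)" using sp2_exchange(2)[OF wc v gw] gwS 1 2 nw by simp
    then show ?thesis unfolding S_def using 1 2 by simp
  qed
qed

lemma S_coefs:
  assumes v: "v \<in> carrier M" "v \<noteq> \<zero>\<^bsub>M\<^esub>"
    and k: "x \<in> carrier R" "y \<in> carrier R" "x' \<in> carrier R" "y' \<in> carrier R"
    and eq: "x \<odot>\<^bsub>M\<^esub> v \<oplus>\<^bsub>M\<^esub> y \<odot>\<^bsub>M\<^esub> g v = x' \<odot>\<^bsub>M\<^esub> v \<oplus>\<^bsub>M\<^esub> y' \<odot>\<^bsub>M\<^esub> g v"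
  shows "x = x'" "y = y'"
proof -
  note gv = g_closed[OF v(1)]
  show y: "y = y'"
    using coef_cancel[OF k(2,4) gv subsp_sp1[OF v(1)] g_indep[OF v] sp1I[OF k(1)] sp1I[OF k(3)] eq] .
  have "\<zero>\<^bsub>M\<^esub> \<oplus>\<^bsub>M\<^esub> x \<odot>\<^bsub>M\<^esub> v = \<zero>\<^bsub>M\<^esub> \<oplus>\<^bsub>M\<^esub> x' \<odot>\<^bsub>M\<^esub> v" using eq y v gv k by simp
  then show "x = x'"
    using coef_cancel[OF k(1,3) v(1) subsp_zero_only _ subsp_zero[OF subsp_zero_only] subsp_zero[OF subsp_zero_only]] v(2) by blast
qed

lemma S_independent:
  assumes v: "v \<in> carrier M" and w: "w \<in> carrier M" "w \<notin> S v"
    and p: "p \<in> S v" "p' \<in> S v" "q \<in> S w" "q' \<in> S w" and eq: "p \<oplus>\<^bsub>M\<^esub> q = p' \<oplus>\<^bsub>M\<^esub> q'"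
  shows "p = p'" "q = q'"
proof -
  have c: "p \<in> carrier M" "p' \<in> carrier M" "q \<in> carrier M" "q' \<in> carrier M"
    using p subsp_carrier[OF subsp_S] v w by auto
  have "p \<ominus>\<^bsub>M\<^esub> p' = (p \<oplus>\<^bsub>M\<^esub> q) \<ominus>\<^bsub>M\<^esub> (p' \<oplus>\<^bsub>M\<^esub> q)"
    using add_diff_cancel[of q p p'] c by (simp add: M.a_comm)
  also have "\<dots> = q' \<ominus>\<^bsub>M\<^esub> q" unfolding eq using add_diff_cancel[of p' q' q] c by simp
  finally have e: "p \<ominus>\<^bsub>M\<^esub> p' = q' \<ominus>\<^bsub>M\<^esub> q" .
  have z: "p \<ominus>\<^bsub>M\<^esub> p' = \<zero>\<^bsub>M\<^esub>"
  proof (rule ccontr)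
    assume nz: "p \<ominus>\<^bsub>M\<^esub> p' \<noteq> \<zero>\<^bsub>M\<^esub>"
    have "p \<ominus>\<^bsub>M\<^esub> p' \<in> S v" "p \<ominus>\<^bsub>M\<^esub> p' \<in> S w"
      using subsp_diff[OF subsp_S[OF v] p(1,2)] subsp_diff[OF subsp_S[OF w(1)] p(4,3)] e by auto
    then have "S v = S w" using S_eq[OF v _ nz] S_eq[OF w(1) _ nz] by simp
    then show False using S_self w by blast
  qed
  then show pp: "p = p'" using c by (metis M.add.inv_solve_right M.l_zero M.minus_eq M.zero_closed)
  have "q' \<ominus>\<^bsub>M\<^esub> q = \<zero>\<^bsub>M\<^esub>" using z e by simp
  then show "q = q'" using c by (metis M.add.inv_solve_right M.l_zero M.minus_eq M.zero_closed)
qed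

lemma g_zero: "g \<zero>\<^bsub>M\<^esub> = \<zero>\<^bsub>M\<^esub>"
  using g_add[of "\<zero>\<^bsub>M\<^esub>" "\<zero>\<^bsub>M\<^esub>"] g_closed[of "\<zero>\<^bsub>M\<^esub>"] by (metis M.add.l_cancel_one M.l_zero M.zero_closed)

lemma g_nonzero: "v \<in> carrier M \<Longrightarrow> v \<noteq> \<zero>\<^bsub>M\<^esub> \<Longrightarrow> g v \<noteq> \<zero>\<^bsub>M\<^esub>"
  using g_indep subsp_zero[OF subsp_sp1] by metis

text \<open>Compare \<open>v\<close>, \<open>w\<close> and \<open>v + w\<close> for \<open>w\<close> outside the spread line of \<open>v\<close>.\<close>

lemma constant_coefs:
  assumes T_add: "\<And>v w. v \<in> carrier M \<Longrightarrow> w \<in> carrier M \<Longrightarrow> T (v \<oplus>\<^bsub>M\<^esub> w) = T v \<oplus>\<^bsub>M\<^esub> T w"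
    and T_S: "\<And>v. v \<in> carrier M \<Longrightarrow> T v \<in> S v"
  obtains x y where "x \<in> carrier R" "y \<in> carrier R"
    "\<And>v. v \<in> carrier M \<Longrightarrow> T v = x \<odot>\<^bsub>M\<^esub> v \<oplus>\<^bsub>M\<^esub> y \<odot>\<^bsub>M\<^esub> g v"
proof -
  have step: "T w = x \<odot>\<^bsub>M\<^esub> w \<oplus>\<^bsub>M\<^esub> y \<odot>\<^bsub>M\<^esub> g w"
    if v: "v \<in> carrier M" "v \<noteq> \<zero>\<^bsub>M\<^esub>" and w: "w \<in> carrier M" "w \<notin> S v"
      and xy: "x \<in> carrier R" "y \<in> carrier R" and Tv: "T v = x \<odot>\<^bsub>M\<^esub> v \<oplus>\<^bsub>M\<^esub> y \<odot>\<^bsub>M\<^esub> g v" for v w x y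
  proof -
    note gv = g_closed[OF v(1)] and gw = g_closed[OF w(1)]
    obtain x' y' where 1: "x' \<in> carrier R" "y' \<in> carrier R" "T w = x' \<odot>\<^bsub>M\<^esub> w \<oplus>\<^bsub>M\<^esub> y' \<odot>\<^bsub>M\<^esub> g w"
      using T_S[OF w(1)] unfolding S_def by (rule sp2E)
    obtain x2 y2 where 2: "x2 \<in> carrier R" "y2 \<in> carrier R"
      "T (v \<oplus>\<^bsub>M\<^esub> w) = x2 \<odot>\<^bsub>M\<^esub> (v \<oplus>\<^bsub>M\<^esub> w) \<oplus>\<^bsub>M\<^esub> y2 \<odot>\<^bsub>M\<^esub> g (v \<oplus>\<^bsub>M\<^esub> w)"
      using T_S[OF M.a_closed[OF v(1) w(1)]] unfolding S_def by (rule sp2E)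
    have comb: "\<alpha> \<odot>\<^bsub>M\<^esub> u \<oplus>\<^bsub>M\<^esub> \<beta> \<odot>\<^bsub>M\<^esub> g u \<in> S u" if "u \<in> carrier M" "\<alpha> \<in> carrier R" "\<beta> \<in> carrier R" for \<alpha> \<beta> u
      using subsp_add[OF subsp_S] subsp_smult[OF subsp_S] S_self that by simp
    have "(x2 \<odot>\<^bsub>M\<^esub> v \<oplus>\<^bsub>M\<^esub> y2 \<odot>\<^bsub>M\<^esub> g v) \<oplus>\<^bsub>M\<^esub> (x2 \<odot>\<^bsub>M\<^esub> w \<oplus>\<^bsub>M\<^esub> y2 \<odot>\<^bsub>M\<^esub> g w) = T v \<oplus>\<^bsub>M\<^esub> T w"
      using 2 T_add[OF v(1) w(1)] v w gv gw by (simp add: g_add smult_r_distr M.a_ac)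
    note E = S_independent[OF v(1) w comb[OF v(1) 2(1,2)] T_S[OF v(1)] comb[OF w(1) 2(1,2)] T_S[OF w(1)] this]
    have "x2 = x" "y2 = y" using S_coefs[OF v 2(1,2) xy] E(1) Tv by auto
    then show ?thesis using E(2) by simp
  qed
  obtain v where v: "v \<in> carrier M" "v \<noteq> \<zero>\<^bsub>M\<^esub>"
    using dim3[of "\<zero>\<^bsub>M\<^esub>" "\<zero>\<^bsub>M\<^esub>"] subsp_zero[OF subsp_sp2[of "\<zero>\<^bsub>M\<^esub>" "\<zero>\<^bsub>M\<^esub>"]] M.zero_closed by metis
  obtain x y where xy: "x \<in> carrier R" "y \<in> carrier R" "T v = x \<odot>\<^bsub>M\<^esub> v \<oplus>\<^bsub>M\<^esub> y \<odot>\<^bsub>M\<^esub> g v"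
    using T_S[OF v(1)] unfolding S_def by (rule sp2E)
  have "T w = x \<odot>\<^bsub>M\<^esub> w \<oplus>\<^bsub>M\<^esub> y \<odot>\<^bsub>M\<^esub> g w" if w: "w \<in> carrier M" for w
  proof (cases "w \<in> S v")
    case False then show ?thesis using step[OF v w] xy by blast
  next
    case True
    show ?thesis
    proof (cases "w = \<zero>\<^bsub>M\<^esub>")
      case True
      have "T \<zero>\<^bsub>M\<^esub> \<in> carrier M" using subsp_carrier[OF subsp_S T_S] by simp
      then have "T \<zero>\<^bsub>M\<^esub> = \<zero>\<^bsub>M\<^esub>"
        using T_add[of "\<zero>\<^bsub>M\<^esub>" "\<zero>\<^bsub>M\<^esub>"] by (metis M.add.l_cancel_one M.l_zero M.zero_closed)
      then show ?thesis using True xy g_zero by simp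
    next
      case False
      \<comment> \<open>A vector \<open>w\<close> of \<open>S v\<close> itself is reached in two
        steps through a vector \<open>u\<close> outside \<open>S v\<close>.\<close>
      obtain u where u: "u \<in> carrier M" "u \<notin> S v" using dim3[OF v(1) g_closed[OF v(1)]] unfolding S_def by blast
      have u0: "u \<noteq> \<zero>\<^bsub>M\<^esub>" using u subsp_zero[OF subsp_S[OF v(1)]] by metis
      have "w \<notin> S u"
      proof
        assume "w \<in> S u"
        then have "S u = S v" using S_eq[OF u(1) _ False] S_eq[OF v(1) True False] by simp
        then show False using S_self(1)[OF u(1)] u(2) by simp
      qed
      then show ?thesis using step[OF u(1) u0 w _ xy(1,2) step[OF v u xy]] by blast
    qed
  qed
  then show ?thesis using that xy by blast
qed

end

text \<open>
  As \<open>R\<close> is commutative, comparing \<open>g\<^sup>2\<close> on \<open>v\<close> and \<open>c v\<close> shows that \<open>\<sigma>\<close> is trivial or an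
  involution, and that \<open>a\<close> is zero in the latter case.
\<close>

locale quadratic_rep = spread_rep R M g
  for R :: "('k, 'm) ring_scheme" (structure) and M :: "('k, 'v, 'n) module_scheme" (structure) and g +
  fixes \<sigma> :: "'k \<Rightarrow> 'k" and a b :: 'k
  assumes sg_closed [simp]: "\<And>c. c \<in> carrier R \<Longrightarrow> \<sigma> c \<in> carrier R"
    and g_smult: "\<And>c v. c \<in> carrier R \<Longrightarrow> v \<in> carrier M \<Longrightarrow> g (c \<odot>\<^bsub>M\<^esub> v) = \<sigma> c \<odot>\<^bsub>M\<^esub> g v"
    and ab [simp]: "a \<in> carrier R" "b \<in> carrier R"
    and g_sq: "\<And>v. v \<in> carrier M \<Longrightarrow> g (g v) = b \<odot>\<^bsub>M\<^esub> v \<oplus>\<^bsub>M\<^esub> a \<odot>\<^bsub>M\<^esub> g v"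

text \<open>\<open>constant_coefs\<close> is applied to \<open>v \<mapsto> g (c v)\<close>, where
  \<open>g_sp1\<close> removes the coefficient of \<open>v\<close> and leaves
  \<open>\<sigma> c\<close>, and to \<open>v \<mapsto> g (g v)\<close>, which yields
  \<open>b\<close> and \<open>a\<close>.\<close>

lemma (in spread_rep) quadratic:
  obtains \<sigma> a b where "quadratic_rep R M g \<sigma> a b"
proof -
  have "\<exists>s \<in> carrier R. \<forall>v \<in> carrier M. g (c \<odot>\<^bsub>M\<^esub> v) = s \<odot>\<^bsub>M\<^esub> g v" if c: "c \<in> carrier R" for c
  proof -
    have "g (c \<odot>\<^bsub>M\<^esub> v) \<in> S v" if "v \<in> carrier M" for v
      using S_g[OF that] subsp_smult[OF subsp_S[OF that] c S_self(1)[OF that]] by blast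
    moreover have "g (c \<odot>\<^bsub>M\<^esub> (v \<oplus>\<^bsub>M\<^esub> w)) = g (c \<odot>\<^bsub>M\<^esub> v) \<oplus>\<^bsub>M\<^esub> g (c \<odot>\<^bsub>M\<^esub> w)"
      if "v \<in> carrier M" "w \<in> carrier M" for v w using that c by (simp add: smult_r_distr g_add)
    ultimately obtain x y where xy: "x \<in> carrier R" "y \<in> carrier R"
      "\<And>v. v \<in> carrier M \<Longrightarrow> g (c \<odot>\<^bsub>M\<^esub> v) = x \<odot>\<^bsub>M\<^esub> v \<oplus>\<^bsub>M\<^esub> y \<odot>\<^bsub>M\<^esub> g v"
      using constant_coefs[of "\<lambda>v. g (c \<odot>\<^bsub>M\<^esub> v)"] by blast
    obtain v where v: "v \<in> carrier M" "v \<noteq> \<zero>\<^bsub>M\<^esub>"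
      using dim3[of "\<zero>\<^bsub>M\<^esub>" "\<zero>\<^bsub>M\<^esub>"] subsp_zero[OF subsp_sp2[of "\<zero>\<^bsub>M\<^esub>" "\<zero>\<^bsub>M\<^esub>"]] M.zero_closed by metis
    obtain s where s: "s \<in> carrier R" "g (c \<odot>\<^bsub>M\<^esub> v) = s \<odot>\<^bsub>M\<^esub> g v" using g_sp1[OF v(1) c] by (rule sp1E)
    have "\<zero> \<odot>\<^bsub>M\<^esub> v \<oplus>\<^bsub>M\<^esub> s \<odot>\<^bsub>M\<^esub> g v = g (c \<odot>\<^bsub>M\<^esub> v)"
      using s v g_closed[OF v(1)] by simp
    note trans[OF xy(3)[OF v(1), symmetric] this[symmetric]]
    then have "x = \<zero>" using S_coefs[OF v xy(1,2) R.zero_closed s(1)] by blast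
    then show ?thesis using xy g_closed by (intro bexI[of _ y]) auto
  qed
  then obtain \<sigma> where \<sigma>: "\<And>c. c \<in> carrier R \<Longrightarrow> \<sigma> c \<in> carrier R \<and> (\<forall>v \<in> carrier M. g (c \<odot>\<^bsub>M\<^esub> v) = \<sigma> c \<odot>\<^bsub>M\<^esub> g v)"
    by metis
  have "g (g (v \<oplus>\<^bsub>M\<^esub> w)) = g (g v) \<oplus>\<^bsub>M\<^esub> g (g w)" if "v \<in> carrier M" "w \<in> carrier M" for v w
    using that g_add g_closed by simp
  moreover have "g (g v) \<in> S v" if "v \<in> carrier M" for v using g_line[OF that] unfolding S_def .
  ultimately obtain b a where "b \<in> carrier R" "a \<in> carrier R"
    "\<And>v. v \<in> carrier M \<Longrightarrow> g (g v) = b \<odot>\<^bsub>M\<^esub> v \<oplus>\<^bsub>M\<^esub> a \<odot>\<^bsub>M\<^esub> g v"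
    using constant_coefs[of "\<lambda>v. g (g v)"] by blast
  then have "quadratic_rep R M g \<sigma> a b" by unfold_locales (use \<sigma> in auto)
  then show ?thesis by (rule that)
qed

section \<open>The division ring of operators\<close>

context quadratic_rep
begin

lemma vec: obtains v where "v \<in> carrier M" "v \<noteq> \<zero>\<^bsub>M\<^esub>"
  using dim3[of "\<zero>\<^bsub>M\<^esub>" "\<zero>\<^bsub>M\<^esub>"] subsp_zero[OF subsp_sp2[of "\<zero>\<^bsub>M\<^esub>" "\<zero>\<^bsub>M\<^esub>"]] M.zero_closed by metis

lemma smult_inj: "v \<in> carrier M \<Longrightarrow> v \<noteq> \<zero>\<^bsub>M\<^esub> \<Longrightarrow> x \<in> carrier R \<Longrightarrow> y \<in> carrier R \<Longrightarrow> x \<odot>\<^bsub>M\<^esub> v = y \<odot>\<^bsub>M\<^esub> v \<Longrightarrow> x = y"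
  using S_coefs(1)[of v x "\<zero>" y "\<zero>"] by simp

lemma sg:
  shows sg_add: "c \<in> carrier R \<Longrightarrow> d \<in> carrier R \<Longrightarrow> \<sigma> (c \<oplus> d) = \<sigma> c \<oplus> \<sigma> d"
    and sg_mult: "c \<in> carrier R \<Longrightarrow> d \<in> carrier R \<Longrightarrow> \<sigma> (c \<otimes> d) = \<sigma> c \<otimes> \<sigma> d"
    and sg_one: "\<sigma> \<one> = \<one>"
proof -
  obtain v where v: "v \<in> carrier M" "v \<noteq> \<zero>\<^bsub>M\<^esub>" by (rule vec)
  note gv = g_closed[OF v(1)] g_nonzero[OF v]
  note inj = smult_inj[OF gv]
  show "\<sigma> (c \<oplus> d) = \<sigma> c \<oplus> \<sigma> d" if c: "c \<in> carrier R" "d \<in> carrier R"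
  proof (rule inj)
    have "\<sigma> (c \<oplus> d) \<odot>\<^bsub>M\<^esub> g v = g (c \<odot>\<^bsub>M\<^esub> v \<oplus>\<^bsub>M\<^esub> d \<odot>\<^bsub>M\<^esub> v)"
      using g_smult[of "c \<oplus> d" v] c v by (simp add: smult_l_distr)
    then show "\<sigma> (c \<oplus> d) \<odot>\<^bsub>M\<^esub> g v = (\<sigma> c \<oplus> \<sigma> d) \<odot>\<^bsub>M\<^esub> g v"
      using c v gv by (simp add: g_add g_smult smult_l_distr)
  qed (use c in auto)
  show "\<sigma> (c \<otimes> d) = \<sigma> c \<otimes> \<sigma> d" if c: "c \<in> carrier R" "d \<in> carrier R"
  proof (rule inj)
    have "\<sigma> (c \<otimes> d) \<odot>\<^bsub>M\<^esub> g v = g (c \<odot>\<^bsub>M\<^esub> (d \<odot>\<^bsub>M\<^esub> v))"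
      using g_smult[of "c \<otimes> d" v] c v by (simp add: smult_assoc)
    then show "\<sigma> (c \<otimes> d) \<odot>\<^bsub>M\<^esub> g v = (\<sigma> c \<otimes> \<sigma> d) \<odot>\<^bsub>M\<^esub> g v"
      using c v gv by (simp add: g_smult smult_assoc)
  qed (use c in auto)
  show "\<sigma> \<one> = \<one>"
    by (rule inj) (use g_smult[of "\<one>" v] v gv in auto)
qed

lemma sg_zero: "\<sigma> \<zero> = \<zero>"
  using sg_add[of "\<zero>" "\<zero>"] sg_closed[of "\<zero>"] by (metis R.add.l_cancel_one R.l_zero R.zero_closed)

lemma sg_minus: "c \<in> carrier R \<Longrightarrow> \<sigma> (\<ominus> c) = \<ominus> \<sigma> c"
  using sg_add[of "\<ominus> c" c] sg_zero by (simp add: R.minus_equality R.l_neg)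

text \<open>Otherwise \<open>g (g v)\<close> would be a multiple of \<open>g v\<close>, a point not
  moved by \<open>g\<close>.\<close>

lemma b_nonzero: "b \<noteq> \<zero>"
proof
  assume "b = \<zero>"
  obtain v where v: "v \<in> carrier M" "v \<noteq> \<zero>\<^bsub>M\<^esub>" by (rule vec)
  have "g (g v) = a \<odot>\<^bsub>M\<^esub> g v" using g_sq[OF v(1)] \<open>b = \<zero>\<close> v g_closed[OF v(1)] by simp
  then show False using g_indep[OF g_closed[OF v(1)] g_nonzero[OF v]] sp1I[OF ab(1)] by simp
qed

lemma m_rcancel: "x \<in> carrier R \<Longrightarrow> y \<in> carrier R \<Longrightarrow> z \<in> carrier R \<Longrightarrow> z \<noteq> \<zero> \<Longrightarrow> x \<otimes> z = y \<otimes> z \<Longrightarrow> x = y"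
  using F.m_rcancel by blast

lemma sg_sg:
  assumes c: "c \<in> carrier R" shows "\<sigma> (\<sigma> c) = c" and "a \<noteq> \<zero> \<Longrightarrow> \<sigma> c = c"
proof -
  obtain v where v: "v \<in> carrier M" "v \<noteq> \<zero>\<^bsub>M\<^esub>" by (rule vec)
  note gv = g_closed[OF v(1)]
  have "(\<sigma> (\<sigma> c) \<otimes> b) \<odot>\<^bsub>M\<^esub> v \<oplus>\<^bsub>M\<^esub> (\<sigma> (\<sigma> c) \<otimes> a) \<odot>\<^bsub>M\<^esub> g v = g (g (c \<odot>\<^bsub>M\<^esub> v))"
    using c v gv by (simp add: g_smult g_sq smult_r_distr smult_assoc)
  also have "\<dots> = (b \<otimes> c) \<odot>\<^bsub>M\<^esub> v \<oplus>\<^bsub>M\<^esub> (a \<otimes> \<sigma> c) \<odot>\<^bsub>M\<^esub> g v"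
    using g_sq[of "c \<odot>\<^bsub>M\<^esub> v"] c v gv by (simp add: g_smult smult_assoc)
  finally have "\<sigma> (\<sigma> c) \<otimes> b = b \<otimes> c" "\<sigma> (\<sigma> c) \<otimes> a = a \<otimes> \<sigma> c"
    using S_coefs[OF v, of "\<sigma> (\<sigma> c) \<otimes> b" "\<sigma> (\<sigma> c) \<otimes> a" "b \<otimes> c" "a \<otimes> \<sigma> c"] c by auto
  then have e: "\<sigma> (\<sigma> c) \<otimes> b = c \<otimes> b" "\<sigma> (\<sigma> c) \<otimes> a = \<sigma> c \<otimes> a"
    using F.m_comm c by (metis ab(2), metis ab(1) sg_closed)
  show 1: "\<sigma> (\<sigma> c) = c" using m_rcancel[OF _ c ab(2) b_nonzero e(1)] c by simp
  show "\<sigma> c = c" if "a \<noteq> \<zero>" using m_rcancel[OF _ _ ab(1) that e(2)] c 1 by simp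
qed

text \<open>The vector \<open>g (g (g v))\<close> is computed once by applying \<open>g\<close> to
  the quadratic relation at \<open>v\<close> and once from the relation at
  \<open>g v\<close>.\<close>

lemma sg_ab: "\<sigma> a = a" "\<sigma> b = b"
proof -
  obtain v where v: "v \<in> carrier M" "v \<noteq> \<zero>\<^bsub>M\<^esub>" by (rule vec)
  note gv = g_closed[OF v(1)]
  have l: "g (g (g v)) = (\<sigma> a \<otimes> b) \<odot>\<^bsub>M\<^esub> v \<oplus>\<^bsub>M\<^esub> (\<sigma> b \<oplus> \<sigma> a \<otimes> a) \<odot>\<^bsub>M\<^esub> g v"
  proof -
    have "g (g (g v)) = \<sigma> b \<odot>\<^bsub>M\<^esub> g v \<oplus>\<^bsub>M\<^esub> \<sigma> a \<odot>\<^bsub>M\<^esub> g (g v)" using v gv by (simp add: g_sq g_add g_smult)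
    then show ?thesis
      using v gv by (simp add: g_sq smult_r_distr smult_l_distr smult_assoc M.a_ac)
  qed
  have "g (g (g v)) = b \<odot>\<^bsub>M\<^esub> g v \<oplus>\<^bsub>M\<^esub> a \<odot>\<^bsub>M\<^esub> g (g v)" using g_sq[OF gv] .
  then have r: "g (g (g v)) = (a \<otimes> b) \<odot>\<^bsub>M\<^esub> v \<oplus>\<^bsub>M\<^esub> (b \<oplus> a \<otimes> a) \<odot>\<^bsub>M\<^esub> g v"
    using v gv by (simp add: g_sq smult_r_distr smult_l_distr smult_assoc M.a_ac)
  have e: "\<sigma> a \<otimes> b = a \<otimes> b" "\<sigma> b \<oplus> \<sigma> a \<otimes> a = b \<oplus> a \<otimes> a"
    using S_coefs[OF v, of "\<sigma> a \<otimes> b" "\<sigma> b \<oplus> \<sigma> a \<otimes> a" "a \<otimes> b" "b \<oplus> a \<otimes> a"] l r by auto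
  show sa: "\<sigma> a = a" using m_rcancel[OF _ ab(1,2) b_nonzero e(1)] by simp
  show "\<sigma> b = b" using e(2) unfolding sa by simp
qed

text \<open>\<open>(x, y)\<close> stands for the operator \<open>x + y g\<close>. The product is
  composition, worked out with \<open>g z = \<sigma> z g\<close> and
  \<open>g g = b + a g\<close>.\<close>

definition L :: "('k \<times> 'k) ring" where
  "L = \<lparr>carrier = carrier R \<times> carrier R,
     mult = (\<lambda>(x, y) (z, w). (x \<otimes> z \<oplus> y \<otimes> (\<sigma> w \<otimes> b),
       x \<otimes> w \<oplus> (y \<otimes> \<sigma> z \<oplus> y \<otimes> (\<sigma> w \<otimes> a)))),
     one = (\<one>, \<zero>), zero = (\<zero>, \<zero>),
     add = (\<lambda>(x, y) (z, w). (x \<oplus> z, y \<oplus> w))\<rparr>"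

lemma L_simps:
  "carrier L = carrier R \<times> carrier R" "\<one>\<^bsub>L\<^esub> = (\<one>, \<zero>)" "\<zero>\<^bsub>L\<^esub> = (\<zero>, \<zero>)"
  "(x, y) \<oplus>\<^bsub>L\<^esub> (z, w) = (x \<oplus> z, y \<oplus> w)"
  "(x, y) \<otimes>\<^bsub>L\<^esub> (z, w) = (x \<otimes> z \<oplus> y \<otimes> (\<sigma> w \<otimes> b),
     x \<otimes> w \<oplus> (y \<otimes> \<sigma> z \<oplus> y \<otimes> (\<sigma> w \<otimes> a)))"
  unfolding L_def by simp_all

definition act :: "'k \<times> 'k \<Rightarrow> 'v \<Rightarrow> 'v" where
  "act l v = fst l \<odot>\<^bsub>M\<^esub> v \<oplus>\<^bsub>M\<^esub> snd l \<odot>\<^bsub>M\<^esub> g v"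

lemma act_pair: "act (x, y) v = x \<odot>\<^bsub>M\<^esub> v \<oplus>\<^bsub>M\<^esub> y \<odot>\<^bsub>M\<^esub> g v"
  unfolding act_def by simp

lemma act_closed: "l \<in> carrier L \<Longrightarrow> v \<in> carrier M \<Longrightarrow> act l v \<in> carrier M"
  unfolding act_def L_simps using g_closed by auto

text \<open>An operator is determined by its value at one nonzero vector, which reduces identities
  between pairs to identities between vectors.\<close>

lemma act_inj: "l \<in> carrier L \<Longrightarrow> k \<in> carrier L \<Longrightarrow> v \<in> carrier M \<Longrightarrow> v \<noteq> \<zero>\<^bsub>M\<^esub> \<Longrightarrow> act l v = act k v \<Longrightarrow> l = k"
  unfolding act_def L_simps using S_coefs[of v "fst l" "snd l" "fst k" "snd k"] by (auto simp: prod_eq_iff)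

lemma L_add_closed: "l \<in> carrier L \<Longrightarrow> k \<in> carrier L \<Longrightarrow> l \<oplus>\<^bsub>L\<^esub> k \<in> carrier L"
  by (cases l; cases k) (auto simp: L_simps)

lemma L_mult_closed: "l \<in> carrier L \<Longrightarrow> k \<in> carrier L \<Longrightarrow> l \<otimes>\<^bsub>L\<^esub> k \<in> carrier L"
  by (cases l; cases k) (auto simp: L_simps)

lemma act_add: "l \<in> carrier L \<Longrightarrow> k \<in> carrier L \<Longrightarrow> v \<in> carrier M \<Longrightarrow> act (l \<oplus>\<^bsub>L\<^esub> k) v = act l v \<oplus>\<^bsub>M\<^esub> act k v"
  using g_closed[of v] by (cases l; cases k) (simp add: L_simps act_pair smult_l_distr M.a_ac)

lemma act_vadd: "l \<in> carrier L \<Longrightarrow> v \<in> carrier M \<Longrightarrow> w \<in> carrier M \<Longrightarrow> act l (v \<oplus>\<^bsub>M\<^esub> w) = act l v \<oplus>\<^bsub>M\<^esub> act l w"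
  using g_closed[of v] g_closed[of w] by (cases l) (simp add: L_simps act_pair smult_r_distr g_add M.a_ac)

lemma act_mult:
  assumes l: "l \<in> carrier L" "k \<in> carrier L" and v: "v \<in> carrier M"
  shows "act (l \<otimes>\<^bsub>L\<^esub> k) v = act l (act k v)"
proof -
  obtain x y z w where e: "l = (x, y)" "k = (z, w)" by (cases l; cases k)
  then have c: "x \<in> carrier R" "y \<in> carrier R" "z \<in> carrier R" "w \<in> carrier R" using l by (auto simp: L_simps)
  note gv = g_closed[OF v]
  have "g (act k v) = \<sigma> z \<odot>\<^bsub>M\<^esub> g v \<oplus>\<^bsub>M\<^esub> \<sigma> w \<odot>\<^bsub>M\<^esub> (b \<odot>\<^bsub>M\<^esub> v \<oplus>\<^bsub>M\<^esub> a \<odot>\<^bsub>M\<^esub> g v)"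
    unfolding e act_pair using c v gv by (simp add: g_add g_smult g_sq)
  then have "act l (act k v) = x \<odot>\<^bsub>M\<^esub> (z \<odot>\<^bsub>M\<^esub> v \<oplus>\<^bsub>M\<^esub> w \<odot>\<^bsub>M\<^esub> g v) \<oplus>\<^bsub>M\<^esub>
     y \<odot>\<^bsub>M\<^esub> (\<sigma> z \<odot>\<^bsub>M\<^esub> g v \<oplus>\<^bsub>M\<^esub> \<sigma> w \<odot>\<^bsub>M\<^esub> (b \<odot>\<^bsub>M\<^esub> v \<oplus>\<^bsub>M\<^esub> a \<odot>\<^bsub>M\<^esub> g v))"
    unfolding e act_pair by simp
  then show ?thesis
    unfolding e L_simps act_pair using c v gv
    by (simp add: smult_r_distr smult_l_distr smult_assoc M.a_ac)
qed

lemma L_zero_closed: "\<zero>\<^bsub>L\<^esub> \<in> carrier L" and L_one_closed: "\<one>\<^bsub>L\<^esub> \<in> carrier L"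
  by (auto simp: L_simps)

lemma act_one: "v \<in> carrier M \<Longrightarrow> act \<one>\<^bsub>L\<^esub> v = v" and act_zero: "v \<in> carrier M \<Longrightarrow> act \<zero>\<^bsub>L\<^esub> v = \<zero>\<^bsub>M\<^esub>"
  using g_closed[of v] by (simp_all add: L_simps act_pair)

text \<open>The ring laws hold for composition of additive operators. \<open>act_inj\<close> carries
  them over to pairs without expanding the product formula.\<close>

lemma L_ring: "ring L"
proof -
  obtain v where v: "v \<in> carrier M" "v \<noteq> \<zero>\<^bsub>M\<^esub>" by (rule vec)
  note inj = act_inj[OF _ _ v]
  note cl = L_add_closed L_mult_closed L_zero_closed L_one_closed act_closed v(1)
  have "abelian_group L"
  proof (rule abelian_groupI)
    fix l assume l: "l \<in> carrier L"
    show "\<exists>k \<in> carrier L. k \<oplus>\<^bsub>L\<^esub> l = \<zero>\<^bsub>L\<^esub>"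
      using l by (intro bexI[of _ "(\<ominus> fst l, \<ominus> snd l)"]) (auto simp: L_simps R.l_neg)
  qed (auto simp: L_simps R.a_ac)
  moreover have "monoid L"
  proof (rule monoidI)
    show "(l \<otimes>\<^bsub>L\<^esub> k) \<otimes>\<^bsub>L\<^esub> m = l \<otimes>\<^bsub>L\<^esub> (k \<otimes>\<^bsub>L\<^esub> m)" if "l \<in> carrier L" "k \<in> carrier L" "m \<in> carrier L" for l k m
      by (rule inj) (use that cl in \<open>simp_all add: act_mult\<close>)
    show "\<one>\<^bsub>L\<^esub> \<otimes>\<^bsub>L\<^esub> l = l" if "l \<in> carrier L" for l
      by (rule inj) (use that cl in \<open>simp_all add: act_mult act_one\<close>)
    show "l \<otimes>\<^bsub>L\<^esub> \<one>\<^bsub>L\<^esub> = l" if "l \<in> carrier L" for l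
      by (rule inj) (use that cl in \<open>simp_all add: act_mult act_one\<close>)
  qed (use cl in auto)
  ultimately show ?thesis
  proof (rule ringI)
    show "(l \<oplus>\<^bsub>L\<^esub> k) \<otimes>\<^bsub>L\<^esub> m = l \<otimes>\<^bsub>L\<^esub> m \<oplus>\<^bsub>L\<^esub> k \<otimes>\<^bsub>L\<^esub> m" if "l \<in> carrier L" "k \<in> carrier L" "m \<in> carrier L" for l k m
      by (rule inj) (use that cl in \<open>simp_all add: act_mult act_add\<close>)
    show "m \<otimes>\<^bsub>L\<^esub> (l \<oplus>\<^bsub>L\<^esub> k) = m \<otimes>\<^bsub>L\<^esub> l \<oplus>\<^bsub>L\<^esub> m \<otimes>\<^bsub>L\<^esub> k" if "l \<in> carrier L" "k \<in> carrier L" "m \<in> carrier L" for l k m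
      by (rule inj) (use that cl in \<open>simp_all add: act_mult act_add act_vadd\<close>)
  qed
qed

sublocale L: ring L by (rule L_ring)

lemma act_eq_zero:
  assumes l: "l \<in> carrier L" and v: "v \<in> carrier M" and z: "act l v = \<zero>\<^bsub>M\<^esub>" shows "l = \<zero>\<^bsub>L\<^esub> \<or> v = \<zero>\<^bsub>M\<^esub>"
  using act_inj[OF l L_zero_closed v] act_zero[OF v] z by auto

text \<open>A nonzero operator has trivial kernel, and hence so has a product of two.\<close>

lemma L_zero_divisor: "l \<in> carrier L \<Longrightarrow> k \<in> carrier L \<Longrightarrow> l \<otimes>\<^bsub>L\<^esub> k = \<zero>\<^bsub>L\<^esub> \<Longrightarrow> l = \<zero>\<^bsub>L\<^esub> \<or> k = \<zero>\<^bsub>L\<^esub>"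
proof -
  assume l: "l \<in> carrier L" "k \<in> carrier L" "l \<otimes>\<^bsub>L\<^esub> k = \<zero>\<^bsub>L\<^esub>"
  obtain v where v: "v \<in> carrier M" "v \<noteq> \<zero>\<^bsub>M\<^esub>" by (rule vec)
  have "act l (act k v) = \<zero>\<^bsub>M\<^esub>" using act_mult[OF l(1,2) v(1)] l(3) act_zero[OF v(1)] by simp
  then show ?thesis using act_eq_zero[OF l(1) act_closed[OF l(2) v(1)]] act_eq_zero[OF l(2) v(1)] v(2) by blast
qed

text \<open>The second factor is the conjugate of \<open>x + y g\<close>.\<close>

lemma L_norm:
  assumes xy: "x \<in> carrier R" "y \<in> carrier R"
  shows "\<exists>N \<in> carrier R. (x, y) \<otimes>\<^bsub>L\<^esub> (\<sigma> x \<oplus> a \<otimes> y, \<ominus> y) = (N, \<zero>)"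
proof -
  have e: "\<sigma> (\<sigma> x \<oplus> a \<otimes> y) = x \<oplus> a \<otimes> \<sigma> y" using xy by (simp add: sg_add sg_mult sg_sg sg_ab)
  have "x \<otimes> (\<ominus> y) \<oplus> (y \<otimes> (x \<oplus> a \<otimes> \<sigma> y) \<oplus> y \<otimes> (\<sigma> (\<ominus> y) \<otimes> a)) =
    (y \<otimes> x \<oplus> \<ominus> (y \<otimes> x)) \<oplus> (y \<otimes> (a \<otimes> \<sigma> y) \<oplus> \<ominus> (y \<otimes> (a \<otimes> \<sigma> y)))"
    using xy by (simp add: sg_minus R.r_distr R.r_minus R.l_minus F.m_comm[of x y] F.m_comm[of "\<sigma> y" a] R.a_ac)
  also have "\<dots> = \<zero>" using xy by (simp add: R.r_neg)
  finally show ?thesis using xy unfolding L_simps e by auto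
qed

text \<open>The product of \<open>l\<close> with its conjugate \<open>k\<close> is a scalar
  \<open>N\<close>, nonzero for lack of zero divisors; dividing \<open>k\<close> by \<open>N\<close>
  gives the inverse.\<close>

lemma L_right_inverse:
  assumes l: "l \<in> carrier L" "l \<noteq> \<zero>\<^bsub>L\<^esub>" shows "\<exists>k \<in> carrier L. l \<otimes>\<^bsub>L\<^esub> k = \<one>\<^bsub>L\<^esub>"
proof -
  obtain x y where e: "l = (x, y)" "x \<in> carrier R" "y \<in> carrier R" using l by (auto simp: L_simps)
  define k where "k = (\<sigma> x \<oplus> a \<otimes> y, \<ominus> y)"
  have k: "k \<in> carrier L" using e unfolding k_def by (simp add: L_simps)
  obtain N where N: "N \<in> carrier R" "l \<otimes>\<^bsub>L\<^esub> k = (N, \<zero>)" using L_norm[OF e(2,3)] unfolding e(1) k_def by blast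
  have "N \<noteq> \<zero>"
  proof
    assume "N = \<zero>"
    then have "k = \<zero>\<^bsub>L\<^esub>" using L_zero_divisor[OF l(1) k] l(2) N by (simp add: L_simps)
    then have "\<ominus> y = \<zero>" "\<sigma> x \<oplus> a \<otimes> y = \<zero>" unfolding k_def L_simps by auto
    then have y: "y = \<zero>" using e R.minus_minus[of y] by simp
    then have "\<sigma> x = \<zero>" using \<open>\<sigma> x \<oplus> a \<otimes> y = \<zero>\<close> e by simp
    then have "x = \<zero>" using sg_sg(1)[OF e(2)] sg_zero by simp
    then show False using y e(1) l(2) by (simp add: L_simps)
  qed
  then have i: "inv N \<in> carrier R" "N \<otimes> inv N = \<one>" using N r_inv inv_closed by auto
  have "l \<otimes>\<^bsub>L\<^esub> (k \<otimes>\<^bsub>L\<^esub> (inv N, \<zero>)) = (l \<otimes>\<^bsub>L\<^esub> k) \<otimes>\<^bsub>L\<^esub> (inv N, \<zero>)"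
    using L.m_assoc[OF l(1) k] i by (simp add: L_simps)
  also have "\<dots> = \<one>\<^bsub>L\<^esub>" using N i by (simp add: L_simps sg_zero)
  finally show ?thesis using L.m_closed[OF k] i by (intro bexI[of _ "k \<otimes>\<^bsub>L\<^esub> (inv N, \<zero>)"]) (auto simp: L_simps)
qed

lemma L_division: "division_ring L"
proof -
  have one: "\<one>\<^bsub>L\<^esub> \<noteq> \<zero>\<^bsub>L\<^esub>" by (simp add: L_simps)
  have "Units L = carrier L - {\<zero>\<^bsub>L\<^esub>}"
  proof (intro subset_antisym subsetI)
    fix l assume l: "l \<in> Units L"
    have "l \<noteq> \<zero>\<^bsub>L\<^esub>"
    proof
      assume "l = \<zero>\<^bsub>L\<^esub>"
      then show False using L.Units_r_inv[OF l] L.l_null[OF L.Units_inv_closed[OF l]] one by simp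
    qed
    then show "l \<in> carrier L - {\<zero>\<^bsub>L\<^esub>}" using L.Units_closed[OF l] by simp
  next
    fix l assume "l \<in> carrier L - {\<zero>\<^bsub>L\<^esub>}"
    then have l: "l \<in> carrier L" "l \<noteq> \<zero>\<^bsub>L\<^esub>" by auto
    obtain k where k: "k \<in> carrier L" "l \<otimes>\<^bsub>L\<^esub> k = \<one>\<^bsub>L\<^esub>" using L_right_inverse[OF l] by blast
    have "k \<noteq> \<zero>\<^bsub>L\<^esub>" using k(2) L.r_null[OF l(1)] one by auto
    then obtain m where m: "m \<in> carrier L" "k \<otimes>\<^bsub>L\<^esub> m = \<one>\<^bsub>L\<^esub>" using L_right_inverse[OF k(1)] by blast
    have "l = l \<otimes>\<^bsub>L\<^esub> (k \<otimes>\<^bsub>L\<^esub> m)" using m(2) l by simp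
    also have "\<dots> = m" using L.m_assoc[OF l(1) k(1) m(1)] k(2) m(1) by simp
    finally show "l \<in> Units L" unfolding Units_def using l k m by auto
  qed
  then show ?thesis unfolding division_ring_def using one L_ring by simp
qed

section \<open>Dimensions over the ground field and over the centre\<close>

definition h :: "'k \<Rightarrow> 'k \<times> 'k" where "h c = (c, \<zero>)"

lemma h_carrier: "h ` carrier R = carrier R \<times> {\<zero>}"
  unfolding h_def by auto

lemma h_hom: "h \<in> ring_hom R L"
  unfolding ring_hom_def h_def by (auto simp: L_simps sg_zero)

lemma h_subfield: "subfield (h ` carrier R) L"
proof -
  interpret H: ring_hom_ring R L h by (rule ring_hom_ringI2[OF R.ring_axioms L_ring h_hom])
  show ?thesis using H.img_is_subfield(2)[OF F.carrier_is_subfield] by (simp add: L_simps)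
qed

lemma line_ext: "u \<in> L.line_extension Z l E \<longleftrightarrow> (\<exists>k \<in> Z. \<exists>e \<in> E. u = k \<otimes>\<^bsub>L\<^esub> l \<oplus>\<^bsub>L\<^esub> e)"
  by (rule L.line_extension_mem_iff)

text \<open>The basis consists of the identity \<open>(\<one>, \<zero>)\<close> and of
  \<open>g\<close>, which is \<open>(\<zero>, \<one>)\<close>.\<close>

lemma L_dimension: "L.dimension 2 (h ` carrier R) (carrier L)"
proof -
  let ?Z = "h ` carrier R"
  have 1: "L.line_extension ?Z (\<one>, \<zero>) {\<zero>\<^bsub>L\<^esub>} = carrier R \<times> {\<zero>}"
    by (rule Set.set_eqI) (auto simp: line_ext h_def L_simps sg_zero sg_one)
  have 2: "L.line_extension ?Z (\<zero>, \<one>) (carrier R \<times> {\<zero>}) = carrier L"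
    by (rule Set.set_eqI) (auto simp: line_ext h_def L_simps sg_zero sg_one)
  have "L.dimension (Suc 0) ?Z (carrier R \<times> {\<zero>})"
    unfolding 1[symmetric] by (rule L.Suc_dim[OF _ _ L.zero_dim]) (auto simp: L_simps)
  then have "L.dimension (Suc (Suc 0)) ?Z (carrier L)"
    unfolding 2[symmetric] by (rule L.Suc_dim[rotated 2]) (auto simp: L_simps)
  then show ?thesis by (simp add: numeral_2_eq_2)
qed

text \<open>With \<open>\<sigma>\<close> trivial, \<open>g\<close> commutes with scalars. The
  quadratic polynomial of \<open>g\<close> may be inseparable.\<close>

lemma L_quadratic: "(\<And>c. c \<in> carrier R \<Longrightarrow> \<sigma> c = c) \<Longrightarrow> quadratic_extension R L h"
proof -
  assume s: "\<And>c. c \<in> carrier R \<Longrightarrow> \<sigma> c = c"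
  have "cring L"
  proof unfold_locales
    show "l \<otimes>\<^bsub>L\<^esub> k = k \<otimes>\<^bsub>L\<^esub> l" if "l \<in> carrier L" "k \<in> carrier L" for l k
      using that by (cases l; cases k) (simp add: L_simps s F.m_ac R.a_ac)
  qed
  then have "field L" using cring.cring_fieldI L_division unfolding division_ring_def by blast
  then show ?thesis unfolding quadratic_extension_def using h_hom h_subfield L_dimension by blast
qed

text \<open>\<open>\<sigma>\<close> is an involution with fixed field \<open>F\<close>. The centre
  is \<open>F\<close>, and \<open>1\<close>, \<open>k\<close>, \<open>g\<close>, \<open>k g\<close>
  form a basis over it.\<close>

lemma L_quaternion:
  assumes "k \<in> carrier R" "\<sigma> k \<noteq> k" shows "quaternion_extension R L h"
proof -
  have a0: "a = \<zero>" using sg_sg(2) assms by blast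
  define F where "F = {c \<in> carrier R. \<sigma> c = c}"
  have Z: "ring_center L = h ` F"
  proof (intro subset_antisym subsetI)
    fix l assume l: "l \<in> ring_center L"
    then obtain x y where e: "l = (x, y)" "x \<in> carrier R" "y \<in> carrier R"
      unfolding ring_center_def by (auto simp: L_simps)
    have c: "l \<otimes>\<^bsub>L\<^esub> m = m \<otimes>\<^bsub>L\<^esub> l" if "m \<in> carrier L" for m using l that unfolding ring_center_def by blast
    \<comment> \<open>Commuting with \<open>k\<close> forces \<open>y\<close> to vanish; commuting
      with \<open>g\<close> then makes \<open>x\<close> fixed by \<open>\<sigma>\<close>.\<close>
    have "y \<otimes> \<sigma> k = k \<otimes> y" using c[of "(k, \<zero>)"] e assms by (simp add: L_simps sg_zero)
    then have "\<sigma> k \<otimes> y = k \<otimes> y" using F.m_comm[of y "\<sigma> k"] e assms by simp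
    then have y: "y = \<zero>" using m_rcancel[of "\<sigma> k" k y] e assms by auto
    have "x = \<sigma> x" using c[of "(\<zero>, \<one>)"] e y by (simp add: L_simps sg_zero sg_one)
    then show "l \<in> h ` F" unfolding F_def h_def using e y by auto
  next
    fix l assume "l \<in> h ` F"
    then obtain x where x: "l = (x, \<zero>)" "x \<in> carrier R" "\<sigma> x = x" unfolding F_def h_def by auto
    have "l \<otimes>\<^bsub>L\<^esub> m = m \<otimes>\<^bsub>L\<^esub> l" if "m \<in> carrier L" for m
      using that x by (cases m) (simp add: L_simps sg_zero F.m_comm)
    moreover have "l \<in> carrier L" using x by (simp add: L_simps)
    ultimately show "l \<in> ring_center L" unfolding ring_center_def by blast
  qed
  have split: "\<exists>p \<in> F. \<exists>q \<in> F. x = q \<otimes> k \<oplus> p" if x: "x \<in> carrier R" for x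
  proof -
    let ?d = "k \<ominus> \<sigma> k"
    have d: "?d \<in> carrier R" "?d \<noteq> \<zero>"
      using assms by (simp, metis R.add.inv_solve_right R.l_zero R.minus_eq R.zero_closed sg_closed)
    \<comment> \<open>If \<open>x = q k + p\<close> with \<open>p\<close> and \<open>q\<close> fixed
      by \<open>\<sigma>\<close>, then \<open>x - \<sigma> x = q (k - \<sigma> k)\<close>. This
      determines \<open>q\<close>, also in characteristic 2.\<close>
    define q where "q = (x \<ominus> \<sigma> x) \<otimes> inv ?d"
    have qc: "q \<in> carrier R" unfolding q_def using x d by simp
    have qd: "q \<otimes> ?d = x \<ominus> \<sigma> x" unfolding q_def using x d by (simp add: R.m_assoc l_inv)
    have sd: "\<sigma> (y \<ominus> \<sigma> y) = \<ominus> (y \<ominus> \<sigma> y)" if "y \<in> carrier R" for y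
      using that by (simp add: R.minus_eq sg_add sg_minus sg_sg R.minus_add R.a_comm)
    have "\<sigma> q \<otimes> \<ominus> ?d = \<ominus> (x \<ominus> \<sigma> x)" using arg_cong[OF qd, of \<sigma>] sg_mult[OF qc d(1)] sd assms x by simp
    then have "\<ominus> (\<sigma> q \<otimes> ?d) = \<ominus> (q \<otimes> ?d)" using qc d qd by (simp add: R.r_minus)
    then have "\<sigma> q \<otimes> ?d = q \<otimes> ?d" using R.minus_minus qc d by (metis R.m_closed sg_closed)
    then have sq: "\<sigma> q = q" using m_rcancel[OF _ qc d] qc by simp
    define p where "p = x \<ominus> q \<otimes> k"
    have pc: "p \<in> carrier R" unfolding p_def using x qc assms by simp
    have xp: "x = q \<otimes> k \<oplus> p" unfolding p_def using x qc assms by (simp add: R.minus_eq R.a_lcomm[of _ x] R.r_neg)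
    have "\<sigma> x = q \<otimes> \<sigma> k \<oplus> \<sigma> p"
      using arg_cong[OF xp, of \<sigma>] qc pc assms sq by (simp add: sg_add sg_mult)
    moreover have "\<sigma> x = q \<otimes> \<sigma> k \<oplus> p"
    proof -
      have "x = q \<otimes> ?d \<oplus> \<sigma> x" unfolding qd using x by (simp add: R.minus_eq R.a_assoc R.l_neg)
      then have "q \<otimes> ?d \<oplus> \<sigma> x = q \<otimes> k \<oplus> p" using xp by simp
      moreover have "q \<otimes> k = q \<otimes> ?d \<oplus> q \<otimes> \<sigma> k"
        using qc assms by (simp add: R.minus_eq R.r_distr[symmetric] R.a_assoc R.l_neg)
      ultimately have "q \<otimes> ?d \<oplus> \<sigma> x = q \<otimes> ?d \<oplus> (q \<otimes> \<sigma> k \<oplus> p)"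
        using qc assms pc d by (simp add: R.a_assoc)
      then show ?thesis using x qc assms pc d by simp
    qed
    ultimately have "\<sigma> p = p" using qc pc assms by simp
    then show ?thesis using xp pc qc sq unfolding F_def by blast
  qed
  have F: "\<zero> \<in> F" "\<And>c. c \<in> F \<Longrightarrow> c \<in> carrier R" "k \<notin> F" unfolding F_def using sg_zero assms by auto
  let ?Z = "h ` F"
  have 1: "L.line_extension ?Z (\<one>, \<zero>) {\<zero>\<^bsub>L\<^esub>} = F \<times> {\<zero>}"
    by (rule Set.set_eqI) (use F in \<open>auto simp: line_ext h_def L_simps sg_zero sg_one\<close>)
  have 2: "L.line_extension ?Z (k, \<zero>) (F \<times> {\<zero>}) = carrier R \<times> {\<zero>}"
  proof (rule Set.set_eqI)
    fix u
    show "u \<in> L.line_extension ?Z (k, \<zero>) (F \<times> {\<zero>}) \<longleftrightarrow> u \<in> carrier R \<times> {\<zero>}"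
    proof
      assume "u \<in> L.line_extension ?Z (k, \<zero>) (F \<times> {\<zero>})"
      then show "u \<in> carrier R \<times> {\<zero>}" using F assms by (auto simp: line_ext h_def L_simps sg_zero)
    next
      assume "u \<in> carrier R \<times> {\<zero>}"
      then obtain x where u: "u = (x, \<zero>)" "x \<in> carrier R" by auto
      obtain p q where pq: "p \<in> F" "q \<in> F" "x = q \<otimes> k \<oplus> p" using split[OF u(2)] by blast
      have "u = h q \<otimes>\<^bsub>L\<^esub> (k, \<zero>) \<oplus>\<^bsub>L\<^esub> (p, \<zero>)"
        using u pq F assms by (simp add: h_def L_simps sg_zero)
      then show "u \<in> L.line_extension ?Z (k, \<zero>) (F \<times> {\<zero>})" unfolding line_ext using pq by blast
    qed
  qed
  have 3: "L.line_extension ?Z (\<zero>, \<one>) (carrier R \<times> {\<zero>}) = carrier R \<times> F"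
    by (rule Set.set_eqI) (use F in \<open>auto simp: line_ext h_def L_simps sg_zero sg_one\<close>)
  have 4: "L.line_extension ?Z (\<zero>, k) (carrier R \<times> F) = carrier L"
  proof (rule Set.set_eqI)
    fix u
    show "u \<in> L.line_extension ?Z (\<zero>, k) (carrier R \<times> F) \<longleftrightarrow> u \<in> carrier L"
    proof
      assume "u \<in> L.line_extension ?Z (\<zero>, k) (carrier R \<times> F)"
      then show "u \<in> carrier L" using F assms by (auto simp: line_ext h_def L_simps sg_zero)
    next
      assume "u \<in> carrier L"
      then obtain x y where u: "u = (x, y)" "x \<in> carrier R" "y \<in> carrier R" by (auto simp: L_simps)
      obtain p q where pq: "p \<in> F" "q \<in> F" "y = q \<otimes> k \<oplus> p" using split[OF u(3)] by blast
      have "u = h q \<otimes>\<^bsub>L\<^esub> (\<zero>, k) \<oplus>\<^bsub>L\<^esub> (x, p)"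
        using u pq F assms by (simp add: h_def L_simps sg_zero)
      then show "u \<in> L.line_extension ?Z (\<zero>, k) (carrier R \<times> F)" unfolding line_ext using pq u by blast
    qed
  qed
  have d1: "L.dimension (Suc 0) ?Z (F \<times> {\<zero>})"
    unfolding 1[symmetric] by (rule L.Suc_dim[OF _ _ L.zero_dim]) (auto simp: L_simps)
  have d2: "L.dimension (Suc (Suc 0)) ?Z (carrier R \<times> {\<zero>})"
    unfolding 2[symmetric] by (rule L.Suc_dim[OF _ _ d1]) (use F assms in \<open>auto simp: L_simps\<close>)
  have d3: "L.dimension (Suc (Suc (Suc 0))) ?Z (carrier R \<times> F)"
    unfolding 3[symmetric] by (rule L.Suc_dim[OF _ _ d2]) (auto simp: L_simps)
  have "L.dimension (Suc (Suc (Suc (Suc 0)))) ?Z (carrier L)"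
    unfolding 4[symmetric] by (rule L.Suc_dim[OF _ _ d3]) (use F assms in \<open>auto simp: L_simps\<close>)
  then have d: "L.dimension 4 ?Z (carrier L)" "L.dimension 2 ?Z (h ` carrier R)"
    using d2 by (simp_all add: h_carrier numeral_eq_Suc)
  have "?Z \<subseteq> h ` carrier R" unfolding F_def by auto
  then show ?thesis
    unfolding quaternion_extension_def quaternion_division_algebra_def Z
    using L_division d h_hom h_subfield L_dimension by blast
qed

lemma L_extension: "quadratic_extension R L h \<or> quaternion_extension R L h"
  using L_quadratic L_quaternion by blast

end

section \<open>Projection from a common opposite\<close>

context domestic
begin

text \<open>The intersection has even rank, at least \<open>n - 2\<close> and less than
  \<open>n\<close>, so it is no larger than \<open>Y\<close>.\<close>

lemma max_inter:
  assumes A: "A \<in> Fix" "rk A = n" and B: "B \<in> Fix" "rk B = n" and Y: "Y \<in> Fix" "Y \<subseteq> A" "Y \<subseteq> B" "n = Suc (Suc (rk Y))"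
    and s: "s \<in> B" "s \<notin> A"
  shows "A \<inter> B = Y"
proof -
  have AB: "A \<inter> B \<in> Fix" using Fix_Int A B by blast
  have "rk (A \<inter> B) < rk B" using rk_less[OF FixD(1)[OF AB] FixD(1)[OF B(1)]] s by blast
  then have "rk (A \<inter> B) \<le> rk Y" using Fix_even[OF AB] Fix_even[OF Y(1)] B(2) Y(4) by presburger
  then show ?thesis using rk_eq[OF FixD(1)[OF Y(1)] FixD(1)[OF AB]] Y by blast
qed

lemma max_through:
  assumes Y: "Y \<in> Fix" "n = Suc (Suc (rk Y))" and x: "x \<in> perp Y" "x \<notin> Y"
    and Z: "Z \<in> Fix" "rk Z = n" "Y \<subseteq> Z" "x \<in> Z"
  shows "jn Y x = Z"
  using rk_eq[OF FixD(1)[OF jn(1)[OF Y(1) x]] FixD(1)[OF Z(1)]] jn(2)[OF Y(1) x] jn(5)[OF Y(1) x FixD(1)[OF Z(1)] Z(3)]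
    Fix_L_sub[OF Z(1,4)] Z(2) Y(2) by simp

text \<open>Through a fixed \<open>Y\<close> of rank \<open>n - 2\<close> in \<open>Z\<close> pass
  two more maximal fixed subspaces, one through \<open>q\<close> and one through a third point
  \<open>s\<close> of a line from \<open>p\<close> to \<open>L q\<close>. Both meet
  \<open>X0\<close> in less than \<open>Z\<close> does, and if \<open>Z\<close> misses
  \<open>X\<close> then at least one of them does.\<close>

lemma opposite_step:
  assumes Z: "Z \<in> Fix" "rk Z = n" and X: "X \<in> Fix" "rk X = n" and X0: "X0 \<in> Fix" "rk X0 = n"
    and p: "p \<in> Z" "p \<in> X0"
  obtains Z' where "Z' \<in> Fix" "rk Z' = n" "Z' \<inter> X0 \<subset> Z \<inter> X0" "Z \<inter> X = {} \<Longrightarrow> Z' \<inter> X = {}"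
proof -
  have pP: "p \<in> P" using Fix_P Z p by blast
  obtain q where q: "q \<in> P" "\<not> col p q" using noncol[OF pP] by blast
  have qp: "\<not> col q p" using q(2) col_sym[of p q] by simp
  define Y where "Y = Z \<inter> perp (L q)"
  have Y: "Y \<in> Fix" "n = Suc (Suc (rk Y))" "Y \<subseteq> Z"
    using Fix_perp_L[OF Z(1) q(1)] rk_perp_L[OF Z(1) p(1) q(1) qp] Z(2) unfolding Y_def by auto
  have YP: "Y \<subseteq> P" using FixD(1)[OF Y(1)] Omega_sub by blast
  have Lq: "q \<in> L q" using L_line(2)[OF q(1)] .
  have pY: "p \<notin> Y" using perpD[of p "L q" q] Lq q(2) unfolding Y_def by blast
  have qY: "q \<in> perp Y" using q(1) perpD[of _ "L q" q] Lq unfolding Y_def by (intro perpI) (auto simp: col_sym[of q])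
  have qZ: "q \<notin> Z" using Omega_col[OF FixD(1)[OF Z(1)] p(1)] q(2) by blast
  then have qnY: "q \<notin> Y" using Y(3) by blast
  note J1 = jn[OF Y(1) qY qnY]
  let ?Z1 = "jn Y q"
  have q1: "q \<in> ?Z1" using J1(4) Lq by blast
  have p1: "p \<notin> ?Z1" using Omega_col[OF FixD(1)[OF J1(1)] _ q1] q(2) by blast
  have pYp: "p \<in> perp Y" using Omega_perp_self[OF FixD(1)[OF Z(1)] FixD(1)[OF Y(1)] Y(3)] p(1) by blast
  obtain r where r: "r \<in> L q" "col p r" using meets[OF L_line(1)[OF q(1)] pP] by blast
  have rZ1: "r \<in> ?Z1" using r(1) J1(4) by blast
  have rp: "p \<noteq> r" using p1 rZ1 by blast
  obtain m where m: "m \<in> lines \<Omega>" "p \<in> m" "r \<in> m" using col_line[OF r(2) rp] by blast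
  obtain s where s: "s \<in> m" "s \<noteq> p" "s \<noteq> r" using line_third[OF m(1)] by blast
  have rY: "r \<in> perp Y"
    using Omega_perp_self[OF FixD(1)[OF J1(1)] FixD(1)[OF Y(1)] J1(3)] rZ1 by blast
  have "m \<subseteq> perp Y" using closedD[OF closed_perp[OF YP] m pYp rY rp] .
  then have sY: "s \<in> perp Y" using s by blast
  have sZ: "s \<notin> Z"
  proof
    assume sZ: "s \<in> Z"
    have "m \<subseteq> Z" using closedD[OF Omega_closed[OF FixD(1)[OF Z(1)]] m(1,2) s(1) p(1) sZ] s(2) by auto
    then have "L r \<subseteq> Z" using Fix_L_sub[OF Z(1)] m(3) by blast
    then show False using L_eq[OF q(1) r(1)] Lq qZ by auto
  qed
  have sZ1: "s \<notin> ?Z1"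
  proof
    assume "s \<in> ?Z1"
    then have "m \<subseteq> ?Z1" using closedD[OF Omega_closed[OF FixD(1)[OF J1(1)]] m(1,3) s(1) rZ1] s(3) by auto
    then show False using m(2) p1 by blast
  qed
  have snY: "s \<notin> Y" using sZ Y(3) by blast
  note J2 = jn[OF Y(1) sY snY]
  let ?Z2 = "jn Y s"
  have s2: "s \<in> ?Z2" using J2(4) L_line(2)[of s] sY perp_sub by blast
  have n1: "rk ?Z1 = n" and n2: "rk ?Z2 = n" using J1(2) J2(2) Y(2) by auto
  have I1: "Z \<inter> ?Z1 = Y" using max_inter[OF Z J1(1) n1 Y(1,3) J1(3) Y(2) q1 qZ] .
  have I2: "Z \<inter> ?Z2 = Y" using max_inter[OF Z J2(1) n2 Y(1,3) J2(3) Y(2) s2 sZ] .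
  have I3: "?Z1 \<inter> ?Z2 = Y" using max_inter[OF J1(1) n1 J2(1) n2 Y(1) J1(3) J2(3) Y(2) s2 sZ1] .
  have dec: "Z' \<inter> X0 \<subset> Z \<inter> X0" if Z': "Z' \<in> Fix" "rk Z' = n" "Z \<inter> Z' = Y" for Z'
  proof -
    have YZ': "Y \<subseteq> Z'" using Z'(3) by blast
    \<comment> \<open>Outside \<open>Y\<close>, the line \<open>L x\<close> would generate
      \<open>Z'\<close> together with \<open>Y\<close>. The point \<open>p\<close> is perpendicular
      to \<open>Y\<close> inside \<open>Z\<close> and to \<open>L x\<close> inside
      \<open>X0\<close>, so maximality would put it in \<open>Z'\<close>.\<close>
    have "x \<in> Y" if x: "x \<in> Z'" "x \<in> X0" for x
    proof (rule ccontr)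
      assume xY: "x \<notin> Y"
      have xp: "x \<in> perp Y" using Omega_perp_self[OF FixD(1)[OF Z'(1)] FixD(1)[OF Y(1)] YZ'] x(1) by blast
      have xP: "x \<in> P" using Fix_P X0 x by blast
      have J: "jn Y x = Z'" using max_through[OF Y(1,2) xp xY Z'(1,2) YZ' x(1)] .
      have "X0 \<subseteq> perp (L x)"
        using Omega_perp_self[OF FixD(1)[OF X0(1)] L_Omega[OF xP] Fix_L_sub[OF X0(1) x(2)]] .
      then have "p \<in> perp (jn Y x)" using jn(6)[OF Y(1) xp xY] pYp p(2) by blast
      then have "p \<in> Z'" using J max_perp[OF FixD(1)[OF Z'(1)] Z'(2)] by simp
      then show False using Z'(3) p(1) pY by blast
    qed
    then have "Z' \<inter> X0 \<subseteq> Z \<inter> X0" using Y(3) by blast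
    moreover have "p \<notin> Z'" using Z'(3) p(1) pY by blast
    ultimately show ?thesis using p by blast
  qed
  show ?thesis
  proof (cases "Z \<inter> X = {} \<longrightarrow> ?Z1 \<inter> X = {}")
    case True
    then show ?thesis using that[OF J1(1) n1 dec[OF J1(1) n1 I1]] by blast
  next
    case False
    then have ZX: "Z \<inter> X = {}" by blast
    obtain x1 where x1: "x1 \<in> ?Z1" "x1 \<in> X" using False by blast
    have "?Z2 \<inter> X = {}"
    proof (rule ccontr)
      assume "?Z2 \<inter> X \<noteq> {}"
      then obtain x2 where x2: "x2 \<in> ?Z2" "x2 \<in> X" by blast
      \<comment> \<open>\<open>?E\<close> has rank at most 2, so all points of \<open>X\<close>
        perpendicular to \<open>Y\<close> lie on one fixed line. Points \<open>x1\<close> and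
        \<open>x2\<close> on it would put \<open>x1\<close> into both candidates, hence into
        \<open>Y\<close> and \<open>Z\<close>.\<close>
      let ?E = "X \<inter> perp Y"
      have E: "?E \<in> Fix" using Fix_perp_Fix[OF X(1) Y(1)] .
      have "rk ?E + rk Y \<le> n"
        using opposite_bound[OF FixD(1)[OF Z(1)] Z(2) FixD(1)[OF Y(1)] Y(3) FixD(1)[OF E]] ZX by blast
      then have rE: "rk ?E \<le> 2" using Y(2) by linarith
      have LE: "L x = ?E" if "x \<in> ?E" for x
      proof -
        have xP: "x \<in> P" using Fix_P[OF E that] .
        show ?thesis
          using rk_eq[OF L_Omega[OF xP] FixD(1)[OF E] Fix_L_sub[OF E that]] rE L_line(1)[OF xP] by (simp add: lines_iff)
      qed
      have "x1 \<in> ?E" "x2 \<in> ?E"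
        using Omega_perp_self[OF FixD(1)[OF J1(1)] FixD(1)[OF Y(1)] J1(3)]
          Omega_perp_self[OF FixD(1)[OF J2(1)] FixD(1)[OF Y(1)] J2(3)] x1 x2 by blast+
      then have "x1 \<in> L x2" using LE[of x2] by simp
      then have "x1 \<in> ?Z2" using Fix_L_sub[OF J2(1) x2(1)] by blast
      then have "x1 \<in> Y" using I3 x1(1) by blast
      then show False using Y(3) ZX x1(2) by blast
    qed
    then show ?thesis using that[OF J2(1) n2 dec[OF J2(1) n2 I2]] by blast
  qed
qed

lemma opposite_descent:
  assumes X: "X \<in> Fix" "rk X = n" and X0: "X0 \<in> Fix" "rk X0 = n"
  shows "Z \<in> Fix \<Longrightarrow> rk Z = n \<Longrightarrow> \<exists>Z' \<in> Fix. rk Z' = n \<and> Z' \<inter> X0 = {} \<and> (Z \<inter> X = {} \<longrightarrow> Z' \<inter> X = {})"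
proof (induction "rk (Z \<inter> X0)" arbitrary: Z rule: less_induct)
  case less
  show ?case
  proof (cases "Z \<inter> X0 = {}")
    case True then show ?thesis using less.prems by blast
  next
    case False
    then obtain p where p: "p \<in> Z" "p \<in> X0" by blast
    obtain Z' where Z': "Z' \<in> Fix" "rk Z' = n" "Z' \<inter> X0 \<subset> Z \<inter> X0" "Z \<inter> X = {} \<Longrightarrow> Z' \<inter> X = {}"
      using opposite_step[OF less.prems X X0 p] by metis
    have "rk (Z' \<inter> X0) < rk (Z \<inter> X0)"
      using rk_less[OF FixD(1)[OF Fix_Int] FixD(1)[OF Fix_Int]] Z' less.prems X0 by blast
    then obtain Z2 where "Z2 \<in> Fix" "rk Z2 = n" "Z2 \<inter> X0 = {}" "Z' \<inter> X = {} \<longrightarrow> Z2 \<inter> X = {}"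
      using less.hyps[OF _ Z'(1,2)] by blast
    then show ?thesis using Z'(4) by blast
  qed
qed

text \<open>A first descent, with \<open>X\<close> in both roles, yields a subspace disjoint from
  \<open>X\<close>. A second frees it from \<open>X0\<close> while keeping it disjoint from
  \<open>X\<close>.\<close>

lemma common_opposite:
  assumes X: "X \<in> Fix" "rk X = n" and X0: "X0 \<in> Fix" "rk X0 = n"
  obtains Z where "Z \<in> Fix" "rk Z = n" "Z \<inter> X = {}" "Z \<inter> X0 = {}"
proof -
  obtain Z where Z: "Z \<in> Fix" "rk Z = n" "Z \<inter> X = {}" using opposite_descent[OF X X X] by blast
  then show ?thesis using that opposite_descent[OF X X0 Z(1,2)] by blast
qed

section \<open>Projection between maximal fixed subspaces\<close>

lemma rk_hyperplane:
  assumes Z: "Z \<in> \<Omega>" "rk Z = n" and x: "x \<in> P" "x \<notin> Z"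
  shows "Z \<inter> perp {x} \<in> \<Omega>" "n = Suc (rk (Z \<inter> perp {x}))"
proof -
  show "Z \<inter> perp {x} \<in> \<Omega>" using Omega_perp Z x by simp
  have "x \<notin> perp Z" using max_perp[OF Z] x by simp
  then obtain z where "z \<in> Z" "\<not> col x z" using x(1) perpI by blast
  then show "n = Suc (rk (Z \<inter> perp {x}))" using rk_perp[OF Z(1) x(1)] Z(2) by simp
qed

text \<open>A point outside the maximal \<open>Z\<close> is recorded by its hyperplane
  \<open>?H\<close> in \<open>Z\<close>. The part of \<open>X0\<close> perpendicular to
  \<open>?H\<close> has rank at least 1 by \<open>rk_perp_bound0\<close> and at most 1 because
  \<open>X0\<close> misses \<open>Z\<close>.\<close>

lemma project_point:
  assumes Z: "Z \<in> \<Omega>" "rk Z = n" and X0: "X0 \<in> \<Omega>" "rk X0 = n" "Z \<inter> X0 = {}"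
    and x: "x \<in> P" "x \<notin> Z"
  shows "\<exists>!u. u \<in> X0 \<and> Z \<inter> perp {u} = Z \<inter> perp {x}"
proof -
  let ?H = "Z \<inter> perp {x}" let ?E = "X0 \<inter> perp ?H"
  note H = rk_hyperplane[OF Z x]
  have HP: "?H \<subseteq> P" using Omega_sub[OF H(1)] .
  have E: "?E \<in> \<Omega>" using Omega_perp[OF X0(1) HP] .
  have "rk X0 \<le> rk ?E + rk ?H" using rk_perp_bound0[OF H(1) X0(1)] .
  moreover have "rk ?E + rk ?H \<le> n" using opposite_bound[OF Z H(1) _ E] X0(3) by blast
  ultimately have "rk ?E = 1" using X0(2) H(2) by linarith
  then obtain u where u: "?E = {u}" using rk_1[OF E] by blast
  then have uE: "u \<in> X0" "u \<in> perp ?H" by auto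
  have uP: "u \<in> P" "u \<notin> Z" using uE(1) Omega_sub[OF X0(1)] X0(3) by auto
  note U = rk_hyperplane[OF Z uP]
  have "?H \<subseteq> Z \<inter> perp {u}" using perpD[OF uE(2)] HP by (auto simp: mem_perp1 col_sym[of u])
  then have "?H = Z \<inter> perp {u}" using rk_eq[OF H(1) U(1)] H(2) U(2) by simp
  moreover have "w = u" if w: "w \<in> X0" "Z \<inter> perp {w} = ?H" for w
  proof -
    have "w \<in> perp ?H"
    proof (rule perpI)
      show "w \<in> P" using w(1) Omega_sub[OF X0(1)] by blast
      fix a assume "a \<in> ?H"
      then have "a \<in> perp {w}" using w(2) by blast
      then show "col w a" by (simp add: mem_perp1 col_sym[of w])
    qed
    then have "w \<in> ?E" using w(1) by blast
    then show ?thesis using u by blast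
  qed
  ultimately show ?thesis using uE(1) by metis
qed

text \<open>Between disjoint maximal subspaces, taking perps is a duality; comparison of ranks shows
  that two applications return \<open>Y\<close>.\<close>

lemma double_perp:
  assumes Z: "Z \<in> \<Omega>" "rk Z = n" and X: "X \<in> \<Omega>" "rk X = n" "Z \<inter> X = {}" and Y: "Y \<in> \<Omega>" "Y \<subseteq> X"
  shows "X \<inter> perp (Z \<inter> perp Y) = Y"
proof -
  let ?D = "Z \<inter> perp Y" let ?E = "X \<inter> perp ?D"
  have D: "?D \<in> \<Omega>" using Omega_perp[OF Z(1) Omega_sub[OF Y(1)]] .
  have E: "?E \<in> \<Omega>" using Omega_perp[OF X(1) Omega_sub[OF D]] .
  have "rk Z \<le> rk ?D + rk Y" using rk_perp_bound0[OF Y(1) Z(1)] .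
  moreover have "rk ?E + rk ?D \<le> n" using opposite_bound[OF Z D _ E] X(3) by blast
  ultimately have "rk ?E \<le> rk Y" using Z(2) by linarith
  moreover have "Y \<subseteq> ?E"
    using Y Omega_sub[OF Y(1)] by (auto simp: perp_def col_sym)
  ultimately show ?thesis using rk_eq[OF Y(1) E] by simp
qed

text \<open>\<open>f\<close> preserves perpendicularity to points of \<open>Z\<close>, so the image
  of \<open>Y\<close> is cut out of \<open>X0\<close> by the perp of
  \<open>Z \<inter> perp Y\<close>.\<close>

lemma project_image:
  assumes Z: "Z \<in> \<Omega>" "rk Z = n" and X: "X \<in> \<Omega>" "rk X = n" "Z \<inter> X = {}"
    and X0: "X0 \<in> \<Omega>" "rk X0 = n" "Z \<inter> X0 = {}"
    and f: "\<And>x. x \<in> X \<Longrightarrow> f x \<in> X0 \<and> Z \<inter> perp {f x} = Z \<inter> perp {x}" and surj: "f ` X = X0"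
    and Y: "Y \<in> \<Omega>" "Y \<subseteq> X"
  shows "f ` Y \<in> \<Omega>"
proof -
  let ?D = "Z \<inter> perp Y"
  have DP: "?D \<subseteq> P" using Omega_sub[OF Z(1)] by blast
  have iff: "f x \<in> perp ?D \<longleftrightarrow> x \<in> perp ?D" if x: "x \<in> X" for x
  proof -
    have P: "x \<in> P" "f x \<in> P" using x f[OF x] Omega_sub X0(1) X(1) by blast+
    have "col (f x) d \<longleftrightarrow> col x d" if "d \<in> ?D" for d
    proof -
      have "d \<in> Z \<inter> perp {f x} \<longleftrightarrow> d \<in> Z \<inter> perp {x}" using f[OF x] by simp
      then show ?thesis using that DP by (auto simp: mem_perp1 col_sym[of _ d])
    qed
    then show ?thesis using P unfolding perp_def by simp
  qed
  have "f ` Y = X0 \<inter> perp ?D"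
  proof (intro subset_antisym subsetI)
    fix u assume "u \<in> f ` Y"
    then obtain y where y: "y \<in> Y" "u = f y" by blast
    then have "y \<in> perp ?D" using double_perp[OF Z X Y] by blast
    then show "u \<in> X0 \<inter> perp ?D" using iff f y Y(2) by blast
  next
    fix u assume u: "u \<in> X0 \<inter> perp ?D"
    then obtain x where x: "x \<in> X" "u = f x" using surj by blast
    then have "x \<in> X \<inter> perp ?D" using iff u by blast
    then show "u \<in> f ` Y" using double_perp[OF Z X Y] x by blast
  qed
  then show ?thesis using Omega_perp[OF X0(1) DP] by simp
qed

text \<open>The inverse of \<open>f\<close> is the projection in the other direction.
  \<open>f\<close> commutes with \<open>\<theta>\<close> because \<open>f x\<close> is characterised
  by a hyperplane of \<open>Z\<close> and \<open>\<theta>\<close> maps \<open>Z\<close> to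
  itself.\<close>

lemma transport:
  assumes X: "X \<in> Fix" "rk X = n" and X0: "X0 \<in> Fix" "rk X0 = n"
  obtains f where "bij_betw f X X0" "\<And>Y. Y \<subseteq> X \<Longrightarrow> f ` Y \<in> \<Omega> \<longleftrightarrow> Y \<in> \<Omega>" "\<And>x. x \<in> X \<Longrightarrow> f (\<theta> x) = \<theta> (f x)"
proof -
  obtain Z where Z: "Z \<in> Fix" "rk Z = n" "Z \<inter> X = {}" "Z \<inter> X0 = {}" using common_opposite[OF X X0] .
  note ZO = FixD(1)[OF Z(1)] Z(2) and XO = FixD(1)[OF X(1)] X(2) Z(3) and X0O = FixD(1)[OF X0(1)] X0(2) Z(4)
  have xP: "x \<in> P" "x \<notin> Z" if "x \<in> X" for x using that Fix_P[OF X(1)] Z(3) by auto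
  have uP: "x \<in> P" "x \<notin> Z" if "x \<in> X0" for x using that Fix_P[OF X0(1)] Z(4) by auto
  define f where "f x = (THE u. u \<in> X0 \<and> Z \<inter> perp {u} = Z \<inter> perp {x})" for x
  define f' where "f' u = (THE x. x \<in> X \<and> Z \<inter> perp {x} = Z \<inter> perp {u})" for u
  have f: "f x \<in> X0 \<and> Z \<inter> perp {f x} = Z \<inter> perp {x}" if "x \<in> X" for x
    unfolding f_def by (rule theI'[OF project_point[OF ZO X0O xP[OF that]]])
  have f': "f' x \<in> X \<and> Z \<inter> perp {f' x} = Z \<inter> perp {x}" if "x \<in> X0" for x
    unfolding f'_def by (rule theI'[OF project_point[OF ZO XO uP[OF that]]])
  have f_eq: "f x = u" if "x \<in> X" "u \<in> X0" "Z \<inter> perp {u} = Z \<inter> perp {x}" for x u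
    unfolding f_def by (rule the1_equality[OF project_point[OF ZO X0O xP[OF that(1)]]]) (use that in simp)
  have f'_eq: "f' u = x" if "u \<in> X0" "x \<in> X" "Z \<inter> perp {x} = Z \<inter> perp {u}" for x u
    unfolding f'_def by (rule the1_equality[OF project_point[OF ZO XO uP[OF that(1)]]]) (use that in simp)
  have ff': "f (f' u) = u" if "u \<in> X0" for u using f_eq[of "f' u" u] f'[OF that] that by simp
  have f'f: "f' (f x) = x" if "x \<in> X" for x using f'_eq[of "f x" x] f[OF that] that by simp
  have bij: "bij_betw f X X0"
    by (rule bij_betw_byWitness[of _ f']) (use f f' ff' f'f in auto)
  have bij': "bij_betw f' X0 X"
    by (rule bij_betw_byWitness[of _ f]) (use f f' ff' f'f in auto)
  have iff: "f ` Y \<in> \<Omega> \<longleftrightarrow> Y \<in> \<Omega>" if Y: "Y \<subseteq> X" for Y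
  proof
    show "f ` Y \<in> \<Omega>" if "Y \<in> \<Omega>"
      using project_image[OF ZO XO X0O f bij_betw_imp_surj_on[OF bij] that Y] .
    have s: "f ` Y \<subseteq> X0" using Y f by blast
    have "f' ` f ` Y = Y" unfolding image_image using f'f Y by (auto simp: subset_iff)
    then show "Y \<in> \<Omega>" if "f ` Y \<in> \<Omega>"
      using project_image[OF ZO X0O XO f' bij_betw_imp_surj_on[OF bij'] that s] by simp
  qed
  have th: "Z \<inter> perp {\<theta> x} = \<theta> ` (Z \<inter> perp {x})" if x: "x \<in> P" for x
  proof -
    have "\<theta> ` (Z \<inter> perp {x}) = \<theta> ` Z \<inter> \<theta> ` perp {x}"
      using inj_on_image_Int[OF th_inj] Omega_sub[OF ZO(1)] perp_sub by blast
    also have "\<theta> ` Z = Z" using FixD(2)[OF Z(1)] unfolding invar_def by simp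
    also have "\<theta> ` perp {x} = perp {\<theta> x}" using perp_image[of "{x}"] x by simp
    finally show ?thesis by simp
  qed
  have "f (\<theta> x) = \<theta> (f x)" if x: "x \<in> X" for x
  proof (rule f_eq)
    show "\<theta> x \<in> X" using invar_th[OF FixD(2)[OF X(1)] x] .
    show "\<theta> (f x) \<in> X0" using invar_th[OF FixD(2)[OF X0(1)]] f[OF x] by blast
    show "Z \<inter> perp {\<theta> (f x)} = Z \<inter> perp {\<theta> x}"
      using th[OF xP(1)[OF x]] th[OF uP(1), of "f x"] f[OF x] by simp
  qed
  then show ?thesis using that[OF bij iff] by blast
qed

lemma clique_image: "clique A \<Longrightarrow> clique (\<theta> ` A)"
  unfolding clique_def using th_col by (auto simp: subset_iff)

lemma th_sp: "clique A \<Longrightarrow> sp (\<theta> ` A) = \<theta> ` sp A"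
proof
  assume A: "clique A"
  show "sp (\<theta> ` A) \<subseteq> \<theta> ` sp A"
    using sp_least[OF th_Omega[OF sp_Omega[OF A]]] sp_sup[of A] by blast
  have O: "sp (\<theta> ` A) \<in> \<Omega>" using sp_Omega[OF clique_image[OF A]] .
  obtain Z where Z: "Z \<subseteq> P" "\<theta> ` Z = sp (\<theta> ` A)" using th_preimage[OF Omega_sub[OF O]] by blast
  have AP: "A \<subseteq> P" using A unfolding clique_def by blast
  have "\<theta> ` A \<subseteq> \<theta> ` Z" using Z(2) sp_sup by simp
  then have "A \<subseteq> Z" using th_sub[OF AP Z(1)] by simp
  moreover have "Z \<in> \<Omega>" using th_Omega_iff[OF Z(1)] Z(2) O by simp
  ultimately have "sp A \<subseteq> Z" using sp_least by blast
  then show "\<theta> ` sp A \<subseteq> sp (\<theta> ` A)" using Z(2) by blast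
qed

end

section \<open>The representing map on one maximal fixed subspace\<close>

locale coordinatised = domestic P \<Omega> n K \<theta> + C: proj K "carrier K" r M0 "{Y \<in> \<Omega>. Y \<subseteq> M0}" \<phi>
  for P :: "'p set" and \<Omega> :: "'p set set" and n :: nat and K :: "('k, 'm) ring_scheme" and \<theta> :: "'p \<Rightarrow> 'p"
    and r M0 \<phi> +
  assumes M0: "M0 \<in> Fix" "rk M0 = n" and n4: "n \<ge> 4"
begin

lemma M0_Omega: "M0 \<in> \<Omega>"
  using FixD(1) M0 by blast

lemma M0_P: "x \<in> M0 \<Longrightarrow> x \<in> P"
  using Fix_P M0 by blast

lemma M0_th: "x \<in> M0 \<Longrightarrow> \<theta> x \<in> M0"
  using invar_th FixD(2) M0 by blast

lemma phi_sp1: "x \<in> M0 \<Longrightarrow> v \<in> \<phi> x \<Longrightarrow> v \<noteq> vec_zero K \<Longrightarrow> \<phi> x = C.V.sp1 v"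
  using C.phi_ray[of x v] unfolding C.ray_def C.V.sp1_def by simp

lemma VS_subsp: "Y \<in> \<Omega> \<Longrightarrow> Y \<subseteq> M0 \<Longrightarrow> C.V.subsp (C.VS Y)"
  using C.VS_Sigma[of Y] by (simp add: subspaces_iff[OF K])

lemma sp2_iff:
  assumes x: "x \<in> M0" "u \<in> \<phi> x" "u \<noteq> vec_zero K" and y: "y \<in> M0" "v \<in> \<phi> y" "v \<noteq> vec_zero K"
    and z: "z \<in> M0" "w \<in> \<phi> z" "w \<noteq> vec_zero K"
  shows "w \<in> C.V.sp2 u v \<longleftrightarrow> z \<in> sp {x, y}"
proof -
  have xO: "{x} \<in> \<Omega>" using sing_Omega M0_P x by blast
  have yx: "y \<in> perp {x}" using Omega_col[OF M0_Omega y(1) x(1)] M0_P y(1) by (simp add: mem_perp1)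
  have eq: "insert y {x} = {x, y}" by blast
  have s: "sp {x, y} \<subseteq> M0" using sp_least[OF M0_Omega] x y by simp
  have O: "sp {x, y} \<in> {Y \<in> \<Omega>. Y \<subseteq> M0}" using sp_insert_Omega[OF xO yx] s unfolding eq by simp
  have "C.VS {x} = C.V.sp1 u"
    unfolding C.VS_def using phi_sp1[OF x] C.V.subsp_zero[OF C.V.subsp_sp1, of u] C.phi_vecs[OF x(1)] x(2)
      C.V.M.zero_closed by auto
  then have "C.VS (sp {x, y}) = C.V.sp2 u v"
    using VS_join[OF C.proj_axioms xO yx _ y(2,3)] s unfolding eq C.V.sp2_def by simp
  then show ?thesis using C.VS_iff[OF O z] by simp
qed

lemma vec_pt: "v \<in> vecs K r \<Longrightarrow> v \<noteq> vec_zero K \<Longrightarrow> \<exists>x \<in> M0. v \<in> \<phi> x"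
  using C.pt' by blast

text \<open>Two points span rank at most 2, while \<open>M0\<close> has rank at least 4. Zero
  vectors are replaced by a nonzero \<open>e\<close>, which only enlarges the span.\<close>

lemma dim3:
  assumes "u \<in> vecs K r" "v \<in> vecs K r" shows "\<exists>w \<in> vecs K r. w \<notin> C.V.sp2 u v"
proof -
  have nz: "\<exists>w \<in> vecs K r. w \<notin> C.V.sp2 u v"
    if uv: "u \<in> vecs K r" "v \<in> vecs K r" "u \<noteq> vec_zero K" "v \<noteq> vec_zero K" for u v
  proof -
    obtain x where x: "x \<in> M0" "u \<in> \<phi> x" using vec_pt uv by blast
    obtain y where y: "y \<in> M0" "v \<in> \<phi> y" using vec_pt uv by blast
    have xO: "{x} \<in> \<Omega>" using sing_Omega M0_P x by blast
    have yx: "y \<in> perp {x}" using Omega_col[OF M0_Omega y(1) x(1)] M0_P y(1) by (simp add: mem_perp1)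
    have eq: "insert y {x} = {x, y}" by blast
    have O: "sp {x, y} \<in> \<Omega>" using sp_insert_Omega[OF xO yx] unfolding eq .
    have "rk (sp {x, y}) \<le> 2"
    proof (cases "x = y")
      case True
      then have "sp {x, y} \<subseteq> {x}" using sp_least[OF xO, of "{x, y}"] by simp
      then show ?thesis using rk_mono[OF O xO] rk_sing[OF M0_P[OF x(1)]] by simp
    next
      case False
      then show ?thesis using rk_join[OF xO yx] rk_sing[OF M0_P[OF x(1)]] unfolding eq by simp
    qed
    then have "\<not> M0 \<subseteq> sp {x, y}" using rk_mono[OF M0_Omega O] M0(2) n4 by linarith
    then obtain z where z: "z \<in> M0" "z \<notin> sp {x, y}" by blast
    obtain w where w: "w \<in> \<phi> z" "w \<in> vecs K r" "w \<noteq> vec_zero K" using C.phi_rep[OF z(1)] by blast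
    then show ?thesis using sp2_iff[OF x uv(3) y uv(4) z(1) w(1,3)] z(2) by blast
  qed
  have "M0 \<noteq> {}" using M0(2) n4 rk_empty by auto
  then obtain e where e: "e \<in> vecs K r" "e \<noteq> vec_zero K" using C.phi_rep by blast
  define u' v' where "u' = (if u = vec_zero K then e else u)" and "v' = (if v = vec_zero K then e else v)"
  have uv': "u' \<in> vecs K r" "v' \<in> vecs K r" "u' \<noteq> vec_zero K" "v' \<noteq> vec_zero K"
    using assms e unfolding u'_def v'_def by auto
  have S: "C.V.subsp (C.V.sp2 u' v')" using C.V.subsp_sp2 uv' by simp
  have "u \<in> C.V.sp2 u' v'" "v \<in> C.V.sp2 u' v'"
    using C.V.subsp_zero[OF S] C.V.sp2_l[of u' v'] C.V.sp2_r[of u' v'] uv' unfolding u'_def v'_def by auto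
  then have "C.V.sp2 u v \<subseteq> C.V.sp2 u' v'" using C.V.sp2_least[of u v, OF _ _ S] assms by simp
  then show ?thesis using nz[OF uv'] by blast
qed

text \<open>\<open>additive_rep\<close> is applied to an arbitrary choice \<open>t\<close> of
  vectors. Of the conditions on the resulting \<open>g\<close>, \<open>g_indep\<close> reflects the
  absence of fixed points and \<open>g_line\<close> the invariance of \<open>L x\<close>.\<close>

lemma semilinear_rep:
  obtains g where "spread_rep K (tuples K r) g"
    "\<And>x v. x \<in> M0 \<Longrightarrow> v \<in> \<phi> x \<Longrightarrow> v \<noteq> vec_zero K \<Longrightarrow> g v \<in> \<phi> (\<theta> x) \<and> g v \<noteq> vec_zero K"
proof -
  have ex: "\<exists>w \<in> vecs K r. w \<noteq> vec_zero K \<and> (\<exists>x \<in> M0. v \<in> \<phi> x \<and> w \<in> \<phi> (\<theta> x))"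
    if v: "v \<in> vecs K r" "v \<noteq> vec_zero K" for v
  proof -
    obtain x where x: "x \<in> M0" "v \<in> \<phi> x" using vec_pt v by blast
    then show ?thesis using C.phi_rep[OF M0_th[OF x(1)]] by blast
  qed
  define t where "t v = (SOME w. w \<in> vecs K r \<and> w \<noteq> vec_zero K \<and> (\<exists>x \<in> M0. v \<in> \<phi> x \<and> w \<in> \<phi> (\<theta> x)))" for v
  have t: "t v \<in> vecs K r \<and> t v \<noteq> vec_zero K \<and> (\<exists>x \<in> M0. v \<in> \<phi> x \<and> t v \<in> \<phi> (\<theta> x))"
    if v: "v \<in> vecs K r" "v \<noteq> vec_zero K" for v
    using someI_ex[OF ex[OF v, unfolded Bex_def]] unfolding t_def Bex_def .
  have t_phi: "t v \<in> \<phi> (\<theta> x)" if "x \<in> M0" "v \<in> \<phi> x" "v \<noteq> vec_zero K" for x v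
    using t[OF C.phi_vecs[OF that(1,2)] that(3)] C.phi_inj[OF that(1) _ that(2) _ that(3)] by blast
  interpret T: collineation_rep K "tuples K r" t
  proof
    fix u v w :: "nat \<Rightarrow> 'k"
    show "v \<in> carrier (tuples K r) \<Longrightarrow> v \<noteq> \<zero>\<^bsub>tuples K r\<^esub> \<Longrightarrow> t v \<in> carrier (tuples K r)" using t[of v] by simp
    show "v \<in> carrier (tuples K r) \<Longrightarrow> v \<noteq> \<zero>\<^bsub>tuples K r\<^esub> \<Longrightarrow> t v \<noteq> \<zero>\<^bsub>tuples K r\<^esub>" using t[of v] by simp
    show "u \<in> carrier (tuples K r) \<Longrightarrow> v \<in> carrier (tuples K r) \<Longrightarrow> \<exists>w \<in> carrier (tuples K r). w \<notin> C.V.sp2 u v"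
      using dim3[of u v] by simp
    assume c: "u \<in> carrier (tuples K r)" "v \<in> carrier (tuples K r)" "w \<in> carrier (tuples K r)"
      "u \<noteq> \<zero>\<^bsub>tuples K r\<^esub>" "v \<noteq> \<zero>\<^bsub>tuples K r\<^esub>" "w \<noteq> \<zero>\<^bsub>tuples K r\<^esub>"
    then have nz: "u \<noteq> vec_zero K" "v \<noteq> vec_zero K" "w \<noteq> vec_zero K"
      and tnz: "t u \<noteq> vec_zero K" "t v \<noteq> vec_zero K" "t w \<noteq> vec_zero K" using t by auto
    obtain x where x: "x \<in> M0" "u \<in> \<phi> x" using vec_pt[of u] c by auto
    obtain y where y: "y \<in> M0" "v \<in> \<phi> y" using vec_pt[of v] c by auto
    obtain z where z: "z \<in> M0" "w \<in> \<phi> z" using vec_pt[of w] c by auto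
    have xyP: "x \<in> P" "y \<in> P" "z \<in> P" using M0_P x y z by auto
    have cl: "clique {x, y}" using clique2[OF xyP(1,2) Omega_col[OF M0_Omega x(1) y(1)]] .
    have "w \<in> C.V.sp2 u v \<longleftrightarrow> z \<in> sp {x, y}" using sp2_iff[OF x nz(1) y nz(2) z nz(3)] .
    also have "\<dots> \<longleftrightarrow> \<theta> z \<in> \<theta> ` sp {x, y}"
      using inj_on_image_mem_iff[OF th_inj xyP(3) Omega_sub[OF sp_Omega[OF cl]]] by simp
    also have "\<theta> ` sp {x, y} = sp {\<theta> x, \<theta> y}" using th_sp[OF cl] by simp
    also have "\<theta> z \<in> \<dots> \<longleftrightarrow> t w \<in> C.V.sp2 (t u) (t v)"
      using sp2_iff[OF M0_th[OF x(1)] t_phi[OF x nz(1)] tnz(1) M0_th[OF y(1)] t_phi[OF y nz(2)] tnz(2)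
        M0_th[OF z(1)] t_phi[OF z nz(3)] tnz(3)] by simp
    finally show "w \<in> C.V.sp2 u v \<longleftrightarrow> t w \<in> C.V.sp2 (t u) (t v)" .
  qed
  obtain g where g: "\<And>v. v \<in> carrier (tuples K r) \<Longrightarrow> g v \<in> carrier (tuples K r)"
    "\<And>v w. v \<in> carrier (tuples K r) \<Longrightarrow> w \<in> carrier (tuples K r) \<Longrightarrow>
      g (v \<oplus>\<^bsub>tuples K r\<^esub> w) = g v \<oplus>\<^bsub>tuples K r\<^esub> g w"
    "\<And>v. v \<in> carrier (tuples K r) \<Longrightarrow> v \<noteq> \<zero>\<^bsub>tuples K r\<^esub> \<Longrightarrow> g v \<noteq> \<zero>\<^bsub>tuples K r\<^esub> \<and> g v \<in> C.V.sp1 (t v)"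
    using T.additive_rep by blast
  have gphi: "g v \<in> \<phi> (\<theta> x) \<and> g v \<noteq> vec_zero K" if x: "x \<in> M0" "v \<in> \<phi> x" "v \<noteq> vec_zero K" for x v
  proof -
    have v: "v \<in> vecs K r" using C.phi_vecs x by blast
    have "\<phi> (\<theta> x) = C.V.sp1 (t v)" using phi_sp1[OF M0_th[OF x(1)] t_phi[OF x]] t[OF v x(3)] by blast
    then show ?thesis using g(3)[of v] v x(3) by simp
  qed
  have g0: "g (vec_zero K) = vec_zero K"
    using g(2)[of "vec_zero K" "vec_zero K"] g(1)[of "vec_zero K"] C.V.M.zero_closed C.V.M.add.l_cancel_one[of "g (vec_zero K)" "g (vec_zero K)"]
      C.V.M.l_zero[of "vec_zero K"] by simp
  have "spread_rep K (tuples K r) g"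
  proof (intro spread_rep.intro spread_rep_axioms.intro)
    show "left_vs K (tuples K r)" by (rule left_vs_tuples[OF K])
    show "field K" using K_field n4 by blast
    fix v w c assume v: "v \<in> carrier (tuples K r)"
    show "g v \<in> carrier (tuples K r)" using g v by blast
    show "g (v \<oplus>\<^bsub>tuples K r\<^esub> w) = g v \<oplus>\<^bsub>tuples K r\<^esub> g w" if "w \<in> carrier (tuples K r)" using g v that by blast
    show "\<exists>u \<in> carrier (tuples K r). u \<notin> C.V.sp2 v w" if "w \<in> carrier (tuples K r)" using dim3[of v w] v that by simp
    show "g v \<notin> C.V.sp1 v" if "v \<noteq> \<zero>\<^bsub>tuples K r\<^esub>"
    proof
      have nz: "v \<noteq> vec_zero K" using that by simp
      obtain x where x: "x \<in> M0" "v \<in> \<phi> x" using vec_pt[of v] v nz by auto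
      assume "g v \<in> C.V.sp1 v"
      then have "g v \<in> \<phi> x" using phi_sp1[OF x nz] by simp
      then have "x = \<theta> x" using C.phi_inj[OF x(1) M0_th[OF x(1)]] gphi[OF x nz] by blast
      then show False using nofix[OF M0_P[OF x(1)]] by simp
    qed
    show "g (c \<odot>\<^bsub>tuples K r\<^esub> v) \<in> C.V.sp1 (g v)" if c: "c \<in> carrier K"
    proof (cases "c \<odot>\<^bsub>tuples K r\<^esub> v = vec_zero K")
      case True
      then show ?thesis using g0 C.V.subsp_zero[OF C.V.subsp_sp1[OF g(1)[OF v]]] by simp
    next
      case False
      then have nz: "v \<noteq> vec_zero K" using C.V.smult_zero_r[OF c] by auto
      obtain x where x: "x \<in> M0" "v \<in> \<phi> x" using vec_pt[of v] v nz by auto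
      have "c \<odot>\<^bsub>tuples K r\<^esub> v \<in> \<phi> x" using phi_sp1[OF x nz] C.V.sp1I[OF c] by blast
      then have "g (c \<odot>\<^bsub>tuples K r\<^esub> v) \<in> \<phi> (\<theta> x)" using gphi[OF x(1) _ False] by blast
      then show ?thesis using phi_sp1[OF M0_th[OF x(1)]] gphi[OF x nz] by blast
    qed
    show "g (g v) \<in> C.V.sp2 v (g v)"
    proof (cases "v = vec_zero K")
      case True
      then show ?thesis using g0 C.V.sp2_l[OF v v] by simp
    next
      case False
      obtain x where x: "x \<in> M0" "v \<in> \<phi> x" using vec_pt[of v] v False by auto
      have xP: "x \<in> P" using M0_P x by blast
      note 1 = gphi[OF x False]
      note 2 = gphi[OF M0_th[OF x(1)] conjunct1[OF 1] conjunct2[OF 1]]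
      have "\<theta> (\<theta> x) \<in> sp {x, \<theta> x}" using L_th[OF xP L_line(3)[OF xP]] unfolding L_def .
      then show ?thesis
        using sp2_iff[OF x False M0_th[OF x(1)] conjunct1[OF 1] conjunct2[OF 1]
          M0_th[OF M0_th[OF x(1)]] conjunct1[OF 2] conjunct2[OF 2]] by simp
    qed
  qed
  then show ?thesis using that gphi by blast
qed

end

section \<open>Coordinates over the extension\<close>

context quadratic_rep
begin

text \<open>The additive group is kept and only the scalars are enlarged, so the subspaces of
  \<open>LM\<close> are the subspaces of \<open>M\<close> stable under \<open>g\<close>.\<close>

definition LM :: "('k \<times> 'k, 'v) module" where
  "LM = \<lparr>carrier = carrier M, mult = mult M, one = one M, zero = zero M, add = add M, smult = act\<rparr>"

lemma LM_simps [simp]: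
  "carrier LM = carrier M" "\<zero>\<^bsub>LM\<^esub> = \<zero>\<^bsub>M\<^esub>" "v \<oplus>\<^bsub>LM\<^esub> w = v \<oplus>\<^bsub>M\<^esub> w" "l \<odot>\<^bsub>LM\<^esub> v = act l v"
  unfolding LM_def by simp_all

lemma LM_left_vs: "left_vs L LM"
proof (intro left_vs.intro)
  show "abelian_group LM"
    by (rule abelian_groupI) (auto simp: M.a_ac intro: bexI[of _ "\<ominus>\<^bsub>M\<^esub> x" for x] M.l_neg)
qed (simp_all add: L_division act_closed act_add act_vadd act_mult act_one)

lemma act_h: "c \<in> carrier R \<Longrightarrow> v \<in> carrier M \<Longrightarrow> act (h c) v = c \<odot>\<^bsub>M\<^esub> v"
  unfolding h_def act_pair using g_closed by simp

lemma h_L: "c \<in> carrier R \<Longrightarrow> h c \<in> carrier L"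
  unfolding h_def by (simp add: L_simps)

lemma act_g: "v \<in> carrier M \<Longrightarrow> act (\<zero>, \<one>) v = g v"
  unfolding act_pair using g_closed by simp

end

locale coordinatised_ext = coordinatised P \<Omega> n K \<theta> r M0 \<phi> + QR: quadratic_rep K "tuples K r" g \<sigma> a b
  for P :: "'p set" and \<Omega> :: "'p set set" and n :: nat and K :: "('k, 'm) ring_scheme" and \<theta> :: "'p \<Rightarrow> 'p"
    and r M0 \<phi> g \<sigma> a b +
  assumes g_phi: "\<And>x v. x \<in> M0 \<Longrightarrow> v \<in> \<phi> x \<Longrightarrow> v \<noteq> vec_zero K \<Longrightarrow> g v \<in> \<phi> (\<theta> x) \<and> g v \<noteq> vec_zero K"
begin

sublocale LM: left_vs QR.L QR.LM by (rule QR.LM_left_vs)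

lemma VS_vecs: "C.VS Y \<subseteq> vecs K r"
  unfolding C.VS_def by blast

text \<open>Invariance under \<open>\<theta>\<close> makes the vectors of \<open>Y\<close> stable
  under \<open>g\<close>, hence under every \<open>x + y g\<close>.\<close>

lemma VS_LM_subsp:
  assumes Y: "Y \<in> Fix" "Y \<subseteq> M0" shows "LM.subsp (C.VS Y)"
proof -
  note S = VS_subsp[OF FixD(1)[OF Y(1)] Y(2)]
  have YO: "Y \<in> {Y \<in> \<Omega>. Y \<subseteq> M0}" using FixD(1) Y by blast
  have g: "g v \<in> C.VS Y" if v: "v \<in> C.VS Y" for v
  proof (cases "v = vec_zero K")
    case True then show ?thesis using QR.g_zero C.V.subsp_zero[OF S] by simp
  next
    case False
    then obtain y where y: "y \<in> Y" "v \<in> \<phi> y" using v unfolding C.VS_def by blast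
    then have yM: "y \<in> M0" using Y(2) by blast
    have "\<theta> y \<in> Y" using invar_th[OF FixD(2)[OF Y(1)] y(1)] .
    then show ?thesis using C.VS_iff[OF YO M0_th[OF yM]] g_phi[OF yM y(2) False] by blast
  qed
  have "QR.act l v \<in> C.VS Y" if "l \<in> carrier QR.L" "v \<in> C.VS Y" for l v
    using C.V.subsp_add[OF S] C.V.subsp_smult[OF S _ that(2)] C.V.subsp_smult[OF S _ g[OF that(2)]] that(1)
    unfolding QR.act_def QR.L_simps by auto
  then show ?thesis
    unfolding LM.subsp_def using C.V.subsp_zero[OF S] C.V.subsp_add[OF S] VS_vecs by simp
qed

text \<open>Joining \<open>x\<close> and then \<open>\<theta> x\<close> adjoins \<open>e\<close> and
  \<open>g e\<close> over \<open>K\<close>, which is the same as adjoining \<open>e\<close> over the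
  extension.\<close>

lemma VS_jn:
  assumes Y: "Y \<in> Fix" "Y \<subseteq> M0" and x: "x \<in> perp Y" "x \<notin> Y" and J: "jn Y x \<subseteq> M0"
    and e: "e \<in> \<phi> x" "e \<noteq> vec_zero K"
  shows "C.VS (jn Y x) = LM.ext (C.VS Y) e"
proof -
  note YO = FixD(1)[OF Y(1)]
  have xP: "x \<in> P" using x perp_sub by blast
  have xM: "x \<in> M0" using jn(4)[OF Y(1) x] J L_line(2)[OF xP] by blast
  have thM: "\<theta> x \<in> M0" using M0_th[OF xM] .
  let ?X = "sp (insert x Y)"
  have X: "?X \<in> \<Omega>" "?X \<subseteq> M0" using sp_insert_Omega[OF YO x(1)] sp_least[OF M0_Omega, of "insert x Y"] Y(2) xM by auto
  have 1: "C.VS ?X = C.V.ext (C.VS Y) e" using VS_join[OF C.proj_axioms YO x(1) X(2) e] .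
  have p: "\<theta> x \<in> perp ?X" using Omega_perp_self[OF M0_Omega X] thM by blast
  have gx: "g e \<in> \<phi> (\<theta> x)" "g e \<noteq> vec_zero K" using g_phi[OF xM e] by auto
  have 2: "C.VS (jn Y x) = C.V.ext (C.V.ext (C.VS Y) e) (g e)"
    using VS_join[OF C.proj_axioms X(1) p _ gx] J 1 unfolding jn_def by simp
  have ec: "e \<in> carrier (tuples K r)" "g e \<in> carrier (tuples K r)"
    using C.phi_vecs[OF xM e(1)] C.phi_vecs[OF thM gx(1)] by auto
  show ?thesis
  proof (rule Set.set_eqI)
    fix u
    have "u \<in> C.VS (jn Y x) \<longleftrightarrow> (\<exists>w \<in> C.VS Y. \<exists>c \<in> carrier K. \<exists>d \<in> carrier K.
        u = (w \<oplus>\<^bsub>tuples K r\<^esub> c \<odot>\<^bsub>tuples K r\<^esub> e) \<oplus>\<^bsub>tuples K r\<^esub> d \<odot>\<^bsub>tuples K r\<^esub> g e)"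
      unfolding 2 C.V.ext_def by blast
    also have "\<dots> \<longleftrightarrow> (\<exists>w \<in> C.VS Y. \<exists>c \<in> carrier K. \<exists>d \<in> carrier K. u = w \<oplus>\<^bsub>tuples K r\<^esub> QR.act (c, d) e)"
      unfolding QR.act_pair
      using C.V.M.a_assoc[OF _ C.V.smult_closed[OF _ ec(1)] C.V.smult_closed[OF _ ec(2)]] VS_vecs
      by (auto simp: subset_iff intro!: bex_cong)
    also have "\<dots> \<longleftrightarrow> u \<in> LM.ext (C.VS Y) e"
      unfolding LM.ext_def QR.L_simps(1) by auto
    finally show "u \<in> C.VS (jn Y x) \<longleftrightarrow> u \<in> LM.ext (C.VS Y) e" .
  qed
qed

section \<open>Bases over the extension\<close>

abbreviation LL where "LL \<equiv> QR.L"

lemma LL_vs: "left_vs LL (tuples LL s)"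
  by (rule left_vs_tuples[OF QR.L_division])

text \<open>In effect the choice of an \<open>LL\<close>-basis of \<open>C.VS Y\<close>, whose
  vectors are still written over \<open>K\<close>.\<close>

definition lincoord :: "nat \<Rightarrow> ((nat \<Rightarrow> 'k \<times> 'k) \<Rightarrow> nat \<Rightarrow> 'k) \<Rightarrow> 'p set \<Rightarrow> bool" where
  "lincoord s \<Phi> Y \<longleftrightarrow> bij_betw \<Phi> (vecs LL s) (C.VS Y) \<and>
     (\<forall>v \<in> vecs LL s. \<forall>w \<in> vecs LL s. \<Phi> (vec_add LL v w) = vec_add K (\<Phi> v) (\<Phi> w)) \<and>
     (\<forall>l \<in> carrier LL. \<forall>v \<in> vecs LL s. \<Phi> (vec_smult LL l v) = QR.act l (\<Phi> v))"

lemma lincoord_extend: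
  assumes Y: "Y \<in> Fix" "Y \<subseteq> M0" and x: "x \<in> perp Y" "x \<notin> Y" and J: "jn Y x \<subseteq> M0"
    and lin: "lincoord s \<Phi> Y"
  shows "\<exists>\<Psi>. lincoord (Suc s) \<Psi> (jn Y x)"
proof -
  have xP: "x \<in> P" using x perp_sub by blast
  have xM: "x \<in> M0" using jn(4)[OF Y(1) x] J L_line(2)[OF xP] by blast
  obtain e where e: "e \<in> \<phi> x" "e \<in> vecs K r" "e \<noteq> vec_zero K" using C.phi_rep[OF xM] by blast
  have ec: "e \<in> carrier (tuples K r)" using e by simp
  have YO: "Y \<in> {Y \<in> \<Omega>. Y \<subseteq> M0}" using FixD(1) Y by blast
  have eY: "e \<notin> C.VS Y" using C.VS_iff[OF YO xM e(1,3)] x(2) by simp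
  note S = VS_LM_subsp[OF Y]
  note VJ = VS_jn[OF Y x J e(1,3)]
  have bij: "bij_betw \<Phi> (vecs LL s) (C.VS Y)"
    and add: "\<And>v w. v \<in> vecs LL s \<Longrightarrow> w \<in> vecs LL s \<Longrightarrow> \<Phi> (vec_add LL v w) = vec_add K (\<Phi> v) (\<Phi> w)"
    and sm: "\<And>l v. l \<in> carrier LL \<Longrightarrow> v \<in> vecs LL s \<Longrightarrow> \<Phi> (vec_smult LL l v) = QR.act l (\<Phi> v)"
    using lin unfolding lincoord_def by auto
  \<comment> \<open>\<open>rs\<close> removes the new coordinate, which \<open>\<Psi>\<close> uses
    as the coefficient of the new basis vector \<open>e\<close>.\<close>
  define rs where "rs v = v(s := \<zero>\<^bsub>LL\<^esub>)" for v :: "nat \<Rightarrow> 'k \<times> 'k"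
  define \<Psi> where "\<Psi> v = vec_add K (\<Phi> (rs v)) (QR.act (v s) e)" for v
  have rs: "rs v \<in> vecs LL s" "v s \<in> carrier LL" if "v \<in> vecs LL (Suc s)" for v
    using that unfolding vecs_def rs_def by (auto simp: less_Suc_eq)
  have PhiV: "\<Phi> v \<in> C.VS Y" if "v \<in> vecs LL s" for v using bij_betwE[OF bij] that by blast
  have PhiC: "\<Phi> v \<in> carrier (tuples K r)" if "v \<in> vecs LL s" for v using PhiV[OF that] VS_vecs by auto
  have actC: "QR.act l e \<in> carrier (tuples K r)" if "l \<in> carrier LL" for l using QR.act_closed[OF that ec] .
  have inj: "inj_on \<Psi> (vecs LL (Suc s))"
  proof (rule inj_onI)
    fix v w assume v: "v \<in> vecs LL (Suc s)" and w: "w \<in> vecs LL (Suc s)" and eq: "\<Psi> v = \<Psi> w"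
    have 1: "v s = w s"
      using LM.coef_cancel[OF rs(2)[OF v] rs(2)[OF w] _ S eY PhiV[OF rs(1)[OF v]] PhiV[OF rs(1)[OF w]]] eq ec
      unfolding \<Psi>_def by simp
    have "\<Phi> (rs v) \<oplus>\<^bsub>tuples K r\<^esub> QR.act (v s) e = \<Phi> (rs w) \<oplus>\<^bsub>tuples K r\<^esub> QR.act (v s) e"
      using eq 1 unfolding \<Psi>_def by simp
    then have "\<Phi> (rs v) = \<Phi> (rs w)"
      using C.V.M.add.right_cancel[OF actC[OF rs(2)[OF v]] PhiC[OF rs(1)[OF v]] PhiC[OF rs(1)[OF w]]] by simp
    then have "rs v = rs w" using inj_onD[OF bij_betw_imp_inj_on[OF bij]] rs(1) v w by blast
    then have "v i = w i" for i using 1 unfolding rs_def by (metis fun_upd_apply)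
    then show "v = w" by blast
  qed
  have surj: "\<Psi> ` vecs LL (Suc s) = C.VS (jn Y x)"
  proof (intro subset_antisym subsetI)
    fix u assume "u \<in> \<Psi> ` vecs LL (Suc s)"
    then obtain v where v: "v \<in> vecs LL (Suc s)" "u = \<Psi> v" by blast
    have "u = \<Phi> (rs v) \<oplus>\<^bsub>QR.LM\<^esub> v s \<odot>\<^bsub>QR.LM\<^esub> e" using v(2) unfolding \<Psi>_def by simp
    then show "u \<in> C.VS (jn Y x)"
      unfolding VJ LM.ext_def using PhiV[OF rs(1)[OF v(1)]] rs(2)[OF v(1)] by blast
  next
    fix u assume "u \<in> C.VS (jn Y x)"
    then obtain w l where wl: "w \<in> C.VS Y" "l \<in> carrier LL" "u = vec_add K w (QR.act l e)"
      unfolding VJ LM.ext_def by auto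
    have "w \<in> \<Phi> ` vecs LL s" unfolding bij_betw_imp_surj_on[OF bij] by (rule wl(1))
    then obtain v where v: "v \<in> vecs LL s" "\<Phi> v = w" by blast
    have "v(s := l) \<in> vecs LL (Suc s)" using v(1) wl(2) unfolding vecs_def by (auto simp: less_Suc_eq)
    moreover have "rs (v(s := l)) = v" using v(1) unfolding rs_def vecs_def by auto
    then have "\<Psi> (v(s := l)) = u" unfolding \<Psi>_def using v wl by simp
    ultimately show "u \<in> \<Psi> ` vecs LL (Suc s)" by blast
  qed
  have addS: "\<Psi> (vec_add LL v w) = vec_add K (\<Psi> v) (\<Psi> w)"
    if v: "v \<in> vecs LL (Suc s)" and w: "w \<in> vecs LL (Suc s)" for v w
  proof -
    have "rs (vec_add LL v w) = vec_add LL (rs v) (rs w)"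
      unfolding rs_def vec_add_def using QR.L_zero_closed by auto
    then have "\<Psi> (vec_add LL v w) = (\<Phi> (rs v) \<oplus>\<^bsub>tuples K r\<^esub> \<Phi> (rs w)) \<oplus>\<^bsub>tuples K r\<^esub>
        (QR.act (v s) e \<oplus>\<^bsub>tuples K r\<^esub> QR.act (w s) e)"
      unfolding \<Psi>_def using add[OF rs(1)[OF v] rs(1)[OF w]] QR.act_add[OF rs(2)[OF v] rs(2)[OF w] ec]
      by (simp add: vec_add_def[of LL])
    also have "\<dots> = (\<Phi> (rs v) \<oplus>\<^bsub>tuples K r\<^esub> QR.act (v s) e) \<oplus>\<^bsub>tuples K r\<^esub>
        (\<Phi> (rs w) \<oplus>\<^bsub>tuples K r\<^esub> QR.act (w s) e)"
      using PhiC[OF rs(1)[OF v]] PhiC[OF rs(1)[OF w]] actC[OF rs(2)[OF v]] actC[OF rs(2)[OF w]]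
      by (simp only: C.V.M.a_ac C.V.M.a_closed)
    finally show ?thesis unfolding \<Psi>_def by simp
  qed
  have smS: "\<Psi> (vec_smult LL l v) = QR.act l (\<Psi> v)" if l: "l \<in> carrier LL" and v: "v \<in> vecs LL (Suc s)" for l v
  proof -
    have "rs (vec_smult LL l v) = vec_smult LL l (rs v)"
      unfolding rs_def vec_smult_def using QR.L.r_null[OF l] by auto
    then have "\<Psi> (vec_smult LL l v) = QR.act l (\<Phi> (rs v)) \<oplus>\<^bsub>tuples K r\<^esub> QR.act l (QR.act (v s) e)"
      unfolding \<Psi>_def using sm[OF l rs(1)[OF v]] QR.act_mult[OF l rs(2)[OF v] ec]
      by (simp add: vec_smult_def[of LL])
    also have "\<dots> = QR.act l (\<Psi> v)"
      unfolding \<Psi>_def using QR.act_vadd[OF l PhiC[OF rs(1)[OF v]] actC[OF rs(2)[OF v]]] by simp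
    finally show ?thesis .
  qed
  have "bij_betw \<Psi> (vecs LL (Suc s)) (C.VS (jn Y x))" using inj surj unfolding bij_betw_def by blast
  then show ?thesis unfolding lincoord_def using addS smS by blast
qed

text \<open>A nonempty fixed subspace is the join of \<open>L x\<close> and its part perpendicular
  to some \<open>L q\<close>, whose rank is smaller by two.\<close>

lemma ex_lincoord: "Y \<in> Fix \<Longrightarrow> Y \<subseteq> M0 \<Longrightarrow> \<exists>s \<Phi>. lincoord s \<Phi> Y"
proof (induction "rk Y" arbitrary: Y rule: less_induct)
  case less
  show ?case
  proof (cases "Y = {}")
    case True
    have v: "vecs LL 0 = {vec_zero LL}" unfolding vecs_def vec_zero_def by auto
    have V: "C.VS Y = {vec_zero K}" unfolding C.VS_def True using C.V.M.zero_closed by auto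
    have z: "vec_add K (vec_zero K) (vec_zero K) = vec_zero K" using C.V.M.l_zero[OF C.V.M.zero_closed] by simp
    have a: "QR.act l (vec_zero K) = vec_zero K" if "l \<in> carrier LL" for l
      using LM.smult_zero_r[OF that] by simp
    have "lincoord 0 (\<lambda>_. vec_zero K) Y"
      unfolding lincoord_def v V using z a by (auto simp: bij_betw_def)
    then show ?thesis by blast
  next
    case False
    then obtain x where x: "x \<in> Y" by blast
    have xP: "x \<in> P" using Fix_P less.prems x by blast
    obtain q where q: "q \<in> P" "\<not> col x q" using noncol[OF xP] by blast
    let ?Y = "Y \<inter> perp (L q)"
    have Y': "?Y \<in> Fix" "rk Y = Suc (Suc (rk ?Y))"
      using Fix_perp_L[OF less.prems(1) q(1)] rk_perp_L[OF less.prems(1) x q(1)] q(2) by (auto simp: col_sym[of q])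
    have xn: "x \<notin> ?Y" using perpD[of x "L q" q] L_line(2)[OF q(1)] q(2) by blast
    have xp: "x \<in> perp ?Y" using Omega_perp_self[OF FixD(1)[OF less.prems(1)] FixD(1)[OF Y'(1)]] x by blast
    note J = jn[OF Y'(1) xp xn]
    have "jn ?Y x \<subseteq> Y" using J(5)[OF FixD(1)[OF less.prems(1)]] Fix_L_sub[OF less.prems(1) x] by blast
    then have JY: "jn ?Y x = Y" using rk_eq[OF FixD(1)[OF J(1)] FixD(1)[OF less.prems(1)]] J(2) Y'(2) by simp
    have sub: "?Y \<subseteq> M0" using less.prems(2) by blast
    obtain s \<Phi> where "lincoord s \<Phi> ?Y" using less.hyps[OF _ Y'(1) sub] Y'(2) by auto
    then show ?thesis using lincoord_extend[OF Y'(1) sub xp xn] JY less.prems(2) by metis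
  qed
qed

text \<open>\<open>\<Phi>\<close> carries \<open>K\<close>-subspaces of tuples to the vectors of
  singular subspaces of \<open>Y\<close>. Closure under all of \<open>LL\<close> adds stability
  under \<open>g\<close>, which singles out the fixed ones.\<close>

lemma lincoord_proj_iso:
  assumes Y: "Y \<in> Fix" "Y \<subseteq> M0" and lin: "lincoord s \<Phi> Y"
  defines "\<psi> \<equiv> \<lambda>y. {v \<in> vecs LL s. \<Phi> v \<in> \<phi> y}"
  shows "proj_iso LL (QR.h ` carrier K) s Y {Z \<in> \<Omega>. Z \<subseteq> Y} \<psi>"
    and "{Z \<in> Fix. Z \<subseteq> Y} = {{y \<in> Y. \<psi> y \<subseteq> W} | W. W \<in> subspaces LL (carrier LL) s}"
proof -
  interpret VL: left_vs LL "tuples LL s" by (rule LL_vs)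
  have bij: "bij_betw \<Phi> (vecs LL s) (C.VS Y)"
    and add: "\<And>v w. v \<in> vecs LL s \<Longrightarrow> w \<in> vecs LL s \<Longrightarrow> \<Phi> (vec_add LL v w) = vec_add K (\<Phi> v) (\<Phi> w)"
    and sm: "\<And>l v. l \<in> carrier LL \<Longrightarrow> v \<in> vecs LL s \<Longrightarrow> \<Phi> (vec_smult LL l v) = QR.act l (\<Phi> v)"
    using lin unfolding lincoord_def by auto
  have inj: "\<Phi> v = \<Phi> w \<longleftrightarrow> v = w" if "v \<in> vecs LL s" "w \<in> vecs LL s" for v w
    using inj_on_eq_iff[OF bij_betw_imp_inj_on[OF bij] that] .
  have PhiV: "\<Phi> v \<in> C.VS Y" if "v \<in> vecs LL s" for v using bij_betwE[OF bij] that by blast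
  have PhiC: "\<Phi> v \<in> vecs K r" if "v \<in> vecs LL s" for v using PhiV[OF that] VS_vecs by auto
  have surj: "\<exists>v \<in> vecs LL s. \<Phi> v = u" if "u \<in> C.VS Y" for u
    using that bij_betw_imp_surj_on[OF bij] by (metis imageE)
  have zL: "vec_zero LL \<in> vecs LL s" using VL.M.zero_closed by simp
  have Phi0: "\<Phi> (vec_zero LL) = vec_zero K"
  proof -
    have "vec_smult LL \<zero>\<^bsub>LL\<^esub> (vec_zero LL) = vec_zero LL" using VL.smult_zero_l[of "vec_zero LL"] zL by simp
    then show ?thesis using sm[OF QR.L_zero_closed zL] QR.act_zero[of "\<Phi> (vec_zero LL)"] PhiC[OF zL] by simp
  qed
  have Phi_nz: "\<Phi> v \<noteq> vec_zero K \<longleftrightarrow> v \<noteq> vec_zero LL" if "v \<in> vecs LL s" for v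
    using inj[OF that zL] Phi0 by simp
  have hsm: "\<Phi> (vec_smult LL (QR.h c) v) = vec_smult K c (\<Phi> v)" if "c \<in> carrier K" "v \<in> vecs LL s" for c v
    using sm[OF QR.h_L[OF that(1)] that(2)] QR.act_h[OF that(1)] PhiC[OF that(2)] by simp
  have YO: "Y \<in> {Y \<in> \<Omega>. Y \<subseteq> M0}" using FixD(1) Y by blast
  have smV: "vec_smult LL l v \<in> vecs LL s" if "l \<in> carrier LL" "v \<in> vecs LL s" for l v
    using VL.smult_closed[of l v] that by simp
  have addV: "vec_add LL v w \<in> vecs LL s" if "v \<in> vecs LL s" "w \<in> vecs LL s" for v w
    using VL.M.a_closed[of v w] that by simp
  have phiV: "\<phi> y \<subseteq> C.VS Y" if "y \<in> Y" for y using C.VS_phi[OF YO] that Y(2) by blast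
  have psi_ray: "\<psi> y = {vec_smult LL l v | l. l \<in> QR.h ` carrier K}"
    if y: "y \<in> Y" and v: "v \<in> vecs LL s" "\<Phi> v \<in> \<phi> y" "v \<noteq> vec_zero LL" for y v
  proof -
    have yM: "y \<in> M0" using y Y(2) by blast
    have ray: "\<phi> y = C.ray (\<Phi> v)" using C.phi_ray[OF yM v(2)] Phi_nz[OF v(1)] v(3) by simp
    show ?thesis
    proof (intro subset_antisym subsetI)
      fix w assume "w \<in> \<psi> y"
      then have w: "w \<in> vecs LL s" "\<Phi> w \<in> \<phi> y" unfolding \<psi>_def by auto
      then obtain c where c: "c \<in> carrier K" "\<Phi> w = vec_smult K c (\<Phi> v)" unfolding ray C.ray_iff by blast
      then have "\<Phi> w = \<Phi> (vec_smult LL (QR.h c) v)" using hsm[OF c(1) v(1)] by simp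
      then have "w = vec_smult LL (QR.h c) v" using inj[OF w(1) smV[OF QR.h_L[OF c(1)] v(1)]] by simp
      then show "w \<in> {vec_smult LL l v | l. l \<in> QR.h ` carrier K}" using c(1) by blast
    next
      fix w assume "w \<in> {vec_smult LL l v | l. l \<in> QR.h ` carrier K}"
      then obtain c where c: "c \<in> carrier K" "w = vec_smult LL (QR.h c) v" by blast
      then show "w \<in> \<psi> y"
        unfolding \<psi>_def ray using hsm[OF c(1) v(1)] smV[OF QR.h_L[OF c(1)] v(1)] by (auto simp: C.ray_iff)
    qed
  qed
  have psi_ex: "\<exists>v \<in> vecs LL s. \<Phi> v \<in> \<phi> y \<and> v \<noteq> vec_zero LL" if y: "y \<in> Y" for y
  proof -
    obtain u where u: "u \<in> \<phi> y" "u \<noteq> vec_zero K" using C.phi_rep y Y(2) by blast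
    then have "u \<in> C.VS Y" using phiV[OF y] by blast
    then obtain v where v: "v \<in> vecs LL s" "\<Phi> v = u" using surj by blast
    then show ?thesis using Phi_nz[OF v(1)] u by blast
  qed
  have bij_psi: "bij_betw \<psi> Y (one_spaces LL (QR.h ` carrier K) s)"
    unfolding bij_betw_def
  proof
    show "inj_on \<psi> Y"
    proof (rule inj_onI)
      fix y z assume y: "y \<in> Y" and z: "z \<in> Y" and eq: "\<psi> y = \<psi> z"
      obtain v where v: "v \<in> vecs LL s" "\<Phi> v \<in> \<phi> y" "v \<noteq> vec_zero LL" using psi_ex[OF y] by blast
      then have "v \<in> \<psi> z" using eq unfolding \<psi>_def by blast
      then have "\<Phi> v \<in> \<phi> z" unfolding \<psi>_def by blast
      then show "y = z" using C.phi_inj[of y z "\<Phi> v"] v Phi_nz[OF v(1)] y z Y(2) by blast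
    qed
    show "\<psi> ` Y = one_spaces LL (QR.h ` carrier K) s"
    proof (intro subset_antisym subsetI)
      fix A assume "A \<in> \<psi> ` Y"
      then obtain y where y: "y \<in> Y" "A = \<psi> y" by blast
      obtain v where v: "v \<in> vecs LL s" "\<Phi> v \<in> \<phi> y" "v \<noteq> vec_zero LL" using psi_ex[OF y(1)] by blast
      show "A \<in> one_spaces LL (QR.h ` carrier K) s"
        unfolding y(2) psi_ray[OF y(1) v] one_spaces_def using v by blast
    next
      fix A assume "A \<in> one_spaces LL (QR.h ` carrier K) s"
      then obtain v where v: "v \<in> vecs LL s" "v \<noteq> vec_zero LL" "A = {vec_smult LL l v | l. l \<in> QR.h ` carrier K}"
        unfolding one_spaces_def by blast
      have "\<Phi> v \<in> C.VS Y" "\<Phi> v \<noteq> vec_zero K" using PhiV Phi_nz v by auto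
      then obtain y where y: "y \<in> Y" "\<Phi> v \<in> \<phi> y" unfolding C.VS_def by blast
      then have "A = \<psi> y" using psi_ray[OF y(1) v(1) y(2) v(2)] v(3) by simp
      then show "A \<in> \<psi> ` Y" using y(1) by blast
    qed
  qed
  have psi_img: "\<phi> y = \<Phi> ` \<psi> y" if y: "y \<in> Y" for y
  proof (intro subset_antisym subsetI)
    fix u assume u: "u \<in> \<phi> y"
    then obtain v where "v \<in> vecs LL s" "\<Phi> v = u" using surj phiV[OF y] by blast
    then show "u \<in> \<Phi> ` \<psi> y" using u unfolding \<psi>_def by blast
  qed (auto simp: \<psi>_def)
  \<comment> \<open>\<open>pre\<close> and \<open>img\<close> move the containment of a point in a
    subspace across \<open>\<Phi>\<close>, backward and forward.\<close>
  have pre: "\<psi> y \<subseteq> {v \<in> vecs LL s. \<Phi> v \<in> U} \<longleftrightarrow> \<phi> y \<subseteq> U" if "y \<in> Y" for y U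
    unfolding psi_img[OF that] by (auto simp: \<psi>_def)
  have img: "\<psi> y \<subseteq> W \<longleftrightarrow> \<phi> y \<subseteq> \<Phi> ` W" if y: "y \<in> Y" and W: "W \<subseteq> vecs LL s" for y W
  proof
    assume "\<phi> y \<subseteq> \<Phi> ` W"
    show "\<psi> y \<subseteq> W"
    proof
      fix v assume v: "v \<in> \<psi> y"
      then have vv: "v \<in> vecs LL s" "\<Phi> v \<in> \<phi> y" unfolding \<psi>_def by auto
      then obtain w where "w \<in> W" "\<Phi> v = \<Phi> w" using \<open>\<phi> y \<subseteq> \<Phi> ` W\<close> by blast
      then show "v \<in> W" using inj[OF vv(1), of w] W by blast
    qed
  qed (use psi_img[OF y] in blast)
  have sub_pre: "{v \<in> vecs LL s. \<Phi> v \<in> U} \<in> subspaces LL S s"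
    if U: "vec_zero K \<in> U" "\<And>u w. u \<in> U \<Longrightarrow> w \<in> U \<Longrightarrow> vec_add K u w \<in> U"
      and S: "S \<subseteq> carrier LL" "\<And>l u. l \<in> S \<Longrightarrow> u \<in> U \<Longrightarrow> QR.act l u \<in> U" for U S
    unfolding subspaces_def
    using U S(2) add sm subsetD[OF S(1)] zL Phi0 smV addV by auto
  have img_K: "\<Phi> ` W \<in> subspaces K (carrier K) r" if W: "W \<in> subspaces LL (QR.h ` carrier K) s" for W
  proof -
    have w: "W \<subseteq> vecs LL s" "vec_zero LL \<in> W" "\<And>v w. v \<in> W \<Longrightarrow> w \<in> W \<Longrightarrow> vec_add LL v w \<in> W"
      "\<And>c v. c \<in> carrier K \<Longrightarrow> v \<in> W \<Longrightarrow> vec_smult LL (QR.h c) v \<in> W"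
      using W unfolding subspaces_def by auto
    show ?thesis
      unfolding subspaces_def
    proof (intro CollectI conjI ballI)
      show "\<Phi> ` W \<subseteq> vecs K r" using w(1) PhiC by blast
      show "vec_zero K \<in> \<Phi> ` W" using w(2) Phi0 by (metis imageI)
    next
      fix u u' assume "u \<in> \<Phi> ` W" "u' \<in> \<Phi> ` W"
      then obtain v v' where v: "v \<in> W" "v' \<in> W" "u = \<Phi> v" "u' = \<Phi> v'" by blast
      then have "vec_add K u u' = \<Phi> (vec_add LL v v')" using add[OF subsetD[OF w(1) v(1)] subsetD[OF w(1) v(2)]] v(3,4) by simp
      then show "vec_add K u u' \<in> \<Phi> ` W" using w(3)[OF v(1,2)] by simp
    next
      fix c u assume c: "c \<in> carrier K" and "u \<in> \<Phi> ` W"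
      then obtain v where v: "v \<in> W" "u = \<Phi> v" by blast
      then have "vec_smult K c u = \<Phi> (vec_smult LL (QR.h c) v)" using hsm[OF c subsetD[OF w(1) v(1)]] v(2) by simp
      then show "vec_smult K c u \<in> \<Phi> ` W" using w(4)[OF c v(1)] by simp
    qed
  qed
  have hL: "QR.h ` carrier K \<subseteq> carrier LL" using QR.h_L by blast
  have ZVS: "Z = {y \<in> Y. \<psi> y \<subseteq> {v \<in> vecs LL s. \<Phi> v \<in> C.VS Z}}" if Z: "Z \<in> \<Omega>" "Z \<subseteq> Y" for Z
  proof -
    have ZO: "Z \<in> {Y \<in> \<Omega>. Y \<subseteq> M0}" using Z Y(2) by blast
    show ?thesis using C.VS_phi[OF ZO] pre Z(2) Y(2) by blast
  qed
  have bck: "{y \<in> Y. \<psi> y \<subseteq> W} \<in> \<Omega>" "C.VS {y \<in> Y. \<psi> y \<subseteq> W} = \<Phi> ` W"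
    if W: "W \<in> subspaces LL (QR.h ` carrier K) s" for W
  proof -
    have Wv: "W \<subseteq> vecs LL s" using W unfolding subspaces_def by blast
    have "\<Phi> ` W \<subseteq> C.VS Y" using PhiV Wv by blast
    then have "x \<in> Y" if "x \<in> M0" "\<phi> x \<subseteq> \<Phi> ` W" for x
      using C.VS_phi[OF YO that(1)] that(2) by blast
    then have e: "{y \<in> Y. \<psi> y \<subseteq> W} = {x \<in> M0. \<phi> x \<subseteq> \<Phi> ` W}" using img[OF _ Wv] Y(2) by blast
    show "{y \<in> Y. \<psi> y \<subseteq> W} \<in> \<Omega>" "C.VS {y \<in> Y. \<psi> y \<subseteq> W} = \<Phi> ` W"
      unfolding e using C.sub_Sigma[OF img_K[OF W]] C.VS_sub[OF img_K[OF W]] by simp_all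
  qed
  show "proj_iso LL (QR.h ` carrier K) s Y {Z \<in> \<Omega>. Z \<subseteq> Y} \<psi>"
    unfolding proj_iso_def
  proof (intro conjI bij_psi subset_antisym subsetI)
    fix Z assume "Z \<in> {Z \<in> \<Omega>. Z \<subseteq> Y}"
    then have Z: "Z \<in> \<Omega>" "Z \<subseteq> Y" by auto
    have S: "C.V.subsp (C.VS Z)" using VS_subsp[OF Z(1)] Z(2) Y(2) by blast
    have "{v \<in> vecs LL s. \<Phi> v \<in> C.VS Z} \<in> subspaces LL (QR.h ` carrier K) s"
    proof (rule sub_pre[OF _ _ hL])
      show "vec_zero K \<in> C.VS Z" using C.V.subsp_zero[OF S] by simp
      show "vec_add K u w \<in> C.VS Z" if "u \<in> C.VS Z" "w \<in> C.VS Z" for u w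
        using C.V.subsp_add[OF S that] by simp
      show "QR.act l u \<in> C.VS Z" if "l \<in> QR.h ` carrier K" "u \<in> C.VS Z" for l u
        using that C.V.subsp_smult[OF S _ that(2)] QR.act_h C.V.subsp_carrier[OF S that(2)] by auto
    qed
    then show "Z \<in> {{y \<in> Y. \<psi> y \<subseteq> W} | W. W \<in> subspaces LL (QR.h ` carrier K) s}" using ZVS[OF Z] by blast
  next
    fix Z assume "Z \<in> {{y \<in> Y. \<psi> y \<subseteq> W} | W. W \<in> subspaces LL (QR.h ` carrier K) s}"
    then obtain W where W: "W \<in> subspaces LL (QR.h ` carrier K) s" "Z = {y \<in> Y. \<psi> y \<subseteq> W}" by blast
    then show "Z \<in> {Z \<in> \<Omega>. Z \<subseteq> Y}" using bck(1) by auto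
  qed
  show "{Z \<in> Fix. Z \<subseteq> Y} = {{y \<in> Y. \<psi> y \<subseteq> W} | W. W \<in> subspaces LL (carrier LL) s}"
  proof (intro subset_antisym subsetI)
    fix Z assume "Z \<in> {Z \<in> Fix. Z \<subseteq> Y}"
    then have Z: "Z \<in> Fix" "Z \<subseteq> Y" by auto
    have S: "LM.subsp (C.VS Z)" using VS_LM_subsp[OF Z(1)] Z(2) Y(2) by blast
    have "{v \<in> vecs LL s. \<Phi> v \<in> C.VS Z} \<in> subspaces LL (carrier LL) s"
    proof (rule sub_pre[OF _ _ subset_refl])
      show "vec_zero K \<in> C.VS Z" using LM.subsp_zero[OF S] by simp
      show "vec_add K u w \<in> C.VS Z" if "u \<in> C.VS Z" "w \<in> C.VS Z" for u w
        using LM.subsp_add[OF S that] by simp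
      show "QR.act l u \<in> C.VS Z" if "l \<in> carrier LL" "u \<in> C.VS Z" for l u
        using LM.subsp_smult[OF S that] by simp
    qed
    then show "Z \<in> {{y \<in> Y. \<psi> y \<subseteq> W} | W. W \<in> subspaces LL (carrier LL) s}"
      using ZVS[OF FixD(1)[OF Z(1)] Z(2)] by blast
  next
    fix Z assume "Z \<in> {{y \<in> Y. \<psi> y \<subseteq> W} | W. W \<in> subspaces LL (carrier LL) s}"
    then obtain W where W: "W \<in> subspaces LL (carrier LL) s" "Z = {y \<in> Y. \<psi> y \<subseteq> W}" by blast
    have Wh: "W \<in> subspaces LL (QR.h ` carrier K) s" using W(1) hL unfolding subspaces_def by blast
    have ZO: "Z \<in> \<Omega>" "Z \<subseteq> Y" "C.VS Z = \<Phi> ` W" using bck[OF Wh] W(2) by auto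
    have ZM: "Z \<in> {Y \<in> \<Omega>. Y \<subseteq> M0}" using ZO Y(2) by blast
    \<comment> \<open>The scalar \<open>(\<zero>, \<one>)\<close> acts as \<open>g\<close>, so an
      \<open>LL\<close>-subspace is stable under \<open>g\<close> and its points under
      \<open>\<theta>\<close>.\<close>
    have "\<theta> z \<in> Z" if z: "z \<in> Z" for z
    proof -
      have zM: "z \<in> M0" using z ZO(2) Y(2) by blast
      obtain u where u: "u \<in> \<phi> z" "u \<in> vecs K r" "u \<noteq> vec_zero K" using C.phi_rep[OF zM] by blast
      have "u \<in> C.VS Z" using C.VS_iff[OF ZM zM u(1,3)] z by simp
      then obtain v where v: "v \<in> W" "u = \<Phi> v" using ZO(3) by auto
      have vv: "v \<in> vecs LL s" using v(1) W(1) unfolding subspaces_def by blast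
      have l: "(\<zero>\<^bsub>K\<^esub>, \<one>\<^bsub>K\<^esub>) \<in> carrier LL" by (simp add: QR.L_simps)
      have "g u = \<Phi> (vec_smult LL (\<zero>\<^bsub>K\<^esub>, \<one>\<^bsub>K\<^esub>) v)" using sm[OF l vv] QR.act_g[of u] u(2) v(2) by simp
      moreover have "vec_smult LL (\<zero>\<^bsub>K\<^esub>, \<one>\<^bsub>K\<^esub>) v \<in> W" using W(1) l v(1) unfolding subspaces_def by blast
      ultimately have "g u \<in> C.VS Z" using ZO(3) by blast
      then show ?thesis using C.VS_iff[OF ZM M0_th[OF zM]] g_phi[OF zM u(1,3)] by blast
    qed
    then show "Z \<in> {Z \<in> Fix. Z \<subseteq> Y}" unfolding Fix_def using invar_Omega[OF ZO(1)] ZO by blast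
  qed
qed

end

text \<open>Stated for arbitrary families \<open>A\<close> and \<open>B\<close> so as to serve both
  for all singular subspaces and for the fixed ones.\<close>

lemma pull_back:
  assumes f: "bij_betw f X Y" and AB: "\<And>Z. Z \<subseteq> X \<Longrightarrow> Z \<in> A \<longleftrightarrow> f ` Z \<in> B"
    and eq: "{Z \<in> B. Z \<subseteq> Y} = {{y \<in> Y. \<psi> y \<subseteq> W} | W. W \<in> T}"
  shows "{Z \<in> A. Z \<subseteq> X} = {{x \<in> X. \<psi> (f x) \<subseteq> W} | W. W \<in> T}"
proof (intro subset_antisym subsetI)
  have fY: "f x \<in> Y" if "x \<in> X" for x using bij_betwE[OF f] that by blast
  fix Z assume "Z \<in> {Z \<in> A. Z \<subseteq> X}"
  then have Z: "Z \<in> A" "Z \<subseteq> X" by auto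
  have "f ` Z \<in> B" "f ` Z \<subseteq> Y" using AB Z fY by auto
  then have "f ` Z \<in> {{y \<in> Y. \<psi> y \<subseteq> W} | W. W \<in> T}" using eq by blast
  then obtain W where W: "W \<in> T" "f ` Z = {y \<in> Y. \<psi> y \<subseteq> W}" by blast
  have "x \<in> Z \<longleftrightarrow> \<psi> (f x) \<subseteq> W" if "x \<in> X" for x
    using inj_on_image_mem_iff[OF bij_betw_imp_inj_on[OF f] that Z(2)] fY[OF that] unfolding W(2) by simp
  then have "Z = {x \<in> X. \<psi> (f x) \<subseteq> W}" using Z(2) by blast
  then show "Z \<in> {{x \<in> X. \<psi> (f x) \<subseteq> W} | W. W \<in> T}" using W(1) by blast
next
  have fY: "f x \<in> Y" if "x \<in> X" for x using bij_betwE[OF f] that by blast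
  fix Z assume "Z \<in> {{x \<in> X. \<psi> (f x) \<subseteq> W} | W. W \<in> T}"
  then obtain W where W: "W \<in> T" "Z = {x \<in> X. \<psi> (f x) \<subseteq> W}" by blast
  have "{y \<in> Y. \<psi> y \<subseteq> W} \<in> {Z \<in> B. Z \<subseteq> Y}" unfolding eq using W(1) by blast
  moreover have "f ` Z = {y \<in> Y. \<psi> y \<subseteq> W}"
  proof (intro subset_antisym subsetI)
    fix y assume y: "y \<in> {y \<in> Y. \<psi> y \<subseteq> W}"
    then have "y \<in> f ` X" using bij_betw_imp_surj_on[OF f] by simp
    then show "y \<in> f ` Z" using y W(2) by blast
  qed (use W(2) fY in auto)
  ultimately show "Z \<in> {Z \<in> A. Z \<subseteq> X}" using AB[of Z] W(2) by auto
qed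

section \<open>One extension for all fixed subspaces\<close>

context domestic
begin

lemma ex_scalar_extension:
  assumes n4: "n \<ge> 4"
  shows "\<exists>(LL :: ('k \<times> 'k) ring) h. division_ring LL \<and> (quadratic_extension K LL h \<or> quaternion_extension K LL h) \<and>
    scalar_extension K LL h \<Omega> \<theta>"
proof -
  obtain M0 where M0: "M0 \<in> Fix" "rk M0 = n" using Fix_extend[OF empty_Fix] by blast
  obtain r \<phi> where C: "proj K (carrier K) r M0 {Y \<in> \<Omega>. Y \<subseteq> M0} \<phi>" using coord[OF FixD(1)[OF M0(1)]] .
  interpret C: proj K "carrier K" r M0 "{Y \<in> \<Omega>. Y \<subseteq> M0}" \<phi> by (rule C)
  interpret CO: coordinatised P \<Omega> n K \<theta> r M0 \<phi> by unfold_locales (use M0 n4 in auto)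
  obtain g where g: "spread_rep K (tuples K r) g"
    "\<And>x v. x \<in> M0 \<Longrightarrow> v \<in> \<phi> x \<Longrightarrow> v \<noteq> vec_zero K \<Longrightarrow> g v \<in> \<phi> (\<theta> x) \<and> g v \<noteq> vec_zero K"
    using CO.semilinear_rep by blast
  obtain \<sigma> a b where q: "quadratic_rep K (tuples K r) g \<sigma> a b" using spread_rep.quadratic[OF g(1)] by blast
  interpret QR: quadratic_rep K "tuples K r" g \<sigma> a b by (rule q)
  interpret CE: coordinatised_ext P \<Omega> n K \<theta> r M0 \<phi> g \<sigma> a b
    by unfold_locales (use g(2) in blast)
  have "\<exists>s \<psi>. proj_iso QR.L (QR.h ` carrier K) s X {Y \<in> \<Omega>. Y \<subseteq> X} \<psi> \<and>
      {Y \<in> Fix. Y \<subseteq> X} = {{x \<in> X. \<psi> x \<subseteq> W} | W. W \<in> subspaces QR.L (carrier QR.L) s}"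
    if X: "X \<in> Fix" for X
  proof -
    obtain M where M: "M \<in> Fix" "X \<subseteq> M" "rk M = n" using Fix_extend[OF X] by blast
    obtain f where f: "bij_betw f M M0" "\<And>Y. Y \<subseteq> M \<Longrightarrow> f ` Y \<in> \<Omega> \<longleftrightarrow> Y \<in> \<Omega>" "\<And>x. x \<in> M \<Longrightarrow> f (\<theta> x) = \<theta> (f x)"
      using transport[OF M(1,3) M0] by blast
    have fM: "f x \<in> M0" if "x \<in> M" for x using bij_betwE[OF f(1)] that by blast
    \<comment> \<open>As \<open>f\<close> commutes with \<open>\<theta>\<close>, it preserves being
      fixed as well as being singular.\<close>
    have fFix: "Z \<in> Fix \<longleftrightarrow> f ` Z \<in> Fix" if Z: "Z \<subseteq> M" for Z
    proof -
      have th: "\<theta> ` f ` Z = f ` \<theta> ` Z" using f(3) Z unfolding image_image by (intro image_cong) auto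
      have tZ: "\<theta> ` Z \<subseteq> M" using invar_th[OF FixD(2)[OF M(1)]] Z by blast
      have "\<theta> ` Z = Z \<longleftrightarrow> f ` \<theta> ` Z = f ` Z"
        using inj_on_image_eq_iff[OF bij_betw_imp_inj_on[OF f(1)] tZ Z] by simp
      moreover have "Z \<subseteq> P" "f ` Z \<subseteq> P" using Z Fix_P[OF M(1)] Fix_P[OF M0(1)] fM by auto
      ultimately show ?thesis unfolding Fix_def invar_def using f(2)[OF Z] th by auto
    qed
    let ?Y = "f ` X"
    have Y: "?Y \<in> Fix" "?Y \<subseteq> M0" using fFix[OF M(2)] X fM M(2) by auto
    have fX: "bij_betw f X ?Y" using bij_betw_subset[OF f(1) M(2)] by simp
    obtain s \<Phi> where "CE.lincoord s \<Phi> ?Y" using CE.ex_lincoord[OF Y] by blast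
    note iso = CE.lincoord_proj_iso[OF Y this]
    let ?\<psi> = "\<lambda>y. {v \<in> vecs QR.L s. \<Phi> v \<in> \<phi> y}"
    have 1: "bij_betw ?\<psi> ?Y (one_spaces QR.L (QR.h ` carrier K) s)"
      and 2: "{Z \<in> \<Omega>. Z \<subseteq> ?Y} = {{y \<in> ?Y. ?\<psi> y \<subseteq> W} | W. W \<in> subspaces QR.L (QR.h ` carrier K) s}"
      using iso(1) unfolding proj_iso_def by auto
    have "bij_betw (?\<psi> \<circ> f) X (one_spaces QR.L (QR.h ` carrier K) s)" using bij_betw_trans[OF fX 1] .
    moreover have "{Z \<in> \<Omega>. Z \<subseteq> X} = {{x \<in> X. (?\<psi> \<circ> f) x \<subseteq> W} | W. W \<in> subspaces QR.L (QR.h ` carrier K) s}"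
      unfolding comp_apply by (rule pull_back[OF fX _ 2]) (use f(2) M(2) in auto)
    moreover have "{Z \<in> Fix. Z \<subseteq> X} = {{x \<in> X. (?\<psi> \<circ> f) x \<subseteq> W} | W. W \<in> subspaces QR.L (carrier QR.L) s}"
      unfolding comp_apply by (rule pull_back[OF fX _ iso(2)]) (use fFix M(2) in auto)
    ultimately show ?thesis unfolding proj_iso_def by blast
  qed
  then have "scalar_extension K QR.L QR.h \<Omega> \<theta>" unfolding scalar_extension_def Fix_eq[symmetric] by blast
  then show ?thesis using QR.L_division QR.L_extension by blast
qed

text \<open>The coordinates of \<open>scalar_extension\<close> are kept; a fixed line, now a point,
  is recorded by its space of vectors, which is 1-dimensional over \<open>LL\<close>.\<close>

lemma defined_over_fixed:
  fixes LL :: "('l, 'o) ring_scheme"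
  assumes div: "division_ring LL" and sub: "subfield (h ` carrier K) LL" and sc: "scalar_extension K LL h \<Omega> \<theta>"
  shows "defined_over LL Omega'"
  unfolding defined_over_def Omega'_eq
proof
  fix X' assume "X' \<in> F ` Fix"
  then obtain X where X: "X \<in> Fix" "X' = F X" by blast
  let ?S = "h ` carrier K"
  obtain r \<phi> where iso: "proj_iso LL ?S r X {Y \<in> \<Omega>. Y \<subseteq> X} \<phi>"
    and fixeq: "{Y \<in> Fix. Y \<subseteq> X} = {{x \<in> X. \<phi> x \<subseteq> W} | W. W \<in> subspaces LL (carrier LL) r}"
    using bspec[OF sc[unfolded scalar_extension_def Fix_eq[symmetric]] X(1)] by (elim exE conjE)
  have ring: "ring LL" using div unfolding division_ring_def by blast
  note E = subringE[OF subfieldE(1)[OF sub]]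
  interpret C: proj LL ?S r X "{Y \<in> \<Omega>. Y \<subseteq> X}" \<phi>
  proof
    show "\<exists>t \<in> ?S. t \<otimes>\<^bsub>LL\<^esub> s = \<one>\<^bsub>LL\<^esub>" if "s \<in> ?S" "s \<noteq> \<zero>\<^bsub>LL\<^esub>" for s
      using ring.subfield_m_inv[OF ring sub, of s] that by blast
  qed (use div E iso in auto)
  have XO: "Y \<in> {Y \<in> \<Omega>. Y \<subseteq> X}" if "Y \<in> Fix" "Y \<subseteq> X" for Y using that FixD(1) by blast
  have LS: "W \<in> subspaces LL ?S r" if "W \<in> subspaces LL (carrier LL) r" for W
    using that E(1) unfolding subspaces_def by blast
  have VL: "C.VS Y \<in> subspaces LL (carrier LL) r" if Y: "Y \<in> Fix" "Y \<subseteq> X" for Y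
  proof -
    have "Y \<in> {{x \<in> X. \<phi> x \<subseteq> W} | W. W \<in> subspaces LL (carrier LL) r}"
      unfolding fixeq[symmetric] using Y by simp
    then obtain W where W: "W \<in> subspaces LL (carrier LL) r" "Y = {x \<in> X. \<phi> x \<subseteq> W}" by blast
    then show ?thesis using C.VS_sub[OF LS[OF W(1)]] by simp
  qed
  have WF: "{x \<in> X. \<phi> x \<subseteq> W} \<in> Fix" "C.VS {x \<in> X. \<phi> x \<subseteq> W} = W" if "W \<in> subspaces LL (carrier LL) r" for W
  proof -
    have "{x \<in> X. \<phi> x \<subseteq> W} \<in> {Y \<in> Fix. Y \<subseteq> X}" unfolding fixeq using that by blast
    then show "{x \<in> X. \<phi> x \<subseteq> W} \<in> Fix" by blast
    show "C.VS {x \<in> X. \<phi> x \<subseteq> W} = W" using C.VS_sub[OF LS[OF that]] .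
  qed
  have VS_sub: "C.VS Y \<subseteq> C.VS Z \<longleftrightarrow> Y \<subseteq> Z" if "Y \<in> Fix" "Y \<subseteq> X" "Z \<in> Fix" "Z \<subseteq> X" for Y Z
  proof
    assume s: "C.VS Y \<subseteq> C.VS Z"
    show "Y \<subseteq> Z"
    proof
      fix x assume x: "x \<in> Y"
      then have "\<phi> x \<subseteq> C.VS Z" using C.VS_phi[OF XO[OF that(1,2)], of x] that(2) s by blast
      then show "x \<in> Z" using C.VS_phi[OF XO[OF that(3,4)], of x] that(2) x by blast
    qed
  qed (rule C.VS_mono)
  have sp1: "C.V.sp1 v \<in> subspaces LL (carrier LL) r" if "v \<in> vecs LL r" for v
    using C.V.subsp_sp1[of v] that by (simp add: subspaces_iff[OF div])
  have line_sp1: "C.VS l = C.V.sp1 v" if l: "l \<in> F X" and v: "v \<in> C.VS l" "v \<noteq> vec_zero LL" for l v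
  proof -
    have lQ: "l \<in> Q" "l \<subseteq> X" using l unfolding F_def by auto
    have lF: "l \<in> Fix" using Q_rk[OF lQ(1)] by blast
    have vv: "v \<in> vecs LL r" using v(1) unfolding C.VS_def by blast
    have lsub: "C.V.subsp (C.VS l)" using VL[OF lF lQ(2)] by (simp add: subspaces_iff[OF div])
    \<comment> \<open>The \<open>LL\<close>-span of \<open>v\<close> belongs to a fixed subspace
      inside \<open>l\<close>. Containing the point \<open>x\<close> of \<open>v\<close>, it
      contains \<open>L x\<close>, which is all of \<open>l\<close>.\<close>
    let ?Y = "{x \<in> X. \<phi> x \<subseteq> C.V.sp1 v}"
    note Y = WF[OF sp1[OF vv]]
    have YX: "?Y \<subseteq> X" by blast
    have "C.V.sp1 v \<subseteq> C.VS l" using C.V.sp1_least[OF lsub v(1)] .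
    then have Yl: "?Y \<subseteq> l" using VS_sub[OF Y(1) YX lF lQ(2)] Y(2) by simp
    obtain x where x: "x \<in> X" "v \<in> \<phi> x" using C.pt'[OF vv v(2)] by blast
    have "v \<in> C.V.sp1 v" using C.V.sp1_self[of v] vv by simp
    then have xY: "x \<in> ?Y" using C.VS_iff[OF XO[OF Y(1) YX] x v(2)] Y(2) by simp
    have "L x \<subseteq> ?Y" using Fix_L_sub[OF Y(1) xY] .
    moreover have "l = L x" using Q_L[OF lQ(1)] Yl xY by blast
    ultimately have "?Y = l" using Yl by blast
    then show ?thesis using Y(2) by simp
  qed
  have line_ex: "\<exists>v \<in> C.VS l. v \<noteq> vec_zero LL" if l: "l \<in> F X" for l
  proof -
    obtain x where "x \<in> l" "x \<in> X" using l Q_ex unfolding F_def by blast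
    then show ?thesis using C.phi_rep[of x] unfolding C.VS_def by blast
  qed
  have "bij_betw C.VS (F X) (one_spaces LL (carrier LL) r)"
    unfolding bij_betw_def
  proof
    show "inj_on C.VS (F X)"
    proof (rule inj_onI)
      fix l m assume "l \<in> F X" "m \<in> F X" "C.VS l = C.VS m"
      then show "l = m" using VS_sub[of l m] VS_sub[of m l] Q_rk[of l] Q_rk[of m] unfolding F_def by blast
    qed
    show "C.VS ` F X = one_spaces LL (carrier LL) r"
    proof (intro subset_antisym subsetI)
      fix A assume "A \<in> C.VS ` F X"
      then obtain l where l: "l \<in> F X" "A = C.VS l" by blast
      obtain v where v: "v \<in> C.VS l" "v \<noteq> vec_zero LL" using line_ex[OF l(1)] by blast
      have "v \<in> vecs LL r" using v(1) unfolding C.VS_def by blast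
      then show "A \<in> one_spaces LL (carrier LL) r"
        unfolding l(2) line_sp1[OF l(1) v] C.V.sp1_def one_spaces_def using v(2) by auto
    next
      fix A assume "A \<in> one_spaces LL (carrier LL) r"
      then obtain v where v: "v \<in> vecs LL r" "v \<noteq> vec_zero LL" "A = C.V.sp1 v"
        unfolding one_spaces_def C.V.sp1_def by auto
      let ?Y = "{x \<in> X. \<phi> x \<subseteq> C.V.sp1 v}"
      note Y = WF[OF sp1[OF v(1)]]
      have YX: "?Y \<subseteq> X" by blast
      obtain x where x: "x \<in> X" "v \<in> \<phi> x" using C.pt'[OF v(1,2)] by blast
      have "v \<in> C.V.sp1 v" using C.V.sp1_self[of v] v by simp
      then have xY: "x \<in> ?Y" using C.VS_iff[OF XO[OF Y(1) YX] x v(2)] Y(2) by simp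
      have xP: "x \<in> P" using Fix_P[OF X(1) x(1)] .
      have lX: "L x \<in> F X" using F_L[OF X(1) x(1)] .
      then have lX': "L x \<subseteq> X" unfolding F_def by blast
      obtain w where w: "w \<in> C.VS (L x)" "w \<noteq> vec_zero LL" using line_ex[OF lX] by blast
      have "C.VS (L x) \<subseteq> C.V.sp1 v" using VS_sub[OF L_Fix[OF xP] lX' Y(1) YX] Fix_L_sub[OF Y(1) xY] Y(2) by simp
      then have "C.V.sp1 w = C.V.sp1 v" using C.V.sp1_eq[of v w] v w by auto
      then have "A = C.VS (L x)" using line_sp1[OF lX w] v(3) by simp
      then show "A \<in> C.VS ` F X" using lX by blast
    qed
  qed
  moreover have "{Y \<in> F ` Fix. Y \<subseteq> X'} = {{l \<in> X'. C.VS l \<subseteq> W} | W. W \<in> subspaces LL (carrier LL) r}"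
  proof (intro subset_antisym subsetI)
    fix S assume "S \<in> {Y \<in> F ` Fix. Y \<subseteq> X'}"
    then obtain Y where Y: "Y \<in> Fix" "S = F Y" "F Y \<subseteq> F X" using X(2) by blast
    have YX: "Y \<subseteq> X" using F_sub[OF Y(1) X(1)] Y(3) by simp
    have "l \<in> F Y \<longleftrightarrow> C.VS l \<subseteq> C.VS Y" if "l \<in> F X" for l
      using VS_sub[of l Y] Q_rk[of l] that Y(1) YX unfolding F_def by blast
    then have "S = {l \<in> X'. C.VS l \<subseteq> C.VS Y}" unfolding Y(2) X(2) using Y(3) by blast
    then show "S \<in> {{l \<in> X'. C.VS l \<subseteq> W} | W. W \<in> subspaces LL (carrier LL) r}" using VL[OF Y(1) YX] by blast
  next
    fix S assume "S \<in> {{l \<in> X'. C.VS l \<subseteq> W} | W. W \<in> subspaces LL (carrier LL) r}"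
    then obtain W where W: "W \<in> subspaces LL (carrier LL) r" "S = {l \<in> X'. C.VS l \<subseteq> W}" by blast
    let ?Y = "{x \<in> X. \<phi> x \<subseteq> W}"
    note Y = WF[OF W(1)]
    have YX: "?Y \<subseteq> X" by blast
    have FYX: "F ?Y \<subseteq> F X" using F_sub[OF Y(1) X(1)] YX by simp
    have "l \<in> F ?Y \<longleftrightarrow> C.VS l \<subseteq> W" if "l \<in> F X" for l
      using VS_sub[of l ?Y] Q_rk[of l] that Y YX unfolding F_def by blast
    then have "S = F ?Y" unfolding W(2) X(2) using FYX by blast
    then show "S \<in> {Y \<in> F ` Fix. Y \<subseteq> X'}" using Y(1) FYX X(2) by blast
  qed
  ultimately have "proj_iso LL (carrier LL) r X' {Y \<in> F ` Fix. Y \<subseteq> X'} C.VS"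
    unfolding proj_iso_def X(2) by blast
  then show "\<exists>r \<phi>. proj_iso LL (carrier LL) r X' {Y \<in> F ` Fix. Y \<subseteq> X'} \<phi>" by blast
qed

end

text \<open>The extension has dimension 2 over \<open>K\<close> in both cases, so its elements can
  be taken as pairs of elements of \<open>K\<close>. The rank \<open>m\<close> of the fixed
  structure is \<open>n div 2\<close>.\<close>

theorem theorem5:
  fixes K :: "'k ring" and n :: nat
    and P :: "'p set" and \<Omega> :: "'p set set" and \<theta> :: "'p \<Rightarrow> 'p"
  assumes "division_ring K" and "n \<ge> 4"
    and "polar_space P \<Omega> n" and "defined_over K \<Omega>"
    and "collineation P \<Omega> \<theta>" and "point_domestic P \<Omega> \<theta>"
    and "\<forall>x \<in> P. \<theta> x \<noteq> x"
  shows "even n \<and>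
    (\<exists>X \<in> {TypeB, TypeC, TypeD}. Diag K n P \<Omega> \<theta> = diagram_half X n) \<and>
    (\<exists>m\<ge>2. polar_space (fixed_lines \<Omega> \<theta>) (as_line_sets \<Omega> \<theta>) m) \<and>
    (\<exists>(L :: ('k \<times> 'k) ring) h.
       (quadratic_extension K L h \<or> quaternion_extension K L h) \<and>
       defined_over L (as_line_sets \<Omega> \<theta>) \<and> scalar_extension K L h \<Omega> \<theta>)"
proof -
  interpret domestic P \<Omega> n K \<theta> by unfold_locales (use assms in auto)
  have "type_of K n P \<Omega> \<in> {TypeB, TypeC, TypeD}" by (cases "type_of K n P \<Omega>") auto
  then have "\<exists>X \<in> {TypeB, TypeC, TypeD}. Diag K n P \<Omega> \<theta> = diagram_half X n" using Diag_half by blast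
  moreover have "\<exists>m\<ge>2. polar_space (fixed_lines \<Omega> \<theta>) (as_line_sets \<Omega> \<theta>) m"
    using fixed_polar_space assms(2) by (intro exI[of _ "n div 2"]) auto
  moreover obtain LL :: "('k \<times> 'k) ring" and h where LL: "division_ring LL"
    "quadratic_extension K LL h \<or> quaternion_extension K LL h" "scalar_extension K LL h \<Omega> \<theta>"
    using ex_scalar_extension[OF assms(2)] by blast
  moreover have "subfield (h ` carrier K) LL"
    using LL(2) unfolding quadratic_extension_def quaternion_extension_def by blast
  ultimately show ?thesis using even_n defined_over_fixed by blast
qed

end
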